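(* Let $(H,\Pi)$ be a connected signed graph that does not contain all three of a negative digon, a positive loop, and a negative loop. Then the decision problem $\textsc{s-Hom}(H,\Pi)$ is polynomial-time solvable if the s-core of $(H,\Pi)$ has at most two edges; it is NP-complete otherwise.
   Context: All graphs are finite and undirected; loops are allowed. A signed graph $(G,\Sigma)$ is a graph $G$ in which every edge (including loops) has a sign $+$ or $-$; $\Sigma\subseteq E(G)$ is the set of negative edges. Multiple edges of the same sign between the same two (possibly equal) vertices are not allowed, but two vertices may be joined by both a positive and a negative edge, and a vertex may carry both a positive and a negative loop; these count as two distinct edges. A negative digon is a pair of distinct vertices joined by both a positive and a negative edge. $(G,\Sigma)$ is connected if $G$ is. Switching at a vertex $v$ changes the sign of every non-loop edge incident with $v$ (loops keep their sign). Two signatures $\Sigma,\Sigma'$ of $G$ are switching equivalent, written $\Sigma\equiv\Sigma'$, if one is obtained from the other by a sequence of switchings. An ec-homomorphism of $(G,\Sigma)$ to $(H,\Pi)$ is a map $\varphi:V(G)\to V(H)$ such that for every edge $e$ between $x$ and $y$ in $(G,\Sigma)$ there is an edge of the same sign between $\varphi(x)$ and $\varphi(y)$ in $(H,\Pi)$. An s-homomorphism of $(G,\Sigma)$ to $(H,\Pi)$ is a map $\varphi:V(G)\to V(H)$ for which there are $\Sigma'\equiv\Sigma$ and $\Pi'\equiv\Pi$ such that $\varphi$ is an ec-homomorphism of $(G,\Sigma')$ to $(H,\Pi')$; one may always take $\Pi'=\Pi$. A signed graph is an s-core if every s-homomorphism of it to itself is an s-automorphism (a bijection on vertices which, together with its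 inverse, is an s-homomorphism). The s-core of $(H,\Pi)$ is a signed subgraph of $(H,\Pi)$ that is an s-core and to which $(H,\Pi)$ admits an s-homomorphism; it exists and is unique up to s-isomorphism and switching. For a fixed signed graph $(H,\Pi)$, $\textsc{s-Hom}(H,\Pi)$ is the decision problem: given a signed graph $(G,\Sigma)$, is there an s-homomorphism of $(G,\Sigma)$ to $(H,\Pi)$? *)

theory Defs
  imports "HOL-Computational_Algebra.Polynomial"
begin

section \<open>Signed graphs\<close>

datatype sign = Pos | Neg

fun flip :: "sign \<Rightarrow> sign" where
  "flip Pos = Neg"
| "flip Neg = Pos"

text \<open>
  An edge is a pair of its set of ends (a singleton for a loop) and its sign. Parallel edges of
  the same sign being forbidden, this identifies every edge, and a positive and a negative edge
  with the same ends are two different elements of \<open>edges\<close>. The signature is the set of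
  edges whose second component is \<open>Neg\<close>.
\<close>

record 'a sgraph =
  verts :: "'a set"
  edges :: "('a set \<times> sign) set"

definition signed_graph :: "'a sgraph \<Rightarrow> bool" where
  "signed_graph G \<longleftrightarrow>
     finite (verts G) \<and> (\<forall>(e, s)\<in>edges G. \<exists>u\<in>verts G. \<exists>v\<in>verts G. e = {u, v})"

definition sg_connected :: "'a sgraph \<Rightarrow> bool" where
  "sg_connected G \<longleftrightarrow> verts G \<noteq> {} \<and>
     (\<forall>u\<in>verts G. \<forall>v\<in>verts G. (u, v) \<in> {(x, y). \<exists>s. ({x, y}, s) \<in> edges G}\<^sup>*)"

definition has_negative_digon :: "'a sgraph \<Rightarrow> bool" where
  "has_negative_digon G \<longleftrightarrow>
     (\<exists>u v. u \<noteq> v \<and> ({u, v}, Pos) \<in> edges G \<and> ({u, v}, Neg) \<in> edges G)"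

definition has_loop :: "sign \<Rightarrow> 'a sgraph \<Rightarrow> bool" where
  "has_loop s G \<longleftrightarrow> (\<exists>v. ({v}, s) \<in> edges G)"

definition switch :: "'a \<Rightarrow> 'a sgraph \<Rightarrow> 'a sgraph" where
  "switch v G = G\<lparr>edges := (\<lambda>(e, s). (e, if v \<in> e \<and> e \<noteq> {v} then flip s else s)) ` edges G\<rparr>"

definition switching_equivalent :: "'a sgraph \<Rightarrow> 'a sgraph \<Rightarrow> bool" where
  "switching_equivalent = (\<lambda>G G'. \<exists>v\<in>verts G. G' = switch v G)\<^sup>*\<^sup>*"

definition ec_hom :: "('a \<Rightarrow> 'b) \<Rightarrow> 'a sgraph \<Rightarrow> 'b sgraph \<Rightarrow> bool" where
  "ec_hom \<phi> G H \<longleftrightarrow> \<phi> ` verts G \<subseteq> verts H \<and>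
     (\<forall>x y s. ({x, y}, s) \<in> edges G \<longrightarrow> ({\<phi> x, \<phi> y}, s) \<in> edges H)"

definition s_hom :: "('a \<Rightarrow> 'b) \<Rightarrow> 'a sgraph \<Rightarrow> 'b sgraph \<Rightarrow> bool" where
  "s_hom \<phi> G H \<longleftrightarrow>
     (\<exists>G' H'. switching_equivalent G G' \<and> switching_equivalent H H' \<and> ec_hom \<phi> G' H')"

definition s_automorphism :: "('a \<Rightarrow> 'a) \<Rightarrow> 'a sgraph \<Rightarrow> bool" where
  "s_automorphism \<phi> G \<longleftrightarrow>
     bij_betw \<phi> (verts G) (verts G) \<and> s_hom \<phi> G G \<and> s_hom (inv_into (verts G) \<phi>) G G"

definition s_core :: "'a sgraph \<Rightarrow> bool" where
  "s_core G \<longleftrightarrow> (\<forall>\<phi>. s_hom \<phi> G G \<longrightarrow> s_automorphism \<phi> G)"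

definition signed_subgraph :: "'a sgraph \<Rightarrow> 'a sgraph \<Rightarrow> bool" where
  "signed_subgraph C G \<longleftrightarrow> signed_graph C \<and> verts C \<subseteq> verts G \<and> edges C \<subseteq> edges G"

definition s_core_of :: "'a sgraph \<Rightarrow> 'a sgraph \<Rightarrow> bool" where
  "s_core_of C H \<longleftrightarrow> signed_subgraph C H \<and> s_core C \<and> (\<exists>\<phi>. s_hom \<phi> H C)"


section \<open>Existence of an s-core\<close>

definition twist :: "('a \<Rightarrow> bool) \<Rightarrow> 'a \<Rightarrow> 'a \<Rightarrow> sign \<Rightarrow> sign" where
  "twist \<sigma> u v s = (if \<sigma> u = \<sigma> v then s else flip s)"

lemma flip_flip [simp]: "flip (flip s) = s"
  by (cases s) auto

lemma twist_twist: "twist \<sigma> u v (twist \<tau> u v s) = twist (\<lambda>x. \<sigma> x \<noteq> \<tau> x) u v s"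
  by (auto simp: twist_def)

lemma twist_self [simp]: "twist \<sigma> u v (twist \<sigma> u v s) = s"
  by (auto simp: twist_def)

lemma twist_swap: "twist \<sigma> u v s = twist \<sigma> v u s"
  by (auto simp: twist_def)

lemma signed_graphD:
  assumes "signed_graph G" "({x, y}, s) \<in> edges G"
  shows "x \<in> verts G" "y \<in> verts G"
proof -
  from assms obtain u v where "u \<in> verts G" "v \<in> verts G" "{x, y} = {u, v}"
    unfolding signed_graph_def by blast
  then show "x \<in> verts G" "y \<in> verts G" by (auto simp: doubleton_eq_iff)
qed

lemma verts_switch [simp]: "verts (switch v G) = verts G"
  by (simp add: switch_def)

lemma switch_edge:
  "({x, y}, s) \<in> edges (switch v G) \<longleftrightarrow> ({x, y}, twist (\<lambda>z. z = v) x y s) \<in> edges G"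
proof -
  have 1: "(v \<in> {x, y} \<and> {x, y} \<noteq> {v}) \<longleftrightarrow> (x = v) \<noteq> (y = v)" by auto
  have "({x, y}, s) \<in> edges (switch v G) \<longleftrightarrow>
     (\<exists>s'. ({x, y}, s') \<in> edges G \<and> s = twist (\<lambda>z. z = v) x y s')"
    unfolding switch_def twist_def using 1 by (auto simp: image_iff Bex_def)
  also have "\<dots> \<longleftrightarrow> ({x, y}, twist (\<lambda>z. z = v) x y s) \<in> edges G"
    by (metis twist_self)
  finally show ?thesis .
qed

lemma switching_equivalent_twist:
  assumes "switching_equivalent G G'"
  shows "verts G' = verts G \<and>
    (\<exists>\<sigma>. \<forall>x y s. ({x, y}, s) \<in> edges G' \<longleftrightarrow> ({x, y}, twist \<sigma> x y s) \<in> edges G)"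
  using assms unfolding switching_equivalent_def
proof (induction rule: rtranclp_induct)
  case base
  show ?case by (auto intro!: exI[of _ "\<lambda>_. False"] simp: twist_def)
next
  case (step G1 G2)
  then obtain \<sigma> v where
    "\<forall>x y s. ({x, y}, s) \<in> edges G1 \<longleftrightarrow> ({x, y}, twist \<sigma> x y s) \<in> edges G"
    "G2 = switch v G1" "verts G1 = verts G" by blast
  then show ?case
    by (auto simp: switch_edge twist_twist intro!: exI[of _ "\<lambda>z. \<sigma> z \<noteq> (z = v)"])
qed

lemma twist_switching_equivalent:
  assumes "finite S" "S \<subseteq> verts G"
  shows "\<exists>G'. switching_equivalent G G' \<and> verts G' = verts G \<and>
    (\<forall>x y s. ({x, y}, s) \<in> edges G' \<longleftrightarrow> ({x, y}, twist (\<lambda>z. z \<in> S) x y s) \<in> edges G)"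
  using assms
proof (induction S rule: finite_induct)
  case empty
  show ?case by (auto intro!: exI[of _ G] simp: twist_def switching_equivalent_def)
next
  case (insert v S)
  then obtain G1 where G1: "switching_equivalent G G1" "verts G1 = verts G"
    "\<forall>x y s. ({x, y}, s) \<in> edges G1 \<longleftrightarrow> ({x, y}, twist (\<lambda>z. z \<in> S) x y s) \<in> edges G"
    by auto
  have "switching_equivalent G (switch v G1)"
    unfolding switching_equivalent_def
  proof (rule rtranclp.rtrancl_into_rtrancl)
    show "(\<lambda>G G'. \<exists>v\<in>verts G. G' = switch v G)\<^sup>*\<^sup>* G G1"
      using G1(1) by (simp add: switching_equivalent_def)
    show "\<exists>w\<in>verts G1. switch v G1 = switch w G1" using G1(2) insert.prems by blast
  qed
  moreover have "(\<lambda>x. (x \<in> S) \<noteq> (x = v)) = (\<lambda>z. z \<in> insert v S)"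
    using insert.hyps by auto
  ultimately show ?case using G1
    by (intro exI[of _ "switch v G1"]) (simp add: switch_edge twist_twist)
qed

lemma s_hom_iff:
  assumes "signed_graph G" "signed_graph H"
  shows "s_hom \<phi> G H \<longleftrightarrow> \<phi> ` verts G \<subseteq> verts H \<and>
    (\<exists>\<sigma>. \<forall>x y s. ({x, y}, s) \<in> edges G \<longrightarrow> ({\<phi> x, \<phi> y}, twist \<sigma> x y s) \<in> edges H)"
    (is "?L \<longleftrightarrow> ?R")
proof
  assume ?L
  then obtain G' H' where *: "switching_equivalent G G'" "switching_equivalent H H'"
    "ec_hom \<phi> G' H'" by (auto simp: s_hom_def)
  from switching_equivalent_twist[OF *(1)] obtain \<sigma> where s: "verts G' = verts G"
    "\<forall>x y s. ({x, y}, s) \<in> edges G' \<longleftrightarrow> ({x, y}, twist \<sigma> x y s) \<in> edges G" by blast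
  from switching_equivalent_twist[OF *(2)] obtain \<tau> where t: "verts H' = verts H"
    "\<forall>x y s. ({x, y}, s) \<in> edges H' \<longleftrightarrow> ({x, y}, twist \<tau> x y s) \<in> edges H" by blast
  have "({\<phi> x, \<phi> y}, twist (\<lambda>z. \<tau> (\<phi> z) \<noteq> \<sigma> z) x y s) \<in> edges H"
    if "({x, y}, s) \<in> edges G" for x y s
  proof -
    have "({x, y}, twist \<sigma> x y s) \<in> edges G'" using that s(2) by simp
    then have "({\<phi> x, \<phi> y}, twist \<sigma> x y s) \<in> edges H'" using *(3) by (simp add: ec_hom_def)
    then have "({\<phi> x, \<phi> y}, twist \<tau> (\<phi> x) (\<phi> y) (twist \<sigma> x y s)) \<in> edges H"
      using t(2) by simp
    moreover have "twist \<tau> (\<phi> x) (\<phi> y) (twist \<sigma> x y s) = twist (\<lambda>z. \<tau> (\<phi> z) \<noteq> \<sigma> z) x y s"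
      by (auto simp: twist_def)
    ultimately show ?thesis by simp
  qed
  moreover have "\<phi> ` verts G \<subseteq> verts H" using *(3) s(1) t(1) by (simp add: ec_hom_def)
  ultimately show ?R by blast
next
  assume ?R
  then obtain \<sigma> where r: "\<phi> ` verts G \<subseteq> verts H"
    "\<forall>x y s. ({x, y}, s) \<in> edges G \<longrightarrow> ({\<phi> x, \<phi> y}, twist \<sigma> x y s) \<in> edges H" by blast
  let ?S = "{z \<in> verts G. \<sigma> z}"
  have "finite ?S" using assms by (simp add: signed_graph_def)
  then obtain G' where g: "switching_equivalent G G'" "verts G' = verts G"
    "\<forall>x y s. ({x, y}, s) \<in> edges G' \<longleftrightarrow> ({x, y}, twist (\<lambda>z. z \<in> ?S) x y s) \<in> edges G"
    using twist_switching_equivalent[of ?S G] by blast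
  have "({\<phi> x, \<phi> y}, s) \<in> edges H" if "({x, y}, s) \<in> edges G'" for x y s
  proof -
    have e: "({x, y}, twist (\<lambda>z. z \<in> ?S) x y s) \<in> edges G" using g(3) that by blast
    have "twist (\<lambda>z. z \<in> ?S) x y s = twist \<sigma> x y s"
      using signed_graphD[OF assms(1) e] by (simp add: twist_def)
    then show ?thesis using r(2) e by (metis twist_self)
  qed
  then have "ec_hom \<phi> G' H" using r(1) g(2) by (simp add: ec_hom_def)
  then show ?L using g(1) unfolding s_hom_def switching_equivalent_def by blast
qed

lemma s_hom_comp:
  assumes "signed_graph G" "signed_graph H" "signed_graph K" "s_hom \<phi> G H" "s_hom \<psi> H K"
  shows "s_hom (\<psi> \<circ> \<phi>) G K"
proof -
  from assms obtain \<sigma> \<tau> where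
    st: "\<forall>x y s. ({x, y}, s) \<in> edges G \<longrightarrow> ({\<phi> x, \<phi> y}, twist \<sigma> x y s) \<in> edges H"
    "\<forall>x y s. ({x, y}, s) \<in> edges H \<longrightarrow> ({\<psi> x, \<psi> y}, twist \<tau> x y s) \<in> edges K"
    "\<phi> ` verts G \<subseteq> verts H" "\<psi> ` verts H \<subseteq> verts K"
    by (auto simp: s_hom_iff)
  have "twist \<tau> (\<phi> x) (\<phi> y) (twist \<sigma> x y s) = twist (\<lambda>z. \<tau> (\<phi> z) \<noteq> \<sigma> z) x y s" for x y s
    by (auto simp: twist_def)
  then have "\<forall>x y s. ({x, y}, s) \<in> edges G \<longrightarrow>
      ({\<psi> (\<phi> x), \<psi> (\<phi> y)}, twist (\<lambda>z. \<tau> (\<phi> z) \<noteq> \<sigma> z) x y s) \<in> edges K"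
    using st(1,2) by metis
  moreover have "(\<psi> \<circ> \<phi>) ` verts G \<subseteq> verts K" using st(3,4) by fastforce
  ultimately show ?thesis using assms(1,3)
    by (simp add: s_hom_iff) (intro exI[of _ "\<lambda>z. \<tau> (\<phi> z) \<noteq> \<sigma> z"], simp)
qed

lemma finite_edges:
  assumes "signed_graph G"
  shows "finite (edges G)"
proof (rule finite_subset)
  have "s \<in> {Pos, Neg}" for s by (cases s) auto
  moreover have "e \<subseteq> verts G" if "(e, s) \<in> edges G" for e s
  proof -
    from assms that have "\<exists>u\<in>verts G. \<exists>v\<in>verts G. e = {u, v}"
      unfolding signed_graph_def by (auto dest!: bspec)
    then show ?thesis by auto
  qed
  ultimately show "edges G \<subseteq> Pow (verts G) \<times> {Pos, Neg}" by auto
  show "finite (Pow (verts G) \<times> {Pos, Neg})" using assms by (simp add: signed_graph_def)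
qed

lemma s_core_exists:
  assumes H: "signed_graph H"
  shows "\<exists>C. s_core_of C H"
proof -
  let ?P = "\<lambda>C. signed_subgraph C H \<and> (\<exists>\<phi>. s_hom \<phi> H C)"
  let ?m = "\<lambda>C. card (verts C) + card (edges C)"
  have "s_hom id H H"
    using H by (auto simp: s_hom_iff twist_def intro!: exI[of _ "\<lambda>_. False"])
  then have "?P H" using H by (auto simp: signed_subgraph_def)
  from arg_min_nat_lemma[of ?P, OF this, of ?m]
  obtain C where C: "?P C" and min: "\<And>D. ?P D \<Longrightarrow> ?m C \<le> ?m D" by blast
  from C obtain \<phi>0 where sub: "signed_graph C" "verts C \<subseteq> verts H" "edges C \<subseteq> edges H"
    and \<phi>0: "s_hom \<phi>0 H C" by (auto simp: signed_subgraph_def)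
  have "s_automorphism f C" if f: "s_hom f C C" for f
  proof -
    from f sub obtain \<sigma> where s: "f ` verts C \<subseteq> verts C"
      "\<forall>x y s. ({x, y}, s) \<in> edges C \<longrightarrow> ({f x, f y}, twist \<sigma> x y s) \<in> edges C"
      by (auto simp: s_hom_iff)
    define D where "D = \<lparr>verts = f ` verts C,
      edges = {({f x, f y}, twist \<sigma> x y s) | x y s. ({x, y}, s) \<in> edges C}\<rparr>"
    have D_sub: "verts D \<subseteq> verts C" "edges D \<subseteq> edges C" using s by (auto simp: D_def)
    have fin: "finite (verts C)" using sub by (simp add: signed_graph_def)
    have wfD: "signed_graph D"
      using fin signed_graphD[OF sub(1)] unfolding signed_graph_def D_def by fastforce
    have "f ` verts C \<subseteq> verts D" by (simp add: D_def)
    moreover have "\<forall>x y s. ({x, y}, s) \<in> edges C \<longrightarrow> ({f x, f y}, twist \<sigma> x y s) \<in> edges D"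
      unfolding D_def by auto
    ultimately have "s_hom f C D" using sub(1) wfD by (subst s_hom_iff) blast+
    then have "s_hom (f \<circ> \<phi>0) H D" using s_hom_comp[OF H sub(1) wfD \<phi>0] by blast
    then have "?P D" using wfD D_sub sub by (auto simp: signed_subgraph_def)
    then have le: "?m C \<le> ?m D" by (rule min)
    have "card (verts D) \<le> card (verts C)" "card (edges D) \<le> card (edges C)"
      using D_sub fin finite_edges[OF sub(1)] by (auto intro: card_mono)
    with le have "card (verts D) = card (verts C)" "card (edges D) = card (edges C)" by auto
    then have eq: "verts D = verts C" "edges D = edges C"
      using D_sub fin finite_edges[OF sub(1)] card_subset_eq by blast+
    have surj: "f ` verts C = verts C" using eq(1) by (simp add: D_def)
    then have inj: "inj_on f (verts C)" using fin by (simp add: eq_card_imp_inj_on)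
    define g where "g = inv_into (verts C) f"
    have gf: "g (f x) = x" if "x \<in> verts C" for x
      using inj that by (simp add: g_def)
    have "({g x, g y}, twist (\<sigma> \<circ> g) x y s) \<in> edges C" if e: "({x, y}, s) \<in> edges C" for x y s
    proof -
      from e eq(2) have "({x, y}, s) \<in> edges D" by simp
      then obtain u v t where uv: "{x, y} = {f u, f v}" "s = twist \<sigma> u v t"
        "({u, v}, t) \<in> edges C" unfolding D_def by (auto simp del: insert_iff)
      have in_C: "u \<in> verts C" "v \<in> verts C" using signed_graphD[OF sub(1) uv(3)] .
      from uv(1) have "x = f u \<and> y = f v \<or> x = f v \<and> y = f u" by (auto simp: doubleton_eq_iff)
      then show ?thesis
      proof
        assume "x = f u \<and> y = f v"
        moreover have "twist (\<sigma> \<circ> g) (f u) (f v) s = t"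
          using in_C gf uv(2) by (auto simp: twist_def)
        ultimately show ?thesis using in_C gf uv(3) by simp
      next
        assume "x = f v \<and> y = f u"
        moreover have "twist (\<sigma> \<circ> g) (f v) (f u) s = t"
          using in_C gf uv(2) by (auto simp: twist_def)
        ultimately show ?thesis using in_C gf uv(3) by (simp add: insert_commute)
      qed
    qed
    moreover have "g ` verts C \<subseteq> verts C"
      using surj by (auto simp: g_def intro: inv_into_into)
    ultimately have "s_hom g C C" using sub(1) by (subst s_hom_iff) blast+
    then show ?thesis using f inj surj by (simp add: s_automorphism_def g_def bij_betw_def)
  qed
  then show ?thesis using C unfolding s_core_of_def s_core_def by blast
qed


section \<open>Turing machines and polynomial time\<close>

text \<open>
  Deterministic multi-tape Turing machines. Tapes are infinite in both directions. Symbol 0 is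
  the blank, symbols 1 and 2 represent the input bits, and there may be further symbols. States
  and symbols are initial segments of the naturals; \<open>tm_states\<close> counts the non-halting
  states, state 0 is initial and state \<open>tm_states\<close> itself is the halting state.
\<close>

datatype move = MLeft | MStay | MRight

record tm =
  tm_tapes :: nat
  tm_symbols :: nat
  tm_states :: nat
  tm_trans :: "nat \<Rightarrow> nat list \<Rightarrow> nat \<times> (nat \<times> move) list"

definition turing_machine :: "tm \<Rightarrow> bool" where
  "turing_machine M \<longleftrightarrow> tm_tapes M \<ge> 1 \<and> tm_symbols M \<ge> 3 \<and>
     (\<forall>q rs. q < tm_states M \<and> length rs = tm_tapes M \<and> (\<forall>r\<in>set rs. r < tm_symbols M) \<longrightarrow>
        (case tm_trans M q rs of (q', acts) \<Rightarrow>
           q' \<le> tm_states M \<and> length acts = tm_tapes M \<and> (\<forall>(w, d)\<in>set acts. w < tm_symbols M)))"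

text \<open>A tape is its head position together with its contents.\<close>

type_synonym tape = "int \<times> (int \<Rightarrow> nat)"
type_synonym config = "nat \<times> tape list"

fun tape_read :: "tape \<Rightarrow> nat" where
  "tape_read (h, t) = t h"

fun move_head :: "move \<Rightarrow> int \<Rightarrow> int" where
  "move_head MLeft h = h - 1"
| "move_head MStay h = h"
| "move_head MRight h = h + 1"

fun tape_act :: "nat \<times> move \<Rightarrow> tape \<Rightarrow> tape" where
  "tape_act (w, d) (h, t) = (move_head d h, t(h := w))"

definition tm_step :: "tm \<Rightarrow> config \<Rightarrow> config" where
  "tm_step M c = (case c of (q, tps) \<Rightarrow>
     if q \<ge> tm_states M then c
     else (case tm_trans M q (map tape_read tps) of (q', acts) \<Rightarrow> (q', map2 tape_act acts tps)))"

definition word_contents :: "bool list \<Rightarrow> int \<Rightarrow> nat" where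
  "word_contents x i =
     (if 0 \<le> i \<and> i < int (length x) then (if x ! nat i then 2 else 1) else 0)"

definition tm_start :: "tm \<Rightarrow> bool list \<Rightarrow> config" where
  "tm_start M x = (0, (0, word_contents x) # replicate (tm_tapes M - 1) (0, \<lambda>_. 0))"

text \<open>
  The output is the word left on the first tape, which must otherwise be blank; the final head
  position and the other tapes are irrelevant.
\<close>

definition tm_outputs_within :: "tm \<Rightarrow> bool list \<Rightarrow> nat \<Rightarrow> bool list \<Rightarrow> bool" where
  "tm_outputs_within M x T y \<longleftrightarrow>
     (\<exists>t\<le>T. case (tm_step M ^^ t) (tm_start M x) of (q, tps) \<Rightarrow>
        q = tm_states M \<and> snd (hd tps) = word_contents y)"

definition polytime_computable :: "(bool list \<Rightarrow> bool list) \<Rightarrow> bool" where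
  "polytime_computable f \<longleftrightarrow>
     (\<exists>M (p :: nat poly). turing_machine M \<and>
        (\<forall>x. tm_outputs_within M x (poly p (length x)) (f x)))"

type_synonym language = "bool list set"

definition class_P :: "language set" where
  "class_P = {L. polytime_computable (\<lambda>x. [x \<in> L])}"

text \<open>Self-delimiting pairing: the bits of \<open>x\<close> are doubled and followed by \<open>10\<close>.\<close>

definition pair_word :: "bool list \<Rightarrow> bool list \<Rightarrow> bool list" where
  "pair_word x u = concat (map (\<lambda>b. [b, b]) x) @ [True, False] @ u"

definition class_NP :: "language set" where
  "class_NP = {L. \<exists>V\<in>class_P. \<exists>p :: nat poly.
     \<forall>x. x \<in> L \<longleftrightarrow> (\<exists>u. length u \<le> poly p (length x) \<and> pair_word x u \<in> V)}"

definition polytime_reducible :: "language \<Rightarrow> language \<Rightarrow> bool" where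
  "polytime_reducible L L' \<longleftrightarrow> (\<exists>f. polytime_computable f \<and> (\<forall>x. x \<in> L \<longleftrightarrow> f x \<in> L'))"

definition NP_complete :: "language \<Rightarrow> bool" where
  "NP_complete L \<longleftrightarrow> L \<in> class_NP \<and> (\<forall>L'\<in>class_NP. polytime_reducible L' L)"


section \<open>The decision problem\<close>

text \<open>
  Instances are signed graphs on \<open>{..<n}\<close>, which represent all finite signed graphs up to
  isomorphism. Such a graph is written as \<open>n\<close> in unary followed by the adjacency matrices of
  its positive and of its negative edges, entry by entry interleaved in row-major order.
\<close>

definition encode_sgraph :: "nat sgraph \<Rightarrow> bool list" where
  "encode_sgraph G = (let n = card (verts G) in
     replicate n True @ [False] @
     concat (map (\<lambda>i. concat (map (\<lambda>j.
       [({i, j}, Pos) \<in> edges G, ({i, j}, Neg) \<in> edges G]) [0..<n])) [0..<n]))"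

definition s_Hom :: "'a sgraph \<Rightarrow> language" where
  "s_Hom H = {encode_sgraph G | G.
     signed_graph G \<and> (\<exists>n. verts G = {..<n}) \<and> (\<exists>\<phi>. s_hom \<phi> G H)}"

end

theory Submission
  imports Defs "HOL-Library.FuncSet"
begin

text \<open>
  Doubling the vertices by a switching bit turns an s-homomorphism to \<open>H\<close> into an ordinary
  homomorphism to an edge-coloured template on \<open>verts H \<times> bool\<close>. The signs and length parities of the
  closed walks of \<open>H\<close> form a subgroup \<open>\<Gamma>\<close> of \<open>(\<int>/2)\<^sup>2\<close>.

  Either \<open>H\<close> contains a signed graph \<open>S\<close> with at most two edges to which everything maps whose closed walks
  are in \<open>\<Gamma>\<close>; then the problem is a reachability problem, and the s-core maps injectively to \<open>S\<close>. Or the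
  template defines, by conjunctions of edges, a loopless nonbipartite graph (hard case). This
  case passes from \<open>H\<close> to its s-core, and it does not occur for graphs with at most two edges.

  In the hard case a form of the Hell-Nesetril theorem for minions assigns to every polymorphism one
  of its essential coordinates, compatibly with minors. This makes the standard encoding of
  label cover by powers of the template sound: reading off the coordinate of the polymorphism on
  each power gives a labelling. Label cover is NP-hard by the tableau of a Turing machine.

  Turing machines are obtained by compiling programs with stacks on the tapes, and languages are put
  in P by describing steps of a computation with bounded arithmetic formulas, which such programs evaluate.
\<close>

section \<open>Programs on stacks\<close>

text \<open>Besides \<Gamma>, three witnesses decide the case of \<open>H\<close>, one for each
  nonzero pair (sign, parity): a negative loop for (1,1), a positive loop for (0,1), and for (1,0) a
  negative digon or two loops at one vertex. If an element of \<Gamma> lacks its witness, the graph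
  that the template defines for it is loopless, and the closed walk yields an odd closed walk in it.
  If none is missing and \<Gamma> has at most two elements, the witness (or a single edge) serves as
  \<open>S\<close>; two loops at one vertex always do. If \<Gamma> is the whole group and no vertex
  carries both loops, the three witnesses form exactly the combination excluded by hypothesis.

  The graph theorem is about a minion acting on a graph because the graph is not the template:
  polymorphisms of the template act on every graph defined from it, and a labelling found there
  already labels them. It commutes with minors exactly, so label cover needs no gap. Label cover
  constraints are maps; a condition on one variable becomes a map whose fixed points are the
  permitted labels, imposed between the variable and itself.\<close>

datatype com =
    Act nat "nat \<Rightarrow> nat \<times> move"
  | Seq com com
  | Cond nat "nat \<Rightarrow> bool" com com
  | While nat "nat \<Rightarrow> bool" com

text \<open>The step counts are those of the compiled code: a test costs one step, and the first
  branch of a conditional and the body of a loop end with one more step for a jump.\<close>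

inductive runs :: "com \<Rightarrow> (nat \<Rightarrow> tape) \<Rightarrow> nat \<Rightarrow> (nat \<Rightarrow> tape) \<Rightarrow> bool" where
  runs_act: "runs (Act r f) s 1 (s(r := tape_act (f (tape_read (s r))) (s r)))"
| runs_seq: "runs c s m s' \<Longrightarrow> runs c' s' n s'' \<Longrightarrow> runs (Seq c c') s (m + n) s''"
| runs_condT: "P (tape_read (s r)) \<Longrightarrow> runs c s n s' \<Longrightarrow> runs (Cond r P c c') s (n + 2) s'"
| runs_condF: "\<not> P (tape_read (s r)) \<Longrightarrow> runs c' s n s' \<Longrightarrow> runs (Cond r P c c') s (n + 1) s'"
| runs_whileF: "\<not> P (tape_read (s r)) \<Longrightarrow> runs (While r P c) s 1 s"
| runs_whileT: "P (tape_read (s r)) \<Longrightarrow> runs c s m s' \<Longrightarrow> runs (While r P c) s' n s'' \<Longrightarrow>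
    runs (While r P c) s (m + 2 + n) s''"

section \<open>Compilation of programs into transition tables\<close>

type_synonym instr = "nat \<times> (nat \<Rightarrow> (nat \<times> move) \<times> nat)"

fun csize :: "com \<Rightarrow> nat" where
  "csize (Act r f) = 1"
| "csize (Seq c c') = csize c + csize c'"
| "csize (Cond r P c c') = csize c + csize c' + 2"
| "csize (While r P c) = csize c + 2"

text \<open>The second argument is the address of the first instruction, so jump targets are
  absolute. A jump is an instruction on tape 0 that writes back what it reads.\<close>

fun compile :: "com \<Rightarrow> nat \<Rightarrow> instr list" where
  "compile (Act r f) n = [(r, \<lambda>a. (f a, n + 1))]"
| "compile (Seq c c') n = compile c n @ compile c' (n + csize c)"
| "compile (Cond r P c c') n =
     (r, \<lambda>a. ((a, MStay), if P a then n + 1 else n + csize c + 2)) # compile c (n + 1) @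
     (0, \<lambda>a. ((a, MStay), n + csize c + csize c' + 2)) # compile c' (n + csize c + 2)"
| "compile (While r P c) n =
     (r, \<lambda>a. ((a, MStay), if P a then n + 1 else n + csize c + 2)) # compile c (n + 1) @
     [(0, \<lambda>a. ((a, MStay), n))]"

fun regs_below :: "nat \<Rightarrow> com \<Rightarrow> bool" where
  "regs_below K (Act r f) \<longleftrightarrow> r < K"
| "regs_below K (Seq c c') \<longleftrightarrow> regs_below K c \<and> regs_below K c'"
| "regs_below K (Cond r P c c') \<longleftrightarrow> r < K \<and> regs_below K c \<and> regs_below K c'"
| "regs_below K (While r P c) \<longleftrightarrow> r < K \<and> regs_below K c"

fun three_symbols :: "com \<Rightarrow> bool" where
  "three_symbols (Act r f) \<longleftrightarrow> (\<forall>a<3. fst (f a) < 3)"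
| "three_symbols (Seq c c') \<longleftrightarrow> three_symbols c \<and> three_symbols c'"
| "three_symbols (Cond r P c c') \<longleftrightarrow> three_symbols c \<and> three_symbols c'"
| "three_symbols (While r P c) \<longleftrightarrow> three_symbols c"

lemma regs_below_exists: "\<exists>K. regs_below K c"
proof -
  have mono: "regs_below K c \<Longrightarrow> K \<le> K' \<Longrightarrow> regs_below K' c" for K K' c
    by (induction c) auto
  show ?thesis
  proof (induction c)
    case (Act r f) show ?case by (auto intro: exI[of _ "Suc r"])
  next
    case (Seq c c')
    then obtain K K' where "regs_below K c" "regs_below K' c'" by blast
    then show ?case using mono by (intro exI[of _ "max K K'"]) (auto intro: mono)
  next
    case (Cond r P c c')
    then obtain K K' where "regs_below K c" "regs_below K' c'" by blast
    then show ?case using mono by (intro exI[of _ "max (Suc r) (max K K')"]) (auto intro: mono)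
  next
    case (While r P c)
    then obtain K where "regs_below K c" by blast
    then show ?case using mono by (intro exI[of _ "max (Suc r) K"]) (auto intro: mono)
  qed
qed

lemma length_compile [simp]: "length (compile c n) = csize c"
  by (induction c arbitrary: n) auto

text \<open>States are addresses, so the halting state is the address just past the last instruction
  and a program halts by running off its end.\<close>

definition machine :: "nat \<Rightarrow> instr list \<Rightarrow> tm" where
  "machine K is = \<lparr>tm_tapes = K, tm_symbols = 3, tm_states = length is,
     tm_trans = (\<lambda>q rs. (snd (snd (is ! q) (rs ! fst (is ! q))),
       map (\<lambda>i. if i = fst (is ! q) then fst (snd (is ! q) (rs ! i)) else (rs ! i, MStay)) [0..<K]))\<rparr>"

lemma compile_wf:
  assumes "three_symbols c" "(r, f) \<in> set (compile c n)" "a < 3"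
  shows "fst (fst (f a)) < 3 \<and> snd (f a) \<le> n + csize c"
  using assms
proof (induction c arbitrary: n)
  case (Act r f) then show ?case by auto
next
  case (Seq c c')
  from Seq.prems(2) show ?case
    using Seq.prems(1,3) Seq.IH(1)[of n] Seq.IH(2)[of "n + csize c"] by auto
next
  case (Cond r P c c')
  from Cond.prems(2) show ?case
    using Cond.prems(1,3) Cond.IH(1)[of "n+1"] Cond.IH(2)[of "n + csize c + 2"] by auto
next
  case (While r P c)
  from While.prems(2) show ?case
    using While.prems(1,3) While.IH(1)[of "n+1"] by auto
qed

lemma turing_machine_compile:
  assumes "three_symbols c" "regs_below K c"
  shows "turing_machine (machine K (compile c 0))"
proof -
  have K: "0 < K" using assms(2) by (induction c) auto
  have r: "r < K" if "(r, f) \<in> set (compile c n)" for r f n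
    using assms(2) that K by (induction c arbitrary: n) auto
  have "snd (f a) \<le> csize c \<and> fst (fst (f a)) < 3"
    if "q < csize c" "f = snd (compile c 0 ! q)" "a < 3" for q f a
    using compile_wf[OF assms(1), of "fst (compile c 0 ! q)" f 0 a] that
    by (simp add: nth_mem)
  moreover have "fst (compile c 0 ! q) < K" if "q < csize c" for q
    using r[of _ "snd (compile c 0 ! q)" 0] that nth_mem[of q "compile c 0"] by (metis length_compile prod.collapse)
  ultimately show ?thesis using K
    by (auto simp: turing_machine_def machine_def all_set_conv_all_nth split: prod.splits) (metis fst_conv nth_mem)
qed

lemma tape_act_stay [simp]: "tape_act (tape_read t, MStay) t = t"
  by (cases t) auto

lemma machine_step:
  assumes "q < length is" "is ! q = (r, f)" "r < K" "f (tape_read (s r)) = (a, q')"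
  shows "tm_step (machine K is) (q, map s [0..<K]) = (q', map (s(r := tape_act a (s r))) [0..<K])"
  using assms by (auto simp: tm_step_def machine_def intro!: nth_equalityI)

text \<open>Stated for code embedded between arbitrary \<open>pre\<close> and \<open>post\<close>,
  because the induction hypotheses concern subprograms somewhere inside the whole list.\<close>

lemma compile_correct:
  assumes "runs c s t s'" "regs_below K c" "is = pre @ compile c (length pre) @ post" "0 < K"
  shows "(tm_step (machine K is) ^^ t) (length pre, map s [0..<K]) =
         (length pre + csize c, map s' [0..<K])"
  using assms
proof (induction arbitrary: pre post rule: runs.induct)
  case (runs_act r f s)
  then show ?case
    by (simp add: machine_step[where r = r and f = "\<lambda>a. (f a, Suc (length pre))"])
next
  case (runs_seq c s m s' c' n s'')
  have 1: "(tm_step (machine K is) ^^ m) (length pre, map s [0..<K]) = (length pre + csize c, map s' [0..<K])"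
    by (rule runs_seq.IH(1)[of pre "compile c' (length pre + csize c) @ post"]) (use runs_seq.prems in auto)
  have 2: "(tm_step (machine K is) ^^ n) (length (pre @ compile c (length pre)), map s' [0..<K]) =
      (length (pre @ compile c (length pre)) + csize c', map s'' [0..<K])"
    by (rule runs_seq.IH(2)[of _ post]) (use runs_seq.prems in auto)
  show ?case using 1 2 by (simp add: add.commute[of m n] funpow_add add.assoc)
next
  case (runs_condT P s r c n s' c')
  let ?g = "\<lambda>a. ((a, MStay), if P a then length pre + 1 else length pre + csize c + 2)"
  have 0: "tm_step (machine K is) (length pre, map s [0..<K]) = (length pre + 1, map s [0..<K])"
    by (subst machine_step[where r = r and f = ?g]) (use runs_condT in auto)
  have 1: "(tm_step (machine K is) ^^ n) (length (pre @ [(r, ?g)]), map s [0..<K]) =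
     (length (pre @ [(r, ?g)]) + csize c, map s' [0..<K])"
    by (rule runs_condT.IH[of _ "(0, \<lambda>a. ((a, MStay), length pre + csize c + csize c' + 2)) #
          compile c' (length pre + csize c + 2) @ post"]) (use runs_condT.prems in auto)
  have 2: "tm_step (machine K is) (length pre + 1 + csize c, map s' [0..<K]) =
     (length pre + csize c + csize c' + 2, map s' [0..<K])"
    by (subst machine_step[where r = 0 and f = "\<lambda>a. ((a, MStay), length pre + csize c + csize c' + 2)"])
      (use runs_condT.prems in \<open>auto simp: nth_append\<close>)
  show ?case using 0 1 2 by (simp add: funpow_swap1 add.assoc)
next
  case (runs_condF P s r c' n s' c)
  let ?g = "\<lambda>a. ((a, MStay), if P a then length pre + 1 else length pre + csize c + 2)"
  let ?h = "\<lambda>a. ((a, MStay), length pre + csize c + csize c' + 2)"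
  have 0: "tm_step (machine K is) (length pre, map s [0..<K]) = (length pre + csize c + 2, map s [0..<K])"
    by (subst machine_step[where r = r and f = ?g]) (use runs_condF in auto)
  have 1: "(tm_step (machine K is) ^^ n) (length (pre @ (r, ?g) # compile c (length pre + 1) @ [(0, ?h)]), map s [0..<K]) =
     (length (pre @ (r, ?g) # compile c (length pre + 1) @ [(0, ?h)]) + csize c', map s' [0..<K])"
    by (rule runs_condF.IH[of _ post]) (use runs_condF.prems in \<open>auto simp: add.commute\<close>)
  show ?case using 0 1 by (simp add: funpow_swap1 add.assoc add.commute add.left_commute)
next
  case (runs_whileF P s r c)
  let ?g = "\<lambda>a. ((a, MStay), if P a then length pre + 1 else length pre + csize c + 2)"
  have 0: "tm_step (machine K is) (length pre, map s [0..<K]) = (length pre + csize c + 2, map s [0..<K])"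
    by (subst machine_step[where r = r and f = ?g]) (use runs_whileF in auto)
  then show ?case by simp
next
  case (runs_whileT P s r c m s' n s'')
  let ?g = "\<lambda>a. ((a, MStay), if P a then length pre + 1 else length pre + csize c + 2)"
  have 0: "tm_step (machine K is) (length pre, map s [0..<K]) = (length pre + 1, map s [0..<K])"
    by (subst machine_step[where r = r and f = ?g]) (use runs_whileT in auto)
  have 1: "(tm_step (machine K is) ^^ m) (length (pre @ [(r, ?g)]), map s [0..<K]) =
     (length (pre @ [(r, ?g)]) + csize c, map s' [0..<K])"
    by (rule runs_whileT.IH(1)[of _ "(0, \<lambda>a. ((a, MStay), length pre)) # post"]) (use runs_whileT.prems in auto)
  have 2: "tm_step (machine K is) (length pre + 1 + csize c, map s' [0..<K]) = (length pre, map s' [0..<K])"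
    by (subst machine_step[where r = 0 and f = "\<lambda>a. ((a, MStay), length pre)"])
      (use runs_whileT.prems in \<open>auto simp: nth_append\<close>)
  have 3: "(tm_step (machine K is) ^^ n) (length pre, map s' [0..<K]) = (length pre + (csize c + 2), map s'' [0..<K])"
    using runs_whileT.IH(2)[of pre post] runs_whileT.prems by simp
  have "(g ^^ (m + 2 + n)) x = (g ^^ n) (g ((g ^^ m) (g x)))" for g :: "config \<Rightarrow> config" and x
  proof -
    have "(g ^^ (n + Suc (Suc m))) x = (g ^^ n) ((g ^^ Suc (Suc m)) x)" by (simp only: funpow_add o_apply)
    then show ?thesis by (simp add: funpow_swap1 add.commute)
  qed
  from this[of "tm_step (machine K is)"] show ?case using 0 1 2 3 by (simp del: funpow.simps)
qed

section \<open>Timed specifications of stack programs\<close>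

definition bit_sym :: "bool \<Rightarrow> nat" where "bit_sym b = (if b then 2 else 1)"

definition topsym :: "bool list \<Rightarrow> nat" where
  "topsym xs = (case xs of [] \<Rightarrow> 0 | b # _ \<Rightarrow> bit_sym b)"

text \<open>Tape \<open>r + 1\<close> holds stack \<open>r\<close>, with the head on its top; tape 0 is not a stack,
  because the output has to start at cell 0.\<close>

definition stack :: "bool list \<Rightarrow> tape \<Rightarrow> bool" where
  "stack xs tp \<longleftrightarrow> snd tp = (\<lambda>i. word_contents xs (i - fst tp))"

text \<open>Total correctness with a time bound. Tape 0 is described exactly, the other tapes only
  up to translation, since the head of a stack tape drifts as the stack is used.\<close>

definition exc :: "com \<Rightarrow> tape \<Rightarrow> (nat \<Rightarrow> bool list) \<Rightarrow> nat \<Rightarrow> tape \<Rightarrow> (nat \<Rightarrow> bool list) \<Rightarrow> bool" where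
  "exc c z s n z' s' \<longleftrightarrow> (\<forall>tp. tp 0 = z \<and> (\<forall>r. stack (s r) (tp (Suc r))) \<longrightarrow>
     (\<exists>m\<le>n. \<exists>tp'. runs c tp m tp' \<and> tp' 0 = z' \<and> (\<forall>r. stack (s' r) (tp' (Suc r)))))"

lemma stack_read: "stack xs tp \<Longrightarrow> tape_read tp = topsym xs"
  by (cases tp) (auto simp: stack_def topsym_def word_contents_def bit_sym_def split: list.splits)

lemma exc_mono: "exc c z s n z' s' \<Longrightarrow> n \<le> n' \<Longrightarrow> exc c z s n' z' s'"
  unfolding exc_def by (blast intro: order_trans)

lemma exc_seq: "exc c z s m z' s' \<Longrightarrow> exc c' z' s' n z'' s'' \<Longrightarrow> exc (Seq c c') z s (m + n) z'' s''"
  unfolding exc_def by (blast intro: add_mono runs_seq)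

lemma exc_condT:
  assumes "P (topsym (s r))" "exc c z s n z' s'"
  shows "exc (Cond (Suc r) P c c') z s (n + 2) z' s'"
  using assms unfolding exc_def by (metis add_le_mono1 runs_condT stack_read)

lemma exc_condF:
  assumes "\<not> P (topsym (s r))" "exc c' z s n z' s'"
  shows "exc (Cond (Suc r) P c c') z s (n + 1) z' s'"
  using assms unfolding exc_def by (metis add_le_mono1 runs_condF stack_read)

lemma exc_cond:
  assumes "P (topsym (s r)) \<Longrightarrow> exc c z s n z' s'" "\<not> P (topsym (s r)) \<Longrightarrow> exc c' z s n z' s'"
  shows "exc (Cond (Suc r) P c c') z s (n + 2) z' s'"
  using assms exc_condT exc_condF exc_mono[of _ _ _ "n+1" _ _ "n+2"] by (cases "P (topsym (s r))") auto

lemma exc_whileF: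
  assumes "\<not> P (topsym (s r))"
  shows "exc (While (Suc r) P c) z s 1 z s"
  using assms unfolding exc_def by (metis order_refl runs_whileF stack_read)

lemma exc_whileT:
  assumes "P (topsym (s r))" "exc c z s m z' s'" "exc (While (Suc r) P c) z' s' n z'' s''"
  shows "exc (While (Suc r) P c) z s (m + 2 + n) z'' s''"
  unfolding exc_def
proof (intro allI impI)
  fix tp assume tp: "tp 0 = z \<and> (\<forall>r. stack (s r) (tp (Suc r)))"
  then obtain m' tp' where 1: "m' \<le> m" "runs c tp m' tp'" "tp' 0 = z'" "\<forall>r. stack (s' r) (tp' (Suc r))"
    using assms(2) unfolding exc_def by blast
  then obtain n' tp'' where 2: "n' \<le> n" "runs (While (Suc r) P c) tp' n' tp''" "tp'' 0 = z''"
    "\<forall>r. stack (s'' r) (tp'' (Suc r))"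
    using assms(3) unfolding exc_def by blast
  have "P (tape_read (tp (Suc r)))" using assms(1) tp stack_read by metis
  from runs_whileT[OF this 1(2) 2(2)]
  show "\<exists>k\<le>m + 2 + n. \<exists>tp''. runs (While (Suc r) P c) tp k tp'' \<and> tp'' 0 = z'' \<and>
      (\<forall>r. stack (s'' r) (tp'' (Suc r)))"
    using 1 2 by (intro exI[of _ "m' + 2 + n'"] conjI exI[of _ tp'']) auto
qed

lemma exc_act0: "exc (Act 0 f) z s 1 (tape_act (f (tape_read z)) z) s"
  unfolding exc_def
proof (intro allI impI)
  fix tp assume "tp 0 = z \<and> (\<forall>r. stack (s r) (tp (Suc r)))"
  then show "\<exists>m\<le>1. \<exists>tp'. runs (Act 0 f) tp m tp' \<and> tp' 0 = tape_act (f (tape_read z)) z \<and>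
     (\<forall>r. stack (s r) (tp' (Suc r)))"
    using runs_act[of 0 f tp] by (intro exI[of _ 1] conjI exI[of _ "tp(0 := tape_act (f (tape_read z)) z)"]) auto
qed

lemma word_contents_Cons:
  "word_contents (b # xs) i = (if i = 0 then bit_sym b else word_contents xs (i - 1))"
proof (cases "i > 0")
  case True
  then have "nat i = Suc (nat (i - 1))" by simp
  then show ?thesis using True by (auto simp: word_contents_def)
qed (auto simp: word_contents_def bit_sym_def)

lemma word_contents_Nil [simp]: "word_contents [] i = 0"
  by (simp add: word_contents_def)

abbreviation nonempty :: "nat \<Rightarrow> bool" where "nonempty a \<equiv> a \<noteq> 0"
abbreviation top_true :: "nat \<Rightarrow> bool" where "top_true a \<equiv> a = 2"

definition Skip :: com where "Skip = Act 0 (\<lambda>a. (a, MStay))"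
definition Pop :: "nat \<Rightarrow> com" where "Pop r = Act (Suc r) (\<lambda>a. (0, MRight))"
definition Push :: "nat \<Rightarrow> bool \<Rightarrow> com" where
  "Push r b = Seq (Act (Suc r) (\<lambda>a. (a, MLeft))) (Act (Suc r) (\<lambda>a. (bit_sym b, MStay)))"

lemma exc_skip: "exc Skip z s 1 z s"
  using exc_act0[of "\<lambda>a. (a, MStay)" z s] by (simp add: Skip_def)

lemma exc_pop: "exc (Pop r) z s 1 z (s(r := tl (s r)))"
  unfolding exc_def Pop_def
proof (intro allI impI)
  fix tp assume tp: "tp 0 = z \<and> (\<forall>r. stack (s r) (tp (Suc r)))"
  \<comment> \<open>Popping an empty stack is harmless: a blank tape represents the empty stack for
    every head position.\<close>
  have "stack (tl xs) (tape_act (0, MRight) t)" if "stack xs t" for xs t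
    using that by (cases t; cases xs)
      (auto simp: stack_def word_contents_Cons fun_eq_iff algebra_simps word_contents_def[of _ "-1"])
  then show "\<exists>m\<le>1. \<exists>tp'. runs (Act (Suc r) (\<lambda>a. (0, MRight))) tp m tp' \<and> tp' 0 = z \<and>
     (\<forall>r'. stack ((s(r := tl (s r))) r') (tp' (Suc r')))"
    using tp runs_act[of "Suc r" "\<lambda>a. (0, MRight)" tp]
    by (intro exI[of _ 1] conjI exI[of _ "tp(Suc r := tape_act (0, MRight) (tp (Suc r)))"]) auto
qed

lemma exc_push: "exc (Push r b) z s 2 z (s(r := b # s r))"
  unfolding exc_def Push_def
proof (intro allI impI)
  fix tp assume tp: "tp 0 = z \<and> (\<forall>r. stack (s r) (tp (Suc r)))"
  have "stack (b # xs) (tape_act (bit_sym b, MStay) (tape_act (tape_read t, MLeft) t))" if "stack xs t" for xs t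
    using that by (cases t) (auto simp: stack_def word_contents_Cons fun_eq_iff algebra_simps)
  then show "\<exists>m\<le>2. \<exists>tp'. runs (Seq (Act (Suc r) (\<lambda>a. (a, MLeft))) (Act (Suc r) (\<lambda>a. (bit_sym b, MStay)))) tp m tp' \<and> tp' 0 = z \<and>
     (\<forall>r'. stack ((s(r := b # s r)) r') (tp' (Suc r')))"
    using tp runs_seq[OF runs_act[of "Suc r" "\<lambda>a. (a, MLeft)" tp] runs_act[of "Suc r" "\<lambda>a. (bit_sym b, MStay)"]]
    by (intro exI[of _ 2] conjI exI[of _ "tp(Suc r := tape_act (bit_sym b, MStay) (tape_act (tape_read (tp (Suc r)), MLeft) (tp (Suc r))))"])
      (auto simp: numeral_2_eq_2)
qed

lemma topsym_simps [simp]: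
  "topsym [] = 0" "topsym (b # xs) = (if b then 2 else 1)" "topsym xs = 0 \<longleftrightarrow> xs = []"
  by (auto simp: topsym_def bit_sym_def split: list.splits)

lemma exc_cong: "exc c z s n z' s' \<Longrightarrow> s = t \<Longrightarrow> s' = t' \<Longrightarrow> n \<le> n' \<Longrightarrow> exc c z t n' z' t'"
  using exc_mono by blast

definition Move :: "nat \<Rightarrow> nat \<Rightarrow> com" where
  "Move r e = While (Suc r) nonempty
     (Cond (Suc r) top_true (Seq (Pop r) (Push e True)) (Seq (Pop r) (Push e False)))"

lemma exc_move:
  assumes "r \<noteq> e"
  shows "exc (Move r e) z s (7 * length (s r) + 1) z (s(r := [], e := rev (s r) @ s e))"
proof (induction "s r" arbitrary: s)
  case Nil
  have "exc (Move r e) z s 1 z s" unfolding Move_def by (rule exc_whileF) (use Nil in simp)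
  then show ?case by (rule exc_cong) (use Nil in \<open>auto simp: fun_eq_iff\<close>)
next
  case (Cons b xs)
  let ?s = "s(r := xs, e := b # s e)"
  have p: "exc (Seq (Pop r) (Push e b)) z s (1 + 2) z ?s"
    by (rule exc_seq[OF exc_pop exc_push, THEN exc_cong]) (use Cons(2)[symmetric] assms in auto)
  have 1: "exc (Cond (Suc r) top_true (Seq (Pop r) (Push e True)) (Seq (Pop r) (Push e False))) z s (1+2+2) z ?s"
    by (rule exc_cond) (use p Cons(2)[symmetric] in \<open>cases b; simp\<close>)+
  have 2: "exc (Move r e) z ?s (7 * length xs + 1) z (?s(r := [], e := rev xs @ ?s e))"
    using Cons(1)[of ?s] assms by simp
  have "exc (Move r e) z s (1+2+2 + 2 + (7 * length xs + 1)) z (?s(r := [], e := rev xs @ ?s e))"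
    unfolding Move_def by (rule exc_whileT[OF _ 1 2[unfolded Move_def]]) (use Cons(2)[symmetric] in simp)
  then show ?case by (rule exc_cong) (use Cons(2)[symmetric] assms in \<open>auto simp: fun_eq_iff\<close>)
qed

definition Move2 :: "nat \<Rightarrow> nat \<Rightarrow> nat \<Rightarrow> com" where
  "Move2 r d e = While (Suc r) nonempty
     (Cond (Suc r) top_true (Seq (Pop r) (Seq (Push d True) (Push e True)))
        (Seq (Pop r) (Seq (Push d False) (Push e False))))"

lemma exc_move2:
  assumes "r \<noteq> e" "r \<noteq> d" "d \<noteq> e"
  shows "exc (Move2 r d e) z s (9 * length (s r) + 1) z (s(r := [], d := rev (s r) @ s d, e := rev (s r) @ s e))"
proof (induction "s r" arbitrary: s)
  case Nil
  have "exc (Move2 r d e) z s 1 z s" unfolding Move2_def by (rule exc_whileF) (use Nil in simp)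
  then show ?case by (rule exc_cong) (use Nil in \<open>auto simp: fun_eq_iff\<close>)
next
  case (Cons b xs)
  let ?s = "s(r := xs, d := b # s d, e := b # s e)"
  have p: "exc (Seq (Pop r) (Seq (Push d b) (Push e b))) z s (1 + (2 + 2)) z ?s"
    by (rule exc_seq[OF exc_pop exc_seq[OF exc_push exc_push], THEN exc_cong])
      (use Cons(2)[symmetric] assms in auto)
  have 1: "exc (Cond (Suc r) top_true (Seq (Pop r) (Seq (Push d True) (Push e True)))
      (Seq (Pop r) (Seq (Push d False) (Push e False)))) z s (1+(2+2)+2) z ?s"
    by (rule exc_cond) (use p Cons(2)[symmetric] in \<open>cases b; simp\<close>)+
  have 2: "exc (Move2 r d e) z ?s (9 * length xs + 1) z
      (?s(r := [], d := rev xs @ ?s d, e := rev xs @ ?s e))"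
    using Cons(1)[of ?s] assms by simp
  have "exc (Move2 r d e) z s (1+(2+2)+2 + 2 + (9 * length xs + 1)) z
      (?s(r := [], d := rev xs @ ?s d, e := rev xs @ ?s e))"
    unfolding Move2_def by (rule exc_whileT[OF _ 1 2[unfolded Move2_def]]) (use Cons(2)[symmetric] in simp)
  then show ?case by (rule exc_cong) (use Cons(2)[symmetric] assms in \<open>auto simp: fun_eq_iff\<close>)
qed

text \<open>Pouring a stack reverses it. Pouring it onto the scratch stack \<open>e\<close> and back
  restores both the order and the original, and leaves a copy on \<open>d\<close>.\<close>

definition Copy :: "nat \<Rightarrow> nat \<Rightarrow> nat \<Rightarrow> com" where
  "Copy r d e = Seq (Move r e) (Move2 e r d)"

lemma exc_copy:
  assumes "r \<noteq> e" "r \<noteq> d" "d \<noteq> e" "s e = []"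
  shows "exc (Copy r d e) z s (16 * length (s r) + 2) z (s(d := s r @ s d))"
  unfolding Copy_def
  by (rule exc_seq[OF exc_move exc_move2, THEN exc_cong]) (use assms in \<open>auto simp: fun_eq_iff\<close>)

definition Clear :: "nat \<Rightarrow> com" where
  "Clear r = While (Suc r) nonempty (Pop r)"

lemma exc_clear: "exc (Clear r) z s (3 * length (s r) + 1) z (s(r := []))"
proof (induction "s r" arbitrary: s)
  case Nil
  have "exc (Clear r) z s 1 z s" unfolding Clear_def by (rule exc_whileF) (use Nil in simp)
  then show ?case by (rule exc_cong) (use Nil in \<open>auto simp: fun_eq_iff\<close>)
next
  case (Cons b xs)
  have 2: "exc (Clear r) z (s(r := xs)) (3 * length xs + 1) z (s(r := []))"
    using Cons(1)[of "s(r := xs)"] by simp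
  have 1: "exc (Pop r) z s 1 z (s(r := xs))"
    using exc_pop[of r z s] Cons(2)[symmetric] by simp
  have "exc (Clear r) z s (1 + 2 + (3 * length xs + 1)) z (s(r := []))"
    unfolding Clear_def by (rule exc_whileT[OF _ 1 2[unfolded Clear_def]]) (use Cons(2)[symmetric] in simp)
  then show ?case by (rule exc_cong) (use Cons(2)[symmetric] in auto)
qed

definition For :: "nat \<Rightarrow> com \<Rightarrow> com" where
  "For r c = While (Suc r) nonempty (Seq (Pop r) c)"

text \<open>Stack \<open>r\<close> is a counter that is consumed. \<open>S i\<close> describes the
  other stacks after \<open>i\<close> rounds; the body runs with the counter already popped. Each
  round costs 3 more steps: test, pop and jump back.\<close>

lemma exc_for:
  assumes "\<And>i. i < length L \<Longrightarrow> exc c z ((S i)(r := drop (Suc i) L)) m z ((S (Suc i))(r := drop (Suc i) L))"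
    and "s = (S 0)(r := L)" and "length L \<le> k"
  shows "exc (For r c) z s (k * (m + 3) + 1) z ((S (length L))(r := []))"
proof -
  have "exc (For r c) z ((S i)(r := drop i L)) ((length L - i) * (m + 3) + 1) z ((S (length L))(r := []))"
    if "i \<le> length L" for i
    using that
  proof (induction rule: inc_induct)
    case base
    show ?case unfolding For_def by (rule exc_whileF[THEN exc_cong]) auto
  next
    case (step i)
    have k: "length L - i = Suc (length L - Suc i)" using step.hyps by simp
    have d: "tl (drop i L) = drop (Suc i) L" by (simp add: drop_Suc drop_tl)
    have 1: "exc (Seq (Pop r) c) z ((S i)(r := drop i L)) (1 + m) z ((S (Suc i))(r := drop (Suc i) L))"
      by (rule exc_seq[OF exc_pop]) (use assms(1)[OF step.hyps(2)] in \<open>simp add: d\<close>)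
    have "exc (For r c) z ((S i)(r := drop i L)) (1 + m + 2 + ((length L - Suc i) * (m + 3) + 1)) z ((S (length L))(r := []))"
      unfolding For_def by (rule exc_whileT[OF _ 1 step.IH[unfolded For_def]]) (use step.hyps in simp)
    then show ?case by (rule exc_cong) (simp_all add: k fun_eq_iff)
  qed
  from this[of 0] have "exc (For r c) z s (length L * (m + 3) + 1) z ((S (length L))(r := []))"
    using assms(2) by simp
  then show ?thesis by (rule exc_mono) (use assms(3) in simp)
qed

section \<open>Loading the input from tape 0 and writing the output to it\<close>

lemma exc_condT0: "P (tape_read z) \<Longrightarrow> exc c z s n z' s' \<Longrightarrow> exc (Cond 0 P c c') z s (n + 2) z' s'"
  unfolding exc_def by (metis add_le_mono1 runs_condT)

lemma exc_condF0: "\<not> P (tape_read z) \<Longrightarrow> exc c' z s n z' s' \<Longrightarrow> exc (Cond 0 P c c') z s (n + 1) z' s'"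
  unfolding exc_def by (metis add_le_mono1 runs_condF)

lemma exc_cond0:
  assumes "P (tape_read z) \<Longrightarrow> exc c z s n z' s'" "\<not> P (tape_read z) \<Longrightarrow> exc c' z s n z' s'"
  shows "exc (Cond 0 P c c') z s (n + 2) z' s'"
  using assms exc_condT0 exc_condF0 exc_mono[of _ _ _ "n+1" _ _ "n+2"] by (cases "P (tape_read z)") auto

lemma exc_whileF0: "\<not> P (tape_read z) \<Longrightarrow> exc (While 0 P c) z s 1 z s"
  unfolding exc_def by (metis order_refl runs_whileF)

lemma exc_whileT0:
  assumes "P (tape_read z)" "exc c z s m z' s'" "exc (While 0 P c) z' s' n z'' s''"
  shows "exc (While 0 P c) z s (m + 2 + n) z'' s''"
  unfolding exc_def
proof (intro allI impI)
  fix tp assume tp: "tp 0 = z \<and> (\<forall>r. stack (s r) (tp (Suc r)))"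
  then obtain m' tp' where 1: "m' \<le> m" "runs c tp m' tp'" "tp' 0 = z'" "\<forall>r. stack (s' r) (tp' (Suc r))"
    using assms(2) unfolding exc_def by blast
  then obtain n' tp'' where 2: "n' \<le> n" "runs (While 0 P c) tp' n' tp''" "tp'' 0 = z''"
    "\<forall>r. stack (s'' r) (tp'' (Suc r))"
    using assms(3) unfolding exc_def by blast
  have "P (tape_read (tp 0))" using assms(1) tp by metis
  from runs_whileT[OF this 1(2) 2(2)]
  show "\<exists>k\<le>m + 2 + n. \<exists>tp''. runs (While 0 P c) tp k tp'' \<and> tp'' 0 = z'' \<and>
      (\<forall>r. stack (s'' r) (tp'' (Suc r)))"
    using 1 2 by (intro exI[of _ "m' + 2 + n'"] conjI exI[of _ tp'']) auto
qed

text \<open>The input is erased while it is pushed, reversed, onto stack 1. \<open>Rewind\<close>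
  pours it onto stack 0, which restores the order, and moves the head of tape 0 left once per
  symbol, so that the output starts at cell 0. Stack 1 is then free to receive the output
  word.\<close>

definition Read_input :: com where
  "Read_input = While 0 nonempty (Seq (Cond 0 top_true (Push 1 True) (Push 1 False)) (Act 0 (\<lambda>a. (0, MRight))))"

definition Rewind :: com where
  "Rewind = While (Suc 1) nonempty (Seq (Act 0 (\<lambda>a. (a, MLeft)))
     (Cond (Suc 1) top_true (Seq (Pop 1) (Push 0 True)) (Seq (Pop 1) (Push 0 False))))"

definition Write_output :: com where
  "Write_output = While (Suc 1) nonempty (Seq (Cond (Suc 1) top_true (Act 0 (\<lambda>a. (2, MRight))) (Act 0 (\<lambda>a. (1, MRight)))) (Pop 1))"

lemma read_shifted: "tape_read (k, \<lambda>i. word_contents xs (i - k)) = topsym xs"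
  by (rule stack_read) (simp add: stack_def)

lemma exc_read_input:
  "exc Read_input (k, \<lambda>i. word_contents xs (i - k)) s (7 * length xs + 1)
     (k + int (length xs), \<lambda>_. 0) (s(1 := rev xs @ s 1))"
proof (induction xs arbitrary: k s)
  case Nil
  have "exc Read_input (k, \<lambda>i. word_contents [] (i - k)) s 1 (k, \<lambda>i. word_contents [] (i - k)) s"
    unfolding Read_input_def by (rule exc_whileF0) simp
  then show ?case by simp
next
  case (Cons b xs)
  let ?z = "(k, \<lambda>i. word_contents (b # xs) (i - k))"
  let ?z' = "(k + 1, \<lambda>i. word_contents xs (i - (k + 1)))"
  have 1: "exc (Cond 0 top_true (Push 1 True) (Push 1 False)) ?z s (2 + 2) ?z (s(1 := b # s 1))"
    by (rule exc_cond0) (use exc_push[of 1 b ?z s] in \<open>auto simp: word_contents_Cons bit_sym_def split: if_splits\<close>)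
  have "tape_act (0, MRight) ?z = ?z'"
    by (auto simp: word_contents_Cons fun_eq_iff algebra_simps) (auto simp: word_contents_def)
  then have 2: "exc (Act 0 (\<lambda>a. (0, MRight))) ?z (s(1 := b # s 1)) 1 ?z' (s(1 := b # s 1))"
    using exc_act0[of "\<lambda>a. (0, MRight)" ?z "s(1 := b # s 1)"] by simp
  have "exc Read_input ?z s (2 + 2 + 1 + 2 + (7 * length xs + 1))
     (k + 1 + int (length xs), \<lambda>_. 0) ((s(1 := b # s 1))(1 := rev xs @ (s(1 := b # s 1)) 1))"
    unfolding Read_input_def
    by (rule exc_whileT0[OF _ exc_seq[OF 1 2] Cons.IH[unfolded Read_input_def]]) (simp add: read_shifted del: tape_read.simps)
  then have "exc Read_input ?z s (7 * length (b # xs) + 1)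
     (k + 1 + int (length xs), \<lambda>_. 0) (s(1 := rev (b # xs) @ s 1))"
    by (rule exc_cong) auto
  moreover have "k + 1 + int (length xs) = k + int (length (b # xs))" by simp
  ultimately show ?case by (simp only:)
qed

lemma exc_rewind:
  "exc Rewind (k, \<lambda>_. 0) s (8 * length (s 1) + 1)
     (k - int (length (s 1)), \<lambda>_. 0) (s(1 := [], 0 := rev (s 1) @ s 0))"
proof (induction "s 1" arbitrary: k s)
  case Nil
  have "exc Rewind (k, \<lambda>_. 0) s 1 (k, \<lambda>_. 0) s"
    unfolding Rewind_def by (rule exc_whileF) (use Nil in simp)
  then show ?case using Nil[symmetric] by simp (erule exc_cong, auto simp: fun_eq_iff)
next
  case (Cons b xs)
  let ?s = "s(1 := xs, 0 := b # s 0)"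
  have p: "exc (Seq (Pop 1) (Push 0 b)) (k - 1, \<lambda>_. 0) s (1 + 2) (k - 1, \<lambda>_. 0) ?s"
    by (rule exc_seq[OF exc_pop exc_push, THEN exc_cong]) (use Cons(2)[symmetric] in auto)
  have 1: "exc (Cond (Suc 1) top_true (Seq (Pop 1) (Push 0 True)) (Seq (Pop 1) (Push 0 False)))
      (k - 1, \<lambda>_. 0) s (1+2+2) (k - 1, \<lambda>_. 0) ?s"
    by (rule exc_cond) (use p Cons(2)[symmetric] in \<open>cases b; simp\<close>)+
  have 0: "exc (Act 0 (\<lambda>a. (a, MLeft))) (k, \<lambda>_. 0) s 1 (k - 1, \<lambda>_. 0) s"
    using exc_act0[of "\<lambda>a. (a, MLeft)" "(k, \<lambda>_. 0)" s] by (simp add: fun_upd_def)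
  have 2: "exc Rewind (k - 1, \<lambda>_. 0) ?s (8 * length xs + 1) (k - 1 - int (length xs), \<lambda>_. 0)
      (?s(1 := [], 0 := rev xs @ ?s 0))"
    using Cons(1)[of ?s "k - 1"] by simp
  have "exc Rewind (k, \<lambda>_. 0) s (1 + (1+2+2) + 2 + (8 * length xs + 1))
      (k - 1 - int (length xs), \<lambda>_. 0) (?s(1 := [], 0 := rev xs @ ?s 0))"
    unfolding Rewind_def
    by (rule exc_whileT[OF _ exc_seq[OF 0 1] 2[unfolded Rewind_def]]) (use Cons(2)[symmetric] in simp)
  then have "exc Rewind (k, \<lambda>_. 0) s (8 * length (s 1) + 1)
      (k - 1 - int (length xs), \<lambda>_. 0) (s(1 := [], 0 := rev (s 1) @ s 0))"
    by (rule exc_cong) (use Cons(2)[symmetric] in \<open>auto simp: fun_eq_iff\<close>)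
  then show ?case using Cons(2)[symmetric] by (simp add: diff_diff_eq)
qed

lemma word_contents_snoc:
  "word_contents (ys @ [b]) = (word_contents ys)(int (length ys) := bit_sym b)"
  by (auto simp: word_contents_def fun_eq_iff nth_append bit_sym_def)

lemma exc_write_output:
  "exc Write_output (int (length ys), word_contents ys) s (6 * length (s 1) + 1)
     (int (length (ys @ s 1)), word_contents (ys @ s 1)) (s(1 := []))"
proof (induction "s 1" arbitrary: ys s)
  case Nil
  have "exc Write_output (int (length ys), word_contents ys) s 1 (int (length ys), word_contents ys) s"
    unfolding Write_output_def by (rule exc_whileF) (use Nil in simp)
  then show ?case using Nil[symmetric] by simp (erule exc_cong, auto simp: fun_eq_iff)
next
  case (Cons b xs)
  let ?z = "(int (length ys), word_contents ys)" and ?z' = "(int (length (ys @ [b])), word_contents (ys @ [b]))"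
  have "exc (Act 0 (\<lambda>a. (bit_sym b, MRight))) ?z s 1 ?z' s"
    using exc_act0[of "\<lambda>a. (bit_sym b, MRight)" ?z s] by (simp add: word_contents_snoc add.commute)
  then have 1: "exc (Cond (Suc 1) top_true (Act 0 (\<lambda>a. (2, MRight))) (Act 0 (\<lambda>a. (1, MRight)))) ?z s (1 + 2) ?z' s"
    by (intro exc_cond) (use Cons(2)[symmetric] in \<open>auto simp: bit_sym_def split: if_splits\<close>)
  have 2: "exc (Pop 1) ?z' s 1 ?z' (s(1 := xs))"
    using exc_pop[of 1 ?z' s] Cons(2)[symmetric] by simp
  have 3: "exc Write_output ?z' (s(1 := xs)) (6 * length xs + 1)
      (int (length ((ys @ [b]) @ xs)), word_contents ((ys @ [b]) @ xs)) (s(1 := []))"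
    using Cons(1)[of "s(1 := xs)" "ys @ [b]"] by simp
  have "exc Write_output ?z s (1 + 2 + 1 + 2 + (6 * length xs + 1))
      (int (length ((ys @ [b]) @ xs)), word_contents ((ys @ [b]) @ xs)) (s(1 := []))"
    unfolding Write_output_def
    by (rule exc_whileT[OF _ exc_seq[OF 1 2] 3[unfolded Write_output_def]]) (use Cons(2)[symmetric] in simp)
  then have "exc Write_output ?z s (6 * length (s 1) + 1)
      (int (length ((ys @ [b]) @ xs)), word_contents ((ys @ [b]) @ xs)) (s(1 := []))"
    by (rule exc_cong) (use Cons(2)[symmetric] in auto)
  then show ?case using Cons(2)[symmetric] by simp
qed

definition Whole :: "com \<Rightarrow> com" where
  "Whole c = Seq Read_input (Seq Rewind (Seq c Write_output))"

lemma Whole_outputs: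
  assumes c: "\<And>z. exc c z ((\<lambda>_. [])(0 := x)) n z s" and y: "s 1 = y"
    and K: "regs_below K (Whole c)"
  shows "tm_outputs_within (machine K (compile (Whole c) 0)) x
     (15 * length x + 6 * length y + n + 3) y"
proof -
  let ?e = "(0, \<lambda>_. 0) :: tape" and ?x = "(\<lambda>_. [])(0 := x)"
  have 1: "exc Read_input (0, word_contents x) (\<lambda>_. []) (7 * length x + 1) (int (length x), \<lambda>_. 0) ((\<lambda>_. [])(1 := rev x))"
    using exc_read_input[of 0 x "\<lambda>_. []"] by simp
  have 2: "exc Rewind (int (length x), \<lambda>_. 0) ((\<lambda>_. [])(1 := rev x)) (8 * length x + 1) ?e ?x"
    by (rule exc_rewind[of "int (length x)" "(\<lambda>_. [])(1 := rev x)", THEN back_subst[of "\<lambda>z. exc _ _ _ _ z _"], THEN exc_cong])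
       (auto simp: fun_eq_iff)
  have 3: "exc Write_output ?e s (6 * length y + 1) (int (length y), word_contents y) (s(1 := []))"
  proof -
    have "word_contents [] = (\<lambda>_. 0)" by (simp add: fun_eq_iff)
    then show ?thesis using exc_write_output[of "[]" s] y by simp
  qed
  define tp0 :: "nat \<Rightarrow> tape" where "tp0 = (\<lambda>_. ?e)(0 := (0, word_contents x))"
  have "exc (Whole c) (0, word_contents x) (\<lambda>_. []) (7 * length x + 1 + (8 * length x + 1 + (n + (6 * length y + 1))))
     (int (length y), word_contents y) (s(1 := []))"
    unfolding Whole_def by (rule exc_seq[OF 1 exc_seq[OF 2 exc_seq[OF c 3]]])
  then have "exc (Whole c) (0, word_contents x) (\<lambda>_. []) (15 * length x + 6 * length y + n + 3)
     (int (length y), word_contents y) (s(1 := []))"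
    by (rule exc_mono) simp
  from this[unfolded exc_def, rule_format, of tp0] obtain m tp where m: "m \<le> 15 * length x + 6 * length y + n + 3"
    "runs (Whole c) tp0 m tp" "tp 0 = (int (length y), word_contents y)"
    by (auto simp: tp0_def stack_def)
  have K0: "0 < K" using K by (cases K) (auto simp: Whole_def Read_input_def)
  have "tm_start (machine K (compile (Whole c) 0)) x = (0, map tp0 [0..<K])"
    using K0 by (intro prod_eqI nth_equalityI) (auto simp: tm_start_def machine_def nth_Cons' tp0_def)
  moreover have "(tm_step (machine K (compile (Whole c) 0)) ^^ m)
      (length ([] :: instr list), map tp0 [0..<K]) =
      (length ([] :: instr list) + csize (Whole c), map tp [0..<K])"
    by (rule compile_correct[OF m(2) K]) (use K0 in auto)
  ultimately show ?thesis
    unfolding tm_outputs_within_def using m(1,3) K0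
    by (intro exI[of _ m]) (auto simp: machine_def hd_map)
qed

section \<open>Bounded formulas\<close>

lemma exc_to: "exc c z s n z' s' \<Longrightarrow> s' = t' \<Longrightarrow> n \<le> n' \<Longrightarrow> exc c z s n' z' t'"
  using exc_mono by blast

datatype trm = Var nat | Num nat | Plus trm trm | Times trm trm

fun tev :: "trm \<Rightarrow> nat list \<Rightarrow> nat" where
  "tev (Var k) e = (if k < length e then e ! k else 0)"
| "tev (Num c) e = c"
| "tev (Plus a b) e = tev a e + tev b e"
| "tev (Times a b) e = tev a e * tev b e"

text \<open>Variables are de Bruijn indices. \<open>Bit False\<close> reads the input word and
  \<open>Bit True\<close> a work word. All quantifiers are bounded by terms, that is by polynomials,
  so exhaustive search evaluates a fixed formula in polynomial time.\<close>

datatype fm = Less trm trm | Bit bool trm | Nand fm fm | Ex trm fm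

fun eval :: "bool list \<Rightarrow> bool list \<Rightarrow> fm \<Rightarrow> nat list \<Rightarrow> bool" where
  "eval x w (Less a b) e \<longleftrightarrow> tev a e < tev b e"
| "eval x w (Bit b t) e \<longleftrightarrow> (let u = if b then w else x in tev t e < length u \<and> u ! tev t e)"
| "eval x w (Nand p q) e \<longleftrightarrow> \<not> (eval x w p e \<and> eval x w q e)"
| "eval x w (Ex t p) e \<longleftrightarrow> (\<exists>v<tev t e. eval x w p (v # e))"

section \<open>Evaluation of terms and formulas in unary\<close>

fun Pushn :: "nat \<Rightarrow> nat \<Rightarrow> com" where
  "Pushn 0 d = Skip"
| "Pushn (Suc c) d = Seq (Push d True) (Pushn c d)"

lemma exc_pushn: "exc (Pushn c d) z s (2 * c + 1) z (s(d := replicate c True @ s d))"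
proof (induction c arbitrary: s)
  case 0
  show ?case using exc_skip by simp
next
  case (Suc c)
  show ?case unfolding Pushn.simps
    by (rule exc_seq[OF exc_push Suc.IH, THEN exc_to]) (auto simp: replicate_app_Cons_same)
qed

fun ct :: "nat list \<Rightarrow> trm \<Rightarrow> nat \<Rightarrow> com" where
  "ct rs (Var k) d = (if k < length rs then Copy (rs ! k) d (Suc d) else Skip)"
| "ct rs (Num c) d = Pushn c d"
| "ct rs (Plus a b) d = Seq (ct rs a d) (Seq (ct rs b (Suc d)) (Move (Suc d) d))"
| "ct rs (Times a b) d = Seq (ct rs a (d + 1)) (Seq (ct rs b (d + 2))
     (Seq (For (d + 1) (Copy (d + 2) d (d + 3))) (Clear (d + 2))))"

text \<open>Stacks 0 and 1 hold the words, the variables of a formula are kept in unary in the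
  stacks \<open>rs\<close>, and the stacks from \<open>d\<close> on are free.\<close>

definition env :: "bool list \<Rightarrow> bool list \<Rightarrow> nat list \<Rightarrow> nat list \<Rightarrow> nat \<Rightarrow> (nat \<Rightarrow> bool list) \<Rightarrow> bool" where
  "env x w rs e d s \<longleftrightarrow> 2 \<le> d \<and> s 0 = x \<and> s 1 = w \<and> length rs = length e \<and>
     (\<forall>i<length e. 2 \<le> rs ! i \<and> rs ! i < d \<and> s (rs ! i) = replicate (e ! i) True) \<and> (\<forall>r\<ge>d. s r = [])"

lemma env_upd: "env x w rs e d s \<Longrightarrow> d \<le> r \<Longrightarrow> r < d' \<Longrightarrow> env x w rs e d' (s(r := u))"
  by (auto simp: env_def)

lemma env_up: "env x w rs e d s \<Longrightarrow> d \<le> d' \<Longrightarrow> env x w rs e d' s"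
  by (auto simp: env_def dest: less_le_trans)

lemma env_cons:
  assumes "env x w rs e d s" "d \<le> r" "r < d'" "s' = s(r := replicate v True)"
  shows "env x w (r # rs) (v # e) d' s'"
  using assms unfolding env_def by (auto simp: nth_Cons' less_Suc_eq_0_disj split: if_splits dest: less_le_trans)

text \<open>Values and times are bounded by recursion on the syntax, in terms of a bound
  \<open>B\<close> on the variables (and, for formulas, on the lengths of the words). For a fixed
  formula the result is a polynomial in \<open>B\<close>.\<close>

fun tmax :: "trm \<Rightarrow> nat \<Rightarrow> nat" where
  "tmax (Var k) B = B"
| "tmax (Num c) B = c"
| "tmax (Plus a b) B = tmax a B + tmax b B"
| "tmax (Times a b) B = tmax a B * tmax b B"

fun ttime :: "trm \<Rightarrow> nat \<Rightarrow> nat" where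
  "ttime (Var k) B = 16 * B + 2"
| "ttime (Num c) B = 2 * c + 1"
| "ttime (Plus a b) B = ttime a B + (ttime b B + (7 * tmax b B + 1))"
| "ttime (Times a b) B = ttime a B + (ttime b B + ((tmax a B * ((16 * tmax b B + 2) + 3) + 1) + (3 * tmax b B + 1)))"

lemma tev_le_tmax: "\<forall>v\<in>set e. v \<le> B \<Longrightarrow> tev t e \<le> tmax t B"
  by (induction t) (auto intro: add_mono mult_mono)

lemma exc_ct:
  assumes "env x w rs e d s" "\<forall>v\<in>set e. v \<le> B"
  shows "exc (ct rs t d) z s (ttime t B) z (s(d := replicate (tev t e) True))"
  using assms(1)
proof (induction t arbitrary: d s)
  case (Var k)
  show ?case
  proof (cases "k < length rs")
    case True
    then have *: "s (rs ! k) = replicate (e ! k) True" "rs ! k < d" "s d = []" "s (Suc d) = []" "k < length e"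
      using Var by (auto simp: env_def)
    have "e ! k \<le> B" using assms(2) *(5) by auto
    then have "exc (Copy (rs ! k) d (Suc d)) z s (16 * B + 2) z (s(d := replicate (e ! k) True))"
      by (intro exc_copy[THEN exc_to]) (use * in auto)
    then show ?thesis using True * by (simp only: ct.simps ttime.simps tev.simps if_True)
  next
    case False
    then have "k \<ge> length e" "s d = []" using Var by (auto simp: env_def)
    then show ?thesis using False by (auto intro!: exc_skip[THEN exc_to])
  qed
next
  case (Num c)
  have "s d = []" using Num by (auto simp: env_def)
  then have "exc (Pushn c d) z s (2 * c + 1) z (s(d := replicate c True))"
    using exc_pushn[of c d z s] by simp
  then show ?case by (simp only: ct.simps ttime.simps tev.simps)
next
  case (Plus a b)
  let ?s = "s(d := replicate (tev a e) True)"
  have 2: "env x w rs e (Suc d) ?s" using env_upd[OF Plus.prems, of d] by simp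
  have f: "s d = []" "s (Suc d) = []" using Plus.prems by (auto simp: env_def)
  have "tev b e \<le> tmax b B" using tev_le_tmax assms(2) by blast
  then have 3: "exc (Move (Suc d) d) z (?s(Suc d := replicate (tev b e) True)) (7 * tmax b B + 1)
     z (s(d := replicate (tev a e + tev b e) True))"
    using f by (intro exc_move[THEN exc_to]) (auto simp: fun_eq_iff replicate_add[symmetric] add.commute)
  show ?case unfolding ct.simps ttime.simps
    by (rule exc_seq[OF Plus.IH(1)[OF Plus.prems] exc_seq[OF Plus.IH(2)[OF 2] 3], THEN exc_to]) auto
next
  case (Times a b)
  have 1: "env x w rs e (d+1) s" using env_up[OF Times.prems, of "d+1"] by simp
  let ?s = "s(d+1 := replicate (tev a e) True)"
  let ?t = "s(d+2 := replicate (tev b e) True)"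
  have 2: "env x w rs e (d+2) ?s" using env_upd[OF Times.prems, of "d+1"] by simp
  have f: "s d = []" "s (Suc d) = []" "s (d+2) = []" "s (d+3) = []" using Times.prems by (auto simp: env_def)
  have le: "tev b e \<le> tmax b B" "tev a e \<le> tmax a B" using tev_le_tmax assms(2) by blast+
  let ?S = "\<lambda>i. ?t(d := replicate (i * tev b e) True)"
  have 3: "exc (For (d+1) (Copy (d+2) d (d+3))) z (?s(d+2 := replicate (tev b e) True))
     (tmax a B * ((16 * tmax b B + 2) + 3) + 1) z ((?S (length (replicate (tev a e) True)))(d+1 := []))"
  proof (rule exc_for)
    fix i
    show "exc (Copy (d + 2) d (d + 3)) z ((?S i)(d + 1 := drop (Suc i) (replicate (tev a e) True))) (16 * tmax b B + 2) z
        ((?S (Suc i))(d + 1 := drop (Suc i) (replicate (tev a e) True)))"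
      by (rule exc_copy[THEN exc_to]) (use f le in \<open>auto simp: fun_eq_iff replicate_add\<close>)
  qed (use f le in \<open>auto simp: fun_eq_iff\<close>)
  have 4: "exc (Clear (d+2)) z ((?S (length (replicate (tev a e) True)))(d+1 := [])) (3 * tmax b B + 1)
      z (s(d := replicate (tev a e * tev b e) True))"
    by (rule exc_clear[THEN exc_to]) (use f le in \<open>auto simp: fun_eq_iff\<close>)
  show ?case unfolding ct.simps ttime.simps
    by (rule exc_seq[OF Times.IH(1)[OF 1] exc_seq[OF Times.IH(2)[OF 2] exc_seq[OF 3 4]], THEN exc_to]) auto
qed

text \<open>The truth value is left on stack \<open>d\<close> as a single bit. A comparison pops the
  second number once for every unit of the first; a bit is looked up by popping a copy of the word.
  For a quantifier, \<open>d + 1\<close> counts down the remaining values and \<open>d + 2\<close>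
  holds the current one in unary.\<close>

fun cf :: "nat list \<Rightarrow> fm \<Rightarrow> nat \<Rightarrow> com" where
  "cf rs (Less a b) d = Seq (ct rs a d) (Seq (ct rs b (d+1)) (Seq (For d (Pop (d+1)))
     (Cond (Suc (d+1)) nonempty (Seq (Clear (d+1)) (Push d True)) (Push d False))))"
| "cf rs (Bit b t) d = Seq (ct rs t d) (Seq (Copy (if b then 1 else 0) (d+1) (d+2)) (Seq (For d (Pop (d+1)))
     (Cond (Suc (d+1)) top_true (Seq (Clear (d+1)) (Push d True)) (Seq (Clear (d+1)) (Push d False)))))"
| "cf rs (Nand p q) d = Seq (cf rs p d) (Cond (Suc d) top_true
     (Seq (Pop d) (Seq (cf rs q d) (Cond (Suc d) top_true (Seq (Pop d) (Push d False)) (Seq (Pop d) (Push d True)))))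
     (Seq (Pop d) (Push d True)))"
| "cf rs (Ex t p) d = Seq (Push d False) (Seq (ct rs t (d+1)) (Seq
     (For (d+1) (Seq (cf ((d+2) # rs) p (d+3)) (Seq
        (Cond (Suc (d+3)) top_true (Seq (Pop (d+3)) (Seq (Pop d) (Push d True))) (Pop (d+3)))
        (Push (d+2) True))))
     (Clear (d+2))))"

fun ftime :: "fm \<Rightarrow> nat \<Rightarrow> nat" where
  "ftime (Less a b) B = ttime a B + (ttime b B + ((tmax a B * (1 + 3) + 1) + ((3 * tmax b B + 1) + 2 + 2)))"
| "ftime (Bit b t) B = ttime t B + ((16 * B + 2) + ((tmax t B * (1 + 3) + 1) + ((3 * B + 1) + 2 + 2)))"
| "ftime (Nand p q) B = ftime p B + ((1 + (ftime q B + (1 + 2 + 2))) + 2)"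
| "ftime (Ex t p) B = 2 + (ttime t B + ((tmax t B * ((ftime p (B + tmax t B) + ((1 + (1 + 2)) + 2 + 2)) + 3) + 1)
     + (3 * tmax t B + 1)))"

lemma exc_cf:
  assumes "env x w rs e d s" "\<forall>v\<in>set e. v \<le> B" "length x \<le> B" "length w \<le> B"
  shows "exc (cf rs p d) z s (ftime p B) z (s(d := [eval x w p e]))"
  using assms
proof (induction p arbitrary: rs e d s B)
  case (Less a b)
  let ?s = "s(d := replicate (tev a e) True)"
  let ?t = "?s(d+1 := replicate (tev b e) True)"
  have 2: "env x w rs e (d+1) ?s" using env_upd[OF Less.prems(1), of d] by simp
  have f: "s d = []" "s (d+1) = []" using Less.prems(1) by (auto simp: env_def)
  have le: "tev b e \<le> tmax b B" "tev a e \<le> tmax a B" using tev_le_tmax Less.prems(2) by blast+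
  let ?S = "\<lambda>i. s(d+1 := replicate (tev b e - i) True)"
  have 3: "exc (For d (Pop (d+1))) z ?t (tmax a B * (1 + 3) + 1) z ((?S (length (replicate (tev a e) True)))(d := []))"
  proof (rule exc_for)
    fix i
    show "exc (Pop (d+1)) z ((?S i)(d := drop (Suc i) (replicate (tev a e) True))) 1 z
        ((?S (Suc i))(d := drop (Suc i) (replicate (tev a e) True)))"
      by (rule exc_pop[THEN exc_to]) (auto simp: fun_eq_iff)
  qed (use f le in \<open>auto simp: fun_eq_iff\<close>)
  have 4: "exc (Cond (Suc (d+1)) nonempty (Seq (Clear (d+1)) (Push d True)) (Push d False)) z
     ((?S (length (replicate (tev a e) True)))(d := [])) ((3 * tmax b B + 1) + 2 + 2) z (s(d := [tev a e < tev b e]))"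
    by (rule exc_cond; (rule exc_seq[OF exc_clear exc_push, THEN exc_to] | rule exc_push[THEN exc_to]))
      (use f le in \<open>auto simp: fun_eq_iff\<close>)
  show ?case unfolding cf.simps ftime.simps eval.simps
    by (rule exc_seq[OF exc_ct exc_seq[OF exc_ct[OF 2] exc_seq[OF 3 4]]]) (use Less.prems in auto)
next
  case (Bit b t)
  let ?u = "if b then w else x"
  let ?s = "s(d := replicate (tev t e) True)"
  let ?t = "?s(d+1 := ?u)"
  have f: "s d = []" "s (d+1) = []" "s (d+2) = []" "s 0 = x" "s 1 = w" "2 \<le> d"
    using Bit.prems(1) by (auto simp: env_def)
  have le: "tev t e \<le> tmax t B" using tev_le_tmax Bit.prems(2) by blast
  have u: "length ?u \<le> B" using Bit.prems by simp
  have 2: "exc (Copy (if b then 1 else 0) (d+1) (d+2)) z ?s (16 * B + 2) z ?t"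
    by (rule exc_copy[THEN exc_to]) (use f u Bit.prems in auto)
  let ?S = "\<lambda>i. s(d+1 := drop i ?u)"
  have 3: "exc (For d (Pop (d+1))) z ?t (tmax t B * (1 + 3) + 1) z ((?S (length (replicate (tev t e) True)))(d := []))"
  proof (rule exc_for)
    fix i
    show "exc (Pop (d+1)) z ((?S i)(d := drop (Suc i) (replicate (tev t e) True))) 1 z
        ((?S (Suc i))(d := drop (Suc i) (replicate (tev t e) True)))"
      by (rule exc_pop[THEN exc_to]) (auto simp: fun_eq_iff drop_Suc drop_tl)
  qed (use f le in \<open>auto simp: fun_eq_iff\<close>)
  have top: "top_true (topsym (drop k v)) \<longleftrightarrow> k < length v \<and> v ! k" for k v
    by (cases "k < length v") (simp_all add: Cons_nth_drop_Suc[symmetric])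
  have 4: "exc (Cond (Suc (d+1)) top_true (Seq (Clear (d+1)) (Push d True)) (Seq (Clear (d+1)) (Push d False))) z
     ((?S (length (replicate (tev t e) True)))(d := [])) ((3 * B + 1) + 2 + 2) z (s(d := [tev t e < length ?u \<and> ?u ! tev t e]))"
    by (rule exc_cond; rule exc_seq[OF exc_clear exc_push, THEN exc_to])
      (use f u in \<open>auto simp: fun_eq_iff top split: if_splits\<close>)
  show ?case unfolding cf.simps ftime.simps eval.simps Let_def
    by (rule exc_seq[OF exc_ct exc_seq[OF 2 exc_seq[OF 3 4]]]) (use Bit.prems in auto)
next
  case (Nand p q)
  have f: "s d = []" using Nand.prems(1) by (auto simp: env_def)
  have 1: "exc (cf rs p d) z s (ftime p B) z (s(d := [eval x w p e]))"
    by (rule Nand.IH(1)[OF Nand.prems])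
  have q: "exc (cf rs q d) z s (ftime q B) z (s(d := [eval x w q e]))"
    by (rule Nand.IH(2)[OF Nand.prems])
  have pop: "exc (Pop d) z (s(d := [b])) 1 z s" for b
    by (rule exc_pop[THEN exc_to]) (use f in auto)
  have r: "exc (Seq (Pop d) (Push d b)) z (s(d := [a])) (1 + 2) z (s(d := [b]))" for a b
    by (rule exc_seq[OF pop exc_push, THEN exc_to]) (use f in auto)
  have 2: "exc (Cond (Suc d) top_true (Seq (Pop d) (Push d False)) (Seq (Pop d) (Push d True))) z
     (s(d := [eval x w q e])) (1 + 2 + 2) z (s(d := [\<not> eval x w q e]))"
    by (rule exc_cond; rule r[THEN exc_to]) (auto split: if_splits)
  have 3: "exc (Cond (Suc d) top_true
     (Seq (Pop d) (Seq (cf rs q d) (Cond (Suc d) top_true (Seq (Pop d) (Push d False)) (Seq (Pop d) (Push d True)))))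
     (Seq (Pop d) (Push d True))) z (s(d := [eval x w p e])) ((1 + (ftime q B + (1 + 2 + 2))) + 2) z
     (s(d := [\<not> (eval x w p e \<and> eval x w q e)]))"
    by (rule exc_cond; (rule exc_seq[OF pop exc_seq[OF q 2], THEN exc_to] | rule r[THEN exc_to])) (auto split: if_splits)
  show ?case unfolding cf.simps ftime.simps eval.simps
    by (rule exc_seq[OF 1 3])
next
  case (Ex t p)
  let ?B = "B + tmax t B"
  have f: "s d = []" "s (d+1) = []" "s (d+2) = []" "s (d+3) = []"
    using Ex.prems(1) by (auto simp: env_def)
  have le: "tev t e \<le> tmax t B" using tev_le_tmax Ex.prems(2) by blast
  have 1: "exc (Push d False) z s 2 z (s(d := [False]))"
    using exc_push[of d False z s] f by simp
  have 2: "exc (ct rs t (d+1)) z (s(d := [False])) (ttime t B) z (s(d := [False], d+1 := replicate (tev t e) True))"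
    by (rule exc_ct) (use env_upd[OF Ex.prems(1), of d] Ex.prems in auto)
  let ?S = "\<lambda>i. s(d := [\<exists>v<i. eval x w p (v # e)], d+2 := replicate i True)"
  have 3: "exc (For (d+1) (Seq (cf ((d+2) # rs) p (d+3)) (Seq
        (Cond (Suc (d+3)) top_true (Seq (Pop (d+3)) (Seq (Pop d) (Push d True))) (Pop (d+3)))
        (Push (d+2) True)))) z (s(d := [False], d+1 := replicate (tev t e) True))
     (tmax t B * ((ftime p ?B + ((1 + (1 + 2)) + 2 + 2)) + 3) + 1) z ((?S (length (replicate (tev t e) True)))(d+1 := []))"
  proof (rule exc_for)
    fix i assume i: "i < length (replicate (tev t e) True)"
    let ?r = "replicate (tev t e - Suc i) True"
    let ?s1 = "(?S i)(d+1 := ?r)"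
    have "env x w rs e (d+2) (s(d := [\<exists>v<i. eval x w p (v # e)], d+1 := ?r))"
      by (rule env_upd[OF env_upd[OF Ex.prems(1), of d "d+1"]]) auto
    then have "env x w ((d+2) # rs) (i # e) (d+3) ?s1"
      by (rule env_cons[of _ _ _ _ "d+2"]) (auto simp: fun_eq_iff)
    then have a: "exc (cf ((d+2) # rs) p (d+3)) z ?s1 (ftime p ?B) z (?s1(d+3 := [eval x w p (i # e)]))"
      by (rule Ex.IH) (use Ex.prems i le in auto)
    let ?s2 = "s(d := [\<exists>v<Suc i. eval x w p (v # e)], d+2 := replicate i True, d+1 := ?r)"
    have b: "exc (Cond (Suc (d+3)) top_true (Seq (Pop (d+3)) (Seq (Pop d) (Push d True))) (Pop (d+3))) z
       (?s1(d+3 := [eval x w p (i # e)])) ((1 + (1 + 2)) + 2) z ?s2"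
      by (rule exc_cond; (rule exc_seq[OF exc_pop exc_seq[OF exc_pop exc_push], THEN exc_to] | rule exc_pop[THEN exc_to]))
        (use f in \<open>auto simp: fun_eq_iff less_Suc_eq split: if_splits\<close>)
    have c: "exc (Push (d+2) True) z ?s2 2 z ((?S (Suc i))(d+1 := ?r))"
      by (rule exc_push[THEN exc_to]) (auto simp: fun_eq_iff)
    show "exc (Seq (cf ((d+2) # rs) p (d+3)) (Seq
        (Cond (Suc (d+3)) top_true (Seq (Pop (d+3)) (Seq (Pop d) (Push d True))) (Pop (d+3)))
        (Push (d+2) True))) z ((?S i)(d+1 := drop (Suc i) (replicate (tev t e) True)))
        (ftime p ?B + ((1 + (1 + 2)) + 2 + 2)) z ((?S (Suc i))(d+1 := drop (Suc i) (replicate (tev t e) True)))"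
      using exc_seq[OF a exc_seq[OF b c]] by simp
  qed (use f le in \<open>auto simp: fun_eq_iff\<close>)
  have 4: "exc (Clear (d+2)) z ((?S (length (replicate (tev t e) True)))(d+1 := [])) (3 * tmax t B + 1) z (s(d := [eval x w (Ex t p) e]))"
    by (rule exc_clear[THEN exc_to]) (use f le in \<open>auto simp: fun_eq_iff\<close>)
  show ?case unfolding cf.simps ftime.simps
    by (rule exc_seq[OF 1 exc_seq[OF 2 exc_seq[OF 3 4]]])
qed

section \<open>Iterating a definable transformation of the work word\<close>

definition Gen :: "trm \<Rightarrow> fm \<Rightarrow> nat \<Rightarrow> com" where
  "Gen t p d = Seq (ct [2] t d) (Seq (For d (Seq (cf [d+1, 2] p (d+3)) (Seq (Move (d+3) (d+2)) (Push (d+1) True))))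
     (Seq (Clear (d+1)) (Seq (Clear 1) (Move (d+2) 1))))"

text \<open>A parallel update: every bit of the new work word is computed from the input and the
  whole old work word. This is why \<open>Gen\<close> collects the new word on a separate stack
  before it replaces the old one.\<close>

definition gen :: "bool list \<Rightarrow> trm \<Rightarrow> fm \<Rightarrow> bool list \<Rightarrow> bool list" where
  "gen x t p w = map (\<lambda>i. eval x w p [i, length x]) [0..<tev t [length x]]"

definition gtime :: "trm \<Rightarrow> fm \<Rightarrow> nat \<Rightarrow> nat" where
  "gtime t p B = ttime t B + ((tmax t B * ((ftime p (B + tmax t B) + ((7 * 1 + 1) + 2)) + 3) + 1)
     + ((3 * tmax t B + 1) + ((3 * B + 1) + (7 * tmax t B + 1))))"

lemma exc_Gen:
  assumes "env x w [2] [length x] d s" "length x \<le> B" "length w \<le> B"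
  shows "exc (Gen t p d) z s (gtime t p B) z (s(1 := gen x t p w))"
proof -
  let ?n = "length x"
  let ?k = "tev t [?n]"
  have f: "s 1 = w" "s d = []" "s (d+1) = []" "s (d+2) = []" "s (d+3) = []" "3 \<le> d"
    using assms(1) by (auto simp: env_def)
  have le: "?k \<le> tmax t B" using tev_le_tmax[of "[?n]" B] assms(2) by simp
  have 1: "exc (ct [2] t d) z s (ttime t B) z (s(d := replicate ?k True))"
    by (rule exc_ct[OF assms(1)]) (use assms(2) in simp)
  let ?g = "\<lambda>i. rev (map (\<lambda>i. eval x w p [i, ?n]) [0..<i])"
  let ?S = "\<lambda>i. s(d+1 := replicate i True, d+2 := ?g i)"
  have 2: "exc (For d (Seq (cf [d+1, 2] p (d+3)) (Seq (Move (d+3) (d+2)) (Push (d+1) True)))) z (s(d := replicate ?k True))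
     (tmax t B * ((ftime p (B + tmax t B) + ((7 * 1 + 1) + 2)) + 3) + 1) z ((?S (length (replicate ?k True)))(d := []))"
  proof (rule exc_for)
    fix i assume i: "i < length (replicate ?k True)"
    let ?r = "replicate (?k - Suc i) True"
    let ?s1 = "(?S i)(d := ?r)"
    have "env x w [2] [?n] (d+1) (s(d := ?r))"
      by (rule env_upd[OF assms(1)]) auto
    then have "env x w [d+1, 2] [i, ?n] (d+2) (s(d := ?r, d+1 := replicate i True))"
      by (rule env_cons[of _ _ _ _ "d+1"]) auto
    then have "env x w [d+1, 2] [i, ?n] (d+3) (s(d := ?r, d+1 := replicate i True, d+2 := ?g i))"
      by (rule env_upd) auto
    moreover have "s(d := ?r, d+1 := replicate i True, d+2 := ?g i) = ?s1"
      by (auto simp: fun_eq_iff)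
    ultimately have a: "exc (cf [d+1, 2] p (d+3)) z ?s1 (ftime p (B + tmax t B)) z (?s1(d+3 := [eval x w p [i, ?n]]))"
      by (intro exc_cf) (use assms i le in auto)
    have b: "exc (Move (d+3) (d+2)) z (?s1(d+3 := [eval x w p [i, ?n]])) (7 * 1 + 1) z
       (s(d := ?r, d+1 := replicate i True, d+2 := ?g (Suc i)))"
      by (rule exc_move[THEN exc_to]) (use f in \<open>auto simp: fun_eq_iff\<close>)
    have c: "exc (Push (d+1) True) z (s(d := ?r, d+1 := replicate i True, d+2 := ?g (Suc i))) 2 z ((?S (Suc i))(d := ?r))"
      by (rule exc_push[THEN exc_to]) (auto simp: fun_eq_iff)
    show "exc (Seq (cf [d+1, 2] p (d+3)) (Seq (Move (d+3) (d+2)) (Push (d+1) True))) z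
        ((?S i)(d := drop (Suc i) (replicate ?k True))) (ftime p (B + tmax t B) + ((7 * 1 + 1) + 2)) z
        ((?S (Suc i))(d := drop (Suc i) (replicate ?k True)))"
      using exc_seq[OF a exc_seq[OF b c]] by simp
  qed (use f le in \<open>auto simp: fun_eq_iff\<close>)
  have 3: "exc (Clear (d+1)) z ((?S (length (replicate ?k True)))(d := [])) (3 * tmax t B + 1) z (s(d+2 := ?g ?k))"
    by (rule exc_clear[THEN exc_to]) (use f le in \<open>auto simp: fun_eq_iff\<close>)
  have 4: "exc (Clear 1) z (s(d+2 := ?g ?k)) (3 * B + 1) z (s(d+2 := ?g ?k, 1 := []))"
    by (rule exc_clear[THEN exc_to]) (use f assms in \<open>auto simp: fun_eq_iff\<close>)
  have 5: "exc (Move (d+2) 1) z (s(d+2 := ?g ?k, 1 := [])) (7 * tmax t B + 1) z (s(1 := gen x t p w))"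
    by (rule exc_move[THEN exc_to]) (use f le in \<open>auto simp: fun_eq_iff gen_def\<close>)
  show ?thesis unfolding Gen_def gtime_def
    by (rule exc_seq[OF 1 exc_seq[OF 2 exc_seq[OF 3 exc_seq[OF 4 5]]]])
qed

definition Iterate :: "trm \<Rightarrow> fm \<Rightarrow> trm \<Rightarrow> trm \<Rightarrow> fm \<Rightarrow> com" where
  "Iterate t p q t' p' = Seq (Copy 0 3 2) (Seq (For 3 (Push 2 True)) (Seq (ct [2] q 3)
     (Seq (For 3 (Gen t p 4)) (Gen t' p' 4))))"

definition itime :: "trm \<Rightarrow> fm \<Rightarrow> trm \<Rightarrow> trm \<Rightarrow> fm \<Rightarrow> nat \<Rightarrow> nat" where
  "itime t p q t' p' n = (16 * n + 2) + ((n * (2 + 3) + 1) + (ttime q n +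
     ((tmax q n * (gtime t p (n + tmax t n) + 3) + 1) + gtime t' p' (n + tmax t n))))"

lemma exc_Iterate:
  "exc (Iterate t p q t' p') z ((\<lambda>_. [])(0 := x)) (itime t p q t' p' (length x)) z
     ((\<lambda>_. [])(0 := x, 2 := replicate (length x) True,
        1 := gen x t' p' ((gen x t p ^^ tev q [length x]) [])))"
proof -
  let ?n = "length x"
  let ?init = "(\<lambda>_ :: nat. [])(0 := x)"
  let ?s = "?init(2 := replicate ?n True)"
  let ?k = "tev q [?n]"
  let ?W = "\<lambda>i. (gen x t p ^^ i) []"
  \<comment> \<open>After the initial empty word the length is dictated by \<open>t\<close>, so the
    cost of a round does not grow from round to round.\<close>
  have "length (?W i) \<le> tev t [?n]" for i by (cases i) (auto simp: gen_def)
  moreover have "tev t [?n] \<le> tmax t ?n" by (rule tev_le_tmax) simp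
  ultimately have W: "length (?W i) \<le> ?n + tmax t ?n" for i by (meson le_trans trans_le_add2)
  have k: "?k \<le> tmax q ?n" by (rule tev_le_tmax) simp
  have 1: "exc (Copy 0 3 2) z ?init (16 * ?n + 2) z (?init(3 := x))"
    by (rule exc_copy[THEN exc_to]) simp_all
  have 2: "exc (For 3 (Push 2 True)) z (?init(3 := x)) (?n * (2 + 3) + 1) z ((?init(2 := replicate (length x) True))(3 := []))"
  proof (rule exc_for[where S = "\<lambda>i. ?init(2 := replicate i True)" and L = x])
    fix i
    show "exc (Push 2 True) z (?init(2 := replicate i True, 3 := drop (Suc i) x)) 2 z
         (?init(2 := replicate (Suc i) True, 3 := drop (Suc i) x))"
      by (rule exc_push[THEN exc_to]) (auto simp: fun_eq_iff)
  next
    show "?init(3 := x) = ?init(2 := replicate 0 True, 3 := x)" by (rule ext) simp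
  qed simp
  have e0: "(?init(2 := replicate ?n True))(3 := []) = ?s" by (auto simp: fun_eq_iff)
  have 3: "exc (ct [2] q 3) z ?s (ttime q ?n) z (?s(3 := replicate ?k True))"
    by (rule exc_ct[where x = x and w = "[]"]) (auto simp: env_def)
  let ?S = "\<lambda>i. ?s(1 := ?W i)"
  have 4: "exc (For 3 (Gen t p 4)) z (?s(3 := replicate ?k True)) (tmax q ?n * (gtime t p (?n + tmax t ?n) + 3) + 1) z
     ((?S (length (replicate ?k True)))(3 := []))"
  proof (rule exc_for)
    fix i
    let ?r = "drop (Suc i) (replicate ?k True)"
    have "env x (?W i) [2] [?n] 4 ((?S i)(3 := ?r))" by (auto simp: env_def)
    then have "exc (Gen t p 4) z ((?S i)(3 := ?r)) (gtime t p (?n + tmax t ?n)) z (((?S i)(3 := ?r))(1 := gen x t p (?W i)))"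
      by (rule exc_Gen) (use W in auto)
    then show "exc (Gen t p 4) z ((?S i)(3 := ?r)) (gtime t p (?n + tmax t ?n)) z ((?S (Suc i))(3 := ?r))"
      by (rule exc_to) (auto simp: fun_eq_iff)
  qed (use k in \<open>auto simp: fun_eq_iff\<close>)
  have "env x (?W ?k) [2] [?n] 4 ((?S (length (replicate ?k True)))(3 := []))" by (auto simp: env_def)
  then have 5: "exc (Gen t' p' 4) z ((?S (length (replicate ?k True)))(3 := [])) (gtime t' p' (?n + tmax t ?n)) z
      (((?S (length (replicate ?k True)))(3 := []))(1 := gen x t' p' (?W ?k)))"
    by (rule exc_Gen) (use W in auto)
  show ?thesis unfolding Iterate_def itime_def
    by (rule exc_seq[OF 1 exc_seq[OF 2[unfolded e0] exc_seq[OF 3 exc_seq[OF 4 5]]], THEN exc_to]) (auto simp: fun_eq_iff)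
qed

section \<open>Polynomial bounds\<close>

definition pbound :: "(nat \<Rightarrow> nat) \<Rightarrow> bool" where
  "pbound f \<longleftrightarrow> (\<exists>p :: nat poly. \<forall>n. f n \<le> poly p n)"

lemma poly_nat_mono: "m \<le> n \<Longrightarrow> poly (p :: nat poly) m \<le> poly p n"
  by (induction p) (auto intro!: add_mono mult_mono)

lemma pbound_intros:
  "pbound (\<lambda>_. c)" "pbound (\<lambda>n. n)" "pbound f \<Longrightarrow> pbound g \<Longrightarrow> pbound (\<lambda>n. f n + g n)"
  "pbound f \<Longrightarrow> pbound g \<Longrightarrow> pbound (\<lambda>n. f n * g n)"
proof -
  show "pbound (\<lambda>_. c)" unfolding pbound_def by (rule exI[of _ "[:c:]"]) simp
  show "pbound (\<lambda>n. n)" unfolding pbound_def by (rule exI[of _ "[:0, 1:]"]) simp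
  assume f: "pbound f" and g: "pbound g"
  from f obtain p where p: "\<And>n. f n \<le> poly p n" by (auto simp: pbound_def)
  from g obtain q where q: "\<And>n. g n \<le> poly q n" by (auto simp: pbound_def)
  show "pbound (\<lambda>n. f n + g n)" unfolding pbound_def
    by (rule exI[of _ "p + q"]) (auto intro: add_mono p q)
  show "pbound (\<lambda>n. f n * g n)" unfolding pbound_def
    by (rule exI[of _ "p * q"]) (auto intro: mult_mono p q)
qed

lemma pbound_comp: "pbound f \<Longrightarrow> pbound g \<Longrightarrow> pbound (\<lambda>n. f (g n))"
proof -
  assume f: "pbound f" and g: "pbound g"
  from f obtain p where p: "\<And>n. f n \<le> poly p n" by (auto simp: pbound_def)
  from g obtain q where q: "\<And>n. g n \<le> poly q n" by (auto simp: pbound_def)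
  show ?thesis unfolding pbound_def
    by (rule exI[of _ "pcompose p q"]) (auto simp: poly_pcompose intro: order_trans[OF p poly_nat_mono[OF q]])
qed

lemma pbound_tmax: "pbound (tmax t)"
  by (induction t) (auto intro!: pbound_intros simp: tmax.simps[abs_def])

lemma pbound_ttime: "pbound (ttime t)"
  by (induction t; unfold ttime.simps[abs_def]; intro pbound_intros pbound_tmax; assumption)

lemma pbound_ftime: "pbound (ftime p)"
proof (induction p)
  case (Ex t p)
  have "pbound (\<lambda>B. ftime p (B + tmax t B))"
    by (rule pbound_comp[OF Ex]) (intro pbound_intros pbound_tmax)
  then show ?case unfolding ftime.simps[abs_def]
    by (intro pbound_intros pbound_tmax pbound_ttime)
qed (unfold ftime.simps[abs_def], (intro pbound_intros pbound_tmax pbound_ttime; assumption)+)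

lemma pbound_gtime: "pbound (gtime t p)"
proof -
  have "pbound (\<lambda>B. ftime p (B + tmax t B))"
    by (rule pbound_comp[OF pbound_ftime]) (intro pbound_intros pbound_tmax)
  then show ?thesis unfolding gtime_def[abs_def]
    by (intro pbound_intros pbound_tmax pbound_ttime)
qed

lemma pbound_itime: "pbound (itime t p q t' p')"
proof -
  have "pbound (\<lambda>B. gtime t p (B + tmax t B))" for t p and t' :: trm
    by (rule pbound_comp[OF pbound_gtime]) (intro pbound_intros pbound_tmax)
  moreover have "pbound (\<lambda>B. gtime t' p' (B + tmax t B))"
    by (rule pbound_comp[OF pbound_gtime]) (intro pbound_intros pbound_tmax)
  ultimately show ?thesis unfolding itime_def[abs_def]
    by (intro pbound_intros pbound_tmax pbound_ttime)
qed

lemma three_symbols_ct: "three_symbols (ct rs t d)"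
proof (induction t arbitrary: d)
  case (Num c)
  have "three_symbols (Pushn c d)" by (induction c) (auto simp: Skip_def Push_def bit_sym_def)
  then show ?case by simp
qed (auto simp: Skip_def Copy_def Move_def Move2_def Push_def Pop_def For_def Clear_def bit_sym_def)

lemma three_symbols_cf: "three_symbols (cf rs p d)"
  by (induction p arbitrary: rs d)
    (auto simp: three_symbols_ct Copy_def Move_def Move2_def Push_def Pop_def For_def Clear_def bit_sym_def)

lemma three_symbols_Iterate: "three_symbols (Whole (Iterate t p q t' p'))"
  by (auto simp: Whole_def Read_input_def Rewind_def Write_output_def Iterate_def Gen_def three_symbols_ct
    three_symbols_cf Copy_def Move_def Move2_def Push_def Pop_def For_def Clear_def bit_sym_def)

text \<open>All later claims of polynomial time go through this theorem: a polynomial number of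
  definable rounds, starting from the empty word, followed by a definable output.\<close>

theorem polytime_iterate:
  "polytime_computable (\<lambda>x. gen x t' p' ((gen x t p ^^ tev q [length x]) []))"
proof -
  let ?c = "Iterate t p q t' p'"
  obtain K where K: "regs_below K (Whole ?c)" using regs_below_exists by blast
  have "pbound (\<lambda>n. 15 * n + 6 * tmax t' n + itime t p q t' p' n + 3)"
    by (intro pbound_intros pbound_tmax pbound_itime)
  then obtain P :: "nat poly" where P: "\<And>n. 15 * n + 6 * tmax t' n + itime t p q t' p' n + 3 \<le> poly P n"
    by (auto simp: pbound_def)
  have "tm_outputs_within (machine K (compile (Whole ?c) 0)) x (poly P (length x))
      (gen x t' p' ((gen x t p ^^ tev q [length x]) []))" for x
  proof -
    let ?y = "gen x t' p' ((gen x t p ^^ tev q [length x]) [])"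
    have 1: "tm_outputs_within (machine K (compile (Whole ?c) 0)) x
        (15 * length x + 6 * length ?y + itime t p q t' p' (length x) + 3) ?y"
      by (rule Whole_outputs[OF exc_Iterate _ K]) simp
    have "length ?y \<le> tmax t' (length x)"
      using tev_le_tmax[of "[length x]" "length x" t'] by (simp add: gen_def)
    then have "15 * length x + 6 * length ?y + itime t p q t' p' (length x) + 3 \<le> poly P (length x)"
      using P[of "length x"] by linarith
    then show ?thesis using 1 unfolding tm_outputs_within_def by (meson le_trans)
  qed
  then show ?thesis unfolding polytime_computable_def
    using turing_machine_compile[OF three_symbols_Iterate K] by blast
qed

section \<open>Minions acting on nonbipartite graphs\<close>

datatype three = T0 | T1 | T2

lemma third_exists: "\<exists>c :: three. c \<noteq> a \<and> c \<noteq> b"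
  by (metis three.distinct(1,3,5))

text \<open>One coordinate of the diamond in \<open>k3_kernel_subcube\<close>: \<open>t\<close> is
  adjacent to both ends of an edge \<open>r\<close>, \<open>s\<close> whose ends are adjacent to
  \<open>x\<close> and to \<open>y\<close> respectively.\<close>

lemma three_cases:
  fixes x y t :: three
  assumes "x = y \<Longrightarrow> t = x"
  shows "\<exists>r s. r \<noteq> x \<and> s \<noteq> y \<and> r \<noteq> s \<and> t \<noteq> r \<and> t \<noteq> s"
proof -
  have "\<exists>r s. r \<noteq> x \<and> s \<noteq> x \<and> r \<noteq> s" by (cases x) (metis three.distinct)+
  moreover obtain w where "w \<noteq> x" "w \<noteq> y" using third_exists by blast
  moreover have "t = x \<or> t = y \<or> t = w" if "x \<noteq> y"
    using that calculation(2,3) by (cases x; cases y; cases t; cases w) auto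
  ultimately show ?thesis using assms by metis
qed

text \<open>A diamond consists of two triangles sharing the edge \<open>r\<close>, \<open>s\<close>.
  Its tips may coincide, so a single triangle is allowed.\<close>

definition diamond_free :: "('v \<times> 'v) set \<Rightarrow> bool" where
  "diamond_free E \<longleftrightarrow> (\<forall>p q r s. (p, r) \<in> E \<and> (p, s) \<in> E \<and> (r, s) \<in> E \<and> (r, q) \<in> E \<and> (s, q) \<in> E \<longrightarrow> p = q)"

definition k3_hom :: "(('i \<Rightarrow> three) \<Rightarrow> 'v) \<Rightarrow> ('v \<times> 'v) set \<Rightarrow> bool" where
  "k3_hom h E \<longleftrightarrow> (\<forall>x y. (\<forall>i. x i \<noteq> y i) \<longrightarrow> (h x, h y) \<in> E)"

text \<open>A collision of \<open>x\<close> and \<open>y\<close> collapses the subcube that they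
  span, third values included. The points \<open>h t\<close> and \<open>h x = h y\<close> are the
  tips of a diamond with middle edge \<open>h r\<close>, \<open>h s\<close>, where \<open>r\<close>
  avoids \<open>x\<close> and \<open>s\<close> avoids \<open>y\<close>.\<close>

lemma k3_kernel_subcube:
  assumes h: "k3_hom h E" and df: "diamond_free E" and eq: "h x = h y"
    and t: "\<And>i. x i = y i \<Longrightarrow> t i = x i"
  shows "h t = h x"
proof -
  have "\<forall>i. \<exists>r s. r \<noteq> x i \<and> s \<noteq> y i \<and> r \<noteq> s \<and> t i \<noteq> r \<and> t i \<noteq> s"
    using three_cases t by blast
  from choice[OF this] obtain r where "\<forall>i. \<exists>s. r i \<noteq> x i \<and> s \<noteq> y i \<and> r i \<noteq> s \<and> t i \<noteq> r i \<and> t i \<noteq> s"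
    by blast
  from choice[OF this] obtain s where rs: "\<And>i. r i \<noteq> x i \<and> s i \<noteq> y i \<and> r i \<noteq> s i \<and> t i \<noteq> r i \<and> t i \<noteq> s i"
    by blast
  have E: "(h u, h v) \<in> E" if "\<And>i. u i \<noteq> v i" for u v using h that unfolding k3_hom_def by blast
  have "(h t, h r) \<in> E" "(h t, h s) \<in> E" "(h r, h s) \<in> E" "(h r, h x) \<in> E" "(h s, h y) \<in> E"
    using rs by (simp_all add: E)
  then show ?thesis using df eq unfolding diamond_free_def by metis
qed

text \<open>A single collision between points that differ at \<open>j\<close> makes \<open>j\<close>
  irrelevant everywhere. The subcube lemma gives this at \<open>x\<close>, and \<open>step\<close>
  carries it from a point to every point that avoids it outside \<open>j\<close>.\<close>

lemma k3_irrelevant_coordinate: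
  assumes h: "k3_hom h E" and df: "diamond_free E" and eq: "h x = h y" and j: "x j \<noteq> y j"
  shows "h (z(j := a)) = h z"
proof -
  define P where "P z \<longleftrightarrow> (\<forall>a. h (z(j := a)) = h z)" for z
  have Px: "P x" unfolding P_def
    using k3_kernel_subcube[OF h df eq] j by (metis fun_upd_apply)
  have step: "P z" if P: "P x" and zx: "\<And>i. i \<noteq> j \<Longrightarrow> z i \<noteq> x i" for x z
  proof -
    have "h (z(j := a)) = h (z(j := b))" if ab: "a \<noteq> b" for a b
    proof -
      have "\<forall>i. \<exists>w. w \<noteq> x i \<and> w \<noteq> z i" using third_exists by blast
      from choice[OF this] obtain w where w: "\<And>i. w i \<noteq> x i \<and> w i \<noteq> z i" by blast
      obtain c where c: "c \<noteq> a" "c \<noteq> b" using third_exists by metis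
      have E: "(h u, h v) \<in> E" if "\<And>i. u i \<noteq> v i" for u v using h that unfolding k3_hom_def by blast
      have k: "h (x(j := d)) = h x" for d using P unfolding P_def by blast
      \<comment> \<open>The images of \<open>z(j := a)\<close> and \<open>z(j := b)\<close> are the
        tips of a diamond. Its middle edge joins \<open>h x\<close>, which does not depend on the
        entry at \<open>j\<close>, to the image of \<open>w(j := c)\<close>.\<close>
      have "(h (z(j := a)), h (x(j := b))) \<in> E" "(h (x(j := a)), h (z(j := b))) \<in> E"
        "(h (z(j := a)), h (w(j := c))) \<in> E" "(h (w(j := c)), h (z(j := b))) \<in> E"
        "(h (x(j := a)), h (w(j := c))) \<in> E"
        using zx ab c w by (auto intro!: E) metis+
      then show ?thesis using df k unfolding diamond_free_def by metis
    qed
    then show ?thesis unfolding P_def by (metis fun_upd_triv)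
  qed
  \<comment> \<open>With three colours some \<open>w\<close> avoids both \<open>x\<close> and
    \<open>z\<close>, so two steps lead from \<open>x\<close> to any \<open>z\<close>.\<close>
  have "\<forall>i. \<exists>w. w \<noteq> x i \<and> w \<noteq> z i" using third_exists by blast
  from choice[OF this] obtain w where w: "\<And>i. w i \<noteq> x i \<and> w i \<noteq> z i" by blast
  have "P w" by (rule step[OF Px]) (use w in metis)
  then have "P z" by (rule step) (use w in metis)
  then show ?thesis unfolding P_def by blast
qed

text \<open>\<open>S\<close> is the set of coordinates that matter somewhere. By the previous lemma
  a colliding pair agrees on it; conversely, entries outside it can be changed one at a time, and
  only the finitely many in \<open>J\<close> count.\<close>

lemma k3_kernel:
  fixes h :: "('i \<Rightarrow> three) \<Rightarrow> 'v"
  assumes h: "k3_hom h E" and df: "diamond_free E" and J: "finite J"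
    and dep: "\<And>x y. (\<forall>i\<in>J. x i = y i) \<Longrightarrow> h x = h y"
  obtains S where "S \<subseteq> J" "\<And>x y. h x = h y \<longleftrightarrow> (\<forall>i\<in>S. x i = y i)"
proof
  let ?S = "{j. \<exists>z a. h (z(j := a)) \<noteq> h z}"
  show "?S \<subseteq> J"
  proof
    fix j assume "j \<in> ?S"
    then obtain z a where "h (z(j := a)) \<noteq> h z" by blast
    then show "j \<in> J" using dep[of "z(j := a)" z] by (metis fun_upd_apply)
  qed
  show "h x = h y \<longleftrightarrow> (\<forall>i\<in>?S. x i = y i)" for x y
  proof
    assume "h x = h y"
    then show "\<forall>i\<in>?S. x i = y i" using k3_irrelevant_coordinate[OF h df] by blast
  next
    assume S: "\<forall>i\<in>?S. x i = y i"
    have "h (\<lambda>i. if i \<in> D then y i else x i) = h x" if "finite D" for D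
      using that
    proof (induction D)
      case (insert j D)
      show ?case
      proof (cases "j \<in> ?S")
        case True
        then have "(\<lambda>i. if i \<in> insert j D then y i else x i) = (\<lambda>i. if i \<in> D then y i else x i)"
        proof -
          have "x j = y j" using S True by blast
          then show ?thesis by auto
        qed
        then show ?thesis using insert by simp
      next
        case False
        have "(\<lambda>i. if i \<in> insert j D then y i else x i) = (\<lambda>i. if i \<in> D then y i else x i)(j := y j)"
          by auto
        then show ?thesis using insert False by auto
      qed
    qed simp
    from this[OF J] show "h x = h y" using dep[of "\<lambda>i. if i \<in> J then y i else x i" y] by simp
  qed
qed

section \<open>Minions and their actions on graphs\<close>

definition ugraph :: "'v set \<Rightarrow> ('v \<times> 'v) set \<Rightarrow> bool" where
  "ugraph V E \<longleftrightarrow> finite V \<and> E \<subseteq> V \<times> V \<and> sym E \<and> irrefl E"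

definition has_triangle :: "('v \<times> 'v) set \<Rightarrow> bool" where
  "has_triangle E \<longleftrightarrow> (\<exists>a b c. (a, b) \<in> E \<and> (b, c) \<in> E \<and> (a, c) \<in> E)"

text \<open>Operations take infinite sequences of arguments and depend on finitely many of them
  (\<open>dep\<close>). Arities are thus avoided, and \<open>minor\<close> reindexes along any map
  of the naturals.\<close>

locale minion =
  fixes M :: "'m set" and minor :: "(nat \<Rightarrow> nat) \<Rightarrow> 'm \<Rightarrow> 'm" and dep :: "'m \<Rightarrow> nat set \<Rightarrow> bool"
  assumes minor_closed: "f \<in> M \<Longrightarrow> minor \<pi> f \<in> M"
    and finite_dep: "f \<in> M \<Longrightarrow> \<exists>I. finite I \<and> dep f I"
begin

text \<open>A minion homomorphism from \<open>M\<close> to the polymorphisms of the graph. Since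
  \<open>act\<close> is separate from \<open>M\<close>, the graph can be shrunk or factored while
  \<open>M\<close>, and hence the labelling sought, stays the same.\<close>

definition acts :: "('m \<Rightarrow> (nat \<Rightarrow> 'v) \<Rightarrow> 'v) \<Rightarrow> 'v set \<Rightarrow> ('v \<times> 'v) set \<Rightarrow> bool" where
  "acts act V E \<longleftrightarrow> (\<forall>f\<in>M.
     (\<forall>x. (\<forall>i. x i \<in> V) \<longrightarrow> act f x \<in> V) \<and>
     (\<forall>x y. (\<forall>i. (x i, y i) \<in> E) \<longrightarrow> (act f x, act f y) \<in> E) \<and>
     (\<forall>x \<pi>. (\<forall>i. x i \<in> V) \<longrightarrow> act (minor \<pi> f) x = act f (\<lambda>i. x (\<pi> i))) \<and>
     (\<forall>x y I. dep f I \<longrightarrow> (\<forall>i. x i \<in> V) \<longrightarrow> (\<forall>i. y i \<in> V) \<longrightarrow> (\<forall>i\<in>I. x i = y i) \<longrightarrow> act f x = act f y))"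

text \<open>A minion homomorphism to the projections, selecting a coordinate that lies in every set
  on which \<open>f\<close> depends.\<close>

definition has_labelling :: bool where
  "has_labelling \<longleftrightarrow> (\<exists>\<xi>. \<forall>f\<in>M. (\<forall>I. dep f I \<longrightarrow> \<xi> f \<in> I) \<and> (\<forall>\<pi>. \<xi> (minor \<pi> f) = \<pi> (\<xi> f)))"

lemma actsD:
  assumes "acts act V E" "f \<in> M"
  shows "(\<And>i. x i \<in> V) \<Longrightarrow> act f x \<in> V" "(\<And>i. (x i, y i) \<in> E) \<Longrightarrow> (act f x, act f y) \<in> E"
    "(\<And>i. x i \<in> V) \<Longrightarrow> act (minor \<pi> f) x = act f (\<lambda>i. x (\<pi> i))"
    "dep f I \<Longrightarrow> (\<And>i. x i \<in> V) \<Longrightarrow> (\<And>i. y i \<in> V) \<Longrightarrow> (\<And>i. i \<in> I \<Longrightarrow> x i = y i) \<Longrightarrow> act f x = act f y"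
proof -
  note * = bspec[OF assms(1)[unfolded acts_def] assms(2)]
  show "(\<And>i. x i \<in> V) \<Longrightarrow> act f x \<in> V" using * by simp
  show "(\<And>i. (x i, y i) \<in> E) \<Longrightarrow> (act f x, act f y) \<in> E" using * by simp
  show "(\<And>i. x i \<in> V) \<Longrightarrow> act (minor \<pi> f) x = act f (\<lambda>i. x (\<pi> i))" using * by simp
  show "dep f I \<Longrightarrow> (\<And>i. x i \<in> V) \<Longrightarrow> (\<And>i. y i \<in> V) \<Longrightarrow> (\<And>i. i \<in> I \<Longrightarrow> x i = y i) \<Longrightarrow> act f x = act f y"
    using * by simp
qed

text \<open>In a diamond-free graph the kernel of a homomorphism from a power of \<open>K\<^sub>3\<close> is given by a set of
  coordinates. Applied to the largest embedded power of \<open>K\<^sub>3\<close>, this makes every \<open>f\<close> act on its first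
  coordinate as a projection.\<close>

lemma labelling_diamond_free:
  fixes E :: "('v \<times> 'v) set"
  assumes G: "ugraph V E" and df: "diamond_free E" and tri: "has_triangle E"
    and act: "acts act V E" and idem: "\<And>f a. f \<in> M \<Longrightarrow> a \<in> V \<Longrightarrow> act f (\<lambda>_. a) = a"
  shows has_labelling
proof -
  define emb where "emb m h \<longleftrightarrow> k3_hom h E \<and> range h \<subseteq> V \<and> (\<forall>x y. h x = h y \<longleftrightarrow> (\<forall>i<m. x i = y i))"
    for m :: nat and h :: "(nat \<Rightarrow> three) \<Rightarrow> 'v"
  \<comment> \<open>The points with a single entry \<open>T1\<close> have different images. So
    \<open>m\<close> is bounded and a largest embedded power exists.\<close>
  have bound: "m \<le> card V" if "emb m h" for m h
  proof -
    let ?k = "\<lambda>k. h (\<lambda>i. if i = k then T1 else T0)"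
    have "inj_on ?k {..<m}"
    proof (rule inj_onI)
      fix k k' assume k: "k \<in> {..<m}" and eq: "?k k = ?k k'"
      from eq have "\<forall>i<m. (if i = k then T1 else T0) = (if i = k' then T1 else T0)"
        using that unfolding emb_def by (elim conjE) (drule spec, drule spec, erule (1) iffD1)
      then have "(if k = k then T1 else T0) = (if k = k' then T1 else T0)" using k by blast
      then show "k = k'" by (simp split: if_splits)
    qed
    moreover have "?k ` {..<m} \<subseteq> V" using that unfolding emb_def by blast
    ultimately show ?thesis using G card_inj_on_le[of ?k "{..<m}" V] by (simp add: ugraph_def)
  qed
  obtain a b c where abc: "(a, b) \<in> E" "(b, c) \<in> E" "(a, c) \<in> E"
    using tri unfolding has_triangle_def by blast
  then have ne: "a \<noteq> b" "b \<noteq> c" "a \<noteq> c" "a \<in> V" "b \<in> V" "c \<in> V"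
    and sy: "(b, a) \<in> E" "(c, b) \<in> E" "(c, a) \<in> E"
    using G unfolding ugraph_def irrefl_def sym_def by blast+
  have "emb 1 (\<lambda>x. case x 0 of T0 \<Rightarrow> a | T1 \<Rightarrow> b | T2 \<Rightarrow> c)"
    unfolding emb_def k3_hom_def
  proof (intro conjI allI impI)
    fix x y :: "nat \<Rightarrow> three" assume "\<forall>i. x i \<noteq> y i"
    then have "x 0 \<noteq> y 0" by blast
    then show "(case x 0 of T0 \<Rightarrow> a | T1 \<Rightarrow> b | T2 \<Rightarrow> c, case y 0 of T0 \<Rightarrow> a | T1 \<Rightarrow> b | T2 \<Rightarrow> c) \<in> E"
      using abc sy by (cases "x 0"; cases "y 0") auto
  next
    show "range (\<lambda>x. case x 0 of T0 \<Rightarrow> a | T1 \<Rightarrow> b | T2 \<Rightarrow> c) \<subseteq> V"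
      using ne by (auto split: three.splits)
  next
    fix x y :: "nat \<Rightarrow> three"
    show "(case x 0 of T0 \<Rightarrow> a | T1 \<Rightarrow> b | T2 \<Rightarrow> c) = (case y 0 of T0 \<Rightarrow> a | T1 \<Rightarrow> b | T2 \<Rightarrow> c) \<longleftrightarrow> (\<forall>i<1. x i = y i)"
      using ne by (cases "x 0"; cases "y 0") auto
  qed
  then have ex: "\<exists>m. 1 \<le> m \<and> (\<exists>h. emb m h)" by blast
  define m where "m = (GREATEST m. 1 \<le> m \<and> (\<exists>h. emb m h))"
  have "1 \<le> m \<and> (\<exists>h. emb m h)"
    unfolding m_def by (rule GreatestI_ex_nat[OF ex]) (use bound in blast)
  then obtain h where m1: "1 \<le> m" and h: "emb m h" by blast
  have mmax: "m' \<le> m" if "emb m' h'" for m' h'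
  proof (cases "1 \<le> m'")
    case True
    then have "1 \<le> m' \<and> (\<exists>h. emb m' h)" using that by blast
    then show ?thesis unfolding m_def by (rule Greatest_le_nat) (use bound in blast)
  qed (use m1 in auto)
  have hk: "k3_hom h E" and hV: "h x \<in> V" and hi: "h x = h y \<longleftrightarrow> (\<forall>i<m. x i = y i)" for x y
    using h unfolding emb_def by auto
  \<comment> \<open>The first coordinate of the value in the embedded power equals that of argument
    \<open>k\<close>. It is well defined because \<open>h x\<close> determines \<open>x 0\<close>
    when \<open>m\<close> is at least 1.\<close>
  define proj where "proj f k \<longleftrightarrow> (\<forall>X. \<exists>x. act f (\<lambda>i. h (X i)) = h x \<and> x 0 = X k 0)" for f k
  have ex: "\<exists>k. proj f k" if f: "f \<in> M" for f
  proof -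
    \<comment> \<open>A matrix \<open>X\<close> lists the arguments of \<open>f\<close> as columns
      \<open>i\<close> and their coordinates in the embedded power as rows \<open>j\<close>.\<close>
    define g where "g X = act f (\<lambda>i. h (\<lambda>j. X (j, i)))" for X :: "nat \<times> nat \<Rightarrow> three"
    obtain I where I: "finite I" "dep f I" using finite_dep[OF f] by blast
    have g: "k3_hom g E"
      unfolding k3_hom_def g_def by (intro allI impI actsD(2)[OF act f] hk[unfolded k3_hom_def, rule_format]) simp
    have gdep: "g x = g y" if "\<forall>i\<in>{..<m} \<times> I. x i = y i" for x y
      unfolding g_def by (rule actsD(4)[OF act f I(2)]) (use hV hi that in auto)
    have fin: "finite ({..<m} \<times> I)" using I(1) by simp
    obtain S where S: "S \<subseteq> {..<m} \<times> I" "\<And>x y. g x = g y \<longleftrightarrow> (\<forall>i\<in>S. x i = y i)"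
      by (rule k3_kernel[OF g df fin gdep]) blast+
    have finS: "finite S" using S(1) fin by (rule finite_subset)
    have diag: "g (\<lambda>(j, i). x j) = h x" for x
      unfolding g_def using idem[OF f hV[of x]] by simp
    \<comment> \<open>On matrices with constant rows \<open>g\<close> is \<open>h\<close>, by
      idempotence, and \<open>h\<close> distinguishes the values in row \<open>j\<close>. So some
      entry of that row matters.\<close>
    have cover: "\<exists>i. (j, i) \<in> S" if j: "j < m" for j
    proof (rule ccontr)
      assume no: "\<nexists>i. (j, i) \<in> S"
      let ?x = "\<lambda>_ :: nat. T0" let ?y = "?x(j := T1)"
      have "\<not> (\<forall>i<m. ?x i = ?y i)" using j by auto
      then have "h ?x \<noteq> h ?y" using hi[of ?x ?y] by simp
      moreover have "g (\<lambda>(j, i). ?x j) = g (\<lambda>(j, i). ?y j)" unfolding S(2) using no by auto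
      ultimately show False unfolding diag by blast
    qed
    have "card S \<le> m"
    proof (cases "S = {}")
      case False
      obtain idx where idx: "bij_betw idx S {0..<card S}"
        using ex_bij_betw_finite_nat[OF finS] by blast
      have pos: "0 < card S" using False finS by (simp add: card_gt_0_iff)
      \<comment> \<open>Otherwise a larger power would be embedded. Entries outside \<open>S\<close>
        receive \<open>y 0\<close>, so that sequences that differ everywhere still give matrices
        that differ everywhere.\<close>
      have "emb (card S) (\<lambda>y. g (\<lambda>k. if k \<in> S then y (idx k) else y 0))"
        unfolding emb_def
      proof (intro conjI allI)
        show "k3_hom (\<lambda>y. g (\<lambda>k. if k \<in> S then y (idx k) else y 0)) E"
          using g unfolding k3_hom_def by auto
        show "range (\<lambda>y. g (\<lambda>k. if k \<in> S then y (idx k) else y 0)) \<subseteq> V"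
          unfolding g_def using actsD(1)[OF act f] hV by auto
        fix x y :: "nat \<Rightarrow> three"
        have "(\<forall>k\<in>S. x (idx k) = y (idx k)) \<longleftrightarrow> (\<forall>i\<in>idx ` S. x i = y i)" by auto
        also have "idx ` S = {0..<card S}" using idx by (simp add: bij_betw_def)
        finally show "g (\<lambda>k. if k \<in> S then x (idx k) else x 0) = g (\<lambda>k. if k \<in> S then y (idx k) else y 0) \<longleftrightarrow>
            (\<forall>i<card S. x i = y i)" unfolding S(2) by auto
      qed
      then show ?thesis by (rule mmax)
    qed simp
    moreover have sub: "{..<m} \<subseteq> fst ` S" using cover by force
    moreover have "card (fst ` S) \<le> card S" using finS by (rule card_image_le)
    moreover have "m \<le> card (fst ` S)" using sub finS card_mono[of "fst ` S" "{..<m}"] by simp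
    ultimately have "card (fst ` S) = card S" by simp
    then have inj: "inj_on fst S" using finS eq_card_imp_inj_on by blast
    \<comment> \<open>\<open>S\<close> has at most \<open>m\<close> elements and meets all
      \<open>m\<close> rows, so it has exactly one in each: the coordinate in row \<open>j\<close>
      is copied from argument \<open>k j\<close>.\<close>
    obtain k where k: "\<And>j. j < m \<Longrightarrow> (j, k j) \<in> S" using cover by metis
    have gh: "g X = h (\<lambda>j. X (j, k j))" for X
    proof -
      have "X p = (\<lambda>(j, i). X (j, k j)) p" if "p \<in> S" for p
      proof -
        obtain j i where p: "p = (j, i)" by fastforce
        then have "j < m" using that S(1) by auto
        then have "i = k j" using inj_onD[OF inj, of "(j, i)" "(j, k j)"] k that p by auto
        then show ?thesis using p by simp
      qed
      then have "g X = g (\<lambda>(j, i). X (j, k j))" unfolding S(2) by blast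
      also have "\<dots> = h (\<lambda>j. X (j, k j))" using diag[of "\<lambda>j. X (j, k j)"] by simp
      finally show ?thesis .
    qed
    have "proj f (k 0)"
      unfolding proj_def
    proof
      fix X :: "nat \<Rightarrow> nat \<Rightarrow> three"
      have "act f (\<lambda>i. h (X i)) = h (\<lambda>j. X (k j) j)"
        using gh[of "\<lambda>(j, i). X i j"] unfolding g_def by simp
      then show "\<exists>x. act f (\<lambda>i. h (X i)) = h x \<and> x 0 = X (k 0) 0" by auto
    qed
    then show ?thesis by blast
  qed
  have uniq: "k = k'" if p: "proj f k" and p': "proj f k'" for f k k'
  proof (rule ccontr)
    assume ne: "k \<noteq> k'"
    let ?X = "\<lambda>i (j :: nat). if i = k then T0 else T1"
    obtain x x' where x: "act f (\<lambda>i. h (?X i)) = h x" "x 0 = ?X k 0"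
      and x': "act f (\<lambda>i. h (?X i)) = h x'" "x' 0 = ?X k' 0"
      using p[unfolded proj_def, rule_format, of ?X] p'[unfolded proj_def, rule_format, of ?X] by blast
    then have "h x = h x'" by simp
    then have "x 0 = x' 0" using m1 hi[of x x'] by simp
    then show False using ne x(2) x'(2) by simp
  qed
  define \<xi> where "\<xi> f = (SOME k. proj f k)" for f
  have \<xi>: "proj f (\<xi> f)" if "f \<in> M" for f
    unfolding \<xi>_def using ex[OF that] by (rule someI_ex)
  show ?thesis
    unfolding has_labelling_def
  proof (intro exI[of _ \<xi>] ballI conjI allI impI)
    fix f I assume f: "f \<in> M" and I: "dep f I"
    show "\<xi> f \<in> I"
    proof (rule ccontr)
      assume no: "\<xi> f \<notin> I"
      let ?X = "\<lambda>i (j :: nat). if i = \<xi> f then T0 else T1" and ?Y = "\<lambda>i (j :: nat). T1"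
      obtain x y where x: "act f (\<lambda>i. h (?X i)) = h x" "x 0 = ?X (\<xi> f) 0"
        and y: "act f (\<lambda>i. h (?Y i)) = h y" "y 0 = ?Y (\<xi> f) 0"
        using \<xi>[OF f, unfolded proj_def, rule_format, of ?X] \<xi>[OF f, unfolded proj_def, rule_format, of ?Y] by blast
      have "act f (\<lambda>i. h (?X i)) = act f (\<lambda>i. h (?Y i))"
        by (rule actsD(4)[OF act f I]) (use hV no in auto)
      then have "h x = h y" using x y by simp
      then have "x 0 = y 0" using m1 hi[of x y] by simp
      then show False using x y by simp
    qed
  next
    fix f \<pi> assume f: "f \<in> M"
    have "proj (minor \<pi> f) (\<pi> (\<xi> f))"
      unfolding proj_def
    proof
      fix X :: "nat \<Rightarrow> nat \<Rightarrow> three"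
      have "act (minor \<pi> f) (\<lambda>i. h (X i)) = act f (\<lambda>i. h (X (\<pi> i)))"
        by (rule actsD(3)[OF act f]) (rule hV)
      then show "\<exists>x. act (minor \<pi> f) (\<lambda>i. h (X i)) = h x \<and> x 0 = X (\<pi> (\<xi> f)) 0"
        using \<xi>[OF f] unfolding proj_def by metis
    qed
    then show "\<xi> (minor \<pi> f) = \<pi> (\<xi> f)" using uniq \<xi>[OF minor_closed[OF f]] by blast
  qed
qed

lemma relpow_preserved:
  assumes "f \<in> M" "acts act V E"
    and R: "\<And>x y. (\<And>i. (x i, y i) \<in> R) \<Longrightarrow> (act f x, act f y) \<in> R"
  shows "(\<And>i. (x i, y i) \<in> R ^^ n) \<Longrightarrow> (act f x, act f y) \<in> R ^^ n"
proof (induction n arbitrary: y)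
  case 0
  then have "x = y" by auto
  then show ?case by simp
next
  case (Suc n)
  have "\<forall>i. \<exists>z. (x i, z) \<in> R ^^ n \<and> (z, y i) \<in> R" using Suc.prems by (auto simp: relcomp_unfold)
  from choice[OF this] obtain z where z: "\<And>i. (x i, z i) \<in> R ^^ n" "\<And>i. (z i, y i) \<in> R" by blast
  have "(act f x, act f z) \<in> R ^^ n" by (rule Suc.IH) (rule z)
  moreover have "(act f z, act f y) \<in> R" by (rule R) (rule z)
  ultimately show ?case by auto
qed

lemma acts_subuniverse:
  fixes V :: "'v set"
  assumes "acts act V E" "W \<subseteq> V" "\<And>f x. f \<in> M \<Longrightarrow> (\<And>i. x i \<in> W) \<Longrightarrow> act f x \<in> W"
  shows "acts act W (E \<inter> W \<times> W)"
  unfolding acts_def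
proof (intro ballI conjI allI impI)
  fix f and x y :: "nat \<Rightarrow> 'v" assume f: "f \<in> M" and xy: "\<forall>i. (x i, y i) \<in> E \<inter> W \<times> W"
  then show "(act f x, act f y) \<in> E \<inter> W \<times> W"
    using actsD(2)[OF assms(1) f, of x y] assms(3)[OF f, of x] assms(3)[OF f, of y] by auto
next
  fix f \<pi> and x :: "nat \<Rightarrow> 'v" assume f: "f \<in> M" and x: "\<forall>i. x i \<in> W"
  then show "act (minor \<pi> f) x = act f (\<lambda>i. x (\<pi> i))"
    using actsD(3)[OF assms(1) f, of x \<pi>] assms(2) by blast
next
  fix f I and x y :: "nat \<Rightarrow> 'v" assume "f \<in> M" "dep f I" "\<forall>i. x i \<in> W" "\<forall>i. y i \<in> W" "\<forall>i\<in>I. x i = y i"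
  then show "act f x = act f y" using actsD(4)[OF assms(1), of f I x y] assms(2) by blast
qed (use assms(3) in blast)

lemma ugraph_subset: "ugraph V E \<Longrightarrow> W \<subseteq> V \<Longrightarrow> ugraph W (E \<inter> W \<times> W)"
  unfolding ugraph_def sym_def irrefl_def by (auto intro: finite_subset)

lemma relpow_sym: "sym R \<Longrightarrow> sym (R ^^ n)"
proof (induction n)
  case (Suc n)
  have "(b, a) \<in> R ^^ Suc n" if ab: "(a, b) \<in> R ^^ Suc n" for a b
  proof -
    obtain c where "(a, c) \<in> R ^^ n" "(c, b) \<in> R" using ab by auto
    then have "(b, c) \<in> R" "(c, a) \<in> R ^^ n" using Suc by (auto dest: symD)
    then show ?thesis by (rule relpow_Suc_I2)
  qed
  then show ?case by (rule symI)
qed (auto intro: symI)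

text \<open>The relation \<open>R\<close> of being opposite corners of a diamond is preserved. An edge between two vertices
  joined by a chain of diamonds would define a proper subset that still contains a triangle, so such
  vertices can be identified.\<close>

lemma labelling_idempotent:
  fixes V :: "'v set"
  assumes IH: "\<And>(V' :: 'v set) E' act'. card V' < card V \<Longrightarrow> ugraph V' E' \<Longrightarrow> has_triangle E' \<Longrightarrow>
      acts act' V' E' \<Longrightarrow> has_labelling"
    and G: "ugraph V E" and tri: "has_triangle E" and act: "acts act V E"
    and idem: "\<And>f a. f \<in> M \<Longrightarrow> a \<in> V \<Longrightarrow> act f (\<lambda>_. a) = a"
  shows has_labelling
proof (rule ccontr)
  assume no: "\<not> has_labelling"
  have fin: "finite V" and EV: "\<And>a b. (a, b) \<in> E \<Longrightarrow> a \<in> V \<and> b \<in> V" and sy: "\<And>a b. (a, b) \<in> E \<Longrightarrow> (b, a) \<in> E"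
    and irr: "\<And>a. (a, a) \<notin> E"
    using G unfolding ugraph_def sym_def irrefl_def by blast+
  \<comment> \<open>A proper subset closed under the action and containing a triangle would be a
    smaller instance and give a labelling. This is used repeatedly to show that a definable set is
    everything.\<close>
  have sub: "W = V" if W: "W \<subseteq> V" "\<And>f x. f \<in> M \<Longrightarrow> (\<And>i. x i \<in> W) \<Longrightarrow> act f x \<in> W"
    and abc: "a \<in> W" "b \<in> W" "c \<in> W" "(a, b) \<in> E" "(b, c) \<in> E" "(a, c) \<in> E" for W a b c
  proof (rule ccontr)
    assume "W \<noteq> V"
    then have "card W < card V" using W(1) fin by (simp add: psubset_card_mono psubsetI)
    moreover have "has_triangle (E \<inter> W \<times> W)" unfolding has_triangle_def using abc by blast
    ultimately have has_labelling
      using IH ugraph_subset[OF G W(1)] acts_subuniverse[OF act W] by blast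
    then show False using no by blast
  qed
  have actE: "(act f x, act f y) \<in> E" if "f \<in> M" "\<And>i. (x i, y i) \<in> E" for f x y
    using actsD(2)[OF act that(1)] that(2) by blast
  have actV: "act f x \<in> V" if "f \<in> M" "\<And>i. x i \<in> V" for f x
    using actsD(1)[OF act that(1)] that(2) by blast
  have in_tri: "\<exists>u v. (x, u) \<in> E \<and> (x, v) \<in> E \<and> (u, v) \<in> E" if x: "x \<in> V" for x
  proof -
    let ?W = "{x \<in> V. \<exists>u v. (x, u) \<in> E \<and> (x, v) \<in> E \<and> (u, v) \<in> E}"
    obtain a b c where "(a, b) \<in> E" "(b, c) \<in> E" "(a, c) \<in> E" using tri unfolding has_triangle_def by blast
    moreover from this have "a \<in> ?W" "b \<in> ?W" "c \<in> ?W" using EV sy by blast+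
    moreover have "act f x \<in> ?W" if f: "f \<in> M" and x: "\<And>i. x i \<in> ?W" for f x
    proof -
      have "\<forall>i. \<exists>u. \<exists>v. (x i, u) \<in> E \<and> (x i, v) \<in> E \<and> (u, v) \<in> E" using x by blast
      from choice[OF this] obtain u where "\<forall>i. \<exists>v. (x i, u i) \<in> E \<and> (x i, v) \<in> E \<and> (u i, v) \<in> E" by blast
      from choice[OF this] obtain v where "\<And>i. (x i, u i) \<in> E" "\<And>i. (x i, v i) \<in> E" "\<And>i. (u i, v i) \<in> E" by blast
      then have "(act f x, act f u) \<in> E" "(act f x, act f v) \<in> E" "(act f u, act f v) \<in> E"
        by (intro actE f; blast)+
      then show ?thesis using EV by blast
    qed
    ultimately have "?W = V" by (intro sub) blast+
    then show ?thesis using x by blast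
  qed
  \<comment> \<open>By idempotence the neighbourhood of \<open>a\<close> is closed under the action.
    Containing the triangle \<open>b\<close>, \<open>c\<close>, \<open>d\<close>, it would be all of
    \<open>V\<close>, but \<open>a\<close> is not its own neighbour.\<close>
  have K4: False if "(a, b) \<in> E" "(a, c) \<in> E" "(a, d) \<in> E" "(b, c) \<in> E" "(c, d) \<in> E" "(b, d) \<in> E" for a b c d
  proof -
    let ?W = "{x. (a, x) \<in> E}"
    have "act f x \<in> ?W" if f: "f \<in> M" and x: "\<And>i. x i \<in> ?W" for f x
    proof -
      have "(act f (\<lambda>_. a), act f x) \<in> E" by (rule actE[OF f]) (use x in blast)
      then show ?thesis using idem[OF f] that EV \<open>(a, b) \<in> E\<close> by simp
    qed
    then have "?W = V" by (intro sub[of ?W b c d]) (use that EV in blast)+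
    then show False using irr[of a] EV[OF that(1)] by blast
  qed
  define R where "R = {(x, y). \<exists>u v. (x, u) \<in> E \<and> (x, v) \<in> E \<and> (u, v) \<in> E \<and> (u, y) \<in> E \<and> (v, y) \<in> E}"
  have Rpres: "(act f x, act f y) \<in> R" if f: "f \<in> M" and x: "\<And>i. (x i, y i) \<in> R" for f x y
  proof -
    have "\<forall>i. \<exists>u. \<exists>v. (x i, u) \<in> E \<and> (x i, v) \<in> E \<and> (u, v) \<in> E \<and> (u, y i) \<in> E \<and> (v, y i) \<in> E"
      using x unfolding R_def by blast
    from choice[OF this] obtain u where
      "\<forall>i. \<exists>v. (x i, u i) \<in> E \<and> (x i, v) \<in> E \<and> (u i, v) \<in> E \<and> (u i, y i) \<in> E \<and> (v, y i) \<in> E" by blast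
    from choice[OF this] obtain v where "\<And>i. (x i, u i) \<in> E" "\<And>i. (x i, v i) \<in> E" "\<And>i. (u i, v i) \<in> E"
      "\<And>i. (u i, y i) \<in> E" "\<And>i. (v i, y i) \<in> E" by blast
    then have "(act f x, act f u) \<in> E" "(act f x, act f v) \<in> E" "(act f u, act f v) \<in> E"
      "(act f u, act f y) \<in> E" "(act f v, act f y) \<in> E"
      by (intro actE f; blast)+
    then show ?thesis unfolding R_def by blast
  qed
  have Rsym: "sym R" unfolding R_def by (rule symI) (use sy in blast)
  have Rrefl: "(x, x) \<in> R" if "x \<in> V" for x using in_tri[OF that] sy unfolding R_def by blast
  have RV: "R \<subseteq> V \<times> V" unfolding R_def using EV by blast
  have Rn_sym: "(b, a) \<in> R ^^ n" if "(a, b) \<in> R ^^ n" for a b n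
    using relpow_sym[OF Rsym] that by (auto dest: symD)
  have Rn_pres: "(act f x, act f y) \<in> R ^^ n" if "f \<in> M" "\<And>i. (x i, y i) \<in> R ^^ n" for f x y n
    by (rule relpow_preserved[OF that(1) act]) (use Rpres that in blast)+
  \<comment> \<open>\<open>S\<close> contains a triangle: \<open>a\<close> reaches \<open>Z\<close>
    through \<open>b\<close> and \<open>q\<close>, while \<open>u\<close> and \<open>v\<close> reach
    it through \<open>a\<close> and \<open>p\<close>. Hence \<open>S\<close> is everything.\<close>
  have far: "z \<in> S" if Z: "Z \<subseteq> V" "\<And>f x. f \<in> M \<Longrightarrow> (\<And>i. x i \<in> Z) \<Longrightarrow> act f x \<in> Z"
    and ab: "(a, b) \<in> E" "(a, p) \<in> R ^^ k" "(b, q) \<in> R ^^ k" "p \<in> Z" "q \<in> Z" "z \<in> V"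
    and S: "S = {x. \<exists>y z. (x, y) \<in> E \<and> (y, z) \<in> R ^^ k \<and> z \<in> Z}" for Z a b p q k z S
  proof -
    obtain u v where uv: "(a, u) \<in> E" "(a, v) \<in> E" "(u, v) \<in> E" using in_tri EV[OF ab(1)] by blast
    have "act f x \<in> S" if f: "f \<in> M" and x: "\<And>i. x i \<in> S" for f x
    proof -
      have "\<forall>i. \<exists>y. \<exists>z. (x i, y) \<in> E \<and> (y, z) \<in> R ^^ k \<and> z \<in> Z" using x unfolding S by blast
      from choice[OF this] obtain y where "\<forall>i. \<exists>z. (x i, y i) \<in> E \<and> (y i, z) \<in> R ^^ k \<and> z \<in> Z" by blast
      from choice[OF this] obtain z where yz: "\<And>i. (x i, y i) \<in> E" "\<And>i. (y i, z i) \<in> R ^^ k" "\<And>i. z i \<in> Z" by blast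
      have "(act f x, act f y) \<in> E" using actE[OF f] yz(1) by blast
      moreover have "(act f y, act f z) \<in> R ^^ k" using Rn_pres[OF f] yz(2) by blast
      moreover have "act f z \<in> Z" using Z(2)[OF f] yz(3) by blast
      ultimately show ?thesis unfolding S by blast
    qed
    moreover have "a \<in> S" "u \<in> S" "v \<in> S" "S \<subseteq> V" unfolding S using ab uv sy EV by blast+
    ultimately have "S = V" using uv by (intro sub[of S a u v]) blast+
    then show ?thesis using ab by blast
  qed
  \<comment> \<open>Take an edge whose ends are joined by a shortest chain of diamonds. For
    \<open>l = 2 * k\<close>, apply \<open>far\<close> to the midpoint \<open>c\<close> and return
    to \<open>c\<close> itself: this gives an edge with a chain of length \<open>k\<close>. For odd
    \<open>l\<close>, the middle diamond is \<open>c\<close>, \<open>u\<close>, \<open>v\<close>,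
    \<open>d\<close>, and \<open>Z\<close> consists of all common neighbours of \<open>u\<close> and
    \<open>v\<close>; each of them is one diamond away from \<open>c\<close>, so \<open>c\<close>
    gets an edge with a chain of length \<open>k + 1\<close>. Length 1 would be a K4.\<close>
  have disj: "(a, b) \<notin> R ^^ n" if "(a, b) \<in> E" for a b n
  proof
    assume "(a, b) \<in> R ^^ n"
    then have ex: "\<exists>n. \<exists>a b. (a, b) \<in> E \<and> (a, b) \<in> R ^^ n" using that by blast
    define l where "l = (LEAST n. \<exists>a b. (a, b) \<in> E \<and> (a, b) \<in> R ^^ n)"
    obtain a b where ab: "(a, b) \<in> E" "(a, b) \<in> R ^^ l" using LeastI_ex[OF ex] unfolding l_def by blast
    have least: "(x, y) \<notin> R ^^ n" if "(x, y) \<in> E" "n < l" for x y n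
      using that not_less_Least unfolding l_def by blast
    have l0: "l \<noteq> 0" using ab irr by (cases l) auto
    have l1: "l \<noteq> 1"
    proof
      assume "l = 1"
      then obtain u v where "(a, u) \<in> E" "(a, v) \<in> E" "(u, v) \<in> E" "(u, b) \<in> E" "(v, b) \<in> E"
        using ab(2) unfolding R_def by auto
      then show False using K4[of a b u v] ab(1) sy by blast
    qed
    show False
    proof (cases "even l")
      case True
      then obtain k where k: "l = k + k" by (metis evenE mult_2)
      then obtain c where c: "(a, c) \<in> R ^^ k" "(c, b) \<in> R ^^ k" using ab(2) by (auto simp: relpow_add)
      have cV: "c \<in> V" using c EV[OF ab(1)] RV by (cases k) (auto simp: k)
      define S where "S = {x. \<exists>y z. (x, y) \<in> E \<and> (y, z) \<in> R ^^ k \<and> z \<in> {c}}"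
      have single: "act f x \<in> {c}" if f: "f \<in> M" and x: "\<And>i. x i \<in> {c}" for f x
      proof -
        have "x = (\<lambda>_. c)" using x by auto
        then show ?thesis using idem[OF f cV] by simp
      qed
      have "c \<in> S"
        by (rule far[of "{c}" a b c k c, OF _ _ ab(1) c(1) Rn_sym[OF c(2)] _ _ cV S_def])
          (use cV single in auto)
      then obtain y where "(c, y) \<in> E" "(y, c) \<in> R ^^ k" unfolding S_def by blast
      then have "(y, c) \<in> E" "(y, c) \<in> R ^^ k" using sy by blast+
      then show False using least[of y c k] k l0 by simp
    next
      case False
      then obtain k where k: "l = (k + 1) + k" by (metis oddE mult_2 add.assoc add.commute)
      have k1: "1 \<le> k" using l1 k by simp
      obtain d where d: "(a, d) \<in> R ^^ (k + 1)" "(d, b) \<in> R ^^ k" using ab(2) unfolding k by (auto simp only: relpow_add)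
      then obtain c where c: "(a, c) \<in> R ^^ k" "(c, d) \<in> R" by auto
      obtain u v where uv: "(c, u) \<in> E" "(c, v) \<in> E" "(u, v) \<in> E" "(u, d) \<in> E" "(v, d) \<in> E"
        using c(2) unfolding R_def by blast
      define Z where "Z = {z. (z, u) \<in> E \<and> (z, v) \<in> E}"
      define S where "S = {x. \<exists>y z. (x, y) \<in> E \<and> (y, z) \<in> R ^^ k \<and> z \<in> Z}"
      have Zact: "act f x \<in> Z" if f: "f \<in> M" and x: "\<And>i. x i \<in> Z" for f x
      proof -
        have "(act f x, act f (\<lambda>_. u)) \<in> E" "(act f x, act f (\<lambda>_. v)) \<in> E"
          using x unfolding Z_def by (intro actE f; blast)+
        then show ?thesis unfolding Z_def using idem[OF f] EV uv by auto
      qed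
      have Z: "Z \<subseteq> V" "c \<in> Z" "d \<in> Z" "c \<in> V" unfolding Z_def using uv sy EV by blast+
      have "c \<in> S"
        by (rule far[OF Z(1) _ ab(1) c(1) Rn_sym[OF d(2)] Z(2,3,4) S_def]) (rule Zact)
      then obtain y z where yz: "(c, y) \<in> E" "(y, z) \<in> R ^^ k" "(z, u) \<in> E" "(z, v) \<in> E" unfolding S_def Z_def by blast
      then have "(z, c) \<in> R" unfolding R_def using uv sy by blast
      then have "(y, c) \<in> R ^^ (k + 1)" using yz(2) by auto
      then show False using least[of y c "k + 1"] yz(1) sy k k1 by simp
    qed
  qed
  \<comment> \<open>Preservation of the closure concerns infinitely many pairs at once, so their
    chains need one common length. Since \<open>R\<close> is reflexive on \<open>V\<close>, all can
    be padded to \<open>N\<close>.\<close>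
  define N where "N = card R"
  have finR: "finite R" using RV fin by (meson finite_SigmaI finite_subset)
  have pad: "(x, y) \<in> R ^^ (n + j)" if "(x, y) \<in> R ^^ n" "y \<in> V" for x y n j
    using that(1) by (induction j) (auto intro: Rrefl[OF that(2)])
  have TN: "(x, y) \<in> R ^^ N" if xy: "(x, y) \<in> R\<^sup>*" "y \<in> V" for x y
  proof -
    obtain n where "n \<le> card R" "(x, y) \<in> R ^^ n"
      using xy(1) unfolding rtrancl_finite_eq_relpow[OF finR] by blast
    then show ?thesis using pad[of x y n "N - n"] xy(2) unfolding N_def by simp
  qed
  have Tpres: "(act f x, act f y) \<in> R\<^sup>*" if f: "f \<in> M" and x: "\<And>i. (x i, y i) \<in> R\<^sup>*" "\<And>i. y i \<in> V" for f x y
    using Rn_pres[OF f, of x y N] TN x by (simp add: relpow_imp_rtrancl)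
  have Tsym: "(y, x) \<in> R\<^sup>*" if "(x, y) \<in> R\<^sup>*" for x y
    using sym_rtrancl[OF Rsym] that by (rule symD)
  define rp where "rp x = (SOME y. (x, y) \<in> R\<^sup>*)" for x
  have rp: "(x, rp x) \<in> R\<^sup>*" for x unfolding rp_def by (rule someI[of _ x]) simp
  have rp_eq: "rp x = rp y" if "(x, y) \<in> R\<^sup>*" for x y
  proof -
    have "(x, z) \<in> R\<^sup>* \<longleftrightarrow> (y, z) \<in> R\<^sup>*" for z using that Tsym by (meson rtrancl_trans)
    then show ?thesis unfolding rp_def by simp
  qed
  have rp_iff: "(x, y) \<in> R\<^sup>*" if "rp x = rp y" for x y
    using rp[of x] rp[of y] that Tsym by (metis rtrancl_trans)
  have rpV: "rp x \<in> V" if "x \<in> V" for x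
    using rp[of x] that RV by (induction rule: rtrancl_induct) auto
  have im: "rp ` V \<subseteq> V" using rpV by blast
  define E' where "E' = (\<lambda>(x, y). (rp x, rp y)) ` E"
  have G': "ugraph (rp ` V) E'"
    unfolding ugraph_def
  proof (intro conjI)
    show "E' \<subseteq> rp ` V \<times> rp ` V" unfolding E'_def using EV by auto
    show "sym E'" unfolding E'_def by (rule symI) (use sy in auto)
    have "rp a \<noteq> rp b" if "(a, b) \<in> E" for a b
      using disj[OF that] rp_iff[of a b] by (auto simp: rtrancl_is_UN_relpow)
    then show "irrefl E'" unfolding E'_def irrefl_def by auto
  qed (use fin in simp)
  have act': "acts (\<lambda>f x. rp (act f x)) (rp ` V) E'"
    unfolding acts_def
  proof (intro ballI conjI allI impI)
    fix f and x :: "nat \<Rightarrow> 'v" assume f: "f \<in> M" and "\<forall>i. x i \<in> rp ` V"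
    then have "\<And>i. x i \<in> V" using im by blast
    then show "rp (act f x) \<in> rp ` V" using actV[OF f] by blast
  next
    fix f \<pi> and x :: "nat \<Rightarrow> 'v" assume f: "f \<in> M" and "\<forall>i. x i \<in> rp ` V"
    then have "\<And>i. x i \<in> V" using im by blast
    then show "rp (act (minor \<pi> f) x) = rp (act f (\<lambda>i. x (\<pi> i)))" using actsD(3)[OF act f] by simp
  next
    fix f I and x y :: "nat \<Rightarrow> 'v" assume f: "f \<in> M" and I: "dep f I" and xy: "\<forall>i. x i \<in> rp ` V" "\<forall>i. y i \<in> rp ` V" "\<forall>i\<in>I. x i = y i"
    have "\<And>i. x i \<in> V" "\<And>i. y i \<in> V" using im xy by blast+
    then show "rp (act f x) = rp (act f y)" using actsD(4)[OF act f I, of x y] xy(3) by simp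
  next
    fix f and x y :: "nat \<Rightarrow> 'v" assume f: "f \<in> M" and xy: "\<forall>i. (x i, y i) \<in> E'"
    have "\<exists>p. \<exists>q. (p, q) \<in> E \<and> x i = rp p \<and> y i = rp q" for i
    proof -
      have "(x i, y i) \<in> E'" using xy by blast
      then show ?thesis unfolding E'_def by auto
    qed
    then have "\<forall>i. \<exists>p. \<exists>q. (p, q) \<in> E \<and> x i = rp p \<and> y i = rp q" by blast
    from choice[OF this] obtain p where "\<forall>i. \<exists>q. (p i, q) \<in> E \<and> x i = rp (p i) \<and> y i = rp q" by blast
    from choice[OF this] obtain q where pq: "\<And>i. (p i, q i) \<in> E" "\<And>i. x i = rp (p i)" "\<And>i. y i = rp (q i)" by blast
    have 1: "(act f p, act f q) \<in> E" using actE[OF f] pq(1) by blast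
    have "(act f p, act f x) \<in> R\<^sup>*" "(act f q, act f y) \<in> R\<^sup>*"
      by (rule Tpres[OF f]; use pq rp rpV EV in metis)+
    then have "rp (act f x) = rp (act f p)" "rp (act f y) = rp (act f q)" using rp_eq by metis+
    then show "(rp (act f x), rp (act f y)) \<in> E'" using 1 unfolding E'_def by force
  qed
  have tri': "has_triangle E'" using tri unfolding has_triangle_def E'_def by (elim exE conjE) (intro exI conjI, (erule rev_image_eqI, simp)+)
  \<comment> \<open>By \<open>disj\<close> the quotient is loopless, hence an instance for the
    induction hypothesis. So it cannot be smaller: chains join only equal vertices, and there are no
    proper diamonds.\<close>
  have "\<not> card (rp ` V) < card V" using IH[OF _ G' tri' act'] no by blast
  then have "card (rp ` V) = card V" using card_image_le[OF fin, of rp] by linarith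
  then have inj: "inj_on rp V" using fin eq_card_imp_inj_on by blast
  have "diamond_free E"
    unfolding diamond_free_def
  proof (intro allI impI, elim conjE)
    fix p q r s assume "(p, r) \<in> E" "(p, s) \<in> E" "(r, s) \<in> E" "(r, q) \<in> E" "(s, q) \<in> E"
    then have "(p, q) \<in> R" "p \<in> V" "q \<in> V" unfolding R_def using EV by blast+
    then show "p = q" using rp_eq[of p q] inj by (simp add: inj_on_eq_iff r_into_rtrancl)
  qed
  then show False using labelling_diamond_free[OF G _ tri act idem] no by blast
qed

text \<open>Induction on the number of vertices. \<open>e f\<close> is the unary operation obtained
  by identifying all arguments of \<open>f\<close>. If one of these is not injective, the instance
  moves to its smaller image; otherwise they are all automorphisms, and composing with their
  inverses makes the action idempotent.\<close>

lemma labelling_triangle: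
  fixes V :: "'v set"
  assumes "ugraph V E" "has_triangle E" "acts act V E"
  shows has_labelling
  using assms
proof (induction "card V" arbitrary: V E act rule: less_induct)
  case less
  have fin: "finite V" and EV: "\<And>a b. (a, b) \<in> E \<Longrightarrow> a \<in> V \<and> b \<in> V" and sy: "\<And>a b. (a, b) \<in> E \<Longrightarrow> (b, a) \<in> E"
    and irr: "\<And>a. (a, a) \<notin> E"
    using less.prems(1) unfolding ugraph_def sym_def irrefl_def by blast+
  note act = less.prems(3)
  define e where "e f a = (if a \<in> V then act f (\<lambda>_. a) else a)" for f a
  have eV: "e f a \<in> V" if "f \<in> M" "a \<in> V" for f a using actsD(1)[OF act that(1)] that(2) by (simp add: e_def)
  have eE: "(e f a, e f b) \<in> E" if "f \<in> M" "(a, b) \<in> E" for f a b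
    using actsD(2)[OF act that(1), of "\<lambda>_. a" "\<lambda>_. b"] that(2) EV by (simp add: e_def)
  show ?case
  proof (cases "\<exists>f\<in>M. \<not> inj_on (e f) V")
    case True
    then obtain g where g: "g \<in> M" "\<not> inj_on (e g) V" by blast
    let ?W = "e g ` V"
    have W: "?W \<subseteq> V" using eV[OF g(1)] by blast
    have "card ?W < card V"
      using g(2) fin card_image_le[OF fin, of "e g"] eq_card_imp_inj_on[OF fin, of "e g"] by linarith
    moreover have "has_triangle (E \<inter> ?W \<times> ?W)"
    proof -
      obtain a b c where "(a, b) \<in> E" "(b, c) \<in> E" "(a, c) \<in> E" using less.prems(2) unfolding has_triangle_def by blast
      then have "(e g a, e g b) \<in> E \<inter> ?W \<times> ?W" "(e g b, e g c) \<in> E \<inter> ?W \<times> ?W" "(e g a, e g c) \<in> E \<inter> ?W \<times> ?W"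
        using eE[OF g(1)] EV by blast+
      then show ?thesis unfolding has_triangle_def by blast
    qed
    moreover have "acts (\<lambda>f x. e g (act f x)) ?W (E \<inter> ?W \<times> ?W)"
      unfolding acts_def
    proof (intro ballI conjI allI impI)
      fix f and x :: "nat \<Rightarrow> 'v" assume f: "f \<in> M" and "\<forall>i. x i \<in> ?W"
      then have "\<And>i. x i \<in> V" using W by blast
      then show "e g (act f x) \<in> ?W" using actsD(1)[OF act f] by blast
    next
      fix f \<pi> and x :: "nat \<Rightarrow> 'v" assume f: "f \<in> M" and "\<forall>i. x i \<in> ?W"
      then have "\<And>i. x i \<in> V" using W by blast
      then show "e g (act (minor \<pi> f) x) = e g (act f (\<lambda>i. x (\<pi> i)))" using actsD(3)[OF act f] by simp
    next
      fix f I and x y :: "nat \<Rightarrow> 'v" assume f: "f \<in> M" and I: "dep f I" and xy: "\<forall>i. x i \<in> ?W" "\<forall>i. y i \<in> ?W" "\<forall>i\<in>I. x i = y i"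
      have "\<And>i. x i \<in> V" "\<And>i. y i \<in> V" using W xy by blast+
      then show "e g (act f x) = e g (act f y)" using actsD(4)[OF act f I, of x y] xy(3) by simp
    next
      fix f and x y :: "nat \<Rightarrow> 'v" assume f: "f \<in> M" and "\<forall>i. (x i, y i) \<in> E \<inter> ?W \<times> ?W"
      then have "(act f x, act f y) \<in> E" using actsD(2)[OF act f] by blast
      then show "(e g (act f x), e g (act f y)) \<in> E \<inter> ?W \<times> ?W" using eE[OF g(1)] EV by blast
    qed
    ultimately show ?thesis using less.hyps ugraph_subset[OF less.prems(1) W] by blast
  next
    case False
    then have inj: "\<And>f. f \<in> M \<Longrightarrow> inj_on (e f) V" by blast
    have surj: "e f ` V = V" if "f \<in> M" for f
      using inj[OF that] fin eV[OF that] by (simp add: endo_inj_surj image_subsetI)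
    have finE: "finite E" using EV fin by (meson finite_SigmaI finite_subset mem_Sigma_iff subrelI)
    define act' where "act' f x = inv_into V (e f) (act f x)" for f x
    \<comment> \<open>A bijection of \<open>V\<close> that maps the finite set \<open>E\<close> into
      itself maps it onto itself, so its inverse preserves edges too.\<close>
    have invE: "(inv_into V (e f) a, inv_into V (e f) b) \<in> E" if f: "f \<in> M" and ab: "(a, b) \<in> E" for f a b
    proof -
      let ?m = "\<lambda>(x, y). (e f x, e f y)"
      have "inj_on ?m E" using inj_onD[OF inj[OF f]] EV by (auto simp: inj_on_def)
      moreover have "?m ` E \<subseteq> E" using eE[OF f] by auto
      ultimately have "?m ` E = E" using finE by (simp add: endo_inj_surj)
      then obtain u v where "(u, v) \<in> E" "a = e f u" "b = e f v" using ab by (auto elim!: equalityE)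
      then show ?thesis using inv_into_f_f[OF inj[OF f]] EV by simp
    qed
    \<comment> \<open>Constant sequences are unaffected by reindexing, so \<open>f\<close> and its
      minors are corrected by the same inverse.\<close>
    have e_minor: "e (minor \<pi> f) = e f" if "f \<in> M" for f \<pi>
      unfolding e_def using actsD(3)[OF act that] by (auto simp: fun_eq_iff)
    have acts': "acts act' V E"
      unfolding acts_def act'_def
    proof (intro ballI conjI allI impI)
      fix f and x :: "nat \<Rightarrow> 'v" assume f: "f \<in> M" and "\<forall>i. x i \<in> V"
      then show "inv_into V (e f) (act f x) \<in> V" using actsD(1)[OF act f] surj[OF f] by (metis inv_into_into)
    next
      fix f \<pi> and x :: "nat \<Rightarrow> 'v" assume f: "f \<in> M" and "\<forall>i. x i \<in> V"
      then show "inv_into V (e (minor \<pi> f)) (act (minor \<pi> f) x) = inv_into V (e f) (act f (\<lambda>i. x (\<pi> i)))"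
        using actsD(3)[OF act f] e_minor[OF f] by simp
    next
      fix f I and x y :: "nat \<Rightarrow> 'v" assume f: "f \<in> M" and I: "dep f I" and xy: "\<forall>i. x i \<in> V" "\<forall>i. y i \<in> V" "\<forall>i\<in>I. x i = y i"
      then show "inv_into V (e f) (act f x) = inv_into V (e f) (act f y)" using actsD(4)[OF act f I, of x y] by simp
    next
      fix f and x y :: "nat \<Rightarrow> 'v" assume f: "f \<in> M" and "\<forall>i. (x i, y i) \<in> E"
      then show "(inv_into V (e f) (act f x), inv_into V (e f) (act f y)) \<in> E"
        using actsD(2)[OF act f] invE[OF f] by blast
    qed
    have idem': "act' f (\<lambda>_. a) = a" if "f \<in> M" "a \<in> V" for f a
    proof -
      have "act f (\<lambda>_. a) = e f a" using that by (simp add: e_def)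
      then show ?thesis unfolding act'_def using inv_into_f_f[OF inj] that by simp
    qed
    show ?thesis
    proof (rule labelling_idempotent[OF _ less.prems(1,2) acts' idem'])
      fix V' :: "'v set" and E' and act' :: "'m \<Rightarrow> (nat \<Rightarrow> 'v) \<Rightarrow> 'v"
      assume "card V' < card V" "ugraph V' E'" "has_triangle E'" "acts act' V' E'"
      then show has_labelling by (rule less.hyps)
    qed
  qed
qed

text \<open>If \<open>l\<close> is the odd girth, then \<open>E ^^ (l - 2)\<close> is loopless and contains a triangle.\<close>

theorem labelling_nonbipartite:
  fixes V :: "'v set"
  assumes G: "ugraph V E" and odd: "(v, v) \<in> E ^^ k" "odd k" and act: "acts act V E"
  shows has_labelling
proof -
  have EV: "\<And>a b. (a, b) \<in> E \<Longrightarrow> a \<in> V \<and> b \<in> V" and sy: "\<And>a b. (a, b) \<in> E \<Longrightarrow> (b, a) \<in> E"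
    and irr: "\<And>a. (a, a) \<notin> E"
    using G unfolding ugraph_def sym_def irrefl_def by blast+
  have ex: "\<exists>k. odd k \<and> (\<exists>v. (v, v) \<in> E ^^ k)" using odd by blast
  define l where "l = (LEAST k. odd k \<and> (\<exists>v. (v, v) \<in> E ^^ k))"
  obtain v where l: "odd l" "(v, v) \<in> E ^^ l" using LeastI_ex[OF ex] unfolding l_def by blast
  have least: "(x, x) \<notin> E ^^ n" if "odd n" "n < l" for x n
    using that not_less_Least unfolding l_def by blast
  have "l \<noteq> 1" using l irr by (cases "l = 1") auto
  then obtain j where j: "l = 2 + (2 * j + 1)"
  proof -
    obtain i where i: "l = 2 * i + 1" using l(1) by (rule oddE)
    then have "l = 2 + (2 * (i - 1) + 1)" using \<open>l \<noteq> 1\<close> by (cases i) auto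
    then show ?thesis by (rule that)
  qed
  let ?E = "E ^^ (2 * j + 1)"
  \<comment> \<open>Walking to and fro along an edge lengthens a walk by 2, so \<open>E\<close> is
    contained in its odd powers.\<close>
  have "(a, a) \<in> E ^^ (2 * i)" if "(a, b) \<in> E" for a b i
  proof (induction i)
    case (Suc i)
    then have "(a, b) \<in> E ^^ (2 * i + 1)" using that by auto
    then show ?case using sy[OF that] by auto
  qed simp
  then have incl: "(a, b) \<in> ?E" if "(a, b) \<in> E" for a b using that by auto
  \<comment> \<open>The first two edges of a shortest odd closed walk, and its remaining
    \<open>2 * j + 1\<close> steps taken as one edge, form the triangle.\<close>
  obtain a b where "(v, a) \<in> E" "(a, b) \<in> E" "(b, v) \<in> ?E"
  proof -
    obtain b where "(v, b) \<in> E ^^ 2" "(b, v) \<in> ?E" using l(2) unfolding j by (auto simp only: relpow_add)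
    then show ?thesis using that by (auto simp: numeral_2_eq_2)
  qed
  moreover have sE: "sym ?E" by (rule relpow_sym) (use sy in \<open>auto intro: symI\<close>)
  ultimately have "has_triangle ?E" unfolding has_triangle_def using incl by (meson symD)
  moreover have "ugraph V ?E"
    unfolding ugraph_def
  proof (intro conjI)
    show "?E \<subseteq> V \<times> V"
    proof -
      have "x \<in> V \<and> y \<in> V" if "(x, y) \<in> E ^^ Suc n" for x y n
        using that by (metis EV relpow_Suc_D2 relpow_Suc_E)
      then show ?thesis by auto
    qed
    show "irrefl ?E" using least[of "2 * j + 1"] by (auto simp: irrefl_def j)
  qed (use G sE in \<open>auto simp: ugraph_def\<close>)
  moreover have "acts act V ?E"
    unfolding acts_def
  proof (intro ballI conjI allI impI)
    fix f and x y :: "nat \<Rightarrow> 'v" assume f: "f \<in> M" and xy: "\<forall>i. (x i, y i) \<in> ?E"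
    show "(act f x, act f y) \<in> ?E"
      by (rule relpow_preserved[OF f act actsD(2)[OF act f]]) (use xy in blast)+
  qed (use act in \<open>unfold acts_def, blast\<close>)+
  ultimately show ?thesis using labelling_triangle by blast
qed

end

section \<open>Templates, polymorphisms and label cover\<close>

definition FNot :: "fm \<Rightarrow> fm" where "FNot p = Nand p p"
definition FConj :: "fm \<Rightarrow> fm \<Rightarrow> fm" where "FConj p q = FNot (Nand p q)"
definition FDisj :: "fm \<Rightarrow> fm \<Rightarrow> fm" where "FDisj p q = Nand (FNot p) (FNot q)"
definition FEq :: "trm \<Rightarrow> trm \<Rightarrow> fm" where "FEq a b = FConj (FNot (Less a b)) (FNot (Less b a))"
definition FAll :: "trm \<Rightarrow> fm \<Rightarrow> fm" where "FAll t p = FNot (Ex t (FNot p))"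
definition FImp :: "fm \<Rightarrow> fm \<Rightarrow> fm" where "FImp p q = FDisj (FNot p) q"
definition FDisjs :: "fm list \<Rightarrow> fm" where "FDisjs ps = foldr FDisj ps (Less (Num 0) (Num 0))"

text \<open>Binds a copy of variable \<open>k\<close> as the new variable 0. This brings the
  arguments of a given formula to the front of the environment, without substitution in de Bruijn
  terms.\<close>

definition Let_var :: "nat \<Rightarrow> fm \<Rightarrow> fm" where
  "Let_var k p = Ex (Plus (Var k) (Num 1)) (FConj (FEq (Var 0) (Var (Suc k))) p)"

definition bit :: "bool list \<Rightarrow> nat \<Rightarrow> bool" where "bit u k \<longleftrightarrow> k < length u \<and> u ! k"

lemma eval_connectives [simp]:
  "eval x w (FNot p) e \<longleftrightarrow> \<not> eval x w p e"
  "eval x w (FConj p q) e \<longleftrightarrow> eval x w p e \<and> eval x w q e"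
  "eval x w (FDisj p q) e \<longleftrightarrow> eval x w p e \<or> eval x w q e"
  "eval x w (FEq a b) e \<longleftrightarrow> tev a e = tev b e"
  "eval x w (FAll t p) e \<longleftrightarrow> (\<forall>v<tev t e. eval x w p (v # e))"
  "eval x w (FImp p q) e \<longleftrightarrow> (eval x w p e \<longrightarrow> eval x w q e)"
  "eval x w (FDisjs ps) e \<longleftrightarrow> (\<exists>p\<in>set ps. eval x w p e)"
  "eval x w (Bit False t) e \<longleftrightarrow> bit x (tev t e)"
  "eval x w (Bit True t) e \<longleftrightarrow> bit w (tev t e)"
proof -
  show "eval x w (FDisjs ps) e \<longleftrightarrow> (\<exists>p\<in>set ps. eval x w p e)"
    by (induction ps) (auto simp: FDisjs_def FDisj_def FNot_def)
qed (auto simp: FNot_def FConj_def FDisj_def FEq_def FAll_def FImp_def bit_def)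

declare eval.simps(2) [simp del]

lemma eval_Let_var [simp]: "k < length e \<Longrightarrow> eval x w (Let_var k p) e \<longleftrightarrow> eval x w p (e ! k # e)"
  by (auto simp: Let_var_def)

definition pt :: "nat poly \<Rightarrow> nat \<Rightarrow> trm" where
  "pt p v = foldr (\<lambda>c t. Plus (Num c) (Times (Var v) t)) (coeffs p) (Num 0)"

lemma tev_pt [simp]: "v < length e \<Longrightarrow> tev (pt p v) e = poly p (e ! v)"
proof -
  assume v: "v < length e"
  have "tev (foldr (\<lambda>c t. Plus (Num c) (Times (Var v) t)) cs (Num 0)) e =
      horner_sum id (e ! v) cs" for cs
    using v by (induction cs) auto
  then show ?thesis by (simp add: pt_def poly_def)
qed

lemma gen_eq:
  assumes "\<And>k. k < poly r (length x) \<Longrightarrow> eval x w p [k, length x] = Q k"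
  shows "gen x (pt r 0) p w = map Q [0..<poly r (length x)]"
  using assms by (auto simp: gen_def)

text \<open>The work word is the matrix of a relation on \<open>poly N (length x)\<close> points,
  and each round lengthens the walks by one step of \<open>S\<close>. The variable
  \<open>rest\<close> expresses that \<open>st\<close> uses only its first three variables and can
  be evaluated under further quantifiers.\<close>

theorem polytime_reach:
  fixes N r :: "nat poly"
  assumes st: "\<And>x w i j rest. eval x w st (i # j # length x # rest) = S x i j"
    and out: "\<And>x w k. (\<And>i j. i < poly N (length x) \<Longrightarrow> j < poly N (length x) \<Longrightarrow>
        bit w (i * poly N (length x) + j) \<longleftrightarrow>
        (i, j) \<in> {(i, j). i < poly N (length x) \<and> j < poly N (length x) \<and> S x i j}\<^sup>*) \<Longrightarrow>
        eval x w out [k, length x] = Q x k"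
  shows "polytime_computable (\<lambda>x. map (Q x) [0..<poly r (length x)])"
proof -
  define p where "p = Ex (pt N 1) (Ex (pt N 2) (FConj (FEq (Var 2) (Plus (Times (Var 1) (pt N 3)) (Var 0)))
     (FDisj (FEq (Var 1) (Var 0)) (Ex (pt N 3) (FConj
        (Bit True (Plus (Times (Var 2) (pt N 4)) (Var 0)))
        (Let_var 4 (Let_var 2 (Let_var 2 st))))))))"
  have step: "eval x w p [k, length x] \<longleftrightarrow> (\<exists>i<poly N (length x). \<exists>j<poly N (length x). k = i * poly N (length x) + j \<and>
      (i = j \<or> (\<exists>l<poly N (length x). bit w (i * poly N (length x) + l) \<and> S x l j)))" for x w k
    unfolding p_def by (simp add: st)
  have "gen x (pt r 0) out ((gen x (pt (N * N) 0) p ^^ tev (pt (N * N + 1) 0) [length x]) []) =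
      map (Q x) [0..<poly r (length x)]" for x
  proof -
    define m where "m = poly N (length x)"
    define R where "R = {(i, j). i < m \<and> j < m \<and> S x i j}"
    define W where "W k = (gen x (pt (N * N) 0) p ^^ k) []" for k
    have dec: "i = i' \<and> j = j'" if "i * m + j = i' * m + j'" "j < m" "j' < m" for i j i' j'
      using that by (metis add.commute add_cancel_right_right div_less div_mult_self3 mod_less mod_mult_self3 nat_neq_iff not_less_zero)
    have len: "length (W (Suc k)) = m * m" for k by (simp add: W_def gen_def m_def)
    \<comment> \<open>The empty initial word stands for the empty relation, so \<open>k\<close>
      rounds give the walks with fewer than \<open>k\<close> steps. This explains the 1 in the
      number of rounds \<open>N * N + 1\<close>.\<close>
    have W: "bit (W k) (i * m + j) \<longleftrightarrow> (\<exists>n<k. (i, j) \<in> R ^^ n)" if "i < m" "j < m" for i j k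
      using that
    proof (induction k arbitrary: i j)
      case 0
      then show ?case by (simp add: W_def bit_def)
    next
      case (Suc k)
      have lt: "i * m + j < m * m"
      proof -
        have "i * m + j < i * m + m" using Suc.prems by simp
        also have "\<dots> = Suc i * m" by simp
        also have "\<dots> \<le> m * m" using Suc.prems by (intro mult_right_mono) auto
        finally show ?thesis .
      qed
      have "bit (W (Suc k)) (i * m + j) \<longleftrightarrow> eval x (W k) p [i * m + j, length x]"
        using lt by (simp add: W_def gen_def bit_def m_def[symmetric])
      also have "\<dots> \<longleftrightarrow> i = j \<or> (\<exists>l<m. bit (W k) (i * m + l) \<and> S x l j)"
        unfolding step m_def[symmetric] using dec Suc.prems by blast
      also have "\<dots> \<longleftrightarrow> i = j \<or> (\<exists>l<m. (\<exists>n<k. (i, l) \<in> R ^^ n) \<and> S x l j)"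
        using Suc.IH[OF \<open>i < m\<close>] by auto
      also have "\<dots> \<longleftrightarrow> (\<exists>n<Suc k. (i, j) \<in> R ^^ n)"
      proof
        assume "i = j \<or> (\<exists>l<m. (\<exists>n<k. (i, l) \<in> R ^^ n) \<and> S x l j)"
        then show "\<exists>n<Suc k. (i, j) \<in> R ^^ n"
        proof
          assume "i = j"
          then show ?thesis by (intro exI[of _ 0]) simp
        next
          assume "\<exists>l<m. (\<exists>n<k. (i, l) \<in> R ^^ n) \<and> S x l j"
          then obtain l n where "l < m" "n < k" "(i, l) \<in> R ^^ n" "S x l j" by blast
          then show ?thesis using Suc.prems by (intro exI[of _ "Suc n"]) (auto simp: R_def relcomp_unfold)
        qed
      next
        assume "\<exists>n<Suc k. (i, j) \<in> R ^^ n"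
        then obtain n where n: "n < Suc k" "(i, j) \<in> R ^^ n" by blast
        show "i = j \<or> (\<exists>l<m. (\<exists>n<k. (i, l) \<in> R ^^ n) \<and> S x l j)"
        proof (cases n)
          case (Suc n')
          then obtain l where "(i, l) \<in> R ^^ n'" "(l, j) \<in> R" using n by auto
          then show ?thesis using Suc n by (auto simp: R_def)
        qed (use n in auto)
      qed
      finally show ?case .
    qed
    have Rsub: "R \<subseteq> {..<m} \<times> {..<m}" by (auto simp: R_def)
    then have finR: "finite R" by (rule finite_subset) simp
    have card: "card R \<le> m * m" using card_mono[OF _ Rsub] by (simp add: card_cartesian_product)
    have "(\<exists>n<m * m + 1. (i, j) \<in> R ^^ n) \<longleftrightarrow> (i, j) \<in> R\<^sup>*" for i j
    proof
      assume "(i, j) \<in> R\<^sup>*"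
      then obtain n where "n \<le> card R" "(i, j) \<in> R ^^ n" unfolding rtrancl_finite_eq_relpow[OF finR] by blast
      then show "\<exists>n<m * m + 1. (i, j) \<in> R ^^ n" using card by (intro exI[of _ n]) auto
    qed (auto simp: rtrancl_power)
    then have "bit (W (m * m + 1)) (i * m + j) \<longleftrightarrow> (i, j) \<in> R\<^sup>*" if "i < m" "j < m" for i j
      using W[OF that] by simp
    then have "eval x (W (m * m + 1)) out [k, length x] = Q x k" for k
      by (intro out) (simp add: m_def R_def)
    then show ?thesis by (simp add: gen_eq W_def m_def)
  qed
  then show ?thesis using polytime_iterate[where t' = "pt r 0" and p' = out and t = "pt (N * N) 0" and p = p and q = "pt (N * N + 1) 0"] by simp
qed

lemma polytime_definable:
  assumes "\<And>x w k. eval x w out [k, length x] = Q x k"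
  shows "polytime_computable (\<lambda>x. map (Q x) [0..<poly r (length x)])"
  by (rule polytime_reach[of "Less (Num 0) (Num 0)" "\<lambda>_ _ _. False" 0 out]) (auto simp: assms)

lemma class_P_reach:
  fixes N :: "nat poly"
  assumes st: "\<And>x w i j rest. eval x w st (i # j # length x # rest) = S x i j"
    and out: "\<And>x w k. (\<And>i j. i < poly N (length x) \<Longrightarrow> j < poly N (length x) \<Longrightarrow>
        bit w (i * poly N (length x) + j) \<longleftrightarrow>
        (i, j) \<in> {(i, j). i < poly N (length x) \<and> j < poly N (length x) \<and> S x i j}\<^sup>*) \<Longrightarrow>
        eval x w out [k, length x] \<longleftrightarrow> x \<in> L"
  shows "L \<in> class_P"
  using polytime_reach[OF st, of N out "\<lambda>x k. x \<in> L" 1] out unfolding class_P_def by simp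

lemma class_P_definable:
  assumes "\<And>x w k. eval x w out [k, length x] \<longleftrightarrow> x \<in> L"
  shows "L \<in> class_P"
  using polytime_definable[of out "\<lambda>x k. x \<in> L" 1] assms unfolding class_P_def by simp

section \<open>Words that encode signed graphs\<close>

definition bitpos :: "nat \<Rightarrow> nat \<Rightarrow> nat \<Rightarrow> nat \<Rightarrow> nat" where
  "bitpos n i j s = n + 1 + (2 * (i * n + j) + s)"

definition sg :: "nat \<Rightarrow> sign" where "sg s = (if s = 0 then Pos else Neg)"

text \<open>These are exactly the words \<open>encode_sgraph G\<close> with vertex set
  \<open>{..<n}\<close>: unary \<open>n\<close>, a separator, and a symmetric matrix for each
  sign.\<close>

definition valid_word :: "bool list \<Rightarrow> nat \<Rightarrow> bool" where
  "valid_word x n \<longleftrightarrow> length x = n + 1 + 2 * (n * n) \<and> (\<forall>i<n. bit x i) \<and> \<not> bit x n \<and>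
     (\<forall>i<n. \<forall>j<n. \<forall>s<2. bit x (bitpos n i j s) = bit x (bitpos n j i s))"

lemma bitpos_less: "i < n \<Longrightarrow> j < n \<Longrightarrow> s < 2 \<Longrightarrow> bitpos n i j s < n + 1 + 2 * (n * n)"
proof -
  assume a: "i < n" "j < n" "s < 2"
  have "i * n + j < i * n + n" using a by simp
  also have "\<dots> = Suc i * n" by simp
  also have "\<dots> \<le> n * n" using a by (intro mult_right_mono) auto
  finally show ?thesis using a by (simp add: bitpos_def)
qed

lemma bitpos_inj:
  assumes "bitpos n i j s = bitpos n i' j' s'" "j < n" "j' < n" "s < 2" "s' < 2"
  shows "i = i' \<and> j = j' \<and> s = s'"
proof -
  have e: "2 * (i * n + j) + s = 2 * (i' * n + j') + s'" using assms(1) by (simp add: bitpos_def)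
  then have "i * n + j = i' * n + j'" "s = s'" using assms(4,5) by presburger+
  moreover have "(i * n + j) div n = i" "(i' * n + j') div n = i'" "(i * n + j) mod n = j" "(i' * n + j') mod n = j'"
    using assms by simp_all
  ultimately show ?thesis by metis
qed

lemma bitpos_surj:
  assumes "n < k" "k < n + 1 + 2 * (n * n)"
  obtains i j s where "i < n" "j < n" "s < 2" "k = bitpos n i j s"
proof -
  define m where "m = k - (n + 1)"
  have m: "m < 2 * (n * n)" "k = n + 1 + m" using assms by (auto simp: m_def)
  have q: "m div 2 < n * n" using m by simp
  show ?thesis
  proof
    show "m div 2 div n < n" using q by (simp add: less_mult_imp_div_less)
    show "m div 2 mod n < n" using q by (cases n) auto
    show "m mod 2 < 2" by simp
    have "n * (m div 2 div n) + m div 2 mod n = m div 2" by simp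
    then show "k = bitpos n (m div 2 div n) (m div 2 mod n) (m mod 2)"
      unfolding bitpos_def m(2) by (simp add: mult.commute)
  qed
qed

lemma length_concat_blocks:
  "(\<And>i. i < n \<Longrightarrow> length (f i) = m) \<Longrightarrow> length (concat (map f [0..<n])) = n * m"
  by (induction n) auto

lemma nth_concat_blocks:
  "(\<And>i. i < n \<Longrightarrow> length (f i) = m) \<Longrightarrow> i < n \<Longrightarrow> j < m \<Longrightarrow>
    concat (map f [0..<n]) ! (i * m + j) = f i ! j"
proof (induction n)
  case (Suc n)
  have l: "length (concat (map f [0..<n])) = n * m" using Suc.prems by (intro length_concat_blocks) auto
  show ?case
  proof (cases "i = n")
    case False
    then have i: "i < n" using Suc.prems by simp
    have "i * m + j < i * m + m" using Suc.prems by simp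
    also have "\<dots> = Suc i * m" by simp
    also have "\<dots> \<le> n * m" using i by (intro mult_right_mono) auto
    finally show ?thesis using Suc i l by (simp add: nth_append)
  qed (use l Suc.prems in \<open>simp add: nth_append\<close>)
qed simp

lemma encode_sgraph_bits:
  assumes "verts G = {..<n}"
  defines "x \<equiv> encode_sgraph G"
  shows "length x = n + 1 + 2 * (n * n)" "i < n \<Longrightarrow> bit x i" "\<not> bit x n"
    "i < n \<Longrightarrow> j < n \<Longrightarrow> s < 2 \<Longrightarrow> bit x (bitpos n i j s) \<longleftrightarrow> ({i, j}, sg s) \<in> edges G"
proof -
  define row where "row i = concat (map (\<lambda>j. [({i, j}, Pos) \<in> edges G, ({i, j}, Neg) \<in> edges G]) [0..<n])" for i
  have x: "x = replicate n True @ [False] @ concat (map row [0..<n])"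
    using assms by (simp add: encode_sgraph_def Let_def row_def[abs_def])
  have r: "length (row i) = n * 2" for i unfolding row_def by (rule length_concat_blocks) simp
  have c: "length (concat (map row [0..<n])) = n * (n * 2)" by (rule length_concat_blocks) (rule r)
  show len: "length x = n + 1 + 2 * (n * n)" unfolding x using c by simp
  show "i < n \<Longrightarrow> bit x i" "\<not> bit x n" unfolding x bit_def by (auto simp: nth_append)
  assume ij: "i < n" "j < n" "s < 2"
  have lt: "j * 2 + s < n * 2" using ij by simp
  have "x ! bitpos n i j s = concat (map row [0..<n]) ! (i * (n * 2) + (j * 2 + s))"
    unfolding x bitpos_def by (simp add: nth_append algebra_simps)
  also have "\<dots> = row i ! (j * 2 + s)" using ij lt r by (intro nth_concat_blocks) auto
  also have "\<dots> = [({i, j}, Pos) \<in> edges G, ({i, j}, Neg) \<in> edges G] ! s"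
    unfolding row_def using ij by (intro nth_concat_blocks) auto
  also have "\<dots> \<longleftrightarrow> ({i, j}, sg s) \<in> edges G" using ij by (cases s) (auto simp: sg_def)
  finally show "bit x (bitpos n i j s) \<longleftrightarrow> ({i, j}, sg s) \<in> edges G"
    unfolding bit_def using bitpos_less[OF ij] len by simp
qed

section \<open>The constraint satisfaction problem of a template and its polymorphisms\<close>

definition csp_sat :: "nat \<Rightarrow> (sign \<Rightarrow> nat \<Rightarrow> nat \<Rightarrow> bool) \<Rightarrow> nat \<Rightarrow> (nat \<Rightarrow> nat \<Rightarrow> nat \<Rightarrow> bool) \<Rightarrow> bool" where
  "csp_sat D K n adj \<longleftrightarrow> (\<exists>g. (\<forall>i<n. g i < D) \<and>
     (\<forall>i<n. \<forall>j<n. \<forall>s<2. adj i j s \<longrightarrow> K (sg s) (g i) (g j)))"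

definition csp :: "nat \<Rightarrow> (sign \<Rightarrow> nat \<Rightarrow> nat \<Rightarrow> bool) \<Rightarrow> language" where
  "csp D K = {x. \<exists>n. valid_word x n \<and> csp_sat D K n (\<lambda>i j s. bit x (bitpos n i j s))}"

definition template :: "'a sgraph \<Rightarrow> sign \<Rightarrow> ('a \<times> bool) \<Rightarrow> ('a \<times> bool) \<Rightarrow> bool" where
  "template H s p q \<longleftrightarrow> ({fst p, fst q}, if snd p = snd q then s else flip s) \<in> edges H"

lemma flip_eq [simp]: "flip s \<noteq> s" "s \<noteq> flip s"
  by (cases s; simp)+

lemma s_Hom_iff_template:
  assumes H: "signed_graph H"
  shows "x \<in> s_Hom H \<longleftrightarrow> (\<exists>n. valid_word x n \<and> (\<exists>g. (\<forall>i<n. fst (g i) \<in> verts H) \<and>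
     (\<forall>i<n. \<forall>j<n. \<forall>s<2. bit x (bitpos n i j s) \<longrightarrow> template H (sg s) (g i) (g j))))"
proof
  assume "x \<in> s_Hom H"
  then obtain G n \<phi> where G: "x = encode_sgraph G" "signed_graph G" "verts G = {..<n}" "s_hom \<phi> G H"
    unfolding s_Hom_def by blast
  then obtain \<sigma> where st: "\<phi> ` verts G \<subseteq> verts H"
    "\<forall>x y s. ({x, y}, s) \<in> edges G \<longrightarrow> ({\<phi> x, \<phi> y}, twist \<sigma> x y s) \<in> edges H"
    using iffD1[OF s_hom_iff[OF G(2) H] G(4)] by (elim conjE exE) (rule that)
  note b = encode_sgraph_bits[OF G(3), folded G(1)]
  have "valid_word x n"
    unfolding valid_word_def using b by (simp add: insert_commute)
  moreover have "\<forall>i<n. \<forall>j<n. \<forall>s<2. bit x (bitpos n i j s) \<longrightarrow> template H (sg s) (\<phi> i, \<sigma> i) (\<phi> j, \<sigma> j)"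
    using b(4) st(2) unfolding template_def twist_def by simp
  moreover have "\<forall>i<n. fst (\<phi> i, \<sigma> i) \<in> verts H" using st(1) G(3) by auto
  ultimately show "\<exists>n. valid_word x n \<and> (\<exists>g. (\<forall>i<n. fst (g i) \<in> verts H) \<and>
     (\<forall>i<n. \<forall>j<n. \<forall>s<2. bit x (bitpos n i j s) \<longrightarrow> template H (sg s) (g i) (g j)))"
    by (intro exI[of _ n] conjI exI[of _ "\<lambda>i. (\<phi> i, \<sigma> i)"])
next
  assume "\<exists>n. valid_word x n \<and> (\<exists>g. (\<forall>i<n. fst (g i) \<in> verts H) \<and>
     (\<forall>i<n. \<forall>j<n. \<forall>s<2. bit x (bitpos n i j s) \<longrightarrow> template H (sg s) (g i) (g j)))"
  then obtain n g where v: "valid_word x n" and g: "\<And>i. i < n \<Longrightarrow> fst (g i) \<in> verts H"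
    "\<And>i j s. i < n \<Longrightarrow> j < n \<Longrightarrow> s < 2 \<Longrightarrow> bit x (bitpos n i j s) \<Longrightarrow> template H (sg s) (g i) (g j)" by blast
  define G where "G = \<lparr>verts = {..<n}, edges = {({i, j}, sg s) | i j s. i < n \<and> j < n \<and> s < 2 \<and> bit x (bitpos n i j s)}\<rparr>"
  have vG: "verts G = {..<n}" by (simp add: G_def)
  have sg_inj: "sg s = sg s' \<longleftrightarrow> s = s'" if "s < 2" "s' < 2" for s s'
    using that by (auto simp: sg_def less_2_cases_iff)
  have eG: "({i, j}, sg s) \<in> edges G \<longleftrightarrow> bit x (bitpos n i j s)" if "i < n" "j < n" "s < 2" for i j s
  proof
    assume "({i, j}, sg s) \<in> edges G"
    then obtain i' j' s' where "{i, j} = {i', j'}" "sg s = sg s'" "s' < 2" "i' < n" "j' < n" "bit x (bitpos n i' j' s')"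
      unfolding G_def by auto
    then show "bit x (bitpos n i j s)" using v that sg_inj[of s s'] unfolding valid_word_def by (auto simp: doubleton_eq_iff)
  qed (use that in \<open>auto simp: G_def\<close>)
  have wf: "signed_graph G" unfolding signed_graph_def G_def by auto
  have "({fst (g i), fst (g j)}, twist (\<lambda>i. snd (g i)) i j s) \<in> edges H" if "({i, j}, s) \<in> edges G" for i j s
  proof -
    have ij: "i < n" "j < n" using signed_graphD[OF wf that] vG by auto
    obtain s' where s': "s' < 2" "s = sg s'" by (cases s) (auto simp: sg_def intro: that[of 0] that[of 1])
    then show ?thesis using g(2)[OF ij s'(1)] that eG[OF ij s'(1)] unfolding template_def twist_def by auto
  qed
  then have "s_hom (\<lambda>i. fst (g i)) G H"
    using s_hom_iff[OF wf H, of "\<lambda>i. fst (g i)"] g(1) vG by auto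
  moreover have "x = encode_sgraph G"
  proof (rule nth_equalityI)
    note b = encode_sgraph_bits[OF vG]
    show len: "length x = length (encode_sgraph G)" using v b(1) by (simp add: valid_word_def)
    fix k assume k: "k < length x"
    have "bit x k = bit (encode_sgraph G) k"
    proof -
      consider "k < n" | "k = n" | "n < k" "k < n + 1 + 2 * (n * n)" using k v unfolding valid_word_def by linarith
      then show ?thesis
      proof cases
        case 3
        then obtain i j s where "i < n" "j < n" "s < 2" "k = bitpos n i j s" by (rule bitpos_surj)
        then show ?thesis using b(4) eG by simp
      qed (use v b in \<open>auto simp: valid_word_def\<close>)
    qed
    then show "x ! k = encode_sgraph G ! k" using k len by (simp add: bit_def)
  qed
  ultimately show "x \<in> s_Hom H" unfolding s_Hom_def using wf vG by blast
qed

lemma s_Hom_eq_csp: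
  assumes H: "signed_graph H" and dec: "bij_betw dec {..<D} (verts H \<times> (UNIV :: bool set))"
  shows "s_Hom H = csp D (\<lambda>s i j. i < D \<and> j < D \<and> template H s (dec i) (dec j))"
proof -
  let ?e = "inv_into {..<D} dec"
  have e: "?e p < D" "dec (?e p) = p" if "fst p \<in> verts H" for p
  proof -
    have "p \<in> dec ` {..<D}" using that dec by (auto simp: bij_betw_def mem_Times_iff)
    then show "?e p < D" "dec (?e p) = p" using inv_into_into[of p dec "{..<D}"] by (auto simp: f_inv_into_f)
  qed
  have d: "fst (dec i) \<in> verts H" if "i < D" for i
  proof -
    have "dec i \<in> verts H \<times> UNIV" using bij_betwE[OF dec] that by blast
    then show ?thesis by (simp add: mem_Times_iff)
  qed
  have "(\<exists>g. (\<forall>i<n. fst (g i) \<in> verts H) \<and>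
     (\<forall>i<n. \<forall>j<n. \<forall>s<2. bit x (bitpos n i j s) \<longrightarrow> template H (sg s) (g i) (g j))) \<longleftrightarrow>
     csp_sat D (\<lambda>s i j. i < D \<and> j < D \<and> template H s (dec i) (dec j)) n (\<lambda>i j s. bit x (bitpos n i j s))" (is "?L \<longleftrightarrow> ?R") for x n
  proof
    assume ?L
    then obtain g where g: "\<forall>i<n. fst (g i) \<in> verts H"
      "\<forall>i<n. \<forall>j<n. \<forall>s<2. bit x (bitpos n i j s) \<longrightarrow> template H (sg s) (g i) (g j)" by blast
    then show ?R unfolding csp_sat_def by (intro exI[of _ "\<lambda>i. ?e (g i)"]) (simp add: e)
  next
    assume ?R
    then obtain g where "\<forall>i<n. g i < D"
      "\<forall>i<n. \<forall>j<n. \<forall>s<2. bit x (bitpos n i j s) \<longrightarrow> template H (sg s) (dec (g i)) (dec (g j))"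
      unfolding csp_sat_def by blast
    then show ?L by (intro exI[of _ "\<lambda>i. dec (g i)"]) (simp add: d)
  qed
  then show ?thesis unfolding csp_def set_eq_iff mem_Collect_eq s_Hom_iff_template[OF H] by simp
qed

text \<open>The polymorphisms of \<open>K\<close> of all arities at once, in the form required by
  \<open>minion\<close>.\<close>

definition ops :: "nat \<Rightarrow> (sign \<Rightarrow> nat \<Rightarrow> nat \<Rightarrow> bool) \<Rightarrow> ((nat \<Rightarrow> nat) \<Rightarrow> nat) set" where
  "ops D K = {f. (\<forall>x. f x < D) \<and> (\<forall>s x y. (\<forall>i. K s (x i) (y i)) \<longrightarrow> K s (f x) (f y)) \<and>
     (\<exists>I. finite I \<and> (\<forall>x y. (\<forall>i\<in>I. x i = y i) \<longrightarrow> f x = f y))}"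

definition op_minor :: "(nat \<Rightarrow> nat) \<Rightarrow> ((nat \<Rightarrow> nat) \<Rightarrow> nat) \<Rightarrow> (nat \<Rightarrow> nat) \<Rightarrow> nat" where
  "op_minor \<pi> f = (\<lambda>x. f (\<lambda>i. x (\<pi> i)))"

definition op_dep :: "((nat \<Rightarrow> nat) \<Rightarrow> nat) \<Rightarrow> nat set \<Rightarrow> bool" where
  "op_dep f I \<longleftrightarrow> (\<forall>x y. (\<forall>i\<in>I. x i = y i) \<longrightarrow> f x = f y)"

lemma minion_ops: "minion (ops D K) op_minor op_dep"
proof
  fix f \<pi> assume f: "f \<in> ops D K"
  then obtain I where I: "finite I" "op_dep f I" unfolding ops_def op_dep_def by blast
  show "\<exists>I. finite I \<and> op_dep f I" using I by blast
  have "finite (\<pi> ` I)" "op_dep (op_minor \<pi> f) (\<pi> ` I)"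
    using I unfolding op_dep_def op_minor_def by auto
  then have "\<exists>I. finite I \<and> (\<forall>x y. (\<forall>i\<in>I. x i = y i) \<longrightarrow> op_minor \<pi> f x = op_minor \<pi> f y)"
    unfolding op_dep_def by blast
  then show "op_minor \<pi> f \<in> ops D K" using f unfolding ops_def op_minor_def by simp
qed

definition essentially_unary :: "nat \<Rightarrow> (sign \<Rightarrow> nat \<Rightarrow> nat \<Rightarrow> bool) \<Rightarrow> bool" where
  "essentially_unary D K \<longleftrightarrow> minion.has_labelling (ops D K) op_minor op_dep"

lemma essentially_unaryD:
  assumes "essentially_unary D K"
  obtains \<xi> where "\<And>f I. f \<in> ops D K \<Longrightarrow> op_dep f I \<Longrightarrow> \<xi> f \<in> I"
    "\<And>f \<pi>. f \<in> ops D K \<Longrightarrow> \<xi> (op_minor \<pi> f) = \<pi> (\<xi> f)"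
  using assms unfolding essentially_unary_def minion.has_labelling_def[OF minion_ops] by blast

text \<open>A numbering of the points of the \<open>A\<close>-th power of \<open>{..<D}\<close>.
  Entries are reduced modulo \<open>D\<close> so that every sequence has a code, as the operations
  in \<open>ops\<close> are applied to arbitrary sequences.\<close>

lemma power_encoding:
  assumes D: "0 < D"
  shows "\<exists>(Kc :: nat) (code :: (nat \<Rightarrow> nat) \<Rightarrow> nat) (dig :: nat \<Rightarrow> nat \<Rightarrow> nat).
    0 < Kc \<and> (\<forall>x. code x < Kc) \<and> (\<forall>x. \<forall>i<A. dig (code x) i = x i mod D) \<and>
     (\<forall>x y. (\<forall>i<A. x i mod D = y i mod D) \<longrightarrow> code x = code y) \<and> (\<forall>c<Kc. \<forall>i<A. dig c i < D)"
proof -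
  let ?P = "PiE {..<A} (\<lambda>_. {..<D})"
  have fin: "finite ?P" by (rule finite_PiE) auto
  obtain enc where enc: "bij_betw enc ?P {0..<card ?P}" using ex_bij_betw_finite_nat[OF fin] by blast
  define code where "code x = enc (restrict (\<lambda>i. x i mod D) {..<A})" for x
  define dig where "dig c = inv_into ?P enc c" for c
  have r: "restrict (\<lambda>i. x i mod D) {..<A} \<in> ?P" for x using D by (auto simp: PiE_iff)
  have c: "code x < card ?P" for x using bij_betwE[OF enc] r unfolding code_def by (metis atLeastLessThan_iff)
  have d: "dig (code x) = restrict (\<lambda>i. x i mod D) {..<A}" for x
    unfolding code_def dig_def using enc r by (simp add: bij_betw_def)
  have 0: "0 < card ?P" using c[of "\<lambda>_. 0"] by linarith
  have 1: "code x = code y" if "\<forall>i<A. x i mod D = y i mod D" for x y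
  proof -
    have "restrict (\<lambda>i. x i mod D) {..<A} = restrict (\<lambda>i. y i mod D) {..<A}"
      by (rule restrict_ext) (use that in simp)
    then show ?thesis by (simp add: code_def)
  qed
  have 2: "dig c i < D" if "c < card ?P" "i < A" for c i
    proof -
      have "c \<in> enc ` ?P" using that(1) enc by (simp add: bij_betw_def)
      then have "dig c \<in> ?P" unfolding dig_def by (rule inv_into_into)
      then show ?thesis using that(2) by auto
    qed
  show ?thesis
    by (rule exI[of _ "card ?P"], rule exI[of _ code], rule exI[of _ dig]) (use 0 1 2 c d in auto)
qed

text \<open>Label cover: variables with labels below \<open>A\<close>, and constraints saying that the label of one
  variable is the image of the label of another one under a fixed map.\<close>

definition label_sat :: "nat \<Rightarrow> (nat \<Rightarrow> nat) list \<Rightarrow> nat \<Rightarrow> (nat \<Rightarrow> nat \<Rightarrow> nat \<Rightarrow> bool) \<Rightarrow> bool" where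
  "label_sat A ps m cons \<longleftrightarrow> (\<exists>lab. (\<forall>i<m. lab i < A) \<and>
     (\<forall>c<length ps. \<forall>i<m. \<forall>j<m. cons c i j \<longrightarrow> lab j = (ps ! c) (lab i)))"

text \<open>The instance built from a label cover instance: variable \<open>i\<close> becomes a copy of the \<open>A\<close>-th
  power of the template, so that its homomorphisms are \<open>A\<close>-ary polymorphisms, and a constraint
  identifies points so as to make one polymorphism a minor of another one. The quotient is replaced
  by its blow-up, in which identified points are twins.\<close>

locale power_gadget =
  fixes D :: nat and K :: "sign \<Rightarrow> nat \<Rightarrow> nat \<Rightarrow> bool" and A :: nat and ps :: "(nat \<Rightarrow> nat) list"
    and Kc :: nat and code :: "(nat \<Rightarrow> nat) \<Rightarrow> nat" and dig :: "nat \<Rightarrow> nat \<Rightarrow> nat"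
  assumes eu: "essentially_unary D K"
    and K_dom: "K s d d' \<Longrightarrow> d < D \<and> d' < D" and K_sym: "K s d d' \<Longrightarrow> K s d' d"
    and ps_A: "c < length ps \<Longrightarrow> k < A \<Longrightarrow> (ps ! c) k < A"
    and Kc: "0 < Kc" and code: "code x < Kc" and dig_code: "i < A \<Longrightarrow> dig (code x) i = x i mod D"
    and code_eq: "(\<And>i. i < A \<Longrightarrow> x i mod D = y i mod D) \<Longrightarrow> code x = code y"
    and dig_D: "c < Kc \<Longrightarrow> i < A \<Longrightarrow> dig c i < D"
begin

text \<open>Precomposition of a point with the constraint map: the value of the polymorphism of
  \<open>j\<close> at \<open>a\<close> has to be the value of the polymorphism of \<open>i\<close>
  at \<open>pull c a\<close>.\<close>

definition pull :: "nat \<Rightarrow> nat \<Rightarrow> nat" where "pull c a = code (\<lambda>k. dig a ((ps ! c) k))"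

definition compatible :: "sign \<Rightarrow> nat \<Rightarrow> nat \<Rightarrow> bool" where
  "compatible s a b \<longleftrightarrow> (\<forall>k<A. K s (dig a k) (dig b k))"

definition glue :: "nat \<Rightarrow> (nat \<Rightarrow> nat \<Rightarrow> nat \<Rightarrow> bool) \<Rightarrow> nat \<Rightarrow> nat \<Rightarrow> bool" where
  "glue m cons I J \<longleftrightarrow> (\<exists>i<m. \<exists>j<m. \<exists>c<length ps. \<exists>a<Kc. cons c i j \<and> I = j * Kc + a \<and> J = i * Kc + pull c a)"

definition edge :: "nat \<Rightarrow> nat \<Rightarrow> nat \<Rightarrow> nat \<Rightarrow> bool" where
  "edge m I J s \<longleftrightarrow> (\<exists>i<m. \<exists>a<Kc. \<exists>b<Kc. compatible (sg s) a b \<and> I = i * Kc + a \<and> J = i * Kc + b)"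

definition twins :: "nat \<Rightarrow> (nat \<Rightarrow> nat \<Rightarrow> nat \<Rightarrow> bool) \<Rightarrow> (nat \<times> nat) set" where
  "twins m cons = {(I, J). I < m * Kc \<and> J < m * Kc \<and> (glue m cons I J \<or> glue m cons J I)}\<^sup>*"

definition blowup :: "nat \<Rightarrow> (nat \<Rightarrow> nat \<Rightarrow> nat \<Rightarrow> bool) \<Rightarrow> nat \<Rightarrow> nat \<Rightarrow> nat \<Rightarrow> bool" where
  "blowup m cons I J s \<longleftrightarrow> (\<exists>I'<m * Kc. \<exists>J'<m * Kc. (I, I') \<in> twins m cons \<and> (J, J') \<in> twins m cons \<and> edge m I' J' s)"

lemma point_less: "i < m \<Longrightarrow> a < Kc \<Longrightarrow> i * Kc + a < m * Kc"
proof -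
  assume a: "i < m" "a < Kc"
  have "i * Kc + a < Suc i * Kc" using a by simp
  also have "\<dots> \<le> m * Kc" using a by (intro mult_right_mono) auto
  finally show ?thesis .
qed

lemma blowup_sym: "blowup m cons I J s \<Longrightarrow> blowup m cons J I s"
  unfolding blowup_def edge_def compatible_def using K_sym by blast

lemma twins_invariant:
  assumes "\<And>I J. glue m cons I J \<Longrightarrow> g I = g J" "(I, J) \<in> twins m cons"
  shows "g I = g J"
  using assms(2) unfolding twins_def by (induction rule: rtrancl_induct) (auto dest: assms(1))

lemma blowup_sat: "csp_sat D K (m * Kc) (blowup m cons) \<longleftrightarrow> label_sat A ps m cons"
proof
  assume "label_sat A ps m cons"
  then obtain lab where lab: "\<And>i. i < m \<Longrightarrow> lab i < A"
    "\<And>c i j. c < length ps \<Longrightarrow> i < m \<Longrightarrow> j < m \<Longrightarrow> cons c i j \<Longrightarrow> lab j = (ps ! c) (lab i)"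
    unfolding label_sat_def by blast
  \<comment> \<open>A labelling gives the solution that acts on the copy of variable
    \<open>i\<close> as the projection to coordinate \<open>lab i\<close>.\<close>
  define g where "g I = dig (I mod Kc) (lab (I div Kc))" for I
  have g: "g (i * Kc + a) = dig a (lab i)" if "a < Kc" for i a using that Kc by (simp add: g_def)
  have "g I = g J" if "glue m cons I J" for I J
  proof -
    obtain i j c a where ij: "i < m" "j < m" "c < length ps" "a < Kc" "cons c i j" "I = j * Kc + a" "J = i * Kc + pull c a"
      using \<open>glue m cons I J\<close> unfolding glue_def by blast
    have "g J = dig a ((ps ! c) (lab i)) mod D"
      using ij code lab(1)[OF ij(1)] by (simp add: g pull_def dig_code)
    also have "\<dots> = g I" using ij lab dig_D ps_A by (simp add: g)
    finally show ?thesis by simp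
  qed
  then have tw: "g I = g J" if "(I, J) \<in> twins m cons" for I J using twins_invariant that by blast
  have "K (sg s) (g I) (g J)" if bl: "blowup m cons I J s" for I J s
  proof -
    obtain I' J' where IJ: "(I, I') \<in> twins m cons" "(J, J') \<in> twins m cons" "edge m I' J' s"
      using bl unfolding blowup_def by blast
    then obtain i a b where "i < m" "a < Kc" "b < Kc" "compatible (sg s) a b" "I' = i * Kc + a" "J' = i * Kc + b"
      unfolding edge_def by blast
    then have "K (sg s) (g I') (g J')" using lab(1) by (simp add: g compatible_def)
    then show ?thesis using tw IJ by simp
  qed
  moreover have "g I < D" if "I < m * Kc" for I
    unfolding g_def using that Kc lab(1) by (intro dig_D) (auto simp: less_mult_imp_div_less)
  ultimately show "csp_sat D K (m * Kc) (blowup m cons)" unfolding csp_sat_def by blast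
next
  assume "csp_sat D K (m * Kc) (blowup m cons)"
  then obtain g0 where g0: "\<And>I. I < m * Kc \<Longrightarrow> g0 I < D"
    "\<And>I J s. I < m * Kc \<Longrightarrow> J < m * Kc \<Longrightarrow> s < 2 \<Longrightarrow> blowup m cons I J s \<Longrightarrow> K (sg s) (g0 I) (g0 J)"
    unfolding csp_sat_def by blast
  \<comment> \<open>A homomorphism from the blow-up may separate twins. Reading it off one
    representative of each class yields a homomorphism from the quotient.\<close>
  define rp where "rp I = (SOME J. (I, J) \<in> twins m cons)" for I
  have sym: "(J, I) \<in> twins m cons" if "(I, J) \<in> twins m cons" for I J
  proof -
    have "sym {(I, J). I < m * Kc \<and> J < m * Kc \<and> (glue m cons I J \<or> glue m cons J I)}" by (auto intro: symI)
    then show ?thesis using that unfolding twins_def by (meson sym_rtrancl symD)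
  qed
  have rp: "(I, rp I) \<in> twins m cons" for I unfolding rp_def by (rule someI[of _ I]) (simp add: twins_def)
  have rp_eq: "rp I = rp J" if "(I, J) \<in> twins m cons" for I J
  proof -
    have "(I, L) \<in> twins m cons \<longleftrightarrow> (J, L) \<in> twins m cons" for L
      using that sym[OF that] unfolding twins_def by (meson rtrancl_trans)
    then show ?thesis unfolding rp_def by simp
  qed
  have rp_less: "rp I < m * Kc" if "I < m * Kc" for I
    using rp[of I] that unfolding twins_def by (induction rule: rtrancl_induct) auto
  define g where "g I = g0 (rp I)" for I
  have gD: "g I < D" if "I < m * Kc" for I using g0(1) rp_less that by (simp add: g_def)
  have g_glue: "g I = g J" if "I < m * Kc" "J < m * Kc" "glue m cons I J" for I J
    using rp_eq[of I J] that unfolding g_def twins_def by (simp add: r_into_rtrancl)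
  have g_edge: "K (sg s) (g I) (g J)" if "edge m I J s" "I < m * Kc" "J < m * Kc" "s < 2" for I J s
  proof -
    have "blowup m cons (rp I) (rp J) s" unfolding blowup_def using that sym[OF rp] by blast
    then show ?thesis using g0(2) rp_less that by (simp add: g_def)
  qed
  define f where "f i x = g (i * Kc + code x)" for i and x :: "nat \<Rightarrow> nat"
  have f: "f i \<in> ops D K" and f_dep: "op_dep (f i) {..<A}" if i: "i < m" for i
  proof -
    show dep: "op_dep (f i) {..<A}" unfolding op_dep_def f_def by (auto intro!: arg_cong[of _ _ g] code_eq)
    have "K s (f i x) (f i y)" if K: "\<And>k. K s (x k) (y k)" for s x y
    proof -
      obtain s' where s': "s' < 2" "s = sg s'" by (cases s) (auto simp: sg_def intro: that[of 0] that[of 1])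
      have "dig (code x) k = x k" "dig (code y) k = y k" if "k < A" for k
        using K_dom[OF K[of k]] that by (simp_all add: dig_code)
      then have "compatible s (code x) (code y)" unfolding compatible_def using K by simp
      then have "edge m (i * Kc + code x) (i * Kc + code y) s'" unfolding edge_def using i code s' by blast
      then show ?thesis unfolding f_def s'(2) using g_edge point_less i code s'(1) by blast
    qed
    moreover have "f i x < D" for x unfolding f_def using gD point_less i code by blast
    ultimately show "f i \<in> ops D K" using dep unfolding ops_def op_dep_def by blast
  qed
  obtain \<xi> where \<xi>: "\<And>f I. f \<in> ops D K \<Longrightarrow> op_dep f I \<Longrightarrow> \<xi> f \<in> I"
    "\<And>f \<pi>. f \<in> ops D K \<Longrightarrow> \<xi> (op_minor \<pi> f) = \<pi> (\<xi> f)" using essentially_unaryD[OF eu] by blast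
  have "\<xi> (f j) = (ps ! c) (\<xi> (f i))" if c: "c < length ps" and i: "i < m" and j: "j < m" and cons: "cons c i j" for c i j
  proof -
    have "f j x = op_minor (ps ! c) (f i) x" for x
    proof -
      have "glue m cons (j * Kc + code x) (i * Kc + pull c (code x))"
        unfolding glue_def using c i j cons code by blast
      then have "g (j * Kc + code x) = g (i * Kc + pull c (code x))"
        by (intro g_glue point_less i j code) (simp_all add: pull_def code)
      also have "pull c (code x) = code (\<lambda>k. x ((ps ! c) k))"
        unfolding pull_def using ps_A[OF c] by (intro code_eq) (simp add: dig_code)
      finally show ?thesis by (simp add: f_def op_minor_def)
    qed
    then have "f j = op_minor (ps ! c) (f i)" by blast
    then show ?thesis using \<xi>(2)[OF f[OF i]] by simp
  qed
  moreover have "\<xi> (f i) < A" if "i < m" for i using \<xi>(1)[OF f f_dep] that by auto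
  ultimately show "label_sat A ps m cons" unfolding label_sat_def by (intro exI[of _ "\<lambda>i. \<xi> (f i)"]) blast
qed

end

lemma valid_word_unique: "valid_word x n \<Longrightarrow> valid_word x n' \<Longrightarrow> n = n'"
  unfolding valid_word_def by (cases n n' rule: linorder_cases) auto

lemma csp_iff_sat:
  assumes "valid_word x n" "\<And>i j s. i < n \<Longrightarrow> j < n \<Longrightarrow> s < 2 \<Longrightarrow> bit x (bitpos n i j s) \<longleftrightarrow> adj i j s"
  shows "x \<in> csp D K \<longleftrightarrow> csp_sat D K n adj"
proof -
  have "x \<in> csp D K \<longleftrightarrow> csp_sat D K n (\<lambda>i j s. bit x (bitpos n i j s))"
  proof
    assume "x \<in> csp D K"
    then obtain n' where "valid_word x n'" "csp_sat D K n' (\<lambda>i j s. bit x (bitpos n' i j s))"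
      unfolding csp_def by blast
    then show "csp_sat D K n (\<lambda>i j s. bit x (bitpos n i j s))"
      using valid_word_unique[OF assms(1)] by metis
  qed (use assms(1) in \<open>auto simp: csp_def\<close>)
  also have "\<dots> \<longleftrightarrow> csp_sat D K n adj" unfolding csp_sat_def using assms(2) by auto
  finally show ?thesis .
qed

text \<open>The twin relation is a transitive closure, which \<open>polytime_reach\<close> supplies
  as a matrix in the work word. The adjacency matrix of the blow-up is then definable by the bounded
  formula \<open>out\<close>.\<close>

theorem label_cover_reduction:
  fixes m :: "nat poly" and forms :: "fm list"
  assumes eu: "essentially_unary D K" and D: "0 < D"
    and K_dom: "\<And>s d d'. K s d d' \<Longrightarrow> d < D \<and> d' < D" and K_sym: "\<And>s d d'. K s d d' \<Longrightarrow> K s d' d"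
    and ps: "\<And>c k. c < length ps \<Longrightarrow> k < A \<Longrightarrow> (ps ! c) k < A"
    and forms: "\<And>x w c i j rest. c < length ps \<Longrightarrow> eval x w (forms ! c) (i # j # length x # rest) = cons x c i j"
    and L: "\<And>x. x \<in> L \<longleftrightarrow> label_sat A ps (poly m (length x)) (cons x)"
  shows "polytime_reducible L (csp D K)"
proof -
  from power_encoding[OF D, of A] obtain Kc :: nat and code :: "(nat \<Rightarrow> nat) \<Rightarrow> nat" and dig :: "nat \<Rightarrow> nat \<Rightarrow> nat" where
    "0 < Kc \<and> (\<forall>x. code x < Kc) \<and> (\<forall>x. \<forall>i<A. dig (code x) i = x i mod D) \<and>
     (\<forall>x y. (\<forall>i<A. x i mod D = y i mod D) \<longrightarrow> code x = code y) \<and> (\<forall>c<Kc. \<forall>i<A. dig c i < D)"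
    by (elim exE) (rule that)
  then have pe: "0 < Kc" "\<And>x. code x < Kc" "\<And>x i. i < A \<Longrightarrow> dig (code x) i = x i mod D"
    "\<And>x y. (\<And>i. i < A \<Longrightarrow> x i mod D = y i mod D) \<Longrightarrow> code x = code y" "\<And>c i. c < Kc \<Longrightarrow> i < A \<Longrightarrow> dig c i < D"
    by simp_all
  interpret power_gadget D K A ps Kc code dig
    by unfold_locales (use eu K_dom K_sym ps pe in blast)+
  define glf where "glf u v z = Ex (pt m z) (Ex (pt m (z + 1)) (FDisjs (concat (map (\<lambda>c. map (\<lambda>a.
      FConj (Let_var (z + 2) (Let_var 1 (Let_var 3 (forms ! c))))
        (FConj (FEq (Var (u + 2)) (Plus (Times (Var 0) (Num Kc)) (Num a)))
               (FEq (Var (v + 2)) (Plus (Times (Var 1) (Num Kc)) (Num (pull c a))))))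
      [0..<Kc]) [0..<length ps]))))" for u v z
  have glf: "eval x w (glf u v z) e \<longleftrightarrow> glue (poly m (length x)) (cons x) (e ! u) (e ! v)"
    if "u < length e" "v < length e" "z < length e" "e ! z = length x" for x w u v z e
  proof -
    have "eval x w (glf u v z) e \<longleftrightarrow> (\<exists>i<poly m (length x). \<exists>j<poly m (length x). \<exists>c\<in>{0..<length ps}. \<exists>a\<in>{0..<Kc}.
        cons x c i j \<and> e ! u = j * Kc + a \<and> e ! v = i * Kc + pull c a)"
      unfolding glf_def using that by (simp add: forms)
    then show ?thesis unfolding glue_def by (simp only: Bex_def atLeastLessThan_iff le0 simp_thms)
  qed
  define edf where "edf = Ex (pt m 6) (FDisjs (map (\<lambda>s. FConj (FEq (Var 3) (Num s)) (FDisjs (concat (map (\<lambda>a. map (\<lambda>b.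
      FConj (FEq (Var 2) (Plus (Times (Var 0) (Num Kc)) (Num a)))
            (FEq (Var 1) (Plus (Times (Var 0) (Num Kc)) (Num b))))
      (filter (compatible (sg s) a) [0..<Kc])) [0..<Kc])))) [0, 1]))"
  have edf: "eval x w edf [J, I, s, J0, I0, k, length x] \<longleftrightarrow> edge (poly m (length x)) I J s" if s: "s < 2" for x w I J s I0 J0 k
  proof -
    have "eval x w edf [J, I, s, J0, I0, k, length x] \<longleftrightarrow> (\<exists>i<poly m (length x). \<exists>a\<in>{0..<Kc}. \<exists>b\<in>{b. b < Kc \<and> compatible (sg s) a b}.
        I = i * Kc + a \<and> J = i * Kc + b)"
      using s unfolding edf_def less_2_cases_iff by (elim disjE) simp_all
    then show ?thesis unfolding edge_def by (auto 4 3)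
  qed
  define M where "M = m * [:Kc:]"
  have M: "poly M n = poly m n * Kc" for n by (simp add: M_def)
  define out where "out = FDisj (Less (Var 0) (pt M 1)) (Ex (pt M 1) (Ex (pt M 2) (Ex (Num 2)
     (FConj (FEq (Var 3) (Plus (Plus (pt M 4) (Num 1)) (Plus (Times (Num 2) (Plus (Times (Var 2) (pt M 4)) (Var 1))) (Var 0))))
     (Ex (pt M 4) (Ex (pt M 5) (FConj (Bit True (Plus (Times (Var 4) (pt M 6)) (Var 1)))
        (FConj (Bit True (Plus (Times (Var 3) (pt M 6)) (Var 0))) edf))))))))"
  define adj where "adj x = blowup (poly m (length x)) (cons x)" for x
  define Q where "Q x k \<longleftrightarrow> k < poly M (length x) \<or> (\<exists>I<poly M (length x). \<exists>J<poly M (length x). \<exists>s<2.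
     k = bitpos (poly M (length x)) I J s \<and> adj x I J s)" for x k
  define r where "r = M + 1 + 2 * (M * M)"
  define f where "f x = map (Q x) [0..<poly r (length x)]" for x
  have "polytime_computable f"
    unfolding f_def
  proof (rule polytime_reach[of "FDisj (glf 0 1 2) (glf 1 0 2)"
      "\<lambda>x I J. glue (poly m (length x)) (cons x) I J \<or> glue (poly m (length x)) (cons x) J I" M out])
    fix x w k
    assume w: "\<And>i j. i < poly M (length x) \<Longrightarrow> j < poly M (length x) \<Longrightarrow>
        bit w (i * poly M (length x) + j) \<longleftrightarrow> (i, j) \<in> {(i, j). i < poly M (length x) \<and> j < poly M (length x) \<and>
          (glue (poly m (length x)) (cons x) i j \<or> glue (poly m (length x)) (cons x) j i)}\<^sup>*"
    then have w': "bit w (i * poly M (length x) + j) \<longleftrightarrow> (i, j) \<in> twins (poly m (length x)) (cons x)"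
      if "i < poly M (length x)" "j < poly M (length x)" for i j
      using that unfolding twins_def M by blast
    show "eval x w out [k, length x] = Q x k"
      unfolding out_def Q_def adj_def blowup_def M[symmetric] bitpos_def by (auto simp: w' edf)
  qed (auto simp: glf)
  moreover have "x \<in> L \<longleftrightarrow> f x \<in> csp D K" for x
  proof -
    let ?n = "poly M (length x)"
    have len: "length (f x) = ?n + 1 + 2 * (?n * ?n)" by (simp add: f_def r_def)
    have b: "bit (f x) k \<longleftrightarrow> k < ?n + 1 + 2 * (?n * ?n) \<and> Q x k" for k
    proof -
      have "poly r (length x) = ?n + 1 + 2 * (?n * ?n)" by (simp add: r_def)
      then show ?thesis unfolding bit_def f_def by (auto simp del: upt_Suc)
    qed
    have adj: "bit (f x) (bitpos ?n i j s) \<longleftrightarrow> adj x i j s" if ij: "i < ?n" "j < ?n" "s < 2" for i j s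
    proof -
      have "Q x (bitpos ?n i j s) \<longleftrightarrow> adj x i j s"
      proof
        assume "Q x (bitpos ?n i j s)"
        moreover have "\<not> bitpos ?n i j s < ?n" by (simp add: bitpos_def)
        ultimately obtain I J s' where "J < ?n" "s' < 2" "bitpos ?n i j s = bitpos ?n I J s'" "adj x I J s'"
          unfolding Q_def by blast
        then show "adj x i j s" using bitpos_inj[of ?n i j s I J s'] ij by simp
      qed (use ij in \<open>auto simp: Q_def\<close>)
      then show ?thesis using b bitpos_less[OF ij] by blast
    qed
    have "valid_word (f x) ?n"
      unfolding valid_word_def
    proof (intro conjI allI impI)
      show "length (f x) = ?n + 1 + 2 * (?n * ?n)" by (rule len)
      show "\<not> bit (f x) ?n" unfolding b Q_def by (auto simp: bitpos_def)
      fix i j s :: nat assume "i < ?n" "j < ?n" "s < 2"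
      then show "bit (f x) (bitpos ?n i j s) = bit (f x) (bitpos ?n j i s)"
        using adj blowup_sym unfolding adj_def by blast
    qed (auto simp: b Q_def)
    from csp_iff_sat[OF this adj] have "f x \<in> csp D K \<longleftrightarrow> csp_sat D K (poly m (length x) * Kc) (adj x)"
      by (simp add: M)
    then show ?thesis unfolding L adj_def blowup_sat by simp
  qed
  ultimately show ?thesis unfolding polytime_reducible_def by blast
qed

section \<open>Hardness from the tableau of a Turing machine\<close>

theorem finite_label_reduction:
  fixes m :: "nat poly" and cs :: "(('l \<Rightarrow> 'l) \<times> fm) list" and Lset :: "'l set"
  assumes eu: "essentially_unary D K" and D: "0 < D"
    and K_dom: "\<And>s d d'. K s d d' \<Longrightarrow> d < D \<and> d' < D" and K_sym: "\<And>s d d'. K s d d' \<Longrightarrow> K s d' d"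
    and fin: "finite Lset" and maps: "\<And>F \<phi> l. (F, \<phi>) \<in> set cs \<Longrightarrow> l \<in> Lset \<Longrightarrow> F l \<in> Lset"
    and forms: "\<And>F \<phi> x w i j rest. (F, \<phi>) \<in> set cs \<Longrightarrow>
      eval x w \<phi> (i # j # length x # rest) = eval x [] \<phi> [i, j, length x]"
    and L: "\<And>x. x \<in> L \<longleftrightarrow> (\<exists>lab. (\<forall>i<poly m (length x). lab i \<in> Lset) \<and>
      (\<forall>(F, \<phi>)\<in>set cs. \<forall>i<poly m (length x). \<forall>j<poly m (length x).
         eval x [] \<phi> [i, j, length x] \<longrightarrow> lab j = F (lab i)))"
  shows "polytime_reducible L (csp D K)"
proof -
  obtain enc where enc: "bij_betw enc Lset {0..<card Lset}" using ex_bij_betw_finite_nat[OF fin] by blast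
  define dec where "dec = inv_into Lset enc"
  have e: "enc l < card Lset" "dec (enc l) = l" if "l \<in> Lset" for l
    using that enc bij_betwE[OF enc] by (auto simp: dec_def bij_betw_def)
  have d: "dec k \<in> Lset" "enc (dec k) = k" if "k < card Lset" for k
  proof -
    have "k \<in> enc ` Lset" using that enc by (simp add: bij_betw_def)
    then show "dec k \<in> Lset" "enc (dec k) = k" by (auto simp: dec_def inv_into_into f_inv_into_f)
  qed
  define ps where "ps = map (\<lambda>(F, \<phi>) l. enc (F (dec l))) cs"
  have nth: "cs ! c \<in> set cs" if "c < length cs" for c using that by simp
  have ps: "(ps ! c) l = enc (fst (cs ! c) (dec l))" if "c < length cs" for c l
    using that by (simp add: ps_def split: prod.splits)
  show ?thesis
  proof (rule label_cover_reduction[OF eu D K_dom K_sym, where ps = ps and A = "card Lset" and m = m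
      and forms = "map snd cs" and cons = "\<lambda>x c i j. eval x [] (snd (cs ! c)) [i, j, length x]"])
    show "(ps ! c) k < card Lset" if "c < length ps" "k < card Lset" for c k
    proof -
      have c: "c < length cs" using that by (simp add: ps_def)
      have "fst (cs ! c) (dec k) \<in> Lset" using maps[of "fst (cs ! c)" "snd (cs ! c)"] nth[OF c] d(1)[OF that(2)] by simp
      then show ?thesis using ps[OF c] e(1) by simp
    qed
    show "eval x w (map snd cs ! c) (i # j # length x # rest) = eval x [] (snd (cs ! c)) [i, j, length x]"
      if "c < length ps" for x w c i j rest
      using forms[of "fst (cs ! c)" "snd (cs ! c)"] nth[of c] that by (simp add: ps_def)
    fix x :: "bool list"
    let ?m = "poly m (length x)"
    show "x \<in> L \<longleftrightarrow> label_sat (card Lset) ps ?m (\<lambda>c i j. eval x [] (snd (cs ! c)) [i, j, length x])"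
    proof
      assume "x \<in> L"
      then obtain lab where lab: "\<And>i. i < ?m \<Longrightarrow> lab i \<in> Lset"
        "\<And>F \<phi> i j. (F, \<phi>) \<in> set cs \<Longrightarrow> i < ?m \<Longrightarrow> j < ?m \<Longrightarrow> eval x [] \<phi> [i, j, length x] \<Longrightarrow> lab j = F (lab i)"
        unfolding L by blast
      show "label_sat (card Lset) ps ?m (\<lambda>c i j. eval x [] (snd (cs ! c)) [i, j, length x])"
        unfolding label_sat_def
      proof (intro exI[of _ "\<lambda>i. enc (lab i)"] conjI allI impI)
        fix c i j assume c: "c < length ps" and ij: "i < ?m" "j < ?m" and ev: "eval x [] (snd (cs ! c)) [i, j, length x]"
        have c': "c < length cs" using c by (simp add: ps_def)
        have "lab j = fst (cs ! c) (lab i)" using lab(2)[of "fst (cs ! c)" "snd (cs ! c)" i j] nth[OF c'] ij ev by simp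
        then show "enc (lab j) = (ps ! c) (enc (lab i))" using ps[OF c'] e(2)[OF lab(1)[OF ij(1)]] by simp
      qed (use e lab in auto)
    next
      assume "label_sat (card Lset) ps ?m (\<lambda>c i j. eval x [] (snd (cs ! c)) [i, j, length x])"
      then obtain lab where lab: "\<And>i. i < ?m \<Longrightarrow> lab i < card Lset"
        "\<And>c i j. c < length ps \<Longrightarrow> i < ?m \<Longrightarrow> j < ?m \<Longrightarrow> eval x [] (snd (cs ! c)) [i, j, length x] \<Longrightarrow> lab j = (ps ! c) (lab i)"
        unfolding label_sat_def by blast
      have "dec (lab j) = F (dec (lab i))" if F: "(F, \<phi>) \<in> set cs" and ij: "i < ?m" "j < ?m" and ev: "eval x [] \<phi> [i, j, length x]" for F \<phi> i j
      proof -
        obtain c where c: "c < length cs" "cs ! c = (F, \<phi>)" using F by (auto simp: in_set_conv_nth)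
        then have "lab j = enc (F (dec (lab i)))" using lab(2)[of c i j] ij ev ps[OF c(1)] by (simp add: ps_def)
        then show ?thesis using e(2) maps[OF F d(1)[OF lab(1)[OF ij(1)]]] by simp
      qed
      then show "x \<in> L" unfolding L using d(1) lab(1) by (intro exI[of _ "\<lambda>i. dec (lab i)"]) auto
    qed
  qed
qed

section \<open>Computations seen from the heads\<close>

type_synonym cell = "nat \<times> nat list"

text \<open>The tapes are aligned at their heads, so a step shifts tapes instead of moving heads.
  Besides its neighbours, a column then depends only on column 0, which holds the state and all
  scanned symbols.\<close>

definition rcell :: "config \<Rightarrow> int \<Rightarrow> cell" where
  "rcell c z = (if z = 0 then fst c else 0, map (\<lambda>tp. snd tp (fst tp + z)) (snd c))"

definition tm_action :: "tm \<Rightarrow> cell \<Rightarrow> nat \<times> (nat \<times> move) list" where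
  "tm_action M c = (if fst c < tm_states M then tm_trans M (fst c) (snd c) else (fst c, map (\<lambda>r. (r, MStay)) (snd c)))"

fun pick :: "move \<Rightarrow> 'a \<Rightarrow> 'a \<Rightarrow> 'a \<Rightarrow> 'a" where
  "pick MLeft a b c = a" | "pick MStay a b c = b" | "pick MRight a b c = c"

text \<open>The contents of all tapes at distance \<open>z\<close> from the heads after a step, from those at the heads
  and at distances \<open>z - 1\<close>, \<open>z\<close>, \<open>z + 1\<close> before it.\<close>

definition next_cell :: "tm \<Rightarrow> int \<Rightarrow> cell \<times> cell \<times> cell \<times> cell \<Rightarrow> cell" where
  "next_cell M z = (\<lambda>(c0, c1, c2, c3). (if z = 0 then fst (tm_action M c0) else 0,
     map (\<lambda>i. case snd (tm_action M c0) ! i of (w, d) \<Rightarrow>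
       if z + move_head d 0 = 0 then w else snd (pick d c1 c2 c3) ! i) [0..<tm_tapes M]))"

definition cells :: "tm \<Rightarrow> cell set" where
  "cells M = {(q, rs). q \<le> tm_states M \<and> length rs = tm_tapes M \<and> set rs \<subseteq> {..<tm_symbols M}}"

lemma finite_cells: "finite (cells M)"
proof (rule finite_subset)
  show "cells M \<subseteq> {..tm_states M} \<times> {rs. set rs \<subseteq> {..<tm_symbols M} \<and> length rs = tm_tapes M}"
    by (auto simp: cells_def)
  show "finite ({..tm_states M} \<times> {rs. set rs \<subseteq> {..<tm_symbols M} \<and> length rs = tm_tapes M})"
    by (intro finite_SigmaI finite_lists_length_eq) auto
qed

lemma tm_action_wf:
  assumes M: "turing_machine M" and c: "c \<in> cells M"
  shows "fst (tm_action M c) \<le> tm_states M" "length (snd (tm_action M c)) = tm_tapes M"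
    "i < tm_tapes M \<Longrightarrow> fst (snd (tm_action M c) ! i) < tm_symbols M"
proof -
  have r: "length (snd c) = tm_tapes M" "\<forall>r\<in>set (snd c). r < tm_symbols M" "fst c \<le> tm_states M"
    using c by (auto simp: cells_def)
  obtain q' acts where tr: "tm_trans M (fst c) (snd c) = (q', acts)" by fastforce
  have *: "fst (tm_trans M (fst c) (snd c)) \<le> tm_states M \<and> length (snd (tm_trans M (fst c) (snd c))) = tm_tapes M \<and>
      (\<forall>a\<in>set (snd (tm_trans M (fst c) (snd c))). fst a < tm_symbols M)" if "fst c < tm_states M"
    using M[unfolded turing_machine_def, THEN conjunct2, THEN conjunct2, rule_format, of "fst c" "snd c"] r that
    by (auto simp: tr)
  show "fst (tm_action M c) \<le> tm_states M" "length (snd (tm_action M c)) = tm_tapes M"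
    using * r by (auto simp: tm_action_def)
  show "i < tm_tapes M \<Longrightarrow> fst (snd (tm_action M c) ! i) < tm_symbols M"
    using * r by (auto simp: tm_action_def)
qed

lemma next_cell_wf:
  assumes M: "turing_machine M" and c: "c0 \<in> cells M" "c1 \<in> cells M" "c2 \<in> cells M" "c3 \<in> cells M"
  shows "next_cell M z (c0, c1, c2, c3) \<in> cells M"
proof -
  have "snd (pick d c1 c2 c3) ! i < tm_symbols M" if "i < tm_tapes M" for i d
    using c that by (cases d) (auto simp: cells_def subset_iff)
  moreover have "w < tm_symbols M" if "i < tm_tapes M" "snd (tm_action M c0) ! i = (w, d)" for i w d
    using tm_action_wf(3)[OF M c(1) that(1)] that(2) by simp
  ultimately show ?thesis using tm_action_wf[OF M c(1)]
    by (auto simp: next_cell_def cells_def split: prod.splits)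
qed

lemma rcell_step:
  assumes M: "turing_machine M" and c: "rcell c 0 \<in> cells M"
  shows "rcell (tm_step M c) z = next_cell M z (rcell c 0, rcell c (z - 1), rcell c z, rcell c (z + 1))"
proof -
  obtain q tps where qt: "c = (q, tps)" by fastforce
  define acts where "acts = snd (tm_action M (rcell c 0))"
  have k: "length tps = tm_tapes M" using c by (auto simp: rcell_def cells_def qt)
  have la: "length acts = tm_tapes M" unfolding acts_def by (rule tm_action_wf[OF M c])
  have r0: "rcell c 0 = (q, map tape_read tps)"
    by (auto simp: rcell_def qt split: prod.splits)
  have st: "tm_step M c = (fst (tm_action M (rcell c 0)), map2 tape_act acts tps)"
  proof (cases "q < tm_states M")
    case True
    then show ?thesis unfolding acts_def r0 by (simp add: tm_step_def qt tm_action_def split: prod.splits)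
  next
    case False
    have "map2 tape_act (map (\<lambda>r. (r, MStay)) (map tape_read tps)) tps = tps"
      by (rule nth_equalityI) auto
    then show ?thesis using False unfolding acts_def r0 by (simp add: tm_step_def qt tm_action_def)
  qed
  have "snd (tape_act (acts ! i) (tps ! i)) (fst (tape_act (acts ! i) (tps ! i)) + z) =
      (case acts ! i of (w, d) \<Rightarrow> if z + move_head d 0 = 0 then w
        else snd (pick d (rcell c (z - 1)) (rcell c z) (rcell c (z + 1))) ! i)" if "i < tm_tapes M" for i
  proof -
    obtain w d where a: "acts ! i = (w, d)" by fastforce
    obtain h t where t: "tps ! i = (h, t)" by fastforce
    show ?thesis using that k by (cases d) (auto simp: a t rcell_def qt algebra_simps)
  qed
  then show ?thesis
    unfolding st next_cell_def rcell_def[of "(_, map2 _ _ _)"]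
    by (auto simp: acts_def[symmetric] la k intro!: nth_equalityI split: prod.splits)
qed

lemma next_cell_far:
  assumes "\<bar>z\<bar> \<ge> 2" "\<bar>z'\<bar> \<ge> 2"
  shows "next_cell M z = next_cell M z'"
proof -
  have "z + move_head d 0 \<noteq> 0" if "\<bar>z\<bar> \<ge> 2" for z d using that by (cases d) auto
  then show ?thesis using assms unfolding next_cell_def by (auto simp: fun_eq_iff split: prod.splits)
qed

definition blank :: "tm \<Rightarrow> cell" where "blank M = (0, replicate (tm_tapes M) 0)"

lemma next_cell_blank:
  assumes M: "turing_machine M" and c: "c0 \<in> cells M" and z: "\<bar>z\<bar> \<ge> 2"
  shows "next_cell M z (c0, blank M, blank M, blank M) = blank M"
proof -
  have "z + move_head d 0 \<noteq> 0" for d using z by (cases d) auto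
  moreover have "pick d a a a = a" for d and a :: cell by (cases d) auto
  ultimately show ?thesis using z by (auto simp: next_cell_def blank_def intro!: nth_equalityI split: prod.splits)
qed

definition start_cell :: "tm \<Rightarrow> nat \<Rightarrow> cell" where
  "start_cell M b = (0, b # replicate (tm_tapes M - 1) 0)"

lemma rcell_start:
  assumes "turing_machine M"
  shows "rcell (tm_start M w) z = start_cell M (word_contents w z)"
  using assms by (auto simp: rcell_def tm_start_def start_cell_def turing_machine_def)

lemma start_cell_0: "turing_machine M \<Longrightarrow> start_cell M 0 = blank M"
  by (cases "tm_tapes M") (auto simp: start_cell_def blank_def turing_machine_def)

lemma start_cell_wf: "turing_machine M \<Longrightarrow> b < 3 \<Longrightarrow> start_cell M b \<in> cells M"
  by (auto simp: start_cell_def cells_def turing_machine_def)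

lemma word_contents_less: "word_contents w z < 3"
  by (simp add: word_contents_def)

text \<open>Cells are seen relative to the heads: \<open>run M w t z\<close> collects what the tapes contain at distance
  \<open>z\<close> from their heads.\<close>

definition run :: "tm \<Rightarrow> bool list \<Rightarrow> nat \<Rightarrow> int \<Rightarrow> cell" where
  "run M w t z = rcell ((tm_step M ^^ t) (tm_start M w)) z"

lemma run_0: "turing_machine M \<Longrightarrow> run M w 0 z = start_cell M (word_contents w z)"
  by (simp add: run_def rcell_start)

lemma run_wf: "turing_machine M \<Longrightarrow> run M w t z \<in> cells M"
  and run_Suc: "turing_machine M \<Longrightarrow> run M w (Suc t) z =
    next_cell M z (run M w t 0, run M w t (z - 1), run M w t z, run M w t (z + 1))"
proof -
  assume M: "turing_machine M"
  have wf: "\<forall>z. run M w t z \<in> cells M" for t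
  proof (induction t)
    case 0
    then show ?case using run_0[OF M] start_cell_wf[OF M word_contents_less] by simp
  next
    case (Suc t)
    then have "run M w (Suc t) z = next_cell M z (run M w t 0, run M w t (z - 1), run M w t z, run M w t (z + 1))" for z
      unfolding run_def by (simp add: rcell_step[OF M])
    then show ?case using Suc next_cell_wf[OF M] by simp
  qed
  then show "run M w t z \<in> cells M" by blast
  show "run M w (Suc t) z = next_cell M z (run M w t 0, run M w t (z - 1), run M w t z, run M w t (z + 1))"
    using wf[of t] unfolding run_def by (simp add: rcell_step[OF M])
qed

lemma run_blank:
  assumes M: "turing_machine M"
  shows "int (length w) + int t + 1 < \<bar>z\<bar> \<Longrightarrow> run M w t z = blank M"
proof (induction t arbitrary: z)
  case 0
  then have "word_contents w z = 0" by (auto simp: word_contents_def)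
  then show ?case by (simp add: run_0[OF M] start_cell_0[OF M])
next
  case (Suc t)
  have "run M w t (z - 1) = blank M" "run M w t z = blank M" "run M w t (z + 1) = blank M"
    by (rule Suc.IH; use Suc.prems in linarith)+
  moreover have "\<bar>z\<bar> \<ge> 2" using Suc.prems by linarith
  ultimately show ?case using next_cell_blank[OF M run_wf[OF M]] by (simp add: run_Suc[OF M])
qed

text \<open>The output is a single bit on an otherwise blank first tape, and rejection writes the
  symbol 1. Acceptance is thus the absence of this symbol, which can be demanded of each column
  separately. The halting configuration persists, so any later time \<open>T\<close> may be
  inspected.\<close>

lemma run_accepts:
  assumes M: "turing_machine M" and out: "tm_outputs_within M w T' [b]" and T: "T' \<le> T"
  shows "b \<longleftrightarrow> (\<forall>z. \<bar>z\<bar> \<le> int (length w) + int T + 1 \<longrightarrow> hd (snd (run M w T z)) \<noteq> 1)"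
proof -
  obtain t where t0: "t \<le> T'" "case (tm_step M ^^ t) (tm_start M w) of (q, tps) \<Rightarrow>
      q = tm_states M \<and> snd (hd tps) = word_contents [b]"
    using out unfolding tm_outputs_within_def by (elim exE conjE) (rule that)
  obtain q tps where qt: "(tm_step M ^^ t) (tm_start M w) = (q, tps)" by fastforce
  then have t: "t \<le> T'" "(tm_step M ^^ t) (tm_start M w) = (q, tps)" "q = tm_states M"
    "snd (hd tps) = word_contents [b]" using t0 by simp_all
  have "(tm_step M ^^ n) (q, tps) = (q, tps)" for n
    by (induction n) (auto simp: tm_step_def t(3))
  then have "(tm_step M ^^ (T - t + t)) (tm_start M w) = (q, tps)" unfolding funpow_add o_apply t(2) by simp
  then have fin: "(tm_step M ^^ T) (tm_start M w) = (q, tps)" using t(1) T by simp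
  have "run M w T 0 \<in> cells M" by (rule run_wf[OF M])
  then have ne: "tps \<noteq> []" using M by (auto simp: run_def fin rcell_def cells_def turing_machine_def)
  have hd: "hd (snd (run M w T z)) = word_contents [b] (fst (hd tps) + z)" for z
    using ne t(4) by (simp add: run_def fin rcell_def hd_map)
  show ?thesis
  proof
    assume b
    then show "\<forall>z. \<bar>z\<bar> \<le> int (length w) + int T + 1 \<longrightarrow> hd (snd (run M w T z)) \<noteq> 1"
      by (simp add: hd word_contents_def)
  next
    assume all: "\<forall>z. \<bar>z\<bar> \<le> int (length w) + int T + 1 \<longrightarrow> hd (snd (run M w T z)) \<noteq> 1"
    show b
    proof (rule ccontr)
      assume "\<not> b"
      let ?z = "- fst (hd tps)"
      have 1: "hd (snd (run M w T ?z)) = 1" using \<open>\<not> b\<close> by (simp add: hd word_contents_def)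
      then have "run M w T ?z \<noteq> blank M" using M by (cases "tm_tapes M") (auto simp: blank_def turing_machine_def)
      then have "\<not> int (length w) + int T + 1 < \<bar>?z\<bar>" using run_blank[OF M] by blast
      then show False using all 1 by auto
    qed
  qed
qed

lemma length_pair_word: "length (pair_word x u) = 2 * length x + 2 + length u"
  by (induction x) (auto simp: pair_word_def)

lemma nth_pair_word:
  "l < length x \<Longrightarrow> pair_word x u ! (2 * l) = x ! l" "l < length x \<Longrightarrow> pair_word x u ! (2 * l + 1) = x ! l"
  "pair_word x u ! (2 * length x) = True" "pair_word x u ! (2 * length x + 1) = False"
  "l < length u \<Longrightarrow> pair_word x u ! (2 * length x + 2 + l) = u ! l"
proof -
  have l: "length (concat (map (\<lambda>b. [b, b]) x)) = 2 * length x" by (induction x) auto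
  have "concat (map (\<lambda>b. [b, b]) x) ! (2 * l) = x ! l \<and> concat (map (\<lambda>b. [b, b]) x) ! (2 * l + 1) = x ! l"
    if "l < length x" for l
    using that by (induction x arbitrary: l) (auto simp: nth_Cons' nth_append less_Suc_eq_0_disj)
  then show "l < length x \<Longrightarrow> pair_word x u ! (2 * l) = x ! l" "l < length x \<Longrightarrow> pair_word x u ! (2 * l + 1) = x ! l"
    by (auto simp: pair_word_def nth_append l)
  show "pair_word x u ! (2 * length x) = True" "pair_word x u ! (2 * length x + 1) = False"
    "l < length u \<Longrightarrow> pair_word x u ! (2 * length x + 2 + l) = u ! l"
    by (auto simp: pair_word_def nth_append l)
qed

definition diag :: "cell \<Rightarrow> cell \<times> cell \<times> cell \<times> cell" where "diag c = (c, c, c, c)"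

text \<open>All positions at distance at least 2 from the heads behave alike; 5 stands for them.\<close>

definition near :: "int \<Rightarrow> int" where "near z = (if \<bar>z\<bar> \<le> 1 then z else 5)"

text \<open>Variable \<open>X t p\<close> stands for the cell at time \<open>t\<close> and distance \<open>p - R\<close> from the heads, as a diagonal
  quadruple; \<open>Y t p\<close> stands for the cells from which \<open>X (t + 1) p\<close> is computed.\<close>

locale tableau =
  fixes M :: tm and q p :: "nat poly"
  assumes M: "turing_machine M"
begin

text \<open>\<open>W\<close> bounds the length of the input with its certificate and
  \<open>T\<close> the running time. \<open>R\<close> is so large that the columns at distance
  \<open>R\<close> stay blank up to time \<open>T\<close>. There are \<open>P\<close> columns from
  \<open>-R\<close> to \<open>R\<close>; the factor 2 in \<open>num\<close> accounts for the
  variables \<open>X\<close> and \<open>Y\<close>.\<close>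

definition W :: "nat poly" where "W = 2 * [:0, 1:] + 2 + p"
definition T :: "nat poly" where "T = pcompose q W"
definition R :: "nat poly" where "R = T + W + 2"
definition P :: "nat poly" where "P = 2 * R + 1"
definition num :: "nat poly" where "num = 2 * ((T + 1) * P)"

text \<open>Formulas below are read in the environment \<open>[p, t, i, j, length x]\<close>, where
  \<open>i\<close> is the source and \<open>j\<close> the target of a constraint.
  \<open>X t p\<close> has the even index \<open>2 * (t * P + p)\<close>, and \<open>Y t p\<close>
  the odd index after it.\<close>

definition X :: "trm \<Rightarrow> trm \<Rightarrow> trm" where "X a b = Times (Num 2) (Plus (Times a (pt P 4)) b)"

abbreviation "pp \<equiv> Var 0"
abbreviation "tt \<equiv> Var 1"
abbreviation "src \<equiv> Var 2"
abbreviation "tgt \<equiv> Var 3"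
abbreviation "inner \<equiv> FConj (Less (Num 0) pp) (Less (Plus pp (Num 1)) (pt P 4))"
abbreviation "isY \<equiv> FEq src (Plus (X tt pp) (Num 1))"
abbreviation "same \<equiv> FEq src tgt"
abbreviation "isX \<equiv> FEq src (X tt pp)"
abbreviation "start \<equiv> FEq tt (Num 0)"
abbreviation "Rt \<equiv> pt R 4"
abbreviation "isStep \<equiv> FConj (Less tt (pt T 4)) (FConj (FEq tgt (X (Plus tt (Num 1)) pp)) (FConj inner isY))"
abbreviation "input v \<equiv> Ex (Var 4) (FConj v (FDisj
  (FEq (Var 1) (Plus (pt R 5) (Times (Num 2) (Var 0)))) (FEq (Var 1) (Plus (pt R 5) (Plus (Times (Num 2) (Var 0)) (Num 1))))))"
abbreviation "certificate \<equiv> FConj start (FConj same (FConj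
  (Less (Plus (Plus Rt (Times (Num 2) (Var 4))) (Num 1)) pp) (Less pp (Plus Rt (pt W 4)))))"

definition cell_constraint :: "fm \<Rightarrow> fm" where
  "cell_constraint f = Ex (pt (T + 1) 2) (Ex (pt P 3) f)"

text \<open>In groups: the components of \<open>Y\<close> agree with column 0, the left neighbour,
  the column itself and the right neighbour; the transition, near the heads and far from them;
  blanks at the borders and around the input; the symbols of doubled \<open>x\<close> and of the
  separator; certificate columns hold initial symbols; a blank is followed by a blank, so that the
  certificate is a word; acceptance. A condition on one label uses \<open>same\<close> and a map
  that fixes the permitted labels and sends each forbidden one to a permitted one.\<close>

definition windows :: "((cell \<times> cell \<times> cell \<times> cell \<Rightarrow> cell \<times> cell \<times> cell \<times> cell) \<times> fm) list" where
  "windows =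
   [(\<lambda>(a, b, c, d). diag a, FConj inner (FConj isY (FEq tgt (X tt Rt)))),
    (\<lambda>(a, b, c, d). diag b, FConj inner (FConj isY (FEq (Plus tgt (Num 2)) (X tt pp)))),
    (\<lambda>(a, b, c, d). diag c, FConj inner (FConj isY (FEq tgt (X tt pp)))),
    (\<lambda>(a, b, c, d). diag d, FConj inner (FConj isY (FEq tgt (Plus (X tt pp) (Num 2))))),
    (\<lambda>y. diag (next_cell M (-1) y), FConj isStep (FEq (Plus pp (Num 1)) Rt)),
    (\<lambda>y. diag (next_cell M 0 y), FConj isStep (FEq pp Rt)),
    (\<lambda>y. diag (next_cell M 1 y), FConj isStep (FEq pp (Plus Rt (Num 1)))),
    (\<lambda>y. diag (next_cell M 5 y), FConj isStep (FDisj (Less (Plus pp (Num 1)) Rt) (Less (Plus Rt (Num 1)) pp))),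
    (\<lambda>_. diag (start_cell M 0), FConj same (FConj isX (FDisj (FEq pp (Num 0)) (FDisj (FEq (Plus pp (Num 1)) (pt P 4))
       (FConj start (FDisj (Less pp Rt) (FNot (Less pp (Plus Rt (pt W 4)))))))))),
    (\<lambda>_. diag (start_cell M 1), FConj same (FConj isX (FConj start
       (FDisj (input (FNot (Bit False (Var 0)))) (FEq pp (Plus Rt (Plus (Times (Num 2) (Var 4)) (Num 1)))))))),
    (\<lambda>_. diag (start_cell M 2), FConj same (FConj isX (FConj start
       (FDisj (input (Bit False (Var 0))) (FEq pp (Plus Rt (Times (Num 2) (Var 4)))))))),
    (\<lambda>(a, b, c, d). diag (if a \<in> start_cell M ` {..<3} then a else blank M), FConj isX certificate),
    (\<lambda>(a, b, c, d). if c = blank M \<longrightarrow> d = blank M then (a, b, c, d) else diag (blank M), FConj isY certificate),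
    (\<lambda>(a, b, c, d). if hd (snd a) \<noteq> 1 then (a, b, c, d) else diag (blank M), FConj same (FConj isX (FEq tt (pt T 4))))]"

definition constraints :: "((cell \<times> cell \<times> cell \<times> cell \<Rightarrow> cell \<times> cell \<times> cell \<times> cell) \<times> fm) list" where
  "constraints = map (map_prod id cell_constraint) windows"

definition labels :: "(cell \<times> cell \<times> cell \<times> cell) set" where
  "labels = cells M \<times> cells M \<times> cells M \<times> cells M"

lemma blank_wf: "blank M \<in> cells M" using start_cell_wf[OF M, of 0] start_cell_0[OF M] by simp

lemma constraints_wf: "(F, \<phi>) \<in> set constraints \<Longrightarrow> l \<in> labels \<Longrightarrow> F l \<in> labels"
  unfolding constraints_def windows_def labels_def diag_def
  by (auto simp: next_cell_wf[OF M] start_cell_wf[OF M] blank_wf split: if_splits)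

lemma constraints_local:
  assumes "(F, \<phi>) \<in> set constraints"
  shows "eval x w \<phi> (i # j # length x # rest) = eval x [] \<phi> [i, j, length x]"
  using assms unfolding constraints_def windows_def cell_constraint_def X_def by auto

definition valid_labelling :: "bool list \<Rightarrow> (nat \<Rightarrow> cell \<times> cell \<times> cell \<times> cell) \<Rightarrow> bool" where
  "valid_labelling x lab \<longleftrightarrow> (\<forall>i<poly num (length x). lab i \<in> labels) \<and>
     (\<forall>(F, \<phi>)\<in>set constraints. \<forall>i<poly num (length x). \<forall>j<poly num (length x).
         eval x [] \<phi> [i, j, length x] \<longrightarrow> lab j = F (lab i))"

lemma valid_labelling_iff:
  "valid_labelling x lab \<longleftrightarrow> (\<forall>i<poly num (length x). lab i \<in> labels) \<and>
     (\<forall>(F, f)\<in>set windows. \<forall>t\<le>poly T (length x). \<forall>k<poly P (length x).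
       \<forall>i<poly num (length x). \<forall>j<poly num (length x).
         eval x [] f [k, t, i, j, length x] \<longrightarrow> lab j = F (lab i))"
proof -
  have "(\<forall>i<m. \<forall>j<m. eval x [] (cell_constraint f) [i, j, length x] \<longrightarrow> Q i j) \<longleftrightarrow>
      (\<forall>t\<le>poly T (length x). \<forall>k<poly P (length x). \<forall>i<m. \<forall>j<m. eval x [] f [k, t, i, j, length x] \<longrightarrow> Q i j)" for m f Q
    unfolding cell_constraint_def less_Suc_eq_le[symmetric] by (simp add: numeral_2_eq_2 numeral_3_eq_3) blast
  then show ?thesis unfolding valid_labelling_def constraints_def by (simp add: case_prod_unfold)
qed

lemma sizes:
  "poly W n = 2 * n + 2 + poly p n" "poly T n = poly q (poly W n)"
  "poly R n = poly T n + poly W n + 2" "poly P n = 2 * poly R n + 1" "poly num n = 2 * ((poly T n + 1) * poly P n)"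
  by (simp_all add: W_def T_def R_def P_def num_def poly_pcompose)

lemma index_less:
  "t \<le> poly T n \<Longrightarrow> k < poly P n \<Longrightarrow> 2 * (t * poly P n + k) + 1 < poly num n"
proof -
  assume a: "t \<le> poly T n" "k < poly P n"
  have "t * poly P n + k < Suc t * poly P n" using a by simp
  also have "\<dots> \<le> (poly T n + 1) * poly P n" using a by (intro mult_right_mono) auto
  finally show ?thesis by (simp add: sizes(5))
qed

lemma word_contents_int: "word_contents w (int k) = (if k < length w then if w ! k then 2 else 1 else 0)"
  by (simp add: word_contents_def)

lemma start_cell_inj: "start_cell M b = start_cell M b' \<longleftrightarrow> b = b'"
  by (simp add: start_cell_def)

lemma run_accepts':
  assumes out: "tm_outputs_within M w (poly q (length w)) [b]" and w: "length w \<le> poly W n"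
  shows "b \<longleftrightarrow> (\<forall>k<poly P n. hd (snd (run M w (poly T n) (int k - int (poly R n)))) \<noteq> 1)"
proof -
  have "poly q (length w) \<le> poly T n" unfolding sizes(2) using w by (rule poly_nat_mono)
  from run_accepts[OF M out this]
  have *: "b \<longleftrightarrow> (\<forall>z. \<bar>z\<bar> \<le> int (length w) + int (poly T n) + 1 \<longrightarrow> hd (snd (run M w (poly T n) z)) \<noteq> 1)" .
  have hb: "hd (snd (blank M)) = 0" using M by (cases "tm_tapes M") (auto simp: blank_def turing_machine_def)
  show ?thesis
  proof
    assume b
    then have 1: "hd (snd (run M w (poly T n) z)) \<noteq> 1" if "\<bar>z\<bar> \<le> int (length w) + int (poly T n) + 1" for z
      using * that by blast
    have "hd (snd (run M w (poly T n) z)) \<noteq> 1" for z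
      using 1[of z] run_blank[OF M, of w "poly T n" z] hb by (cases "\<bar>z\<bar> \<le> int (length w) + int (poly T n) + 1") auto
    then show "\<forall>k<poly P n. hd (snd (run M w (poly T n) (int k - int (poly R n)))) \<noteq> 1" by blast
  next
    assume a: "\<forall>k<poly P n. hd (snd (run M w (poly T n) (int k - int (poly R n)))) \<noteq> 1"
    have "hd (snd (run M w (poly T n) z)) \<noteq> 1" if "\<bar>z\<bar> \<le> int (length w) + int (poly T n) + 1" for z
    proof -
      have z: "\<bar>z\<bar> < int (poly R n)" using that w sizes(3)[of n] by linarith
      define k where "k = nat (z + int (poly R n))"
      have "int k = z + int (poly R n)" "k < poly P n" using z sizes(4)[of n] unfolding k_def by linarith+
      then show ?thesis using a[rule_format, of k] by simp
    qed
    then show b using * by blast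
  qed
qed

lemma labelling_of_run:
  assumes u: "length u \<le> poly p (length x)"
    and acc: "\<forall>k<poly P (length x). hd (snd (run M (pair_word x u) (poly T (length x)) (int k - int (poly R (length x))))) \<noteq> 1"
  shows "\<exists>lab. valid_labelling x lab"
proof -
  let ?n = "length x"
  define Pn Rn Tn Wn where defs: "Pn = poly P ?n" "Rn = poly R ?n" "Tn = poly T ?n" "Wn = poly W ?n"
  define w where "w = pair_word x u"
  have w: "length w \<le> Wn" using u by (simp add: w_def length_pair_word sizes defs)
  have sz: "Pn = 2 * Rn + 1" "Rn = Tn + Wn + 2" "Wn = 2 * ?n + 2 + poly p ?n" by (simp_all add: defs sizes)
  have RP: "Rn < Pn" using sz by linarith
  define ce where "ce t k = run M w t (int k - int Rn)" for t k
  define lab where "lab i = (let t = i div 2 div Pn; k = i div 2 mod Pn in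
    if even i then diag (ce t k) else (ce t Rn, run M w t (int k - int Rn - 1), ce t k, run M w t (int k - int Rn + 1)))" for i
  have labX: "lab (2 * (t * Pn + k)) = diag (ce t k)" if "k < Pn" for t k
    using that by (simp add: lab_def)
  have labY: "lab (Suc (2 * (t * Pn + k))) = (ce t Rn, ce t (k - 1), ce t k, ce t (k + 1))" if "k < Pn" "0 < k" for t k
    using that by (simp add: lab_def ce_def of_nat_diff algebra_simps)
  have blank0: "ce t k = start_cell M 0" if "t \<le> Tn" "k = 0 \<or> Suc k = Pn" for t k
    unfolding ce_def start_cell_0[OF M] by (rule run_blank[OF M]) (use that sz w in linarith)
  define wc where "wc k = word_contents w (int k)" for k
  have wc: "wc k = (if k < length w then if w ! k then 2 else 1 else 0)" for k
    by (simp add: wc_def word_contents_int)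
  have ce0: "ce 0 k = start_cell M (if k < Rn then 0 else wc (k - Rn))" for k
    unfolding ce_def run_0[OF M] wc_def by (auto simp: word_contents_def nat_diff_distrib of_nat_diff)
  have ceSuc: "ce (Suc t) k = next_cell M (int k - int Rn) (ce t Rn, ce t (k - 1), ce t k, ce t (k + 1))" if "0 < k" for t k
    using that unfolding ce_def by (simp add: run_Suc[OF M] of_nat_diff algebra_simps)
  have lw: "length w = 2 * ?n + 2 + length u" by (simp add: w_def length_pair_word)
  have bits: "w ! (2 * l) = bit x l" "w ! (Suc (2 * l)) = bit x l" if "l < ?n" for l
    using nth_pair_word(1,2)[OF that, of u] that by (simp_all add: w_def bit_def)
  have mid: "w ! (2 * ?n)" "\<not> w ! (Suc (2 * ?n))"
    using nth_pair_word(3,4)[of x u] by (simp_all add: w_def)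
  have far: "next_cell M (int k - int Rn) = next_cell M 5" if "Suc k < Rn \<or> Suc Rn < k" for k
    by (rule next_cell_far) (use that in linarith)+
  have ce_step: "ce (Suc t) k = next_cell M z (ce t Rn, ce t (k - 1), ce t k, ce t (Suc k))"
    if "0 < k" "int k - int Rn = z" for t k z using ceSuc[OF that(1)] that(2) by simp
  have ce_far: "ce (Suc t) k = next_cell M 5 (ce t Rn, ce t (k - 1), ce t k, ce t (Suc k))"
    if "0 < k" "Suc k < Rn \<or> Suc Rn < k" for t k using ceSuc[OF that(1)] far[OF that(2)] by simp
  have labX': "lab (2 * (t * Pn) + 2 * k) = diag (ce t k)" "lab (2 * Pn + 2 * (t * Pn) + 2 * k) = diag (ce (Suc t) k)"
    if "k < Pn" for t k using labX[OF that, of t] labX[OF that, of "Suc t"] by (simp_all add: add_mult_distrib2)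
  have labX2: "lab (Suc (Suc (2 * (t * Pn) + 2 * k))) = diag (ce t (Suc k))"
    "lab (Suc (Suc (2 * Pn + 2 * (t * Pn) + 2 * k))) = diag (ce (Suc t) (Suc k))"
    if "Suc k < Pn" for t k using labX[OF that, of t] labX[OF that, of "Suc t"] by (simp_all add: add_mult_distrib2)
  have labX0: "lab (2 * (t * Pn)) = diag (ce t 0)" "k < Pn \<Longrightarrow> lab (2 * k) = diag (ce 0 k)" for t k
    using labX[of 0 t] labX[of k 0] sz by simp_all
  have labY': "lab (Suc (2 * (t * Pn) + 2 * k)) = (ce t Rn, ce t (k - 1), ce t k, ce t (Suc k))"
    if "k < Pn" "0 < k" for t k using labY[OF that] by (simp add: add_mult_distrib2)
  have labY0: "lab (Suc (2 * k)) = (ce 0 Rn, ce 0 (k - 1), ce 0 k, ce 0 (Suc k))"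
    if "k < Pn" "0 < k" for k using labY[OF that, of 0] by simp
  have labY2: "lab (Suc (Suc (Suc (2 * (t * Pn) + 2 * k)))) = (ce t Rn, ce t k, ce t (Suc k), ce t (Suc (Suc k)))"
    if "Suc k < Pn" for t k using labY[OF that, of t] by (simp add: add_mult_distrib2)
  have one: "ce 0 k = start_cell M 1" if "(\<exists>v<?n. \<not> bit x v \<and> (k = Rn + 2 * v \<or> k = Suc (Rn + 2 * v))) \<or> k = Suc (Rn + 2 * ?n)" for k
    using that bits mid lw unfolding ce0 by (auto simp: wc)
  have two: "ce 0 k = start_cell M 2" if "(\<exists>v<?n. bit x v \<and> (k = Rn + 2 * v \<or> k = Suc (Rn + 2 * v))) \<or> k = Rn + 2 * ?n" for k
    using that bits mid lw unfolding ce0 by (auto simp: wc)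
  have outside: "ce 0 k = start_cell M 0" if "k < Rn \<or> \<not> k < Rn + Wn" for k
    using that w unfolding ce0 by (auto simp: wc)
  have cert: "ce 0 k \<in> start_cell M ` {..<3}" for k
    unfolding ce_def run_0[OF M] using word_contents_less by blast
  have mono: "ce 0 (Suc k) = blank M" if "ce 0 k = blank M" "Rn \<le> k" for k
    using that unfolding ce0 start_cell_0[OF M, symmetric] start_cell_inj
    by (auto simp: wc Suc_diff_le split: if_splits)
  have acc': "\<forall>k<Pn. hd (snd (ce Tn k)) \<noteq> Suc 0" using acc by (simp add: ce_def w_def defs)
  have wf: "lab i \<in> labels" for i
    using run_wf[OF M] by (auto simp: lab_def labels_def diag_def ce_def Let_def)
  have "\<forall>(F, f)\<in>set windows. \<forall>t\<le>Tn. \<forall>k<Pn. \<forall>i<poly num ?n. \<forall>j<poly num ?n.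
         eval x [] f [k, t, i, j, ?n] \<longrightarrow> lab j = F (lab i)"
    unfolding windows_def list.set ball_simps prod.case
    \<comment> \<open>One subgoal for each entry of \<open>windows\<close>, in the same
      order.\<close>
    apply (intro conjI TrueI)
    apply (simp_all add: X_def defs[symmetric])
    subgoal using RP by (auto simp: labX' labY')
    subgoal
    proof (intro allI impI, elim conjE, goal_cases)
      case (1 t k i j)
      then have "j = 2 * (t * Pn) + 2 * (k - 1)" by (cases k) auto
      then show ?case using 1 by (simp add: labX' labY')
    qed
    subgoal by (auto simp: labX' labY')
    subgoal by (auto simp: labX2 labY')
    subgoal by (auto simp: labX' labY' ce_step[where z = "-1"])
    subgoal by (auto simp: labX' labY' ce_step[where z = 0])
    subgoal by (auto simp: labX2 labY2 ce_step[where z = 1])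
    subgoal by (auto simp: labX' labY' ce_far)
    subgoal by (auto simp: labX' labX0 blank0 outside)
    subgoal by (auto simp: labX0 one)
    subgoal by (auto simp: labX0 two)
    subgoal using cert by (auto simp: labX0 diag_def)
    subgoal using mono by (auto simp: labY0)
    subgoal using acc' by (auto simp: labX' diag_def)
    done
  then have "valid_labelling x lab" unfolding valid_labelling_iff defs using wf by blast
  then show ?thesis by blast
qed

lemma diag_inj: "diag a = diag b \<longleftrightarrow> a = b" by (simp add: diag_def)

text \<open>The certificate is read off the certificate columns at time 0, up to their first blank.
  The initial row is then that of \<open>pair_word x u\<close>, and induction on time identifies the
  whole labelling with the run.\<close>

lemma run_of_labelling:
  assumes "valid_labelling x lab"
  shows "\<exists>u. length u \<le> poly p (length x) \<and>
    (\<forall>k<poly P (length x). hd (snd (run M (pair_word x u) (poly T (length x)) (int k - int (poly R (length x))))) \<noteq> 1)"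
proof -
  let ?n = "length x"
  define Pn Rn Tn Wn where defs: "Pn = poly P ?n" "Rn = poly R ?n" "Tn = poly T ?n" "Wn = poly W ?n"
  have sz: "Pn = 2 * Rn + 1" "Rn = Tn + Wn + 2" "Wn = 2 * ?n + 2 + poly p ?n" by (simp_all add: defs sizes)
  define Xi where "Xi t k = 2 * (t * Pn + k)" for t k
  have idx: "Xi t k < poly num ?n" "Suc (Xi t k) < poly num ?n" if "t \<le> Tn" "k < Pn" for t k
    using index_less[of t ?n k] that unfolding Xi_def defs by simp_all
  have H: "lab j = fst (windows ! c) (lab i)" if "c < length windows" "t \<le> Tn" "k < Pn" "i < poly num ?n" "j < poly num ?n"
    "eval x [] (snd (windows ! c)) [k, t, i, j, ?n]" for c t k i j
  proof -
    have "windows ! c \<in> set windows" using that(1) by simp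
    then have "(fst (windows ! c), snd (windows ! c)) \<in> set windows" by simp
    then show ?thesis using assms that(2-) unfolding valid_labelling_iff defs by blast
  qed
  have len: "length windows = 14" by (simp add: windows_def)
  have wf: "lab i \<in> labels" if "i < poly num ?n" for i using assms that unfolding valid_labelling_def by blast
  have Y: "\<exists>a b c d. lab (Suc (Xi t k)) = (a, b, c, d) \<and> lab (Xi t Rn) = diag a \<and> lab (Xi t (k - 1)) = diag b \<and>
      lab (Xi t k) = diag c \<and> lab (Xi t (Suc k)) = diag d" if t: "t \<le> Tn" and k: "0 < k" "Suc k < Pn" for t k
  proof -
    obtain a b c d where l: "lab (Suc (Xi t k)) = (a, b, c, d)" by (metis prod_cases4)
    have k': "k < Pn" "Rn < Pn" "k - 1 < Pn" using k sz by linarith+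
    have "lab (Xi t Rn) = diag a"
      using H[of 0 t k "Suc (Xi t k)" "Xi t Rn"] k k' t idx l unfolding len
      by (simp add: windows_def X_def Xi_def defs[symmetric])
    moreover have "lab (Xi t (k - 1)) = diag b"
      using H[of 1 t k "Suc (Xi t k)" "Xi t (k - 1)"] k k' t idx(2)[OF t k'(1)] idx(1)[OF t k'(3)] l unfolding len
      by (cases k) (simp_all add: windows_def X_def Xi_def defs[symmetric])
    moreover have "lab (Xi t k) = diag c"
      using H[of 2 t k "Suc (Xi t k)" "Xi t k"] k k' t idx l unfolding len
      by (simp add: windows_def X_def Xi_def defs[symmetric])
    moreover have "lab (Xi t (Suc k)) = diag d"
      using H[of 3 t k "Suc (Xi t k)" "Xi t (Suc k)"] k k' t idx(2)[OF t k'(1)] idx(1)[OF t k(2)] l unfolding len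
      by (simp add: windows_def X_def Xi_def defs[symmetric])
    ultimately show ?thesis using l by blast
  qed
  have step: "lab (Xi (Suc t) k) = diag (next_cell M (int k - int Rn) (lab (Suc (Xi t k))))"
    if t: "t < Tn" and k: "0 < k" "Suc k < Pn" for t k
  proof -
    have k': "k < Pn" using k by simp
    have t': "Suc t \<le> Tn" "t \<le> Tn" using t by simp_all
    consider "Suc k = Rn" | "k = Rn" | "k = Suc Rn" | "Suc k < Rn \<or> Suc Rn < k" by linarith
    then show ?thesis
    proof cases
      case 1
      then have "lab (Xi (Suc t) k) = diag (next_cell M (-1) (lab (Suc (Xi t k))))"
        using H[of 4 t k "Suc (Xi t k)" "Xi (Suc t) k"] k k' t t' idx(1)[OF t'(1) k'] idx(2)[OF t'(2) k'] unfolding len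
        by (simp add: windows_def X_def Xi_def defs[symmetric])
      moreover have "int k - int Rn = -1" using 1 by linarith
      ultimately show ?thesis by simp
    next
      case 2
      then show ?thesis
        using H[of 5 t k "Suc (Xi t k)" "Xi (Suc t) k"] k k' t t' idx(1)[OF t'(1) k'] idx(2)[OF t'(2) k'] unfolding len
        by (simp add: windows_def X_def Xi_def defs[symmetric])
    next
      case 3
      then show ?thesis
        using H[of 6 t k "Suc (Xi t k)" "Xi (Suc t) k"] k k' t t' idx(1)[OF t'(1) k'] idx(2)[OF t'(2) k'] unfolding len
        by (simp add: windows_def X_def Xi_def defs[symmetric])
    next
      case 4
      then have "lab (Xi (Suc t) k) = diag (next_cell M 5 (lab (Suc (Xi t k))))"
        using H[of 7 t k "Suc (Xi t k)" "Xi (Suc t) k"] k k' t t' idx(1)[OF t'(1) k'] idx(2)[OF t'(2) k'] unfolding len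
        by (simp add: windows_def X_def Xi_def defs[symmetric])
      moreover have "next_cell M (int k - int Rn) = next_cell M 5"
        by (rule next_cell_far) (use 4 in linarith)+
      ultimately show ?thesis by simp
    qed
  qed
  have border: "lab (Xi t k) = diag (start_cell M 0)" if "t \<le> Tn" "k < Pn" "k = 0 \<or> Suc k = Pn \<or> t = 0 \<and> (k < Rn \<or> \<not> k < Rn + Wn)" for t k
    using H[of 8 t k "Xi t k" "Xi t k"] that idx[OF that(1,2)] unfolding len
    by (simp add: windows_def X_def Xi_def defs[symmetric])
  have one: "lab (Xi 0 k) = diag (start_cell M 1)"
    if "k < Pn" "(\<exists>v<?n. \<not> bit x v \<and> (k = Rn + 2 * v \<or> k = Suc (Rn + 2 * v))) \<or> k = Suc (Rn + 2 * ?n)" for k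
    using H[of 9 0 k "Xi 0 k" "Xi 0 k"] that idx[of 0 k] unfolding len
    by (simp add: windows_def X_def Xi_def defs[symmetric])
  have two: "lab (Xi 0 k) = diag (start_cell M 2)"
    if "k < Pn" "(\<exists>v<?n. bit x v \<and> (k = Rn + 2 * v \<or> k = Suc (Rn + 2 * v))) \<or> k = Rn + 2 * ?n" for k
    using H[of 10 0 k "Xi 0 k" "Xi 0 k"] that idx[of 0 k] unfolding len
    by (simp add: windows_def X_def Xi_def defs[symmetric])
  have cert: "\<exists>b<3. lab (Xi 0 k) = diag (start_cell M b)" if k: "Suc (Rn + 2 * ?n) < k" "k < Rn + Wn" for k
  proof -
    have k': "k < Pn" using k sz by linarith
    obtain a b c d where l: "lab (Xi 0 k) = (a, b, c, d)" by (metis prod_cases4)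
    have "lab (Xi 0 k) = diag (if a \<in> start_cell M ` {..<3} then a else blank M)"
      using H[of 11 0 k "Xi 0 k" "Xi 0 k"] k k' idx[of 0 k] l unfolding len
      by (simp add: windows_def X_def Xi_def defs[symmetric] algebra_simps)
    moreover have "(if a \<in> start_cell M ` {..<3} then a else blank M) \<in> start_cell M ` {..<3}"
      by (simp add: start_cell_0[OF M, symmetric])
    ultimately show ?thesis by auto
  qed
  have mono: "lab (Xi 0 (Suc k)) = diag (blank M)"
    if k: "Suc (Rn + 2 * ?n) < k" "k < Rn + Wn" and b: "lab (Xi 0 k) = diag (blank M)" for k
  proof -
    have k': "k < Pn" "0 < k" "Suc k < Pn" using k sz by linarith+
    obtain a b c d where l: "lab (Suc (Xi 0 k)) = (a, b, c, d)" "lab (Xi 0 k) = diag c" "lab (Xi 0 (Suc k)) = diag d"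
      using Y[of 0 k] k' by blast
    have "lab (Suc (Xi 0 k)) = (if c = blank M \<longrightarrow> d = blank M then (a, b, c, d) else diag (blank M))"
      using H[of 12 0 k "Suc (Xi 0 k)" "Suc (Xi 0 k)"] k k' idx[of 0 k] l(1) unfolding len
      by (simp add: windows_def X_def Xi_def defs[symmetric] algebra_simps)
    then show ?thesis using l b by (auto simp: diag_def split: if_splits)
  qed
  have acc: "hd (snd a) \<noteq> 1" if k: "k < Pn" and a: "lab (Xi Tn k) = diag a" for k a
  proof -
    have "lab (Xi Tn k) = (if hd (snd a) \<noteq> 1 then diag a else diag (blank M))"
      using H[of 13 Tn k "Xi Tn k" "Xi Tn k"] k idx[of Tn k] a unfolding len
      by (auto simp: windows_def X_def Xi_def defs[symmetric] diag_def split: if_splits)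
    moreover have "hd (snd (blank M)) = 0" using M by (cases "tm_tapes M") (auto simp: blank_def turing_machine_def)
    ultimately show ?thesis using a by (auto simp: diag_inj split: if_splits)
  qed
  define b where "b l = (SOME b. b < 3 \<and> lab (Xi 0 (Rn + 2 * ?n + 2 + l)) = diag (start_cell M b))" for l
  have b: "b l < 3" "lab (Xi 0 (Rn + 2 * ?n + 2 + l)) = diag (start_cell M (b l))" if "l < poly p ?n" for l
  proof -
    have "\<exists>b<3. lab (Xi 0 (Rn + 2 * ?n + 2 + l)) = diag (start_cell M b)"
      by (rule cert) (use that sz in linarith)+
    then have "b l < 3 \<and> lab (Xi 0 (Rn + 2 * ?n + 2 + l)) = diag (start_cell M (b l))"
      unfolding b_def by (rule someI_ex[OF ex_forward]) blast
    then show "b l < 3" "lab (Xi 0 (Rn + 2 * ?n + 2 + l)) = diag (start_cell M (b l))" by blast+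
  qed
  \<comment> \<open>The length of the certificate: its first blank, or the end of the region if
    there is none. By \<open>mono\<close> everything after it is blank.\<close>
  define L where "L = (LEAST l. l = poly p ?n \<or> b l = 0)"
  have L: "L = poly p ?n \<or> b L = 0" unfolding L_def by (rule LeastI[of _ "poly p ?n"]) simp
  have L_le: "L \<le> poly p ?n" unfolding L_def by (rule Least_le) simp
  have below: "b l \<noteq> 0" if "l < L" for l using not_less_Least[of l] that unfolding L_def by blast
  have above: "b l = 0" if "L \<le> l" "l < poly p ?n" for l
    using that
  proof (induction l rule: dec_induct)
    case base
    then show ?case using L by auto
  next
    case (step l)
    have "lab (Xi 0 (Rn + 2 * ?n + 2 + l)) = diag (blank M)"
      using b(2)[of l] step by (simp add: start_cell_0[OF M])
    then have "lab (Xi 0 (Suc (Rn + 2 * ?n + 2 + l))) = diag (blank M)"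
      by (intro mono) (use step sz in linarith)+
    then have "diag (start_cell M (b (Suc l))) = diag (start_cell M 0)"
      using b(2)[of "Suc l"] step by (simp add: start_cell_0[OF M])
    then show ?case by (simp add: diag_inj start_cell_inj)
  qed
  define u where "u = map (\<lambda>l. b l = 2) [0..<L]"
  define w where "w = pair_word x u"
  have lw: "length w = 2 * ?n + 2 + L" by (simp add: w_def length_pair_word u_def)
  then have w: "length w \<le> Wn" using L_le sz by simp
  define ce where "ce t k = run M w t (int k - int Rn)" for t k
  define wc where "wc k = word_contents w (int k)" for k
  have wc: "wc k = (if k < length w then if w ! k then 2 else 1 else 0)" for k
    by (simp add: wc_def word_contents_int)
  have ce0: "ce 0 k = start_cell M (if k < Rn then 0 else wc (k - Rn))" for k
    unfolding ce_def run_0[OF M] wc_def by (auto simp: word_contents_def nat_diff_distrib of_nat_diff)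
  have bits: "w ! (2 * l) = bit x l" "w ! (Suc (2 * l)) = bit x l" if "l < ?n" for l
    using nth_pair_word(1,2)[OF that, of u] that by (simp_all add: w_def bit_def)
  have mid: "w ! (2 * ?n)" "\<not> w ! (Suc (2 * ?n))"
    using nth_pair_word(3,4)[of x u] by (simp_all add: w_def)
  have tail: "w ! (2 * ?n + 2 + l) \<longleftrightarrow> b l = 2" if "l < L" for l
    using nth_pair_word(5)[of l u x] that by (simp add: w_def u_def)
  have init: "lab (Xi 0 k) = diag (ce 0 k)" if k: "k < Pn" for k
  proof -
    consider "k < Rn \<or> \<not> k < Rn + Wn" | l where "k = Rn + l" "l < 2 * ?n" | "k = Rn + 2 * ?n" | "k = Suc (Rn + 2 * ?n)"
      | l where "k = Rn + 2 * ?n + 2 + l" "l < poly p ?n"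
    proof (cases "k < Rn \<or> \<not> k < Rn + Wn \<or> k - Rn < 2 * ?n \<or> k = Rn + 2 * ?n \<or> k = Suc (Rn + 2 * ?n)")
      case True
      then show ?thesis using that(1) that(2)[of "k - Rn"] that(3,4) by fastforce
    next
      case False
      then have "k = Rn + 2 * ?n + 2 + (k - (Rn + 2 * ?n + 2))" "k - (Rn + 2 * ?n + 2) < poly p ?n"
        using sz(3) by linarith+
      then show ?thesis by (rule that(5))
    qed
    then show ?thesis
    proof cases
      case 1
      then have "ce 0 k = start_cell M 0" using w unfolding ce0 by (auto simp: wc)
      then show ?thesis using border[of 0 k] k 1 by simp
    next
      case (2 l)
      define v where "v = l div 2"
      have v: "v < ?n" "l = 2 * v \<or> l = Suc (2 * v)" using 2 unfolding v_def by linarith+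
      then have wl: "wc l = (if bit x v then 2 else 1)" using bits lw unfolding wc by auto
      have ck: "ce 0 k = start_cell M (wc l)" unfolding ce0 using 2 by simp
      show ?thesis
      proof (cases "bit x v")
        case True
        then have "lab (Xi 0 k) = diag (start_cell M 2)" using v 2 k by (intro two) auto
        then show ?thesis using ck wl True by simp
      next
        case False
        then have "lab (Xi 0 k) = diag (start_cell M 1)" using v 2 k by (intro one) auto
        then show ?thesis using ck wl False by simp
      qed
    next
      case 3
      then show ?thesis using two[of k] k mid lw unfolding ce0 by (simp add: wc)
    next
      case 4
      then show ?thesis using one[of k] k mid lw unfolding ce0 by (simp add: wc)
    next
      case (5 l)
      have "wc (2 * ?n + 2 + l) = b l"
      proof (cases "l < L")
        case True
        have "b l = 1 \<or> b l = 2" using b(1)[OF 5(2)] below[OF True] by linarith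
        then show ?thesis using True tail[OF True] lw unfolding wc by auto
      next
        case False
        then show ?thesis using above[of l] 5 lw unfolding wc by simp
      qed
      then have "ce 0 k = start_cell M (b l)" unfolding ce0 using 5 by simp
      then show ?thesis using b(2)[OF 5(2)] 5(1) by simp
    qed
  qed
  have main: "lab (Xi t k) = diag (ce t k)" if "t \<le> Tn" "k < Pn" for t k
    using that
  proof (induction t arbitrary: k)
    case 0
    then show ?case using init by blast
  next
    case (Suc t)
    show ?case
    proof (cases "k = 0 \<or> Suc k = Pn")
      case True
      have "ce (Suc t) k = blank M" unfolding ce_def
        by (rule run_blank[OF M]) (use True Suc.prems sz w in linarith)
      moreover have "lab (Xi (Suc t) k) = diag (start_cell M 0)" using border Suc.prems True by blast
      ultimately show ?thesis by (simp add: start_cell_0[OF M])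
    next
      case False
      then have k: "0 < k" "Suc k < Pn" using Suc.prems by auto
      obtain a b c d where Y': "lab (Suc (Xi t k)) = (a, b, c, d)" "lab (Xi t Rn) = diag a" "lab (Xi t (k - 1)) = diag b"
        "lab (Xi t k) = diag c" "lab (Xi t (Suc k)) = diag d" using Y[of t k] Suc.prems k by auto
      have "a = ce t Rn" "b = ce t (k - 1)" "c = ce t k" "d = ce t (Suc k)"
        using Suc.IH[of Rn] Suc.IH[of "k - 1"] Suc.IH[of k] Suc.IH[of "Suc k"] Y' Suc.prems k sz by (auto simp: diag_inj)
      moreover have "ce (Suc t) k = next_cell M (int k - int Rn) (ce t Rn, ce t (k - 1), ce t k, ce t (Suc k))"
        unfolding ce_def using k by (simp add: run_Suc[OF M] of_nat_diff algebra_simps)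
      ultimately show ?thesis using step[of t k] Suc.prems k Y'(1) by simp
    qed
  qed
  have "hd (snd (run M w Tn (int k - int Rn))) \<noteq> 1" if "k < Pn" for k
    using acc[OF that main[OF _ that]] unfolding ce_def by simp
  then show ?thesis using L_le unfolding w_def defs
    by (intro exI[of _ u]) (simp add: u_def)
qed

end

theorem cook_levin:
  assumes eu: "essentially_unary D K" and D: "0 < D"
    and K_dom: "\<And>s d d'. K s d d' \<Longrightarrow> d < D \<and> d' < D" and K_sym: "\<And>s d d'. K s d d' \<Longrightarrow> K s d' d"
    and L: "L \<in> class_NP"
  shows "polytime_reducible L (csp D K)"
proof -
  obtain V p where V: "V \<in> class_P" "\<And>x. x \<in> L \<longleftrightarrow> (\<exists>u. length u \<le> poly p (length x) \<and> pair_word x u \<in> V)"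
    using L unfolding class_NP_def by blast
  obtain M q where tm: "turing_machine M" and outputs: "\<And>w. tm_outputs_within M w (poly q (length w)) [w \<in> V]"
    using V(1) unfolding class_P_def polytime_computable_def by blast
  interpret tableau M q p by unfold_locales (rule tm)
  show ?thesis
  proof (rule finite_label_reduction[OF eu D K_dom K_sym, where Lset = labels and cs = constraints and m = num])
    show "finite labels" unfolding labels_def using finite_cells by blast
    show "F l \<in> labels" if "(F, \<phi>) \<in> set constraints" "l \<in> labels" for F \<phi> l
      using constraints_wf that by blast
    show "eval x w \<phi> (i # j # length x # rest) = eval x [] \<phi> [i, j, length x]" if "(F, \<phi>) \<in> set constraints" for F \<phi> x w i j rest
      using constraints_local that by blast
    fix x
    have acc: "pair_word x u \<in> V \<longleftrightarrow> (\<forall>k<poly P (length x).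
        hd (snd (run M (pair_word x u) (poly T (length x)) (int k - int (poly R (length x))))) \<noteq> 1)"
      if "length u \<le> poly p (length x)" for u
      by (rule run_accepts'[OF outputs]) (use that in \<open>simp add: length_pair_word sizes\<close>)
    have "x \<in> L \<longleftrightarrow> (\<exists>lab. valid_labelling x lab)"
      unfolding V(2) using acc labelling_of_run[of _ x] run_of_labelling[of x] by metis
    then show "x \<in> L \<longleftrightarrow> (\<exists>lab. (\<forall>i<poly num (length x). lab i \<in> labels) \<and>
      (\<forall>(F, \<phi>)\<in>set constraints. \<forall>i<poly num (length x). \<forall>j<poly num (length x).
         eval x [] \<phi> [i, j, length x] \<longrightarrow> lab j = F (lab i)))"
      unfolding valid_labelling_def .
  qed
qed

section \<open>Languages in NP and in P\<close>

definition pos_trm :: "trm \<Rightarrow> trm \<Rightarrow> trm \<Rightarrow> trm \<Rightarrow> trm" where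
  "pos_trm n i j s = Plus (Plus n (Num 1)) (Plus (Times (Num 2) (Plus (Times i n) j)) s)"

lemma tev_pos_trm [simp]: "tev (pos_trm n i j s) e = bitpos (tev n e) (tev i e) (tev j e) (tev s e)"
  by (simp add: pos_trm_def bitpos_def)

text \<open>\<open>B\<close> gives access to the bits of the word, \<open>l\<close> is its length, and variable 0 is the number of
  vertices.\<close>

definition valid_fm :: "(trm \<Rightarrow> fm) \<Rightarrow> trm \<Rightarrow> fm" where
  "valid_fm B l = FConj (FEq l (Plus (Plus (Var 0) (Num 1)) (Times (Num 2) (Times (Var 0) (Var 0)))))
     (FConj (FAll (Var 0) (B (Var 0))) (FConj (FNot (B (Var 0)))
     (FAll (Var 0) (FAll (Var 1) (FAll (Num 2) (FConj
        (FImp (B (pos_trm (Var 3) (Var 2) (Var 1) (Var 0))) (B (pos_trm (Var 3) (Var 1) (Var 2) (Var 0))))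
        (FImp (B (pos_trm (Var 3) (Var 1) (Var 2) (Var 0))) (B (pos_trm (Var 3) (Var 2) (Var 1) (Var 0))))))))))"

lemma eval_valid_fm:
  assumes B: "\<And>t e. tev t e < length y \<Longrightarrow> eval x w (B t) e = bit y (tev t e)" and l: "tev l (n # e) = length y"
  shows "eval x w (valid_fm B l) (n # e) \<longleftrightarrow> valid_word y n"
proof (cases "length y = n + 1 + 2 * (n * n)")
  case True
  then have "eval x w (B (pos_trm (Var 3) (Var 2) (Var 1) (Var 0))) (s # j # i # n # e) = bit y (bitpos n i j s)"
    "eval x w (B (pos_trm (Var 3) (Var 1) (Var 2) (Var 0))) (s # j # i # n # e) = bit y (bitpos n j i s)"
    if "i < n" "j < n" "s < 2" for i j s
    using bitpos_less[of i n j s] bitpos_less[of j n i s] that by (simp_all add: B)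
  moreover have "eval x w (B (Var 0)) (i # n # e) = bit y i" if "i < n" for i using that True by (simp add: B)
  moreover have "eval x w (B (Var 0)) (n # e) = bit y n" using True by (simp add: B)
  moreover have iff: "(P \<longrightarrow> Q) \<and> (Q \<longrightarrow> P) \<longleftrightarrow> P = Q" for P Q by blast
  ultimately show ?thesis using True l unfolding valid_fm_def valid_word_def
    by (simp add: iff)
next
  case False
  then have "\<not> eval x w (FEq l (Plus (Plus (Var 0) (Num 1)) (Times (Num 2) (Times (Var 0) (Var 0))))) (n # e)"
    using l by simp
  then show ?thesis using False unfolding valid_fm_def valid_word_def by (simp only: eval_connectives simp_thms)
qed

lemma valid_word_length: "valid_word x n \<Longrightarrow> n < length x"
  by (simp add: valid_word_def)

text \<open>The certificate is a table of \<open>n * D\<close> bits marking values for each vertex.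
  Every vertex needs some mark, and all marked pairs on an edge must be compatible; any choice of
  marked values is then a solution, so marks need not be unique.\<close>

theorem csp_in_NP: "csp D K \<in> class_NP"
proof -
  define B where "B t = Bit False (Times (Num 2) t)" for t
  define C where "C t = Bit False (Plus (Plus (Times (Num 2) (Var 6)) (Num 2)) t)" for t
  define tab where "tab = FDisjs (map (\<lambda>(s, d, d'). FConj (FEq (Var 2) (Num s)) (FConj (FEq (Var 1) (Num d)) (FEq (Var 0) (Num d'))))
     (filter (\<lambda>(s, d, d'). K (sg s) d d') (List.product [0..<2] (List.product [0..<D] [0..<D]))))"
  define \<psi> where "\<psi> = Ex (Var 1) (FConj (FAll (Var 0) (FConj
        (FImp (Bit False (Times (Num 2) (Var 0))) (Bit False (Plus (Times (Num 2) (Var 0)) (Num 1))))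
        (FImp (Bit False (Plus (Times (Num 2) (Var 0)) (Num 1))) (Bit False (Times (Num 2) (Var 0))))))
     (FConj (FConj (Bit False (Times (Num 2) (Var 0))) (FConj (Less (Plus (Times (Num 2) (Var 0)) (Num 1)) (Var 2))
        (FNot (Bit False (Plus (Times (Num 2) (Var 0)) (Num 1))))))
     (Ex (Var 2) (FConj (valid_fm B (Var 1)) (FConj
        (FAll (Var 0) (Ex (Num D) (Bit False (Plus (Plus (Times (Num 2) (Var 3)) (Num 2)) (Plus (Times (Var 1) (Num D)) (Var 0))))))
        (FAll (Var 0) (FAll (Var 1) (FAll (Num 2) (FImp (B (pos_trm (Var 3) (Var 2) (Var 1) (Var 0)))
          (FAll (Num D) (FAll (Num D) (FImp (FConj (C (Plus (Times (Var 4) (Num D)) (Var 1))) (C (Plus (Times (Var 3) (Num D)) (Var 0))))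
             tab)))))))))))) "
  have tab: "eval y w tab (d' # d # s # e) \<longleftrightarrow> K (sg s) d d'" if "d < D" "d' < D" "s < 2" for y w d d' s e
    using that unfolding tab_def by (auto simp: less_2_cases_iff)
  have \<psi>: "eval y w \<psi> [k, length y] \<longleftrightarrow> (\<exists>l. 2 * l + 1 < length y \<and> (\<forall>i<l. (bit y (2 * i) \<longrightarrow> bit y (2 * i + 1)) \<and> (bit y (2 * i + 1) \<longrightarrow> bit y (2 * i))) \<and>
      bit y (2 * l) \<and> \<not> bit y (2 * l + 1) \<and> (\<exists>n<length y. eval y [] (valid_fm B (Var 1)) [n, l] \<and>
      (\<forall>i<n. \<exists>d<D. bit y (2 * l + 2 + (i * D + d))) \<and>
      (\<forall>i<n. \<forall>j<n. \<forall>s<2. bit y (2 * bitpos n i j s) \<longrightarrow> (\<forall>d<D. \<forall>d'<D.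
         bit y (2 * l + 2 + (i * D + d)) \<and> bit y (2 * l + 2 + (j * D + d')) \<longrightarrow> K (sg s) d d'))))" for y w k
  proof -
    have v: "eval y w (valid_fm B (Var (Suc 0))) [n, l, k, length y] \<longleftrightarrow> eval y [] (valid_fm B (Var (Suc 0))) [n, l]" for n l
      unfolding valid_fm_def B_def by simp
    have "eval y w \<psi> [k, length y] \<longleftrightarrow> (\<exists>l<length y. 2 * l + 1 < length y \<and> (\<forall>i<l. (bit y (2 * i) \<longrightarrow> bit y (2 * i + 1)) \<and> (bit y (2 * i + 1) \<longrightarrow> bit y (2 * i))) \<and>
      bit y (2 * l) \<and> \<not> bit y (2 * l + 1) \<and> (\<exists>n<length y. eval y [] (valid_fm B (Var 1)) [n, l] \<and>
      (\<forall>i<n. \<exists>d<D. bit y (2 * l + 2 + (i * D + d))) \<and>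
      (\<forall>i<n. \<forall>j<n. \<forall>s<2. bit y (2 * bitpos n i j s) \<longrightarrow> (\<forall>d<D. \<forall>d'<D.
         bit y (2 * l + 2 + (i * D + d)) \<and> bit y (2 * l + 2 + (j * D + d')) \<longrightarrow> K (sg s) d d'))))"
      unfolding \<psi>_def by (simp add: v B_def C_def tab conj_ac cong: conj_cong)
    moreover have "(\<exists>l<m. 2 * l + 1 < m \<and> Z l) \<longleftrightarrow> (\<exists>l. 2 * l + 1 < m \<and> Z l)" for m :: nat and Z
    proof -
      have "l < m" if "2 * l + 1 < m" for l using that by linarith
      then show ?thesis by blast
    qed
    ultimately show ?thesis by (simp only:)
  qed
  define V where "V = {y. eval y [] \<psi> [0, length y]}"
  have "V \<in> class_P" by (rule class_P_definable[of \<psi>]) (simp add: V_def \<psi>)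
  moreover have "x \<in> csp D K \<longleftrightarrow> (\<exists>u. length u \<le> poly [:0, D:] (length x) \<and> pair_word x u \<in> V)" for x
  proof -
    have bx: "bit (pair_word x u) (2 * l) = bit x l" "bit (pair_word x u) (2 * l + 1) = bit x l" if "l < length x" for l u
      using that nth_pair_word(1,2)[OF that, of u] by (simp_all add: bit_def length_pair_word)
    have bm: "bit (pair_word x u) (2 * length x)" "\<not> bit (pair_word x u) (2 * length x + 1)" for u
      using nth_pair_word(3,4)[of x u] by (simp_all add: bit_def length_pair_word)
    have bu: "bit (pair_word x u) (2 * length x + 2 + l) = bit u l" for l u
      using nth_pair_word(5)[of l u x] by (auto simp: bit_def length_pair_word)
    \<comment> \<open>The verifier has to find \<open>length x\<close> within the paired word.
      Doubled bits agree and the separator does not, so \<open>l\<close> is determined.\<close>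
    have L: "2 * l + 1 < length (pair_word x u) \<and> (\<forall>i<l. (bit (pair_word x u) (2 * i) \<longrightarrow> bit (pair_word x u) (2 * i + 1)) \<and>
        (bit (pair_word x u) (2 * i + 1) \<longrightarrow> bit (pair_word x u) (2 * i))) \<and>
      bit (pair_word x u) (2 * l) \<and> \<not> bit (pair_word x u) (2 * l + 1) \<longleftrightarrow> l = length x" for l u
    proof
      assume a: "2 * l + 1 < length (pair_word x u) \<and> (\<forall>i<l. (bit (pair_word x u) (2 * i) \<longrightarrow> bit (pair_word x u) (2 * i + 1)) \<and>
        (bit (pair_word x u) (2 * i + 1) \<longrightarrow> bit (pair_word x u) (2 * i))) \<and>
        bit (pair_word x u) (2 * l) \<and> \<not> bit (pair_word x u) (2 * l + 1)"
      show "l = length x"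
      proof (cases l "length x" rule: linorder_cases)
        case less
        from bx[OF this, of u] a show ?thesis by blast
      next
        case greater
        then show ?thesis using a bm[of u] by blast
      qed
    qed (use bx bm in \<open>simp add: length_pair_word\<close>)
    have v: "eval (pair_word x u) [] (valid_fm B (Var 1)) [n, length x] \<longleftrightarrow> valid_word x n" for n u
      by (rule eval_valid_fm) (simp_all add: B_def bx(1))
    have V: "pair_word x u \<in> V \<longleftrightarrow> (\<exists>n. valid_word x n \<and> (\<forall>i<n. \<exists>d<D. bit u (i * D + d)) \<and>
      (\<forall>i<n. \<forall>j<n. \<forall>s<2. bit x (bitpos n i j s) \<longrightarrow> (\<forall>d<D. \<forall>d'<D.
         bit u (i * D + d) \<and> bit u (j * D + d') \<longrightarrow> K (sg s) d d')))" for u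
    proof -
      have "pair_word x u \<in> V \<longleftrightarrow> (\<exists>n<length (pair_word x u). valid_word x n \<and> (\<forall>i<n. \<exists>d<D. bit u (i * D + d)) \<and>
      (\<forall>i<n. \<forall>j<n. \<forall>s<2. bit (pair_word x u) (2 * bitpos n i j s) \<longrightarrow> (\<forall>d<D. \<forall>d'<D.
         bit u (i * D + d) \<and> bit u (j * D + d') \<longrightarrow> K (sg s) d d')))"
      proof -
        define Rest where "Rest l \<longleftrightarrow> (\<exists>n<length (pair_word x u). eval (pair_word x u) [] (valid_fm B (Var 1)) [n, l] \<and>
          (\<forall>i<n. \<exists>d<D. bit (pair_word x u) (2 * l + 2 + (i * D + d))) \<and>
          (\<forall>i<n. \<forall>j<n. \<forall>s<2. bit (pair_word x u) (2 * bitpos n i j s) \<longrightarrow> (\<forall>d<D. \<forall>d'<D.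
             bit (pair_word x u) (2 * l + 2 + (i * D + d)) \<and> bit (pair_word x u) (2 * l + 2 + (j * D + d')) \<longrightarrow> K (sg s) d d')))" for l
        have "pair_word x u \<in> V \<longleftrightarrow> Rest (length x)"
        proof -
          have "(\<exists>l. A l \<and> B l \<and> C l \<and> E l \<and> Q l) \<longleftrightarrow> Q c" if "\<And>l. A l \<and> B l \<and> C l \<and> E l \<longleftrightarrow> l = c"
            for A B C E Q and c :: nat using that by metis
          from this[OF L] show ?thesis unfolding V_def mem_Collect_eq \<psi> Rest_def .
        qed
        then show ?thesis unfolding Rest_def bu v .
      qed
      also have "\<dots> \<longleftrightarrow> (\<exists>n<length (pair_word x u). valid_word x n \<and> (\<forall>i<n. \<exists>d<D. bit u (i * D + d)) \<and>
      (\<forall>i<n. \<forall>j<n. \<forall>s<2. bit x (bitpos n i j s) \<longrightarrow> (\<forall>d<D. \<forall>d'<D.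
         bit u (i * D + d) \<and> bit u (j * D + d') \<longrightarrow> K (sg s) d d')))"
      proof -
        have "bit (pair_word x u) (2 * bitpos n i j s) = bit x (bitpos n i j s)"
          if "valid_word x n" "i < n" "j < n" "s < 2" for n i j s
          using bitpos_less[OF that(2-4)] that(1) by (intro bx) (simp add: valid_word_def)
        then show ?thesis by (simp cong: conj_cong)
      qed
      also have "\<dots> \<longleftrightarrow> (\<exists>n. valid_word x n \<and> (\<forall>i<n. \<exists>d<D. bit u (i * D + d)) \<and>
      (\<forall>i<n. \<forall>j<n. \<forall>s<2. bit x (bitpos n i j s) \<longrightarrow> (\<forall>d<D. \<forall>d'<D.
         bit u (i * D + d) \<and> bit u (j * D + d') \<longrightarrow> K (sg s) d d')))"
      proof -
        have "n < length (pair_word x u)" if "valid_word x n" for n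
          using valid_word_length[OF that] by (simp add: length_pair_word)
        then show ?thesis by blast
      qed
      finally show ?thesis .
    qed
    show ?thesis
    proof
      assume "x \<in> csp D K"
      then obtain n g where n: "valid_word x n" and g: "\<And>i. i < n \<Longrightarrow> g i < D"
        "\<And>i j s. i < n \<Longrightarrow> j < n \<Longrightarrow> s < 2 \<Longrightarrow> bit x (bitpos n i j s) \<Longrightarrow> K (sg s) (g i) (g j)"
        unfolding csp_def csp_sat_def by blast
      define u where "u = map (\<lambda>k. g (k div D) = k mod D) [0..<n * D]"
      have u: "bit u (i * D + d) \<longleftrightarrow> g i = d" if "i < n" "d < D" for i d
      proof -
        have "i * D + d < i * D + D" using that by simp
        also have "\<dots> = Suc i * D" by simp
        also have "\<dots> \<le> n * D" using that by (intro mult_right_mono) auto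
        finally show ?thesis using that by (simp add: bit_def u_def)
      qed
      have "\<exists>d<D. bit u (i * D + d)" if "i < n" for i using g(1)[OF that] u[OF that] by blast
      then have "pair_word x u \<in> V" unfolding V using n g(2) by (intro exI[of _ n] conjI) (auto simp: u)
      moreover have "length u \<le> poly [:0, D:] (length x)"
        using valid_word_length[OF n] by (simp add: u_def)
      ultimately show "\<exists>u. length u \<le> poly [:0, D:] (length x) \<and> pair_word x u \<in> V" by blast
    next
      assume "\<exists>u. length u \<le> poly [:0, D:] (length x) \<and> pair_word x u \<in> V"
      then obtain u n where n: "valid_word x n" and u: "\<forall>i<n. \<exists>d<D. bit u (i * D + d)"
        "\<And>i j s d d'. i < n \<Longrightarrow> j < n \<Longrightarrow> s < 2 \<Longrightarrow> bit x (bitpos n i j s) \<Longrightarrow> d < D \<Longrightarrow> d' < D \<Longrightarrow>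
           bit u (i * D + d) \<Longrightarrow> bit u (j * D + d') \<Longrightarrow> K (sg s) d d'"
        unfolding V by blast
      from u(1) obtain g where g: "\<And>i. i < n \<Longrightarrow> g i < D \<and> bit u (i * D + g i)" by metis
      then have "csp_sat D K n (\<lambda>i j s. bit x (bitpos n i j s))"
        unfolding csp_sat_def using u(2) by (intro exI[of _ g]) blast
      then show "x \<in> csp D K" using n unfolding csp_def by blast
    qed
  qed
  ultimately show ?thesis unfolding class_NP_def by blast
qed

text \<open>The two Booleans of a walk are its sign (\<open>True\<close> for negative) and the parity of its length.\<close>

definition cover :: "('b \<Rightarrow> 'b \<Rightarrow> sign \<Rightarrow> bool) \<Rightarrow> (('b \<times> bool \<times> bool) \<times> ('b \<times> bool \<times> bool)) set" where
  "cover A = {((a, \<alpha>, \<pi>), (b, \<alpha> \<noteq> (s = Neg), \<not> \<pi>)) | a b s \<alpha> \<pi>. A a b s}"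

definition closed_walk :: "('b \<Rightarrow> 'b \<Rightarrow> sign \<Rightarrow> bool) \<Rightarrow> 'b \<Rightarrow> bool \<times> bool \<Rightarrow> bool" where
  "closed_walk A a g \<longleftrightarrow> ((a, False, False), (a, g)) \<in> (cover A)\<^sup>*"

definition word_adj :: "bool list \<Rightarrow> nat \<Rightarrow> nat \<Rightarrow> nat \<Rightarrow> sign \<Rightarrow> bool" where
  "word_adj x n i j s \<longleftrightarrow> i < n \<and> j < n \<and> bit x (bitpos n i j (if s = Neg then 1 else 0))"

definition walk_code :: "nat \<times> bool \<times> bool \<Rightarrow> nat" where
  "walk_code = (\<lambda>(v, \<alpha>, \<pi>). v * 4 + ((if \<alpha> then 1 else 0) + (if \<pi> then 2 else 0)))"

lemma walk_code_inj: "walk_code p = walk_code q \<longleftrightarrow> p = q"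
proof
  assume e: "walk_code p = walk_code q"
  obtain v \<alpha> \<pi> v' \<alpha>' \<pi>' where p: "p = (v, \<alpha>, \<pi>)" "q = (v', \<alpha>', \<pi>')" by (metis prod_cases3)
  have "walk_code (u, \<beta>, \<rho>) div 4 = u" for u \<beta> \<rho> by (simp add: walk_code_def)
  then have "v = v'" using e unfolding p by metis
  then show "p = q" using e unfolding p walk_code_def by (auto split: if_splits)
qed simp

lemma rtrancl_image_inj:
  assumes c: "\<And>p q. c p = c q \<longleftrightarrow> p = q"
  shows "(c p, c q) \<in> {(c p, c q) | p q. (p, q) \<in> R}\<^sup>* \<longleftrightarrow> (p, q) \<in> R\<^sup>*"
proof
  have "\<exists>q. j = c q \<and> (p, q) \<in> R\<^sup>*" if "(c p, j) \<in> {(c p, c q) | p q. (p, q) \<in> R}\<^sup>*" for j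
    using that
  proof (induction rule: rtrancl_induct)
    case (step j k)
    then obtain q p' q' where "j = c q" "(p, q) \<in> R\<^sup>*" "j = c p'" "k = c q'" "(p', q') \<in> R" by blast
    then show ?case using c[of q p'] by (auto intro: rtrancl_into_rtrancl)
  qed blast
  moreover assume "(c p, c q) \<in> {(c p, c q) | p q. (p, q) \<in> R}\<^sup>*"
  ultimately obtain q' where "c q = c q'" "(p, q') \<in> R\<^sup>*" by blast
  then show "(p, q) \<in> R\<^sup>*" using c by simp
next
  assume "(p, q) \<in> R\<^sup>*"
  then show "(c p, c q) \<in> {(c p, c q) | p q. (p, q) \<in> R}\<^sup>*"
  proof (induction rule: rtrancl_induct)
    case (step q r)
    then have "(c q, c r) \<in> {(c p, c q) | p q. (p, q) \<in> R}" by blast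
    with step.IH show ?case by (rule rtrancl_into_rtrancl)
  qed simp
qed

text \<open>A closed walk at \<open>v\<close> with value \<open>g\<close> is a path in the fourfold
  cover between two points over \<open>v\<close>. The size bound \<open>4 * length x\<close> serves
  in place of \<open>4 * n\<close>, since \<open>n\<close> is not a polynomial in the length;
  \<open>S\<close> recovers \<open>n\<close> from the length instead.\<close>

theorem walk_language_in_P:
  "{x. \<exists>n. valid_word x n \<and> (\<forall>v<n. \<forall>g. closed_walk (word_adj x n) v g \<longrightarrow> g \<in> \<Gamma>)} \<in> class_P" (is "?L \<in> _")
proof -
  define N :: "nat poly" where "N = [:0, 4:]"
  have N: "poly N k = 4 * k" for k by (simp add: N_def)
  define B where "B t = Bit False t" for t
  define S where "S x i j \<longleftrightarrow> (\<exists>n<length x. length x = n + 1 + 2 * (n * n) \<and> (\<exists>p q. (p, q) \<in> cover (word_adj x n) \<and> i = walk_code p \<and> j = walk_code q))"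
    for x i j
  define tr where "tr = FDisjs (map (\<lambda>(s, \<alpha>, \<pi>). FConj (FEq (Var 0) (Num (if s = Neg then 1 else 0)))
      (FConj (FEq (Var 4) (Plus (Times (Var 2) (Num 4)) (Num (walk_code (0, \<alpha>, \<pi>)))))
             (FEq (Var 5) (Plus (Times (Var 1) (Num 4)) (Num (walk_code (0, \<alpha> \<noteq> (s = Neg), \<not> \<pi>)))))))
     (List.product [Pos, Neg] (List.product [False, True] [False, True])))"
  define st where "st = Ex (Var 2) (FConj (FEq (Var 3) (Plus (Plus (Var 0) (Num 1)) (Times (Num 2) (Times (Var 0) (Var 0)))))
     (Ex (Var 0) (Ex (Var 1) (Ex (Num 2) (FConj (B (pos_trm (Var 3) (Var 2) (Var 1) (Var 0))) tr)))))"
  have tr: "eval x w tr (k # b # a # n # i # j # e) \<longleftrightarrow> (\<exists>s \<alpha> \<pi>. k = (if s = Neg then 1 else 0) \<and>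
      i = walk_code (a, \<alpha>, \<pi>) \<and> j = walk_code (b, \<alpha> \<noteq> (s = Neg), \<not> \<pi>))" for x w k b a n i j e
  proof -
    have set: "set (List.product [Pos, Neg] (List.product [False, True] [False, True])) = UNIV"
    proof (intro set_eqI iffI UNIV_I)
      fix t :: "sign \<times> bool \<times> bool"
      obtain s \<alpha> \<pi> where "t = (s, \<alpha>, \<pi>)" by (metis prod_cases3)
      then show "t \<in> set (List.product [Pos, Neg] (List.product [False, True] [False, True]))"
        by (cases s; cases \<alpha>; cases \<pi>) simp_all
    qed
    have c: "walk_code (a, \<alpha>, \<pi>) = a * 4 + walk_code (0, \<alpha>, \<pi>)" for a \<alpha> \<pi> by (simp add: walk_code_def)
    show ?thesis unfolding tr_def c[of a] c[of b] by (simp only: eval_connectives set_map set) (auto simp: Bex_def)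
  qed
  have st: "eval x w st (i # j # length x # rest) = S x i j" for x w i j rest
  proof -
    have "eval x w st (i # j # length x # rest) \<longleftrightarrow> (\<exists>n<length x. length x = n + 1 + 2 * (n * n) \<and>
       (\<exists>a<n. \<exists>b<n. \<exists>k<2. bit x (bitpos n a b k) \<and> (\<exists>s \<alpha> \<pi>. k = (if s = Neg then 1 else 0) \<and>
      i = walk_code (a, \<alpha>, \<pi>) \<and> j = walk_code (b, \<alpha> \<noteq> (s = Neg), \<not> \<pi>))))"
      unfolding st_def B_def by (simp add: tr)
    also have "\<dots> \<longleftrightarrow> S x i j"
    proof -
      have "(\<exists>a<n. \<exists>b<n. \<exists>k<2. bit x (bitpos n a b k) \<and> (\<exists>s \<alpha> \<pi>. k = (if s = Neg then 1 else 0) \<and>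
          i = walk_code (a, \<alpha>, \<pi>) \<and> j = walk_code (b, \<alpha> \<noteq> (s = Neg), \<not> \<pi>))) \<longleftrightarrow>
        (\<exists>p q. (p, q) \<in> cover (word_adj x n) \<and> i = walk_code p \<and> j = walk_code q)" (is "?l \<longleftrightarrow> ?r") for n
      proof
        assume ?l
        then obtain a b s \<alpha> \<pi> where "word_adj x n a b s" "i = walk_code (a, \<alpha>, \<pi>)" "j = walk_code (b, \<alpha> \<noteq> (s = Neg), \<not> \<pi>)"
          unfolding word_adj_def by blast
        then show ?r unfolding cover_def by blast
      next
        assume ?r
        then obtain a b s \<alpha> \<pi> where *: "word_adj x n a b s" "i = walk_code (a, \<alpha>, \<pi>)" "j = walk_code (b, \<alpha> \<noteq> (s = Neg), \<not> \<pi>)"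
          unfolding cover_def by blast
        have "(if s = Neg then 1 else 0) < (2 :: nat)" by simp
        then show ?l using * unfolding word_adj_def by blast
      qed
      then show ?thesis unfolding S_def by simp
    qed
    finally show ?thesis .
  qed
  define bad where "bad = filter (\<lambda>g. g \<notin> \<Gamma>) (List.product [False, True] [False, True])"
  have bad: "set bad = - \<Gamma>"
  proof -
    have "g \<in> set (List.product [False, True] [False, True])" for g :: "bool \<times> bool"
      by (cases g; cases "fst g"; cases "snd g") simp_all
    then show ?thesis unfolding bad_def set_filter by blast
  qed
  define out where "out = Ex (Var 1) (FConj (valid_fm B (Var 2)) (FAll (Var 0) (FNot (FDisjs (map (\<lambda>g.
     Bit True (Plus (Times (Times (Var 0) (Num 4)) (Times (Num 4) (Var 3))) (Plus (Times (Var 0) (Num 4)) (Num (walk_code (0, g)))))) bad)))))"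
  show ?thesis
  proof (rule class_P_reach[OF st, where N = N and out = out])
    fix x w k
    assume w: "\<And>i j. i < poly N (length x) \<Longrightarrow> j < poly N (length x) \<Longrightarrow>
        bit w (i * poly N (length x) + j) \<longleftrightarrow> (i, j) \<in> {(i, j). i < poly N (length x) \<and> j < poly N (length x) \<and> S x i j}\<^sup>*"
    have v: "eval x w (valid_fm B (Var 2)) [n, k, length x] \<longleftrightarrow> valid_word x n" for n
      by (rule eval_valid_fm) (simp_all add: B_def)
    have key: "bit w (v * 4 * (4 * length x) + (v * 4 + walk_code (0, g))) \<longleftrightarrow> closed_walk (word_adj x n) v g"
      if n: "valid_word x n" and v: "v < n" for n v g
    proof -
      have nl: "n < length x" "length x = n + 1 + 2 * (n * n)" using n by (auto simp: valid_word_def)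
      have less: "walk_code (u, g) < 4 * length x" if "u < n" for u g
        using that nl(1) by (cases g) (auto simp: walk_code_def)
      have uniq: "n' = n" if "length x = n' + 1 + 2 * (n' * n')" for n'
      proof (rule ccontr)
        assume "n' \<noteq> n"
        then consider "n' < n" | "n < n'" by linarith
        then show False
        proof cases
          case 1
          then have "n' * n' \<le> n * n" by (intro mult_mono) auto
          then show False using that nl(2) 1 by linarith
        next
          case 2
          then have "n * n \<le> n' * n'" by (intro mult_mono) auto
          then show False using that nl(2) 2 by linarith
        qed
      qed
      have "{(i, j). i < poly N (length x) \<and> j < poly N (length x) \<and> S x i j} =
          {(walk_code p, walk_code q) | p q. (p, q) \<in> cover (word_adj x n)}"
      proof (intro set_eqI iffI)
        fix ij assume "ij \<in> {(i, j). i < poly N (length x) \<and> j < poly N (length x) \<and> S x i j}"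
        then show "ij \<in> {(walk_code p, walk_code q) | p q. (p, q) \<in> cover (word_adj x n)}"
          unfolding S_def using uniq by blast
      next
        fix ij assume "ij \<in> {(walk_code p, walk_code q) | p q. (p, q) \<in> cover (word_adj x n)}"
        then obtain p q where pq: "ij = (walk_code p, walk_code q)" "(p, q) \<in> cover (word_adj x n)" by blast
        then have "fst p < n" "fst q < n" unfolding cover_def word_adj_def by auto
        then have "walk_code p < 4 * length x" "walk_code q < 4 * length x" using less by (metis prod.collapse)+
        then show "ij \<in> {(i, j). i < poly N (length x) \<and> j < poly N (length x) \<and> S x i j}"
          unfolding pq(1) mem_Collect_eq prod.case S_def N using pq(2) nl by blast
      qed
      note R = this
      have c: "v * 4 = walk_code (v, False, False)" "v * 4 + walk_code (0, g) = walk_code (v, g)"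
        by (cases g; simp add: walk_code_def)+
      have "bit w (walk_code (v, False, False) * poly N (length x) + walk_code (v, g)) \<longleftrightarrow>
          (walk_code (v, False, False), walk_code (v, g)) \<in> {(walk_code p, walk_code q) | p q. (p, q) \<in> cover (word_adj x n)}\<^sup>*"
        unfolding R[symmetric] by (rule w) (simp_all add: N less[OF v])
      also have "\<dots> \<longleftrightarrow> closed_walk (word_adj x n) v g"
        unfolding closed_walk_def by (rule rtrancl_image_inj[OF walk_code_inj])
      finally show ?thesis unfolding c(2) unfolding c(1) N .
    qed
    have "eval x w out [k, length x] \<longleftrightarrow> (\<exists>n<length x. valid_word x n \<and>
        (\<forall>v<n. \<forall>g\<in>- \<Gamma>. \<not> bit w (v * 4 * (4 * length x) + (v * 4 + walk_code (0, g)))))"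
      unfolding out_def by (simp add: v bad)
    also have "\<dots> \<longleftrightarrow> x \<in> ?L"
    proof -
      have "(\<forall>v<n. \<forall>g\<in>- \<Gamma>. \<not> bit w (v * 4 * (4 * length x) + (v * 4 + walk_code (0, g)))) \<longleftrightarrow>
          (\<forall>v<n. \<forall>g. closed_walk (word_adj x n) v g \<longrightarrow> g \<in> \<Gamma>)" if "valid_word x n" for n
      proof -
        have "(\<forall>v<n. \<forall>g\<in>- \<Gamma>. \<not> P v g) \<longleftrightarrow> (\<forall>v<n. \<forall>g. P v g \<longrightarrow> g \<in> \<Gamma>)" for P :: "nat \<Rightarrow> bool \<times> bool \<Rightarrow> bool"
          by blast
        from this[of "closed_walk (word_adj x n)"] show ?thesis using key[OF that] by simp
      qed
      moreover have "(\<exists>n<m. Q n \<and> A n) \<longleftrightarrow> (\<exists>n. Q n \<and> B n)"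
        if "\<And>n. Q n \<Longrightarrow> A n = B n" "\<And>n. Q n \<Longrightarrow> n < m" for Q A B and m :: nat using that by blast
      ultimately show ?thesis unfolding mem_Collect_eq using valid_word_length[of x] by simp
    qed
    finally show "eval x w out [k, length x] \<longleftrightarrow> x \<in> ?L" .
  qed
qed

lemma edgeless_in_P: "{x. \<exists>n. valid_word x n \<and> (\<forall>i<n. \<forall>j<n. \<forall>s<2. \<not> bit x (bitpos n i j s))} \<in> class_P" (is "?L \<in> _")
proof (rule class_P_definable)
  define B where "B t = Bit False t" for t
  fix x :: "bool list" and w k
  have v: "eval x w (valid_fm B (Var 2)) [n, k, length x] \<longleftrightarrow> valid_word x n" for n
    by (rule eval_valid_fm) (simp_all add: B_def)
  show "eval x w (Ex (Var 1) (FConj (valid_fm (Bit False) (Var 2)) (FAll (Var 0) (FAll (Var 1) (FAll (Num 2)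
     (FNot (Bit False (pos_trm (Var 3) (Var 2) (Var 1) (Var 0))))))))) [k, length x] \<longleftrightarrow> x \<in> ?L"
    using v valid_word_length[of x] unfolding B_def[abs_def] by auto
qed

section \<open>Closed walks\<close>

definition adj :: "'a sgraph \<Rightarrow> 'a \<Rightarrow> 'a \<Rightarrow> sign \<Rightarrow> bool" where
  "adj G a b s \<longleftrightarrow> ({a, b}, s) \<in> edges G"

lemma adj_sym: "adj G a b s \<Longrightarrow> adj G b a s" by (simp add: adj_def insert_commute)

lemma cover_step: "A a b s \<Longrightarrow> ((a, \<alpha>, \<pi>), (b, \<alpha> \<noteq> (s = Neg), \<not> \<pi>)) \<in> cover A"
  unfolding cover_def by blast

text \<open>The group of signs and parities acts on the cover by deck transformations.\<close>

lemma cover_shift: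
  "((a, \<alpha>, \<pi>), (b, \<beta>, \<rho>)) \<in> (cover A)\<^sup>* \<Longrightarrow> ((a, \<alpha> \<noteq> \<gamma>, \<pi> \<noteq> \<delta>), (b, \<beta> \<noteq> \<gamma>, \<rho> \<noteq> \<delta>)) \<in> (cover A)\<^sup>*"
proof (induction "(b, \<beta>, \<rho>)" arbitrary: b \<beta> \<rho> rule: rtrancl_induct)
  case (step y)
  obtain c \<gamma>' \<delta>' where y: "y = (c, \<gamma>', \<delta>')" by (metis prod_cases3)
  obtain s where "A c b s" "\<beta> = (\<gamma>' \<noteq> (s = Neg))" "\<rho> = (\<not> \<delta>')" using step(2) unfolding y cover_def by blast
  moreover from this have "((c, \<gamma>' \<noteq> \<gamma>, \<delta>' \<noteq> \<delta>), (b, (\<gamma>' \<noteq> \<gamma>) \<noteq> (s = Neg), \<not> (\<delta>' \<noteq> \<delta>))) \<in> cover A"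
    by (intro cover_step)
  ultimately have "((c, \<gamma>' \<noteq> \<gamma>, \<delta>' \<noteq> \<delta>), (b, \<beta> \<noteq> \<gamma>, \<rho> \<noteq> \<delta>)) \<in> cover A"
    by (elim back_subst[where P = "\<lambda>z. (_, z) \<in> cover A"]) auto
  then show ?case using step(3)[OF y] by (rule rtrancl_into_rtrancl[rotated])
qed simp

lemma cover_rev:
  assumes "\<And>a b s. A a b s \<Longrightarrow> A b a s" "(p, q) \<in> (cover A)\<^sup>*"
  shows "(q, p) \<in> (cover A)\<^sup>*"
proof -
  have "(y, x) \<in> cover A" if "(x, y) \<in> cover A" for x y
  proof -
    obtain a b s \<alpha> \<pi> where *: "x = (a, \<alpha>, \<pi>)" "y = (b, \<alpha> \<noteq> (s = Neg), \<not> \<pi>)" "A a b s"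
      using \<open>(x, y) \<in> cover A\<close> unfolding cover_def by blast
    have "((b, \<alpha> \<noteq> (s = Neg), \<not> \<pi>), (a, (\<alpha> \<noteq> (s = Neg)) \<noteq> (s = Neg), \<not> \<not> \<pi>)) \<in> cover A"
      by (rule cover_step) (rule assms(1)[OF *(3)])
    moreover have "((\<alpha> \<noteq> (s = Neg)) \<noteq> (s = Neg)) = \<alpha>" by auto
    ultimately show ?thesis using * by simp
  qed
  then have "sym (cover A)" by (rule symI)
  then show ?thesis using assms(2) by (meson sym_rtrancl symD)
qed

lemma closed_walk_add:
  assumes "closed_walk A a (\<alpha>, \<pi>)" "closed_walk A a (\<beta>, \<rho>)"
  shows "closed_walk A a (\<alpha> \<noteq> \<beta>, \<pi> \<noteq> \<rho>)"
proof -
  have "((a, \<beta>, \<rho>), (a, \<alpha> \<noteq> \<beta>, \<pi> \<noteq> \<rho>)) \<in> (cover A)\<^sup>*"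
    using cover_shift[of a False False a \<alpha> \<pi> A \<beta> \<rho>] assms(1) unfolding closed_walk_def by simp
  with assms(2) show ?thesis unfolding closed_walk_def by (rule rtrancl_trans)
qed

text \<open>Going to \<open>b\<close>, around the closed walk and back to \<open>a\<close>
  conjugates its value, and the group is commutative.\<close>

lemma closed_walk_conj:
  assumes A: "\<And>a b s. A a b s \<Longrightarrow> A b a s" and ab: "((a, False, False), (b, h)) \<in> (cover A)\<^sup>*"
    and b: "closed_walk A b (\<alpha>, \<pi>)"
  shows "closed_walk A a (\<alpha>, \<pi>)"
proof -
  obtain \<gamma> \<delta> where h: "h = (\<gamma>, \<delta>)" by fastforce
  have 1: "((b, \<gamma>, \<delta>), (b, \<alpha> \<noteq> \<gamma>, \<pi> \<noteq> \<delta>)) \<in> (cover A)\<^sup>*"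
    using cover_shift[of b False False b \<alpha> \<pi> A \<gamma> \<delta>] b unfolding closed_walk_def by simp
  have "((b, \<gamma>, \<delta>), (a, False, False)) \<in> (cover A)\<^sup>*" using cover_rev[OF A ab] h by simp
  from cover_shift[OF this, of \<alpha> \<pi>]
  have 2: "((b, \<gamma> \<noteq> \<alpha>, \<delta> \<noteq> \<pi>), (a, \<alpha>, \<pi>)) \<in> (cover A)\<^sup>*" by simp
  have e: "(\<gamma> \<noteq> \<alpha>) = (\<alpha> \<noteq> \<gamma>)" "(\<delta> \<noteq> \<pi>) = (\<pi> \<noteq> \<delta>)" by auto
  show ?thesis unfolding closed_walk_def using ab[unfolded h] 1 2[unfolded e] by (meson rtrancl_trans)
qed

text \<open>Switching changes the sign of a walk only by the bits at its two ends, which cancel when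
  the walk is closed. Its length does not change.\<close>

lemma closed_walk_hom:
  assumes h: "\<And>a b s. A a b s \<Longrightarrow> template H s (h a) (h b)" and c: "closed_walk A a g"
  shows "closed_walk (adj H) (fst (h a)) g"
proof -
  have "((fst (h a), \<alpha> \<noteq> snd (h a), \<pi>), (fst (h b), \<beta> \<noteq> snd (h b), \<rho>)) \<in> (cover (adj H))\<^sup>*"
    if "((a, \<alpha>, \<pi>), (b, \<beta>, \<rho>)) \<in> (cover A)\<^sup>*" for b \<alpha> \<pi> \<beta> \<rho>
    using that
  proof (induction "(b, \<beta>, \<rho>)" arbitrary: b \<beta> \<rho> rule: rtrancl_induct)
    case (step y)
    obtain c \<gamma> \<delta> where y: "y = (c, \<gamma>, \<delta>)" by (metis prod_cases3)
    obtain s where s: "A c b s" "\<beta> = (\<gamma> \<noteq> (s = Neg))" "\<rho> = (\<not> \<delta>)" using step(2) unfolding y cover_def by blast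
    let ?s = "if snd (h c) = snd (h b) then s else flip s"
    have "adj H (fst (h c)) (fst (h b)) ?s" using h[OF s(1)] unfolding template_def adj_def .
    then have "((fst (h c), \<gamma> \<noteq> snd (h c), \<delta>), (fst (h b), (\<gamma> \<noteq> snd (h c)) \<noteq> (?s = Neg), \<not> \<delta>)) \<in> cover (adj H)"
      by (rule cover_step)
    moreover have "((\<gamma> \<noteq> snd (h c)) \<noteq> (?s = Neg)) = (\<beta> \<noteq> snd (h b))" using s(2) by (cases s) auto
    ultimately have "((fst (h c), \<gamma> \<noteq> snd (h c), \<delta>), (fst (h b), \<beta> \<noteq> snd (h b), \<rho>)) \<in> cover (adj H)"
      using s(3) by simp
    then show ?case using step(3)[OF y] by (rule rtrancl_into_rtrancl[rotated])
  qed simp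
  from this[of False False a "fst g" "snd g"] c
  have "((fst (h a), False \<noteq> snd (h a), False), (fst (h a), fst g \<noteq> snd (h a), snd g)) \<in> (cover (adj H))\<^sup>*"
    unfolding closed_walk_def by simp
  from cover_shift[OF this, of "snd (h a)" False] show ?thesis unfolding closed_walk_def
    by (cases "snd (h a)"; cases g) simp_all
qed

text \<open>\<open>val a\<close> is the value of some walk to \<open>a\<close> from a root chosen in
  its component. An edge together with the walks to its ends closes up, and its own length 1 turns
  the sum of the two parities into the equality in the second entry.\<close>

lemma potential:
  fixes A :: "'b \<Rightarrow> 'b \<Rightarrow> sign \<Rightarrow> bool"
  assumes A: "\<And>a b s. A a b s \<Longrightarrow> A b a s" and \<Gamma>: "\<And>a g. closed_walk A a g \<Longrightarrow> g \<in> \<Gamma>"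
  shows "\<exists>val :: 'b \<Rightarrow> bool \<times> bool. \<forall>a b s. A a b s \<longrightarrow>
    (fst (val a) \<noteq> (fst (val b) \<noteq> (s = Neg)), snd (val a) = snd (val b)) \<in> \<Gamma>"
proof -
  define reach where "reach a = {c. \<exists>g. ((c, False, False), (a, g)) \<in> (cover A)\<^sup>*}" for a
  define r where "r a = (SOME c. c \<in> reach a)" for a
  define val where "val a = (SOME g. ((r a, False, False), (a, g)) \<in> (cover A)\<^sup>*)" for a
  have "a \<in> reach a" for a unfolding reach_def by blast
  then have r: "r a \<in> reach a" for a unfolding r_def by (rule someI)
  have val: "((r a, False, False), (a, val a)) \<in> (cover A)\<^sup>*" for a
  proof -
    obtain g where "((r a, False, False), (a, g)) \<in> (cover A)\<^sup>*" using r[of a] unfolding reach_def by blast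
    then show ?thesis unfolding val_def by (rule someI[where P = "\<lambda>g. ((r a, False, False), (a, g)) \<in> (cover A)\<^sup>*"])
  qed
  have sub: "reach a \<subseteq> reach b" if "A a b s" for a b s
  proof
    fix c assume "c \<in> reach a"
    then obtain \<alpha> \<pi> where "((c, False, False), (a, \<alpha>, \<pi>)) \<in> (cover A)\<^sup>*" unfolding reach_def by auto
    then have "((c, False, False), (b, \<alpha> \<noteq> (s = Neg), \<not> \<pi>)) \<in> (cover A)\<^sup>*"
      using cover_step[of A, OF that] by (rule rtrancl_into_rtrancl)
    then show "c \<in> reach b" unfolding reach_def by blast
  qed
  show ?thesis
  proof (intro exI[of _ val] allI impI)
    fix a b s assume ab: "A a b s"
    have "reach a = reach b" using sub[OF ab] sub[OF A[OF ab]] by blast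
    then have rr: "r a = r b" unfolding r_def by simp
    obtain \<alpha> \<pi> \<beta> \<rho> where v: "val a = (\<alpha>, \<pi>)" "val b = (\<beta>, \<rho>)" by fastforce
    have "((b, \<beta>, \<rho>), (r a, False, False)) \<in> (cover A)\<^sup>*" using cover_rev[OF A val[of b]] v rr by simp
    moreover have "((r a, False, False), (b, \<alpha> \<noteq> (s = Neg), \<not> \<pi>)) \<in> (cover A)\<^sup>*"
      using val[of a] cover_step[of A, OF ab] unfolding v by (rule rtrancl_into_rtrancl)
    ultimately have "((b, \<beta>, \<rho>), (b, \<alpha> \<noteq> (s = Neg), \<not> \<pi>)) \<in> (cover A)\<^sup>*" by (rule rtrancl_trans)
    from cover_shift[OF this, of \<beta> \<rho>]
    have "closed_walk A b ((\<alpha> \<noteq> (s = Neg)) \<noteq> \<beta>, (\<not> \<pi>) \<noteq> \<rho>)" unfolding closed_walk_def by simp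
    from \<Gamma>[OF this] show "(fst (val a) \<noteq> (fst (val b) \<noteq> (s = Neg)), snd (val a) = snd (val b)) \<in> \<Gamma>"
      unfolding v by (elim back_subst[where P = "\<lambda>z. z \<in> \<Gamma>"]) auto
  qed
qed

section \<open>The walk group and the small targets\<close>

definition walk_group :: "'a sgraph \<Rightarrow> (bool \<times> bool) set" where
  "walk_group H = {g. \<exists>a. closed_walk (adj H) a g}"

definition double_loop :: "'a sgraph \<Rightarrow> bool" where
  "double_loop H \<longleftrightarrow> (\<exists>v. ({v}, Pos) \<in> edges H \<and> ({v}, Neg) \<in> edges H)"

text \<open>In each case a loopless graph that is definable from the template contains an odd closed walk.
  In the third case it is a graph on the negative arcs of the template.\<close>

definition hard :: "'a sgraph \<Rightarrow> bool" where
  "hard H \<longleftrightarrow> \<not> has_loop Neg H \<and> (True, True) \<in> walk_group H \<or> \<not> has_loop Pos H \<and> (False, True) \<in> walk_group H \<or>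
     \<not> has_negative_digon H \<and> \<not> double_loop H \<and> (True, False) \<in> walk_group H"

text \<open>Connectedness brings both walks to one base point. Since the empty walk is closed at
  every element of the type, nonzero values are assumed: they force the base points to be
  vertices.\<close>

lemma walk_group_add:
  assumes H: "signed_graph H" and conn: "sg_connected H"
    and g: "(\<alpha>, \<pi>) \<in> walk_group H" and h: "(\<beta>, \<rho>) \<in> walk_group H"
    and ne: "(\<alpha>, \<pi>) \<noteq> (False, False)" "(\<beta>, \<rho>) \<noteq> (False, False)"
  shows "(\<alpha> \<noteq> \<beta>, \<pi> \<noteq> \<rho>) \<in> walk_group H"
proof -
  obtain a b where ab: "closed_walk (adj H) a (\<alpha>, \<pi>)" "closed_walk (adj H) b (\<beta>, \<rho>)"
    using g h unfolding walk_group_def by blast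
  have vert: "c \<in> verts H" if "closed_walk (adj H) c k" "k \<noteq> (False, False)" for c k
  proof -
    have "((c, False, False), (c, k)) \<in> (cover (adj H))\<^sup>*" "(c, False, False) \<noteq> (c, k)"
      using that unfolding closed_walk_def by auto
    then obtain y where "((c, False, False), y) \<in> cover (adj H)" by (meson converse_rtranclE)
    then obtain d s where "adj H c d s" unfolding cover_def by blast
    then show ?thesis using signed_graphD[OF H] unfolding adj_def by blast
  qed
  have "(a, b) \<in> {(x, y). \<exists>s. ({x, y}, s) \<in> edges H}\<^sup>*"
    using conn vert ab ne unfolding sg_connected_def by blast
  then have "\<exists>h. ((a, False, False), (b, h)) \<in> (cover (adj H))\<^sup>*"
  proof (induction rule: rtrancl_induct)
    case (step y z)
    then obtain \<gamma> \<delta> s where "((a, False, False), (y, \<gamma>, \<delta>)) \<in> (cover (adj H))\<^sup>*" "adj H y z s"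
      unfolding adj_def by auto
    then show ?case using cover_step[of "adj H" y z s \<gamma> \<delta>] by (meson rtrancl_into_rtrancl)
  qed blast
  then have "closed_walk (adj H) a (\<beta>, \<rho>)" using closed_walk_conj[OF adj_sym _ ab(2)] by blast
  then show ?thesis using closed_walk_add[OF ab(1)] unfolding walk_group_def by blast
qed

lemma template_simps: "template H s (a, \<alpha>) (b, \<beta>) \<longleftrightarrow> ({a, b}, if \<alpha> = \<beta> then s else flip s) \<in> edges H"
  by (simp add: template_def)

lemma loop_walk_group:
  "({v}, Pos) \<in> edges H \<Longrightarrow> (False, True) \<in> walk_group H" "({v}, Neg) \<in> edges H \<Longrightarrow> (True, True) \<in> walk_group H"
  using cover_step[of "adj H" v v Pos False False] cover_step[of "adj H" v v Neg False False]
  unfolding walk_group_def closed_walk_def by (auto simp: adj_def)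

text \<open>\<open>S\<close> is two loops at one vertex, a negative loop, a positive loop, a
  negative digon or a single edge, according to \<Gamma>. The map is computed from a potential,
  which is determined along edges up to \<Gamma>.\<close>

lemma easy_target:
  fixes H :: "'a sgraph"
  assumes H: "signed_graph H" and conn: "sg_connected H"
    and not3: "\<not> (has_negative_digon H \<and> has_loop Pos H \<and> has_loop Neg H)"
    and easy: "\<not> hard H" and ne: "edges H \<noteq> {}"
  obtains S where "signed_subgraph S H" "card (edges S) \<le> 2"
    "\<forall>A :: 'b \<Rightarrow> 'b \<Rightarrow> sign \<Rightarrow> bool. (\<forall>a b s. A a b s \<longrightarrow> A b a s) \<longrightarrow> (\<forall>a g. closed_walk A a g \<longrightarrow> g \<in> walk_group H) \<longrightarrow>
      (\<exists>h. (\<forall>a. fst (h a) \<in> verts S) \<and> (\<forall>a b s. A a b s \<longrightarrow> template S s (h a) (h b)))"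
proof -
  let ?\<Gamma> = "walk_group H"
  have edgeV: "x \<in> verts H" "y \<in> verts H" if "({x, y}, s) \<in> edges H" for x y s
    using signed_graphD[OF H that] .
  have add: "(\<alpha> \<noteq> \<beta>, \<pi> \<noteq> \<rho>) \<in> ?\<Gamma>" if "(\<alpha>, \<pi>) \<in> ?\<Gamma>" "(\<beta>, \<rho>) \<in> ?\<Gamma>" "\<alpha> \<or> \<pi>" "\<beta> \<or> \<rho>" for \<alpha> \<pi> \<beta> \<rho>
    using walk_group_add[OF H conn that(1,2)] that(3,4) by auto
  consider (dl) "double_loop H" | (mm) "\<not> double_loop H" "(True, True) \<in> ?\<Gamma>" | (pp) "\<not> double_loop H" "(True, True) \<notin> ?\<Gamma>" "(False, True) \<in> ?\<Gamma>"
    | (dg) "\<not> double_loop H" "(True, True) \<notin> ?\<Gamma>" "(False, True) \<notin> ?\<Gamma>" "(True, False) \<in> ?\<Gamma>"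
    | (tr) "(True, True) \<notin> ?\<Gamma>" "(False, True) \<notin> ?\<Gamma>" "(True, False) \<notin> ?\<Gamma>" by blast
  then show ?thesis
  proof cases
    case dl
    then obtain v where v: "({v}, Pos) \<in> edges H" "({v}, Neg) \<in> edges H" unfolding double_loop_def by blast
    let ?S = "\<lparr>verts = {v}, edges = {({v}, Pos), ({v}, Neg)}\<rparr>"
    show ?thesis
    proof (rule that[of ?S]; (intro allI impI)?)
      show "signed_subgraph ?S H" using v edgeV[of v v] unfolding signed_subgraph_def signed_graph_def by auto
      fix A :: "'b \<Rightarrow> 'b \<Rightarrow> sign \<Rightarrow> bool"
      have "template ?S s (v, False) (v, False)" for s by (cases s) (simp_all add: template_simps)
      then show "\<exists>h. (\<forall>a. fst (h a) \<in> verts ?S) \<and> (\<forall>a b s. A a b s \<longrightarrow> template ?S s (h a) (h b))"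
        by (intro exI[of _ "\<lambda>_. (v, False)"]) simp
    qed simp
  next
    case mm
    \<comment> \<open>A second nonzero element would generate the whole group. As \<open>H\<close>
      is not hard, it would then have a negative loop, a positive loop and a negative digon.\<close>
    have no: "(False, True) \<notin> ?\<Gamma>" "(True, False) \<notin> ?\<Gamma>"
      using mm easy not3 add[of True True False True] add[of True True True False] unfolding hard_def by auto
    obtain v where v: "({v}, Neg) \<in> edges H" using mm easy unfolding hard_def has_loop_def by blast
    let ?S = "\<lparr>verts = {v}, edges = {({v}, Neg)}\<rparr>"
    show ?thesis
    proof (rule that[of ?S]; (intro allI impI)?)
      show "signed_subgraph ?S H" using v edgeV[of v v] unfolding signed_subgraph_def signed_graph_def by auto
      fix A :: "'b \<Rightarrow> 'b \<Rightarrow> sign \<Rightarrow> bool"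
      assume A: "\<forall>a b s. A a b s \<longrightarrow> A b a s" "\<forall>a g. closed_walk A a g \<longrightarrow> g \<in> ?\<Gamma>"
      have "\<exists>val :: 'b \<Rightarrow> bool \<times> bool. \<forall>a b s. A a b s \<longrightarrow> (fst (val a) \<noteq> (fst (val b) \<noteq> (s = Neg)), snd (val a) = snd (val b)) \<in> ?\<Gamma>"
        by (rule potential) (use A in blast)+
      then obtain val :: "'b \<Rightarrow> bool \<times> bool" where val: "\<And>a b s. A a b s \<Longrightarrow> (fst (val a) \<noteq> (fst (val b) \<noteq> (s = Neg)), snd (val a) = snd (val b)) \<in> ?\<Gamma>"
        by blast
      \<comment> \<open>Sign plus parity vanishes on \<Gamma>, so along an edge this sum changes as
        the edge prescribes: switching by it makes every edge negative.\<close>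
      have "template ?S s (v, fst (val a) \<noteq> snd (val a)) (v, fst (val b) \<noteq> snd (val b))" if "A a b s" for a b s
        using val[OF that] no by (cases s; cases "fst (val a)"; cases "snd (val a)"; cases "fst (val b)"; cases "snd (val b)") (simp_all add: template_simps)
      then show "\<exists>h. (\<forall>a. fst (h a) \<in> verts ?S) \<and> (\<forall>a b s. A a b s \<longrightarrow> template ?S s (h a) (h b))"
        by (intro exI[of _ "\<lambda>a. (v, fst (val a) \<noteq> snd (val a))"]) simp
    qed simp
  next
    case pp
    have no: "(True, False) \<notin> ?\<Gamma>"
      using pp easy not3 add[of False True True False] unfolding hard_def by auto
    obtain v where v: "({v}, Pos) \<in> edges H" using pp easy unfolding hard_def has_loop_def by blast
    let ?S = "\<lparr>verts = {v}, edges = {({v}, Pos)}\<rparr>"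
    show ?thesis
    proof (rule that[of ?S]; (intro allI impI)?)
      show "signed_subgraph ?S H" using v edgeV[of v v] unfolding signed_subgraph_def signed_graph_def by auto
      fix A :: "'b \<Rightarrow> 'b \<Rightarrow> sign \<Rightarrow> bool"
      assume A: "\<forall>a b s. A a b s \<longrightarrow> A b a s" "\<forall>a g. closed_walk A a g \<longrightarrow> g \<in> ?\<Gamma>"
      have "\<exists>val :: 'b \<Rightarrow> bool \<times> bool. \<forall>a b s. A a b s \<longrightarrow> (fst (val a) \<noteq> (fst (val b) \<noteq> (s = Neg)), snd (val a) = snd (val b)) \<in> ?\<Gamma>"
        by (rule potential) (use A in blast)+
      then obtain val :: "'b \<Rightarrow> bool \<times> bool" where val: "\<And>a b s. A a b s \<Longrightarrow> (fst (val a) \<noteq> (fst (val b) \<noteq> (s = Neg)), snd (val a) = snd (val b)) \<in> ?\<Gamma>"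
        by blast
      have "template ?S s (v, fst (val a)) (v, fst (val b))" if "A a b s" for a b s
        using val[OF that] no pp by (cases s; cases "fst (val a)"; cases "snd (val a)"; cases "fst (val b)"; cases "snd (val b)") (simp_all add: template_simps)
      then show "\<exists>h. (\<forall>a. fst (h a) \<in> verts ?S) \<and> (\<forall>a b s. A a b s \<longrightarrow> template ?S s (h a) (h b))"
        by (intro exI[of _ "\<lambda>a. (v, fst (val a))"]) simp
    qed simp
  next
    case dg
    then obtain p q where pq: "p \<noteq> q" "({p, q}, Pos) \<in> edges H" "({p, q}, Neg) \<in> edges H"
      using easy unfolding hard_def has_negative_digon_def by blast
    let ?S = "\<lparr>verts = {p, q}, edges = {({p, q}, Pos), ({p, q}, Neg)}\<rparr>"
    show ?thesis
    proof (rule that[of ?S]; (intro allI impI)?)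
      show "signed_subgraph ?S H" using pq edgeV[of p q] unfolding signed_subgraph_def signed_graph_def by auto
      fix A :: "'b \<Rightarrow> 'b \<Rightarrow> sign \<Rightarrow> bool"
      assume A: "\<forall>a b s. A a b s \<longrightarrow> A b a s" "\<forall>a g. closed_walk A a g \<longrightarrow> g \<in> ?\<Gamma>"
      have "\<exists>val :: 'b \<Rightarrow> bool \<times> bool. \<forall>a b s. A a b s \<longrightarrow> (fst (val a) \<noteq> (fst (val b) \<noteq> (s = Neg)), snd (val a) = snd (val b)) \<in> ?\<Gamma>"
        by (rule potential) (use A in blast)+
      then obtain val :: "'b \<Rightarrow> bool \<times> bool" where val: "\<And>a b s. A a b s \<Longrightarrow> (fst (val a) \<noteq> (fst (val b) \<noteq> (s = Neg)), snd (val a) = snd (val b)) \<in> ?\<Gamma>"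
        by blast
      have "template ?S s (if snd (val a) then p else q, False) (if snd (val b) then p else q, False)" if "A a b s" for a b s
        using val[OF that] dg by (cases s; cases "fst (val a)"; cases "snd (val a)"; cases "fst (val b)"; cases "snd (val b)") (simp_all add: template_simps insert_commute)
      then show "\<exists>h. (\<forall>a. fst (h a) \<in> verts ?S) \<and> (\<forall>a b s. A a b s \<longrightarrow> template ?S s (h a) (h b))"
        by (intro exI[of _ "\<lambda>a. (if snd (val a) then p else q, False)"]) simp
    qed simp
  next
    case tr
    obtain e s0 where "(e, s0) \<in> edges H" using ne by auto
    moreover from this obtain p q where "e = {p, q}" using H unfolding signed_graph_def by blast
    ultimately have pq: "({p, q}, s0) \<in> edges H" by simp
    have "p \<noteq> q" using pq loop_walk_group[of p H] tr by (cases s0) auto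
    let ?S = "\<lparr>verts = {p, q}, edges = {({p, q}, s0)}\<rparr>"
    show ?thesis
    proof (rule that[of ?S]; (intro allI impI)?)
      show "signed_subgraph ?S H" using pq edgeV[of p q] unfolding signed_subgraph_def signed_graph_def by auto
      fix A :: "'b \<Rightarrow> 'b \<Rightarrow> sign \<Rightarrow> bool"
      assume A: "\<forall>a b s. A a b s \<longrightarrow> A b a s" "\<forall>a g. closed_walk A a g \<longrightarrow> g \<in> ?\<Gamma>"
      have "\<exists>val :: 'b \<Rightarrow> bool \<times> bool. \<forall>a b s. A a b s \<longrightarrow> (fst (val a) \<noteq> (fst (val b) \<noteq> (s = Neg)), snd (val a) = snd (val b)) \<in> ?\<Gamma>"
        by (rule potential) (use A in blast)+
      then obtain val :: "'b \<Rightarrow> bool \<times> bool" where val: "\<And>a b s. A a b s \<Longrightarrow> (fst (val a) \<noteq> (fst (val b) \<noteq> (s = Neg)), snd (val a) = snd (val b)) \<in> ?\<Gamma>"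
        by blast
      \<comment> \<open>The parity selects the end. Exactly one end of each edge has odd parity, so
        the correction for the sign of the target edge enters once per edge.\<close>
      let ?h = "\<lambda>a. (if snd (val a) then p else q, fst (val a) \<noteq> (snd (val a) \<and> s0 = Neg))"
      have "template ?S s (?h a) (?h b)" if "A a b s" for a b s
        using val[OF that] tr by (cases s; cases s0; cases "fst (val a)"; cases "snd (val a)"; cases "fst (val b)"; cases "snd (val b)") (simp_all add: template_simps insert_commute)
      then show "\<exists>h. (\<forall>a. fst (h a) \<in> verts ?S) \<and> (\<forall>a b s. A a b s \<longrightarrow> template ?S s (h a) (h b))"
        by (intro exI[of _ ?h]) simp
    qed simp
  qed
qed

section \<open>Dichotomy\<close>

text \<open>A walk lifts to edges of the one colour \<open>t\<close> of the template: the switching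
  bit changes at each edge whose sign is not \<open>t\<close>. Over the whole walk it changes by the
  sign, plus the parity of the length if \<open>t\<close> is negative. A closed walk of value
  \<open>(t = Neg, True)\<close> therefore lifts to an odd closed walk.\<close>

lemma template_walk:
  assumes "((a, \<alpha>, \<pi>), (b, \<beta>, \<rho>)) \<in> (cover (adj H))\<^sup>*"
  shows "\<exists>k. (odd k \<longleftrightarrow> \<pi> \<noteq> \<rho>) \<and>
    ((a, \<sigma>), (b, \<sigma> \<noteq> ((\<alpha> \<noteq> \<beta>) \<noteq> (t = Neg \<and> \<pi> \<noteq> \<rho>)))) \<in> {(p, q). template H t p q} ^^ k"
  using assms
proof (induction "(b, \<beta>, \<rho>)" arbitrary: b \<beta> \<rho> rule: rtrancl_induct)
  case base
  show ?case by (rule exI[of _ 0]) simp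
next
  case (step y)
  obtain c \<gamma> \<delta> where y: "y = (c, \<gamma>, \<delta>)" by (metis prod_cases3)
  obtain s where s: "adj H c b s" "\<beta> = (\<gamma> \<noteq> (s = Neg))" "\<rho> = (\<not> \<delta>)" using step(2) unfolding y cover_def by blast
  let ?\<tau> = "\<sigma> \<noteq> ((\<alpha> \<noteq> \<gamma>) \<noteq> (t = Neg \<and> \<pi> \<noteq> \<delta>))"
  let ?\<tau>' = "\<sigma> \<noteq> ((\<alpha> \<noteq> \<beta>) \<noteq> (t = Neg \<and> \<pi> \<noteq> \<rho>))"
  obtain k where k: "odd k \<longleftrightarrow> \<pi> \<noteq> \<delta>" "((a, \<sigma>), (c, ?\<tau>)) \<in> {(p, q). template H t p q} ^^ k"
    using step(3)[OF y] by blast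
  have "(?\<tau> = ?\<tau>') = (s = t)" unfolding s(2,3) by (cases s; cases t) auto
  moreover have "flip t = s" if "s \<noteq> t" using that by (cases s; cases t) auto
  ultimately have "template H t (c, ?\<tau>) (b, ?\<tau>')" using s(1) unfolding template_simps adj_def by (cases "s = t") auto
  then have "((a, \<sigma>), (b, ?\<tau>')) \<in> {(p, q). template H t p q} ^^ Suc k" using k(2) by auto
  moreover have "odd (Suc k) \<longleftrightarrow> \<pi> \<noteq> \<rho>" using k(1) s(3) by auto
  ultimately show ?case by blast
qed

lemma template_sym: "template H s p q \<Longrightarrow> template H s q p"
  unfolding template_def by (auto simp: insert_commute)

lemma template_Pos: "template H Pos p q \<longleftrightarrow> template H Neg p (fst q, \<not> snd q)"
  by (cases p; cases q) (auto simp: template_simps)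

lemma template_flip: "template H s (a, \<not> \<alpha>) (b, \<not> \<beta>) \<longleftrightarrow> template H s (a, \<alpha>) (b, \<beta>)"
  by (simp add: template_simps)

lemma template_verts: "signed_graph H \<Longrightarrow> template H s p q \<Longrightarrow> p \<in> verts H \<times> UNIV \<and> q \<in> verts H \<times> UNIV"
  using signed_graphD unfolding template_def by (fastforce simp: mem_Times_iff)

text \<open>For a missing loop of sign \<open>t\<close> the graph is formed by the
  \<open>t\<close>-coloured edges of the template: its loops are the loops of sign \<open>t\<close>
  in \<open>H\<close>. For a missing digon the given closed walk is even, and a graph on arcs is
  needed.\<close>

lemma hard_essentially_unary:
  fixes H :: "'a sgraph"
  assumes H: "signed_graph H" and dec: "bij_betw dec {..<D} (verts H \<times> (UNIV :: bool set))" and hard: "hard H"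
  shows "essentially_unary D (\<lambda>s i j. i < D \<and> j < D \<and> template H s (dec i) (dec j))" (is "essentially_unary D ?K")
proof -
  let ?V = "verts H \<times> (UNIV :: bool set)"
  define enc where "enc = inv_into {..<D} dec"
  have enc: "enc p < D" "dec (enc p) = p" if "p \<in> ?V" for p
  proof -
    have "p \<in> dec ` {..<D}" using that dec by (auto simp: bij_betw_def)
    then show "enc p < D" "dec (enc p) = p"
      unfolding enc_def using inv_into_into[of p dec "{..<D}"] by (auto simp: f_inv_into_f)
  qed
  have decV: "dec i \<in> ?V" if "i < D" for i using bij_betwE[OF dec] that by blast
  have fin: "finite ?V" using H by (simp add: signed_graph_def)
  define act where "act f x = dec (f (\<lambda>i. enc (x i)))" for f and x :: "nat \<Rightarrow> 'a \<times> bool"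
  have actV: "act f x \<in> ?V" if "f \<in> ops D ?K" for f x
    unfolding act_def using that by (intro decV) (simp add: ops_def)
  have actT: "template H s (act f x) (act f y)" if f: "f \<in> ops D ?K" and xy: "\<And>i. template H s (x i) (y i)" for f s x y
  proof -
    have "x i \<in> ?V" "y i \<in> ?V" for i using template_verts[OF H xy[of i]] by blast+
    then have e: "\<forall>i. ?K s (enc (x i)) (enc (y i))" using enc xy by simp
    have *: "\<forall>s x y. (\<forall>i. ?K s (x i) (y i)) \<longrightarrow> ?K s (f x) (f y)"
      using f unfolding ops_def mem_Collect_eq by (elim conjE)
    from spec[OF spec[OF spec[OF *, of s], of "\<lambda>i. enc (x i)"], of "\<lambda>i. enc (y i)"] e
    have "?K s (f (\<lambda>i. enc (x i))) (f (\<lambda>i. enc (y i)))" by (rule mp)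
    then show ?thesis unfolding act_def by blast
  qed
  have minor: "act (op_minor \<pi> f) x = act f (\<lambda>i. x (\<pi> i))" for \<pi> f x by (simp add: act_def op_minor_def)
  have dep: "act f x = act f y" if "op_dep f I" "\<forall>i\<in>I. x i = y i" for f I x y
  proof -
    have "\<forall>i\<in>I. enc (x i) = enc (y i)" using that(2) by simp
    with spec[OF spec[OF that(1)[unfolded op_dep_def], of "\<lambda>i. enc (x i)"], of "\<lambda>i. enc (y i)"]
    have "f (\<lambda>i. enc (x i)) = f (\<lambda>i. enc (y i))" by (rule mp)
    then show ?thesis by (simp add: act_def)
  qed
  note lab = minion.labelling_nonbipartite[OF minion_ops, of _ _ _ _ D ?K, folded essentially_unary_def]
  have loop: "essentially_unary D ?K" if t: "\<not> has_loop t H" "(t = Neg, True) \<in> walk_group H" for t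
  proof -
    let ?E = "{(p, q). template H t p q}"
    obtain a where "((a, False, False), (a, t = Neg, True)) \<in> (cover (adj H))\<^sup>*"
      using t(2) unfolding walk_group_def closed_walk_def by blast
    from template_walk[OF this, of False t] obtain k where k: "odd k" "((a, False), (a, False)) \<in> ?E ^^ k" by auto
    have G: "ugraph ?V ?E"
      unfolding ugraph_def sym_def irrefl_def using fin template_verts[OF H] template_sym[of H t] t(1)
      by (fastforce simp: has_loop_def template_def)
    have "minion.acts (ops D ?K) op_minor op_dep act ?V ?E"
      unfolding minion.acts_def[OF minion_ops] using actV actT minor dep by simp
    then show ?thesis by (rule lab[OF G k(2,1)])
  qed
  consider "\<not> has_loop Neg H" "(True, True) \<in> walk_group H" | "\<not> has_loop Pos H" "(False, True) \<in> walk_group H"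
    | (dg) "\<not> has_negative_digon H" "\<not> double_loop H" "(True, False) \<in> walk_group H"
    using hard unfolding hard_def by blast
  then show ?thesis
  proof cases
    case dg
    let ?E = "{(p, q). template H Neg p q}"
    \<comment> \<open>Two negative arcs are adjacent if positive edges join the tail of each to the
      head of the other. A loop would be an arc with both a positive and a negative edge between its
      ends, hence a negative digon or two loops at one vertex of \<open>H\<close>.\<close>
    let ?F = "{((x1, x2), (y1, y2)). template H Neg x1 x2 \<and> template H Neg y1 y2 \<and> template H Pos x1 y2 \<and> template H Pos y1 x2}"
    define \<iota> where "\<iota> p = (fst p, \<not> snd p)" for p :: "'a \<times> bool"
    have \<iota>\<iota>: "\<iota> (\<iota> p) = p" for p by (simp add: \<iota>_def)
    have P: "template H Pos p q \<longleftrightarrow> template H Neg p (\<iota> q)" for p q unfolding \<iota>_def by (rule template_Pos)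
    have I: "template H s (\<iota> p) (\<iota> q) \<longleftrightarrow> template H s p q" for s p q
      unfolding \<iota>_def using template_flip[of H s "fst p" "snd p" "fst q" "snd q"] by simp
    have P': "template H Pos (\<iota> p) q \<longleftrightarrow> template H Neg p q" for p q using P[of "\<iota> p" q] I by simp
    note simps = P P' I \<iota>\<iota>
    have F1: "((x1, x2), (\<iota> z, \<iota> x2)) \<in> ?F" if "template H Neg x1 x2" "template H Neg z x2" for x1 x2 z
      using that by (simp add: simps)
    have F2: "((x1, x2), (\<iota> x1, \<iota> w)) \<in> ?F" if "template H Neg x1 x2" "template H Neg x1 w" for x1 x2 w
      using that by (simp add: simps)
    obtain a where "((a, False, False), (a, True, False)) \<in> (cover (adj H))\<^sup>*"
      using dg(3) unfolding walk_group_def closed_walk_def by blast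
    from template_walk[OF this, of False Neg] obtain k where k: "even k" "((a, False), (a, True)) \<in> ?E ^^ k" by auto
    let ?x = "(a, False)"
    have "k \<noteq> 0" using k(2) by (intro notI) simp
    then obtain k' where "k = Suc k'" by (cases k) auto
    then obtain w where w: "template H Neg ?x w" using relpow_Suc_D2[of ?x "(a, True)" k' ?E] k(2) by blast
    \<comment> \<open>Two steps of \<open>F\<close> carry the arc \<open>(v1, u)\<close> through
      \<open>(\<iota> v1, \<iota> v)\<close> to \<open>(z, v)\<close> while the walk goes from
      \<open>v1\<close> over \<open>v\<close> to \<open>z\<close>. So an even walk lifts to arcs
      with the same length; as it ends at the switched copy of its start, an odd number of further
      steps closes it.\<close>
    have walk: "\<exists>u. template H Neg z u \<and> ((?x, w), (z, u)) \<in> ?F ^^ (2 * m)" if "(?x, z) \<in> ?E ^^ (2 * m)" for m z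
      using that
    proof (induction m arbitrary: z)
      case 0
      then have "z = ?x" by simp
      then show ?case using w by (intro exI[of _ w]) simp
    next
      case (Suc m)
      then obtain v1 v where v: "(?x, v1) \<in> ?E ^^ (2 * m)" "template H Neg v1 v" "template H Neg v z" by auto
      obtain u where u: "template H Neg v1 u" "((?x, w), (v1, u)) \<in> ?F ^^ (2 * m)" using Suc.IH[OF v(1)] by blast
      have "((v1, u), (\<iota> v1, \<iota> v)) \<in> ?F" by (rule F2) (rule u v)+
      moreover have "((\<iota> v1, \<iota> v), (\<iota> (\<iota> z), \<iota> (\<iota> v))) \<in> ?F"
        by (rule F1) (use v template_sym[of H Neg v z] in \<open>simp_all add: simps\<close>)
      ultimately have "((?x, w), (z, v)) \<in> ?F ^^ Suc (Suc (2 * m))" using u(2) unfolding \<iota>\<iota> by (meson relpow_Suc_I)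
      moreover have "2 * Suc m = Suc (Suc (2 * m))" by simp
      ultimately show ?case using template_sym[OF v(3)] by (intro exI[of _ v]) (simp only:)
    qed
    obtain m where m: "k = 2 * m" using k(1) by blast
    have \<iota>x: "(a, True) = \<iota> ?x" by (simp add: \<iota>_def)
    obtain u where u: "template H Neg (\<iota> ?x) u" "((?x, w), (\<iota> ?x, u)) \<in> ?F ^^ k"
      using walk[of "\<iota> ?x" m] k(2) unfolding m \<iota>x by blast
    have "((\<iota> ?x, u), (\<iota> (\<iota> ?x), \<iota> (\<iota> w))) \<in> ?F" by (rule F2) (use u w in \<open>simp_all add: simps\<close>)
    moreover have "((?x, w), (\<iota> ?x, \<iota> w)) \<in> ?F" by (rule F2) (rule w)+
    moreover have "((\<iota> ?x, \<iota> w), (?x, w)) \<in> ?F" using w by (simp add: simps)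
    ultimately have closed: "((?x, w), (?x, w)) \<in> ?F ^^ Suc (Suc (Suc k))" using u(2) unfolding \<iota>\<iota> by (meson relpow_Suc_I)
    have odd: "odd (Suc (Suc (Suc k)))" using k(1) by simp
    have G: "ugraph (?V \<times> ?V) ?F"
    proof -
      have "irrefl ?F"
      proof (rule irreflI)
        fix X show "(X, X) \<notin> ?F"
        proof
          assume "(X, X) \<in> ?F"
          then obtain p q where "template H Neg p q" "template H Pos p q" by auto
          then have "({fst p, fst q}, Pos) \<in> edges H \<and> ({fst p, fst q}, Neg) \<in> edges H"
            unfolding template_def by (cases "snd p = snd q") auto
          then show False using dg(1,2) unfolding has_negative_digon_def double_loop_def
            by (cases "fst p = fst q") auto
        qed
      qed
      moreover have "sym ?F" by (rule symI) auto
      moreover have "?F \<subseteq> (?V \<times> ?V) \<times> (?V \<times> ?V)" using template_verts[OF H] by (fastforce simp: mem_Times_iff)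
      ultimately show ?thesis using fin unfolding ugraph_def by blast
    qed
    have "minion.acts (ops D ?K) op_minor op_dep (\<lambda>f x. (act f (fst \<circ> x), act f (snd \<circ> x))) (?V \<times> ?V) ?F"
      unfolding minion.acts_def[OF minion_ops]
    proof (intro ballI conjI allI impI)
      fix f and x y :: "nat \<Rightarrow> ('a \<times> bool) \<times> 'a \<times> bool"
      assume f: "f \<in> ops D ?K" and F: "\<forall>i. (x i, y i) \<in> ?F"
      have "template H Neg ((fst \<circ> x) i) ((snd \<circ> x) i)" "template H Neg ((fst \<circ> y) i) ((snd \<circ> y) i)"
        "template H Pos ((fst \<circ> x) i) ((snd \<circ> y) i)" "template H Pos ((fst \<circ> y) i) ((snd \<circ> x) i)" for i
        using spec[OF F, of i] by (auto simp: case_prod_beta)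
      then show "((act f (fst \<circ> x), act f (snd \<circ> x)), (act f (fst \<circ> y), act f (snd \<circ> y))) \<in> ?F"
        using actT[OF f] by simp
    next
      fix f \<pi> and x :: "nat \<Rightarrow> ('a \<times> bool) \<times> 'a \<times> bool"
      show "(act (op_minor \<pi> f) (fst \<circ> x), act (op_minor \<pi> f) (snd \<circ> x)) = (act f (fst \<circ> (\<lambda>i. x (\<pi> i))), act f (snd \<circ> (\<lambda>i. x (\<pi> i))))"
        by (simp add: minor comp_def)
    next
      fix f I and x y :: "nat \<Rightarrow> ('a \<times> bool) \<times> 'a \<times> bool"
      assume "op_dep f I" "\<forall>i\<in>I. x i = y i"
      then show "(act f (fst \<circ> x), act f (snd \<circ> x)) = (act f (fst \<circ> y), act f (snd \<circ> y))"
        using dep[of f I "fst \<circ> x" "fst \<circ> y"] dep[of f I "snd \<circ> x" "snd \<circ> y"] by simp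
    qed (use actV in simp)
    then show ?thesis by (rule lab[OF G closed odd])
  qed (use loop[of Neg] loop[of Pos] in simp_all)
qed

text \<open>If a linear functional of sign and parity is the difference of a potential along every
  edge, it vanishes on closed walks. The pairs \<open>(p, q)\<close> give bipartite graphs, balanced
  graphs, and graphs balanced after reversing all signs.\<close>

lemma closed_walk_potential:
  fixes val :: "'b \<Rightarrow> bool"
  assumes val: "\<And>a b s. A a b s \<Longrightarrow> (val a \<noteq> val b) = ((p \<and> s = Neg) \<noteq> q)" and c: "closed_walk A a (\<alpha>, \<pi>)"
  shows "(p \<and> \<alpha>) = (q \<and> \<pi>)"
proof -
  have "(val a \<noteq> val b) = ((p \<and> \<beta>) \<noteq> (q \<and> \<rho>))" if "((a, False, False), (b, \<beta>, \<rho>)) \<in> (cover A)\<^sup>*" for b \<beta> \<rho>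
    using that
  proof (induction "(b, \<beta>, \<rho>)" arbitrary: b \<beta> \<rho> rule: rtrancl_induct)
    case (step y)
    obtain c \<gamma> \<delta> where y: "y = (c, \<gamma>, \<delta>)" by (metis prod_cases3)
    obtain s where s: "A c b s" "\<beta> = (\<gamma> \<noteq> (s = Neg))" "\<rho> = (\<not> \<delta>)" using step(2) unfolding y cover_def by blast
    show ?case using val[OF s(1)] step(3)[OF y] s(2,3) by blast
  qed simp
  from this[of a \<alpha> \<pi>] c show ?thesis unfolding closed_walk_def by blast
qed

text \<open>Unless the edges have the same ends, one of them has an end outside the other, where the
  value can be chosen last.\<close>

lemma two_edge_potential:
  assumes "u = v \<Longrightarrow> \<not> w" "u' = v' \<Longrightarrow> \<not> w'" "{u, v} = {u', v'} \<Longrightarrow> w = w'"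
  shows "\<exists>val :: 'a \<Rightarrow> bool. (val u \<noteq> val v) = w \<and> (val u' \<noteq> val v') = w'"
proof -
  have extend: "\<exists>val :: 'a \<Rightarrow> bool. (val p \<noteq> val q) = t \<and> (val p' \<noteq> val q') = t'"
    if "p = q \<longrightarrow> \<not> t" "p' = q' \<longrightarrow> \<not> t'" "q' \<noteq> p" "q' \<noteq> q" for p q p' q' :: 'a and t t'
  proof -
    define f where "f x \<longleftrightarrow> x = q \<and> t" for x
    show ?thesis by (rule exI[of _ "f(q' := (f p' \<noteq> t'))"]) (use that in \<open>auto simp: f_def\<close>)
  qed
  consider "{u, v} = {u', v'}" | "v' \<noteq> u" "v' \<noteq> v" | "u' \<noteq> u" "u' \<noteq> v" | "v \<noteq> u'" "v \<noteq> v'" | "u \<noteq> u'" "u \<noteq> v'"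
    by blast
  then show ?thesis
  proof cases
    case 1
    then show ?thesis using assms by (intro exI[of _ "\<lambda>x. x = v \<and> w"]) (auto simp: doubleton_eq_iff)
  next
    case 2
    then show ?thesis using extend[of u v w u' v' w'] assms by blast
  next
    case 3
    then obtain val :: "'a \<Rightarrow> bool" where "(val u \<noteq> val v) = w \<and> (val v' \<noteq> val u') = w'" using extend[of u v w v' u' w'] assms by blast
    then show ?thesis by (intro exI[of _ val]) blast
  next
    case 4
    then obtain val :: "'a \<Rightarrow> bool" where "(val u' \<noteq> val v') = w' \<and> (val u \<noteq> val v) = w" using extend[of u' v' w' u v w] assms by blast
    then show ?thesis by (intro exI[of _ val]) blast
  next
    case 5
    then obtain val :: "'a \<Rightarrow> bool" where "(val u' \<noteq> val v') = w' \<and> (val v \<noteq> val u) = w" using extend[of u' v' w' v u w] assms by blast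
    then show ?thesis by (intro exI[of _ val]) blast
  qed
qed

lemma small_potential:
  assumes C: "signed_graph C" "card (edges C) \<le> 2"
    and loop: "\<And>v s. ({v}, s) \<in> edges C \<Longrightarrow> \<not> w s"
    and digon: "\<And>e. (e, Pos) \<in> edges C \<Longrightarrow> (e, Neg) \<in> edges C \<Longrightarrow> w Pos = w Neg"
  shows "\<exists>val :: 'a \<Rightarrow> bool. \<forall>a b s. adj C a b s \<longrightarrow> (val a \<noteq> val b) = w s"
proof (cases "edges C = {}")
  case True
  then show ?thesis by (simp add: adj_def)
next
  case False
  have ends: "\<exists>u v s. e = ({u, v}, s)" if "e \<in> edges C" for e
    using that C(1) unfolding signed_graph_def by (cases e) fastforce
  have "\<exists>e f. edges C = {e, f}"
  proof (cases "card (edges C) = 2")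
    case True
    then show ?thesis by (metis card_2_iff)
  next
    case ne: False
    have "card (edges C) \<noteq> 0" using False finite_edges[OF C(1)] by simp
    then have "card (edges C) = 1" using ne C(2) by linarith
    then show ?thesis by (metis card_1_singletonE insert_absorb2)
  qed
  then obtain e f where ef: "edges C = {e, f}" by blast
  obtain u v s u' v' s' where uv: "e = ({u, v}, s)" "f = ({u', v'}, s')" using ends ef by (metis insertI1 insertI2)
  have "\<exists>val :: 'a \<Rightarrow> bool. (val u \<noteq> val v) = w s \<and> (val u' \<noteq> val v') = w s'"
  proof (rule two_edge_potential)
    show "\<not> w s" if "u = v" using loop[of v s] that ef uv by simp
    show "\<not> w s'" if "u' = v'" using loop[of v' s'] that ef uv by simp
    show "w s = w s'" if "{u, v} = {u', v'}"
      using digon[of "{u, v}"] that ef uv by (cases s; cases s') simp_all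
  qed
  then obtain val :: "'a \<Rightarrow> bool" where val: "(val u \<noteq> val v) = w s" "(val u' \<noteq> val v') = w s'"
    by (elim exE conjE) (rule that)
  have "(val a \<noteq> val b) = w t" if "adj C a b t" for a b t
  proof -
    have "{a, b} = {u, v} \<and> t = s \<or> {a, b} = {u', v'} \<and> t = s'" using that ef uv unfolding adj_def by auto
    then show ?thesis using val unfolding doubleton_eq_iff by blast
  qed
  then show ?thesis by blast
qed

text \<open>With two edges a potential exists as soon as loops and parallel edges do not obstruct
  it. A closed walk that makes \<open>C\<close> hard must therefore use such edges, and two edges
  leave no room for them beside the missing loop or digon.\<close>

lemma small_not_hard:
  assumes C: "signed_graph C" "card (edges C) \<le> 2"
  shows "\<not> hard C"
proof
  assume "hard C"
  have two: "edges C = {e, f}" if "e \<in> edges C" "f \<in> edges C" "e \<noteq> f" for e f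
  proof -
    have "card {e, f} = 2" using that(3) by simp
    then show ?thesis using card_seteq[OF finite_edges[OF C(1)], of "{e, f}"] that C(2) by simp
  qed
  have bip: "\<not> \<pi>" if "\<And>v s. ({v}, s) \<notin> edges C" and gr: "(\<alpha>, \<pi>) \<in> walk_group C" for \<alpha> \<pi>
  proof -
    have "\<exists>val :: 'a \<Rightarrow> bool. \<forall>a b s. adj C a b s \<longrightarrow> (val a \<noteq> val b) = True"
      by (rule small_potential[OF C]) (use that(1) in blast)+
    then obtain val :: "'a \<Rightarrow> bool" where val: "\<forall>a b s. adj C a b s \<longrightarrow> (val a \<noteq> val b) = True"
      by (elim exE) (rule that)
    obtain a where a: "closed_walk (adj C) a (\<alpha>, \<pi>)" using gr unfolding walk_group_def by blast
    have "(False \<and> \<alpha>) = (True \<and> \<pi>)" by (rule closed_walk_potential[of "adj C" val, OF _ a]) (use val in blast)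
    then show ?thesis by simp
  qed
  have bal: "\<not> \<alpha>" if "\<And>v. ({v}, Neg) \<notin> edges C" "\<And>e. (e, Pos) \<in> edges C \<Longrightarrow> (e, Neg) \<notin> edges C" and gr: "(\<alpha>, \<pi>) \<in> walk_group C" for \<alpha> \<pi>
  proof -
    have "\<exists>val :: 'a \<Rightarrow> bool. \<forall>a b s. adj C a b s \<longrightarrow> (val a \<noteq> val b) = (s = Neg)"
      by (rule small_potential[OF C]) (use that in blast)+
    then obtain val :: "'a \<Rightarrow> bool" where val: "\<forall>a b s. adj C a b s \<longrightarrow> (val a \<noteq> val b) = (s = Neg)"
      by (elim exE) (rule that)
    obtain a where a: "closed_walk (adj C) a (\<alpha>, \<pi>)" using gr unfolding walk_group_def by blast
    have "(True \<and> \<alpha>) = (False \<and> \<pi>)" by (rule closed_walk_potential[of "adj C" val, OF _ a]) (use val in simp)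
    then show ?thesis by simp
  qed
  have anti: "\<alpha> = \<pi>" if "\<And>v. ({v}, Pos) \<notin> edges C" "\<And>e. (e, Pos) \<in> edges C \<Longrightarrow> (e, Neg) \<notin> edges C" and gr: "(\<alpha>, \<pi>) \<in> walk_group C" for \<alpha> \<pi>
  proof -
    have "\<exists>val :: 'a \<Rightarrow> bool. \<forall>a b s. adj C a b s \<longrightarrow> (val a \<noteq> val b) = (s \<noteq> Neg)"
      by (rule small_potential[OF C]) (metis that(1) sign.exhaust, use that(2) in blast)
    then obtain val :: "'a \<Rightarrow> bool" where val: "\<forall>a b s. adj C a b s \<longrightarrow> (val a \<noteq> val b) = (s \<noteq> Neg)"
      by (elim exE) (rule that)
    obtain a where a: "closed_walk (adj C) a (\<alpha>, \<pi>)" using gr unfolding walk_group_def by blast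
    have "(True \<and> \<alpha>) = (True \<and> \<pi>)" by (rule closed_walk_potential[of "adj C" val, OF _ a]) (use val in simp)
    then show ?thesis by simp
  qed
  have one: "e = {v}" if "({v}, s) \<in> edges C" "(e, Pos) \<in> edges C" "(e, Neg) \<in> edges C" for v s e
    using two[OF that(2,3)] that(1) by auto
  consider (nn) "\<not> has_loop Neg C" "(True, True) \<in> walk_group C" | (np) "\<not> has_loop Pos C" "(False, True) \<in> walk_group C"
    | (dg) "\<not> has_negative_digon C" "\<not> double_loop C" "(True, False) \<in> walk_group C"
    using \<open>hard C\<close> unfolding hard_def by blast
  then show False
  proof cases
    case nn
    then obtain v s where v: "({v}, s) \<in> edges C" using bip[of True True] by blast
    have "\<not> True" by (rule bal[OF _ _ nn(2)]) (use one[OF v] nn(1) in \<open>auto simp: has_loop_def\<close>)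
    then show ?thesis by simp
  next
    case np
    then obtain v s where v: "({v}, s) \<in> edges C" using bip[of False True] by blast
    have "False = True" by (rule anti[OF _ _ np(2)]) (use one[OF v] np(1) in \<open>auto simp: has_loop_def\<close>)
    then show ?thesis by simp
  next
    case dg
    have nodg: "(e, Neg) \<notin> edges C" if e: "(e, Pos) \<in> edges C" for e
    proof -
      obtain u v where "e = {u, v}" using C(1) e unfolding signed_graph_def by fastforce
      then show ?thesis using e dg(1,2) unfolding has_negative_digon_def double_loop_def by (cases "u = v") auto
    qed
    obtain u u' where u: "({u}, Pos) \<in> edges C" "({u'}, Neg) \<in> edges C"
      using bal[OF _ nodg dg(3)] anti[OF _ nodg dg(3)] by blast
    then have ne: "u \<noteq> u'" using nodg by blast
    \<comment> \<open>A positive and a negative loop at different vertices remain. They lie in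
      different components, as \<open>C\<close> is not assumed connected, so each walk uses only one
      of them and its value is not \<open>(True, False)\<close>.\<close>
    have E: "edges C = {({u}, Pos), ({u'}, Neg)}" using two[OF u] by simp
    obtain a where a: "((a, False, False), (a, True, False)) \<in> (cover (adj C))\<^sup>*"
      using dg(3) unfolding walk_group_def closed_walk_def by blast
    have "b = a \<and> (if a = u' then \<beta> = \<rho> else \<not> \<beta>)" if "((a, False, False), (b, \<beta>, \<rho>)) \<in> (cover (adj C))\<^sup>*" for b \<beta> \<rho>
      using that
    proof (induction "(b, \<beta>, \<rho>)" arbitrary: b \<beta> \<rho> rule: rtrancl_induct)
      case (step y)
      obtain c \<gamma> \<delta> where y: "y = (c, \<gamma>, \<delta>)" by (metis prod_cases3)
      obtain s where s: "adj C c b s" "\<beta> = (\<gamma> \<noteq> (s = Neg))" "\<rho> = (\<not> \<delta>)" using step(2) unfolding y cover_def by blast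
      have "c = b" "s = Neg \<longleftrightarrow> c = u'" using s(1) ne unfolding adj_def E by auto
      then show ?case using step(3)[OF y] s(2,3) by (auto split: if_splits)
    qed simp
    from this[OF a] show False by (simp split: if_splits)
  qed
qed

text \<open>The homomorphism carries closed walks of \<open>H\<close> to closed walks of
  \<open>C\<close> with the same value, and a subgraph has no new loops or digons.\<close>

lemma hard_s_hom:
  assumes C: "signed_subgraph C H" and H: "signed_graph H" and \<phi>: "s_hom \<phi> H C" and hard: "hard H"
  shows "hard C"
proof -
  have sub: "edges C \<subseteq> edges H" and wf: "signed_graph C" using C by (auto simp: signed_subgraph_def)
  obtain \<sigma> where s: "\<forall>x y s. ({x, y}, s) \<in> edges H \<longrightarrow> ({\<phi> x, \<phi> y}, twist \<sigma> x y s) \<in> edges C"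
    using \<phi> s_hom_iff[OF H wf] by blast
  have "template C s (\<phi> a, \<sigma> a) (\<phi> b, \<sigma> b)" if "adj H a b s" for a b s
    using s that by (simp add: adj_def template_def twist_def)
  from closed_walk_hom[of "adj H" C "\<lambda>a. (\<phi> a, \<sigma> a)", OF this]
  have "walk_group H \<subseteq> walk_group C" unfolding walk_group_def by auto
  then show ?thesis using hard sub unfolding hard_def has_loop_def has_negative_digon_def double_loop_def by blast
qed

lemma closed_walk_mono:
  assumes "\<And>a b s. A a b s \<Longrightarrow> B a b s" "closed_walk A a g"
  shows "closed_walk B a g"
proof -
  have "cover A \<subseteq> cover B" unfolding cover_def using assms(1) by blast
  then show ?thesis using assms(2) rtrancl_mono unfolding closed_walk_def by blast
qed

text \<open>Closed walks of \<open>C\<close> are closed walks of \<open>H\<close>, so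
  \<open>C\<close> maps to \<open>S\<close> by \<open>\<psi>\<close>, and \<open>S\<close>, a
  subgraph of \<open>H\<close>, maps back by \<open>\<phi>\<close>. The composition is an
  s-homomorphism of the core to itself, hence bijective, so \<open>\<psi>\<close> is injective on
  vertices.\<close>

lemma s_core_small:
  assumes H: "signed_graph H" and conn: "sg_connected H"
    and not3: "\<not> (has_negative_digon H \<and> has_loop Pos H \<and> has_loop Neg H)"
    and core: "s_core_of C H" and easy: "\<not> hard H"
  shows "card (edges C) \<le> 2"
proof (cases "edges H = {}")
  case True
  then show ?thesis using core unfolding s_core_of_def signed_subgraph_def by auto
next
  case False
  obtain \<phi> where C: "signed_graph C" "verts C \<subseteq> verts H" "edges C \<subseteq> edges H" and sc: "s_core C" and \<phi>: "s_hom \<phi> H C"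
    using core unfolding s_core_of_def signed_subgraph_def by blast
  obtain S where S: "signed_subgraph S H" "card (edges S) \<le> 2"
    and ex: "\<forall>A :: 'a \<Rightarrow> 'a \<Rightarrow> sign \<Rightarrow> bool. (\<forall>a b s. A a b s \<longrightarrow> A b a s) \<longrightarrow> (\<forall>a g. closed_walk A a g \<longrightarrow> g \<in> walk_group H) \<longrightarrow>
      (\<exists>h. (\<forall>a. fst (h a) \<in> verts S) \<and> (\<forall>a b s. A a b s \<longrightarrow> template S s (h a) (h b)))"
    by (rule easy_target[OF H conn not3 easy False]) (rule that)
  have wS: "signed_graph S" "verts S \<subseteq> verts H" "edges S \<subseteq> edges H" using S by (auto simp: signed_subgraph_def)
  have "g \<in> walk_group H" if "closed_walk (adj C) a g" for a g
  proof -
    have "closed_walk (adj H) a g" by (rule closed_walk_mono[OF _ that]) (use C in \<open>auto simp: adj_def\<close>)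
    then show ?thesis unfolding walk_group_def by blast
  qed
  then have "\<exists>h. (\<forall>a. fst (h a) \<in> verts S) \<and> (\<forall>a b s. adj C a b s \<longrightarrow> template S s (h a) (h b))"
    by (intro ex[rule_format]) (auto intro: adj_sym)
  then obtain h where h: "\<And>a. fst (h a) \<in> verts S" "\<And>a b s. adj C a b s \<Longrightarrow> template S s (h a) (h b)" by blast
  define \<psi> \<sigma> where "\<psi> a = fst (h a)" and "\<sigma> a = snd (h a)" for a
  have e: "({\<psi> x, \<psi> y}, twist \<sigma> x y s) \<in> edges S" if "({x, y}, s) \<in> edges C" for x y s
    using h(2)[of x y s] that by (simp add: adj_def template_def twist_def \<psi>_def \<sigma>_def)
  have "\<psi> ` verts C \<subseteq> verts S" using h(1) unfolding \<psi>_def by blast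
  then have "s_hom \<psi> C S" unfolding s_hom_iff[OF C(1) wS(1)] using e by (intro conjI exI[of _ \<sigma>]) simp_all
  moreover have "s_hom \<phi> S C"
  proof -
    obtain \<tau> where t: "\<phi> ` verts H \<subseteq> verts C" "\<forall>x y s. ({x, y}, s) \<in> edges H \<longrightarrow> ({\<phi> x, \<phi> y}, twist \<tau> x y s) \<in> edges C"
      using iffD1[OF s_hom_iff[OF H C(1)] \<phi>] by (elim conjE exE) (rule that)
    then have "\<phi> ` verts S \<subseteq> verts C" using wS(2) by blast
    moreover have "\<forall>x y s. ({x, y}, s) \<in> edges S \<longrightarrow> ({\<phi> x, \<phi> y}, twist \<tau> x y s) \<in> edges C"
      using t(2) wS(3) by (intro allI impI) (drule subsetD, assumption, simp)
    ultimately show ?thesis unfolding s_hom_iff[OF wS(1) C(1)] by (intro conjI exI[of _ \<tau>])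
  qed
  ultimately have "s_hom (\<phi> \<circ> \<psi>) C C" using s_hom_comp C(1) wS(1) by blast
  then have "inj_on (\<phi> \<circ> \<psi>) (verts C)" using sc unfolding s_core_def s_automorphism_def bij_betw_def by blast
  then have inj: "inj_on \<psi> (verts C)" by (rule inj_on_imageI2)
  \<comment> \<open>The map induced on edges. It is injective: the ends of the image determine the
    ends, and for given ends the change of sign is a bijection.\<close>
  define m where "m = (\<lambda>(e, s). (\<psi> ` e, if \<exists>x\<in>e. \<exists>y\<in>e. \<sigma> x \<noteq> \<sigma> y then flip s else s))"
  have ends: "\<exists>x y. e = {x, y} \<and> x \<in> verts C \<and> y \<in> verts C" if "(e, s) \<in> edges C" for e s
    using that C(1) unfolding signed_graph_def by blast
  have "m ` edges C \<subseteq> edges S"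
  proof (rule image_subsetI)
    fix f assume f: "f \<in> edges C"
    obtain x y s where xy: "f = ({x, y}, s)" using ends f by (metis prod.exhaust)
    have "m f = ({\<psi> x, \<psi> y}, twist \<sigma> x y s)" unfolding m_def xy twist_def by auto
    then show "m f \<in> edges S" using e f xy by simp
  qed
  moreover have "inj_on m (edges C)"
  proof (rule inj_onI)
    fix f f' assume f: "f \<in> edges C" "f' \<in> edges C" and eq: "m f = m f'"
    obtain d s d' s' where ds: "f = (d, s)" "f' = (d', s')" by fastforce
    have "d \<subseteq> verts C" "d' \<subseteq> verts C" using ends f ds by blast+
    moreover have "\<psi> ` d = \<psi> ` d'" using eq by (simp add: m_def ds)
    ultimately have d: "d = d'" using inj_on_image_eq_iff[OF inj] by blast
    have "(if \<exists>x\<in>d'. \<exists>y\<in>d'. \<sigma> x \<noteq> \<sigma> y then flip s else s) = (if \<exists>x\<in>d'. \<exists>y\<in>d'. \<sigma> x \<noteq> \<sigma> y then flip s' else s')"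
      using eq by (simp only: m_def ds d prod.case prod.inject)
    then have "s = s'" by (metis flip_flip)
    then show "f = f'" using ds d by simp
  qed
  ultimately have "card (edges C) \<le> card (edges S)" using finite_edges[OF wS(1)] by (meson card_inj_on_le)
  then show ?thesis using S(2) by linarith
qed

text \<open>The closed walks of an instance are the only obstruction: a homomorphism to
  \<open>H\<close> puts their values into \<Gamma>, and if they lie there,
  \<open>easy_target\<close> maps the instance to a subgraph of \<open>H\<close>.\<close>

lemma s_Hom_easy:
  fixes H :: "'a sgraph"
  assumes H: "signed_graph H" and conn: "sg_connected H"
    and not3: "\<not> (has_negative_digon H \<and> has_loop Pos H \<and> has_loop Neg H)" and easy: "\<not> hard H"
  shows "s_Hom H \<in> class_P"
proof (cases "edges H = {}")
  case True
  obtain v where v: "v \<in> verts H" using conn unfolding sg_connected_def by blast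
  have "x \<in> s_Hom H \<longleftrightarrow> (\<exists>n. valid_word x n \<and> (\<forall>i<n. \<forall>j<n. \<forall>s<2. \<not> bit x (bitpos n i j s)))" for x
    unfolding s_Hom_iff_template[OF H] template_def True
    using v by (intro ex_cong1 conj_cong refl iffI) (auto intro: exI[of _ "\<lambda>_. (v, False)"])
  then have "s_Hom H = {x. \<exists>n. valid_word x n \<and> (\<forall>i<n. \<forall>j<n. \<forall>s<2. \<not> bit x (bitpos n i j s))}" by blast
  then show ?thesis using edgeless_in_P by simp
next
  case False
  obtain S where S: "signed_subgraph S H"
    and ex: "\<forall>A :: nat \<Rightarrow> nat \<Rightarrow> sign \<Rightarrow> bool. (\<forall>a b s. A a b s \<longrightarrow> A b a s) \<longrightarrow> (\<forall>a g. closed_walk A a g \<longrightarrow> g \<in> walk_group H) \<longrightarrow>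
      (\<exists>h. (\<forall>a. fst (h a) \<in> verts S) \<and> (\<forall>a b s. A a b s \<longrightarrow> template S s (h a) (h b)))"
    by (rule easy_target[OF H conn not3 easy False]) (rule that)
  have wS: "verts S \<subseteq> verts H" "edges S \<subseteq> edges H" using S by (auto simp: signed_subgraph_def)
  have "(\<exists>g. (\<forall>i<n. fst (g i) \<in> verts H) \<and> (\<forall>i<n. \<forall>j<n. \<forall>s<2. bit x (bitpos n i j s) \<longrightarrow> template H (sg s) (g i) (g j)))
      \<longleftrightarrow> (\<forall>v<n. \<forall>g. closed_walk (word_adj x n) v g \<longrightarrow> g \<in> walk_group H)" (is "?L \<longleftrightarrow> ?R") if x: "valid_word x n" for x n
  proof
    assume ?L
    then obtain h where h: "\<And>i j s. i < n \<Longrightarrow> j < n \<Longrightarrow> s < 2 \<Longrightarrow> bit x (bitpos n i j s) \<Longrightarrow> template H (sg s) (h i) (h j)" by blast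
    have t: "template H s (h i) (h j)" if "word_adj x n i j s" for i j s
      using h[of i j "if s = Neg then 1 else 0"] that by (cases s) (simp_all add: word_adj_def sg_def)
    from closed_walk_hom[of "word_adj x n" H h, OF t] show ?R unfolding walk_group_def by blast
  next
    assume R: ?R
    have sy: "word_adj x n b a s" if "word_adj x n a b s" for a b s
      using that x unfolding word_adj_def valid_word_def by (cases s) auto
    have "g \<in> walk_group H" if c: "closed_walk (word_adj x n) a g" for a g
    proof (cases "a < n")
      case False
      have "g = (False, False)"
      proof (rule ccontr)
        assume "g \<noteq> (False, False)"
        then obtain y where "((a, False, False), y) \<in> cover (word_adj x n)"
          using c unfolding closed_walk_def by (metis converse_rtranclE prod.inject)
        then show False using False unfolding cover_def word_adj_def by blast
      qed
      then show ?thesis unfolding walk_group_def closed_walk_def by simp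
    qed (use R c in blast)
    then have "\<exists>h. (\<forall>a. fst (h a) \<in> verts S) \<and> (\<forall>a b s. word_adj x n a b s \<longrightarrow> template S s (h a) (h b))"
      by (intro ex[rule_format]) (auto intro: sy)
    then obtain h where h: "\<And>a. fst (h a) \<in> verts S" "\<And>a b s. word_adj x n a b s \<Longrightarrow> template S s (h a) (h b)" by blast
    have "template H (sg s) (h i) (h j)" if "i < n" "j < n" "s < 2" "bit x (bitpos n i j s)" for i j s
    proof -
      have "s = 0 \<or> s = 1" using that(3) by auto
      then have "template S (sg s) (h i) (h j)" using h(2)[of i j "sg s"] that by (auto simp: word_adj_def sg_def)
      then show ?thesis using wS(2) unfolding template_def by blast
    qed
    then show ?L using h(1) wS(1) by (intro exI[of _ h]) blast
  qed
  then have "x \<in> s_Hom H \<longleftrightarrow> (\<exists>n. valid_word x n \<and> (\<forall>v<n. \<forall>g. closed_walk (word_adj x n) v g \<longrightarrow> g \<in> walk_group H))" for x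
    unfolding s_Hom_iff_template[OF H] by (intro ex_cong1 conj_cong refl) simp
  then have "s_Hom H = {x. \<exists>n. valid_word x n \<and> (\<forall>v<n. \<forall>g. closed_walk (word_adj x n) v g \<longrightarrow> g \<in> walk_group H)}" by blast
  then show ?thesis using walk_language_in_P by simp
qed

lemma s_Hom_hard:
  assumes H: "signed_graph H" and conn: "sg_connected H" and hard: "hard H"
  shows "NP_complete (s_Hom H)"
proof -
  let ?V = "verts H \<times> (UNIV :: bool set)"
  have fin: "finite ?V" and ne: "?V \<noteq> {}" using H conn by (auto simp: signed_graph_def sg_connected_def)
  define D where "D = card ?V"
  obtain dec where "bij_betw dec {0..<D} ?V" using ex_bij_betw_nat_finite[OF fin] unfolding D_def by blast
  then have dec: "bij_betw dec {..<D} ?V" by (simp add: lessThan_atLeast0)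
  have D: "0 < D" using fin ne by (simp add: D_def card_gt_0_iff)
  let ?K = "\<lambda>s i j. i < D \<and> j < D \<and> template H s (dec i) (dec j)"
  have "polytime_reducible L (csp D ?K)" if "L \<in> class_NP" for L
    by (rule cook_levin[OF hard_essentially_unary[OF H dec hard] D _ _ that]) (auto intro: template_sym)
  then show ?thesis unfolding NP_complete_def s_Hom_eq_csp[OF H dec] using csp_in_NP by blast
qed

theorem theorem4p2:
  fixes H C :: "'a sgraph"
  assumes "signed_graph H"
    and "sg_connected H"
    and "\<not> (has_negative_digon H \<and> has_loop Pos H \<and> has_loop Neg H)"
    and "s_core_of C H"
  shows "(card (edges C) \<le> 2 \<longrightarrow> s_Hom H \<in> class_P) \<and>
         (\<not> card (edges C) \<le> 2 \<longrightarrow> NP_complete (s_Hom H))"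
proof (cases "hard H")
  case True
  obtain \<phi> where "signed_subgraph C H" "s_hom \<phi> H C" using assms(4) unfolding s_core_of_def by blast
  then have "hard C" "signed_graph C" using hard_s_hom assms(1) True unfolding signed_subgraph_def by blast+
  then show ?thesis using small_not_hard s_Hom_hard[OF assms(1,2) True] by blast
next
  case False
  then show ?thesis using s_core_small s_Hom_easy assms by blast
qed

end
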